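(* There exist a bounded Lipschitz domain $\Omega\subset\mathbb{R}^2$, two disjoint compact intervals $I', I''\subset(-\infty,0)$, and two sequences $(\beta'_k)_{k\in\mathbb{N}}, (\beta''_k)_{k\in\mathbb{N}}\subset(-\infty,0)$ converging to $-\infty$ such that $$\frac{E\big(R_\Omega^{\beta'_k}\big)}{(\beta'_k)^2}\in I' \quad\text{and}\quad \frac{E\big(R_\Omega^{\beta''_k}\big)}{(\beta''_k)^2}\in I''\qquad\text{for all } k\in\mathbb{N}.$$
   Context: For a bounded Lipschitz domain $\Omega\subset\mathbb{R}^n$ ($n\ge 2$) and $\alpha\in\mathbb{R}$, $R^\alpha_\Omega$ denotes the Robin Laplacian $u\mapsto-\Delta u$ in $\Omega$ with boundary condition $\partial_\nu u+\alpha u=0$ on $\partial\Omega$ ($\nu$ the outer unit normal), i.e. the self-adjoint operator in $L^2(\Omega)$ generated by the hermitian sesquilinear form $$r^\alpha_\Omega(u,u)=\int_\Omega|\nabla u|^2\,dx+\alpha\int_{\partial\Omega}|u|^2\,d\sigma,\qquad \mathcal{D}(r^\alpha_\Omega)=H^1(\Omega),$$ where $d\sigma$ is the hypersurface measure and the restriction of $u$ to $\partial\Omega$ is understood in the sense of Sobolev traces. Moreover, $$E(R^\alpha_\Omega):=\inf\operatorname{spec}R^\alpha_\Omega=\inf_{u\in H^1(\Omega),\,u\neq0}\frac{r^\alpha_\Omega(u,u)}{\|u\|^2_{L^2(\Omega)}},$$ which is the lowest eigenvalue of $R^\alpha_\Omega$. *)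

theory Defs
  imports "HOL-Analysis.Analysis"
begin

text \<open>Near each boundary point, \<open>\<Omega>\<close> lies strictly above the graph of a Lipschitz
  function over the hyperplane orthogonal to some unit vector \<open>e\<close>.\<close>

definition bounded_lipschitz_domain :: "'a::euclidean_space set \<Rightarrow> bool" where
  "bounded_lipschitz_domain \<Omega> \<longleftrightarrow>
     open \<Omega> \<and> connected \<Omega> \<and> \<Omega> \<noteq> {} \<and> bounded \<Omega> \<and>
     (\<forall>p\<in>frontier \<Omega>. \<exists>r>0. \<exists>e L h. norm e = 1 \<and> L-lipschitz_on {y. y \<bullet> e = 0} h \<and>
        \<Omega> \<inter> ball p r = {x \<in> ball p r. h (x - (x \<bullet> e) *\<^sub>R e) < x \<bullet> e})"

text \<open>Elements of \<open>L\<^sup>2\<close> are handled through representatives. Both measures used below live on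
  the Borel sets; every class of Lebesgue measurable functions has a Borel representative.\<close>

definition L2 :: "'a measure \<Rightarrow> ('a \<Rightarrow> complex) set" where
  "L2 M = {u \<in> borel_measurable M. integrable M (\<lambda>x. (cmod (u x))\<^sup>2)}"

definition L2_inner :: "'a measure \<Rightarrow> ('a \<Rightarrow> complex) \<Rightarrow> ('a \<Rightarrow> complex) \<Rightarrow> complex" where
  "L2_inner M u v = (\<integral>x. u x * cnj (v x) \<partial>M)"

definition L2_norm :: "'a measure \<Rightarrow> ('a \<Rightarrow> complex) \<Rightarrow> real" where
  "L2_norm M u = sqrt (\<integral>x. (cmod (u x))\<^sup>2 \<partial>M)"

abbreviation volume_on :: "'a::euclidean_space set \<Rightarrow> 'a measure" where
  "volume_on \<Omega> \<equiv> restrict_space lborel \<Omega>"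

text \<open>The factor \<open>unit_ball_vol s / 2 ^ s\<close> normalises the \<open>s\<close>-dimensional Hausdorff measure to
  agree with Lebesgue measure on \<open>s\<close>-dimensional subspaces; it is \<open>1\<close> for \<open>s = 1\<close>.\<close>

definition hausdorff_pre :: "nat \<Rightarrow> real \<Rightarrow> 'a::metric_space set \<Rightarrow> ennreal" where
  "hausdorff_pre s \<delta> A =
     (INF U \<in> {U :: nat \<Rightarrow> 'a set. A \<subseteq> (\<Union>i. U i) \<and> (\<forall>i. bounded (U i) \<and> diameter (U i) \<le> \<delta>)}.
        \<Sum>i. if U i = {} then 0
            else ennreal (unit_ball_vol (real s) / 2 ^ s * diameter (U i) ^ s))"

definition hausdorff_outer :: "nat \<Rightarrow> 'a::metric_space set \<Rightarrow> ennreal" where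
  "hausdorff_outer s A = (SUP \<delta>\<in>{0<..}. hausdorff_pre s \<delta> A)"

definition hausdorff_measure :: "nat \<Rightarrow> 'a::metric_space measure" where
  "hausdorff_measure s = measure_of UNIV (sets borel) (hausdorff_outer s)"

definition surface_on :: "'a::euclidean_space set \<Rightarrow> 'a measure" where
  "surface_on \<Omega> = restrict_space (hausdorff_measure (DIM('a) - 1)) (frontier \<Omega>)"

text \<open>Derivatives are Frechet derivatives over the reals, also for complex-valued functions.\<close>

primrec Ck :: "nat \<Rightarrow> ('a::euclidean_space \<Rightarrow> 'b::real_normed_vector) \<Rightarrow> bool" where
  "Ck 0 f \<longleftrightarrow> continuous_on UNIV f"
| "Ck (Suc k) f \<longleftrightarrow> (\<forall>x. f differentiable (at x)) \<and>
     (\<forall>i\<in>Basis. Ck k (\<lambda>x. frechet_derivative f (at x) i))"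

definition test_functions :: "'a::euclidean_space set \<Rightarrow> ('a \<Rightarrow> complex) set" where
  "test_functions S = {\<phi>. (\<forall>k. Ck k \<phi>) \<and>
     compact (closure {x. \<phi> x \<noteq> 0}) \<and> closure {x. \<phi> x \<noteq> 0} \<subseteq> S}"

definition has_weak_deriv ::
  "'a::euclidean_space set \<Rightarrow> 'a \<Rightarrow> ('a \<Rightarrow> complex) \<Rightarrow> ('a \<Rightarrow> complex) \<Rightarrow> bool" where
  "has_weak_deriv \<Omega> i u g \<longleftrightarrow> (\<forall>\<phi>\<in>test_functions \<Omega>.
     (\<integral>x. u x * frechet_derivative \<phi> (at x) i \<partial>volume_on \<Omega>)
       = - (\<integral>x. g x * \<phi> x \<partial>volume_on \<Omega>))"

definition H1 :: "'a::euclidean_space set \<Rightarrow> ('a \<Rightarrow> complex) set" where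
  "H1 \<Omega> = {u \<in> L2 (volume_on \<Omega>).
     \<forall>i\<in>Basis. \<exists>g\<in>L2 (volume_on \<Omega>). has_weak_deriv \<Omega> i u g}"

text \<open>Weak derivatives and traces are unique only up to null sets; the choice of
  representative does not affect any of the integrals formed with them.\<close>

definition weak_deriv ::
  "'a::euclidean_space set \<Rightarrow> 'a \<Rightarrow> ('a \<Rightarrow> complex) \<Rightarrow> 'a \<Rightarrow> complex" where
  "weak_deriv \<Omega> i u = (SOME g. g \<in> L2 (volume_on \<Omega>) \<and> has_weak_deriv \<Omega> i u g)"

definition H1_norm :: "'a::euclidean_space set \<Rightarrow> ('a \<Rightarrow> complex) \<Rightarrow> real" where
  "H1_norm \<Omega> u = sqrt ((L2_norm (volume_on \<Omega>) u)\<^sup>2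
     + (\<Sum>i\<in>Basis. (L2_norm (volume_on \<Omega>) (weak_deriv \<Omega> i u))\<^sup>2))"

text \<open>The trace is the continuous extension of \<open>u \<mapsto> u|\<^bsub>\<partial>\<Omega>\<^esub>\<close> from the restrictions to \<open>\<Omega>\<close> of
  smooth, compactly supported functions on the whole space, which are dense in \<open>H\<^sup>1\<close>.\<close>

definition has_trace ::
  "'a::euclidean_space set \<Rightarrow> ('a \<Rightarrow> complex) \<Rightarrow> ('a \<Rightarrow> complex) \<Rightarrow> bool" where
  "has_trace \<Omega> u g \<longleftrightarrow> g \<in> L2 (surface_on \<Omega>) \<and>
     (\<exists>\<phi>. (\<forall>k::nat. \<phi> k \<in> test_functions UNIV) \<and>
        (\<lambda>k. H1_norm \<Omega> (\<lambda>x. \<phi> k x - u x)) \<longlonglongrightarrow> 0 \<and>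
        (\<lambda>k. L2_norm (surface_on \<Omega>) (\<lambda>x. \<phi> k x - g x)) \<longlonglongrightarrow> 0)"

definition trace_on :: "'a::euclidean_space set \<Rightarrow> ('a \<Rightarrow> complex) \<Rightarrow> 'a \<Rightarrow> complex" where
  "trace_on \<Omega> u = (SOME g. has_trace \<Omega> u g)"

definition robin_form ::
  "'a::euclidean_space set \<Rightarrow> real \<Rightarrow> ('a \<Rightarrow> complex) \<Rightarrow> ('a \<Rightarrow> complex) \<Rightarrow> complex" where
  "robin_form \<Omega> \<alpha> u v =
     (\<Sum>i\<in>Basis. L2_inner (volume_on \<Omega>) (weak_deriv \<Omega> i u) (weak_deriv \<Omega> i v))
     + of_real \<alpha> * L2_inner (surface_on \<Omega>) (trace_on \<Omega> u) (trace_on \<Omega> v)"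

text \<open>Operators are represented by their graphs, as sets of pairs of representatives.\<close>

definition robin_laplacian ::
  "'a::euclidean_space set \<Rightarrow> real \<Rightarrow> (('a \<Rightarrow> complex) \<times> ('a \<Rightarrow> complex)) set" where
  "robin_laplacian \<Omega> \<alpha> = {(u, f). u \<in> H1 \<Omega> \<and> f \<in> L2 (volume_on \<Omega>) \<and>
     (\<forall>v\<in>H1 \<Omega>. robin_form \<Omega> \<alpha> u v = L2_inner (volume_on \<Omega>) f v)}"

text \<open>For (the graph of) a linear operator \<open>T\<close> in \<open>L\<^sup>2(M)\<close>: \<open>z\<close> is in the resolvent set iff \<open>T - z\<close>
  maps onto \<open>L\<^sup>2(M)\<close> and is injective with bounded inverse; the norm estimate contains both
  injectivity and boundedness.\<close>

definition resolvent_set ::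
  "'a measure \<Rightarrow> (('a \<Rightarrow> complex) \<times> ('a \<Rightarrow> complex)) set \<Rightarrow> complex set" where
  "resolvent_set M T = {z.
     (\<forall>f\<in>L2 M. \<exists>u. (u, \<lambda>x. f x + z * u x) \<in> T) \<and>
     (\<exists>C. \<forall>(u, g)\<in>T. L2_norm M u \<le> C * L2_norm M (\<lambda>x. g x - z * u x))}"

definition op_spectrum ::
  "'a measure \<Rightarrow> (('a \<Rightarrow> complex) \<times> ('a \<Rightarrow> complex)) set \<Rightarrow> complex set" where
  "op_spectrum M T = - resolvent_set M T"

text \<open>The Robin Laplacian is self-adjoint, so its spectrum consists of real numbers.\<close>

definition robin_energy :: "'a::euclidean_space set \<Rightarrow> real \<Rightarrow> real" where
  "robin_energy \<Omega> \<alpha> =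
     Inf {t. complex_of_real t \<in> op_spectrum (volume_on \<Omega>) (robin_laplacian \<Omega> \<alpha>)}"

end

theory Submission
  imports Defs
begin

text \<open>The domain is \<open>{hh x < y < 1, |x| < 1}\<close>, where the even Lipschitz function \<open>hh\<close> has slopes \<open>0\<close> and \<open>3\<close>
  on alternating sequences of intervals shrinking to \<open>0\<close>, with rapidly growing ratios of end points.
  For a large parameter \<open>\<alpha> = - B\<close> the energy \<open>E\<close> is determined by the corner at the lowest point, seen on the scale \<open>1/B\<close>. If
  the scale \<open>1/B\<close> lies deep inside a steep range (\<open>B = 1/b\<^sup>2\<close> with \<open>a = b\<^sup>3\<close>), the corner looks like a sector of slope
  \<open>3\<close>, and the test function \<open>exp (- 3 B y)\<close> gives \<open>E \<le> - 7 B\<^sup>2\<close>. If it lies in a flat range (\<open>B = 1/a\<^sup>2\<close>, next steep end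
  point \<open>a\<^sup>3\<close>), the boundary resolves into horizontal pieces and steep pieces of length at least \<open>a\<close>; one-dimensional
  trace inequalities, vertical for the former and horizontal for the latter, give \<open>E \<ge> - 6 B\<^sup>2\<close>.

  The lowest Rayleigh quotient of the form is the infimum of the spectrum of the associated operator
  (by completeness of \<open>H\<^sup>1\<close> and the Riesz representation theorem), so that all estimates reduce to
  smooth functions.\<close>

section \<open>Closed forms and the Riesz representation\<close>

text \<open>Enlarging the domain by the factor B turns \<open>E\<close> / B^2 into the energy at
  \<alpha> = -1, so a corner that is an exact sector yields a limit; two limit ranges require a
  corner whose shape keeps changing under magnification. A sector of slope m has the sharp value -(1
  + m^2), hence -10 for m = 3, while a flat boundary has -1 and a right angle -2. The gap between
  -10 and -2 leaves room for crude estimates, and arc length is never computed exactly: from above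
  it is bounded by horizontal plus vertical increment, from below by a projection to an axis, so
  that sqrt 10 becomes 4 or 3. With 3 the exponential gives -9, and -7 after errors. For the lower
  bound, vertical lines cost only the second partial derivative and horizontal lines only the first;
  spending half the gradient gives -4, and the other half pays for errors, which leads to -6. The
  obstacle there is the infinitely many steep intervals much closer to 0 than 1/B: their horizontal
  chords are too short for the trace inequality. They lie in |x| <= a^3, far below 1/B = a^2, so the
  mass of a thin vertical strip controls them.\<close>

locale semi_inner =
  fixes V :: "('a \<Rightarrow> complex) set"
    and q :: "('a \<Rightarrow> complex) \<Rightarrow> ('a \<Rightarrow> complex) \<Rightarrow> complex"
  assumes zero_mem: "(\<lambda>_. 0) \<in> V"
    and add_mem: "\<lbrakk>u \<in> V; v \<in> V\<rbrakk> \<Longrightarrow> (\<lambda>x. u x + v x) \<in> V"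
    and scale_mem: "u \<in> V \<Longrightarrow> (\<lambda>x. c * u x) \<in> V"
    and q_add: "\<lbrakk>u \<in> V; v \<in> V; w \<in> V\<rbrakk> \<Longrightarrow> q (\<lambda>x. u x + v x) w = q u w + q v w"
    and q_scale: "\<lbrakk>u \<in> V; w \<in> V\<rbrakk> \<Longrightarrow> q (\<lambda>x. c * u x) w = c * q u w"
    and q_herm: "\<lbrakk>u \<in> V; v \<in> V\<rbrakk> \<Longrightarrow> q v u = cnj (q u v)"
    and q_nonneg: "u \<in> V \<Longrightarrow> 0 \<le> Re (q u u)"
begin

text \<open>Vectors are functions rather than classes modulo null sets, so \<open>q\<close> is only
  positive semidefinite and \<open>nrm\<close> is a seminorm; limits are unique only up to functions
  of seminorm 0.\<close>

definition nrm :: "('a \<Rightarrow> complex) \<Rightarrow> real" where "nrm u = sqrt (Re (q u u))"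

lemma nrm_sq: "u \<in> V \<Longrightarrow> (nrm u)\<^sup>2 = Re (q u u)"
  by (simp add: nrm_def q_nonneg)

lemma nrm_ge0: "u \<in> V \<Longrightarrow> 0 \<le> nrm u"
  by (simp add: nrm_def q_nonneg)

lemma q_self: "u \<in> V \<Longrightarrow> q u u = of_real ((nrm u)\<^sup>2)"
  using q_herm[of u u] by (auto simp: nrm_sq complex_eq_iff)

lemma diff_mem: "\<lbrakk>u \<in> V; v \<in> V\<rbrakk> \<Longrightarrow> (\<lambda>x. u x - v x) \<in> V"
  using add_mem[of u "\<lambda>x. (-1) * v x"] scale_mem[of v "-1"] by simp

lemma q_add_right: "\<lbrakk>u \<in> V; v \<in> V; w \<in> V\<rbrakk> \<Longrightarrow> q w (\<lambda>x. u x + v x) = q w u + q w v"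
  using q_herm[of "\<lambda>x. u x + v x" w] q_herm[of u w] q_herm[of v w] by (simp add: q_add add_mem)

lemma q_scale_right: "\<lbrakk>u \<in> V; w \<in> V\<rbrakk> \<Longrightarrow> q w (\<lambda>x. c * u x) = cnj c * q w u"
  using q_herm[of "\<lambda>x. c * u x" w] q_herm[of u w] by (simp add: q_scale scale_mem)

lemma q_diff: "\<lbrakk>u \<in> V; v \<in> V; w \<in> V\<rbrakk> \<Longrightarrow> q (\<lambda>x. u x - v x) w = q u w - q v w"
  using q_add[of u "\<lambda>x. (-1) * v x" w] scale_mem[of v "-1"] q_scale[of v w "-1"] by simp

text \<open>Cauchy-Schwarz, homogeneity, the triangle inequality and the variation of the functional
  in the Riesz argument are all read off from this expansion along a complex line.\<close>

lemma nrm_add_scale_sq: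
  assumes "u \<in> V" "v \<in> V"
  shows "(nrm (\<lambda>x. u x + c * v x))\<^sup>2 = (nrm u)\<^sup>2 + 2 * Re (c * q v u) + (cmod c)\<^sup>2 * (nrm v)\<^sup>2"
proof -
  have cv: "(\<lambda>x. c * v x) \<in> V" using assms scale_mem by blast
  have "q (\<lambda>x. u x + c * v x) (\<lambda>x. u x + c * v x)
      = q u u + cnj c * q u v + c * q v u + c * cnj c * q v v"
    using assms cv by (simp add: q_add q_add_right q_scale q_scale_right add_mem algebra_simps)
  moreover have "c * cnj c * q v v = of_real ((cmod c)\<^sup>2 * (nrm v)\<^sup>2)"
    using assms by (simp add: q_self complex_norm_square flip: of_real_power)
  moreover have "cnj c * q u v = cnj (c * q v u)" using q_herm[of v u] assms by simp
  ultimately show ?thesis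
    using assms cv by (simp add: nrm_sq add_mem)
qed

lemma nrm_scale: "u \<in> V \<Longrightarrow> nrm (\<lambda>x. c * u x) = cmod c * nrm u"
proof -
  assume u: "u \<in> V"
  have "(nrm (\<lambda>x. 0 + c * u x))\<^sup>2 = (cmod c)\<^sup>2 * (nrm u)\<^sup>2"
    using nrm_add_scale_sq[OF zero_mem u, of c] q_scale[OF zero_mem u, of 0]
      q_herm[OF zero_mem u] q_self[OF zero_mem] q_scale[OF zero_mem zero_mem, of 0] by simp
  then show ?thesis
    using nrm_ge0[OF u] nrm_ge0[OF scale_mem[OF u, of c]]
    by (metis (no_types, lifting) ext add_0 mult_nonneg_nonneg norm_ge_zero power2_eq_imp_eq power_mult_distrib)
qed

text \<open>With the coefficient - t cnj z the cross term of the expansion becomes real, and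
  negative for t > 0, whatever the phase of z.\<close>

lemma Re_scaled_cnj: "Re ((- of_real t * cnj z) * z) = - t * (cmod z)\<^sup>2"
  using cmod_power2[of z] by (simp add: algebra_simps) (simp add: power2_eq_square algebra_simps)

text \<open>Moving from u in the direction - t cnj z v, with z = q v u, gives a real quadratic in t
  that stays nonnegative. As \<open>nrm v\<close> may vanish for a function v other than 0, that
  case is separate: the quadratic is then affine in t and forces z = 0.\<close>

lemma Cauchy_Schwarz:
  assumes u: "u \<in> V" and v: "v \<in> V"
  shows "cmod (q u v) \<le> nrm u * nrm v"
proof -
  let ?z = "q v u"
  have key: "0 \<le> (nrm u)\<^sup>2 - 2 * t * (cmod ?z)\<^sup>2 + t\<^sup>2 * (cmod ?z)\<^sup>2 * (nrm v)\<^sup>2" for t :: real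
  proof -
    have "0 \<le> (nrm (\<lambda>x. u x + (- of_real t * cnj ?z) * v x))\<^sup>2" by simp
    also have "\<dots> = (nrm u)\<^sup>2 + 2 * Re ((- of_real t * cnj ?z) * ?z)
        + (cmod (- of_real t * cnj ?z))\<^sup>2 * (nrm v)\<^sup>2"
      by (rule nrm_add_scale_sq[OF u v])
    also have "Re ((- of_real t * cnj ?z) * ?z) = - t * (cmod ?z)\<^sup>2" by (rule Re_scaled_cnj)
    also have "(cmod (- of_real t * cnj ?z))\<^sup>2 = t\<^sup>2 * (cmod ?z)\<^sup>2"
      by (simp add: norm_mult power_mult_distrib)
    finally show ?thesis by simp
  qed
  have "(cmod ?z)\<^sup>2 \<le> (nrm u)\<^sup>2 * (nrm v)\<^sup>2"
  proof (cases "nrm v = 0")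
    case True
    have "cmod ?z = 0"
    proof (rule ccontr)
      assume "cmod ?z \<noteq> 0"
      then have p: "(cmod ?z)\<^sup>2 > 0" by simp
      define A where "A = (nrm u)\<^sup>2"
      have "0 \<le> A - 2 * ((A + 1) / (cmod ?z)\<^sup>2) * (cmod ?z)\<^sup>2"
        using key[of "((nrm u)\<^sup>2 + 1) / (cmod ?z)\<^sup>2"] True by (simp add: A_def)
      also have "\<dots> = A - 2 * (A + 1)" using p by simp
      finally have "A + 2 \<le> 0" by simp
      moreover have "0 \<le> A" by (simp add: A_def)
      ultimately show False by simp
    qed
    then show ?thesis by simp
  next
    case False
    then have p: "(nrm v)\<^sup>2 > 0" by simp
    define A where "A = (nrm v)\<^sup>2"
    have "A > 0" using p by (simp add: A_def)
    then have "0 \<le> (nrm u)\<^sup>2 - (cmod ?z)\<^sup>2 / A"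
      using key[of "1 / A", folded A_def] by (simp add: power2_eq_square[of A] power_divide)
    then have "0 \<le> (nrm u)\<^sup>2 - (cmod ?z)\<^sup>2 / (nrm v)\<^sup>2" by (simp add: A_def)
    then show ?thesis using p by (simp add: pos_divide_le_eq)
  qed
  then have "cmod ?z \<le> nrm u * nrm v"
    using nrm_ge0[OF u] nrm_ge0[OF v] by (metis abs_le_square_iff abs_norm_cancel abs_of_nonneg mult_nonneg_nonneg power_mult_distrib)
  moreover have "cmod (q u v) = cmod ?z" using q_herm[OF v u] by simp
  ultimately show ?thesis by simp
qed

lemma nrm_triangle:
  assumes u: "u \<in> V" and v: "v \<in> V"
  shows "nrm (\<lambda>x. u x + v x) \<le> nrm u + nrm v"
proof -
  have "(nrm (\<lambda>x. u x + 1 * v x))\<^sup>2 = (nrm u)\<^sup>2 + 2 * Re (q v u) + (nrm v)\<^sup>2"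
    using nrm_add_scale_sq[OF u v, of 1] by simp
  also have "\<dots> \<le> (nrm u)\<^sup>2 + 2 * (nrm v * nrm u) + (nrm v)\<^sup>2"
    using Cauchy_Schwarz[OF v u] complex_Re_le_cmod[of "q v u"] by linarith
  also have "\<dots> = (nrm u + nrm v)\<^sup>2" by (simp add: power2_sum)
  finally show ?thesis
    using nrm_ge0[OF u] nrm_ge0[OF v] by (auto intro: power2_le_imp_le)
qed

lemma nrm_minus_commute:
  assumes u: "u \<in> V" and v: "v \<in> V"
  shows "nrm (\<lambda>x. u x - v x) = nrm (\<lambda>x. v x - u x)"
  using nrm_scale[OF diff_mem[OF u v], of "-1"] by simp

lemma nrm_triangle_diff:
  assumes "u \<in> V" "v \<in> V" "w \<in> V"
  shows "nrm (\<lambda>x. u x - w x) \<le> nrm (\<lambda>x. u x - v x) + nrm (\<lambda>x. v x - w x)"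
  using nrm_triangle[OF diff_mem[OF assms(1,2)] diff_mem[OF assms(2,3)]] by simp

lemma nrm_diff_le:
  assumes "u \<in> V" "v \<in> V"
  shows "\<bar>nrm u - nrm v\<bar> \<le> nrm (\<lambda>x. u x - v x)"
  using nrm_triangle[OF diff_mem[OF assms] assms(2)] nrm_triangle[OF diff_mem[OF assms(2,1)] assms(1)]
    nrm_minus_commute[OF assms] by simp

lemma tendsto_nrm:
  assumes "\<And>n. un n \<in> V" "u \<in> V" "(\<lambda>n. nrm (\<lambda>x. un n x - u x)) \<longlonglongrightarrow> 0"
  shows "(\<lambda>n. nrm (un n)) \<longlonglongrightarrow> nrm u"
proof (rule Lim_transform[OF _ tendsto_rabs_zero_cancel[OF tendsto_sandwich[OF _ _ tendsto_const assms(3)]]])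
  show "(\<lambda>n. nrm u) \<longlonglongrightarrow> nrm u" by simp
  show "\<forall>\<^sub>F n in sequentially. 0 \<le> \<bar>nrm (un n) - nrm u\<bar>" by simp
  show "\<forall>\<^sub>F n in sequentially. \<bar>nrm (un n) - nrm u\<bar> \<le> nrm (\<lambda>x. un n x - u x)"
    using nrm_diff_le[OF assms(1,2)] by simp
qed

lemma tendsto_q_left:
  assumes "\<And>n. un n \<in> V" "u \<in> V" "w \<in> V" "(\<lambda>n. nrm (\<lambda>x. un n x - u x)) \<longlonglongrightarrow> 0"
  shows "(\<lambda>n. q (un n) w) \<longlonglongrightarrow> q u w"
proof (rule LIM_zero_cancel, rule tendsto_norm_zero_cancel, rule tendsto_sandwich[OF _ _ tendsto_const])
  show "\<forall>\<^sub>F n in sequentially. 0 \<le> cmod (q (un n) w - q u w)" by simp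
  show "\<forall>\<^sub>F n in sequentially. cmod (q (un n) w - q u w) \<le> nrm (\<lambda>x. un n x - u x) * nrm w"
    using Cauchy_Schwarz[OF diff_mem[OF assms(1,2)] assms(3)] by (simp add: q_diff assms)
  show "(\<lambda>n. nrm (\<lambda>x. un n x - u x) * nrm w) \<longlonglongrightarrow> 0"
    using tendsto_mult_left_zero[OF assms(4)] .
qed

definition Cauchy_seq :: "(nat \<Rightarrow> 'a \<Rightarrow> complex) \<Rightarrow> bool" where
  "Cauchy_seq un \<longleftrightarrow> (\<forall>e>0. \<exists>N. \<forall>m\<ge>N. \<forall>n\<ge>N. nrm (\<lambda>x. un m x - un n x) < e)"

definition complete_form :: bool where
  "complete_form \<longleftrightarrow> (\<forall>un. (\<forall>n. un n \<in> V) \<longrightarrow> Cauchy_seq un \<longrightarrow>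
     (\<exists>u\<in>V. (\<lambda>n. nrm (\<lambda>x. un n x - u x)) \<longlonglongrightarrow> 0))"

text \<open>The functional \<open>l\<close> is represented by the minimiser of \<open>\<parallel>v\<parallel>\<^sup>2 - 2 Re (l v)\<close>;
  by the parallelogram law every minimising sequence is Cauchy.\<close>

theorem Riesz:
  assumes compl: complete_form
    and l_add: "\<And>u v. \<lbrakk>u \<in> V; v \<in> V\<rbrakk> \<Longrightarrow> l (\<lambda>x. u x + v x) = l u + l v"
    and l_scale: "\<And>u c. u \<in> V \<Longrightarrow> l (\<lambda>x. c * u x) = c * l u"
    and l_bound: "\<And>u. u \<in> V \<Longrightarrow> cmod (l u) \<le> C * nrm u"
  obtains u where "u \<in> V" "\<And>v. v \<in> V \<Longrightarrow> q v u = l v"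
proof -
  define J where "J v = (nrm v)\<^sup>2 - 2 * Re (l v)" for v
  have J_lb: "- C\<^sup>2 \<le> J v" if "v \<in> V" for v
  proof -
    have "Re (l v) \<le> C * nrm v" using l_bound[OF that] complex_Re_le_cmod[of "l v"] by linarith
    moreover have "0 \<le> (nrm v - C)\<^sup>2" by simp
    ultimately show ?thesis by (simp add: J_def power2_diff algebra_simps)
  qed
  have bdd: "bdd_below (J ` V)" using J_lb by (auto intro!: bdd_belowI)
  define m where "m = Inf (J ` V)"
  have m_le: "m \<le> J v" if "v \<in> V" for v unfolding m_def using that bdd by (intro cInf_lower) auto
  have "\<exists>u\<in>V. J u < m + 1 / Suc n" for n
  proof -
    have "Inf (J ` V) < m + 1 / Suc n" by (simp add: m_def)
    then show ?thesis using cInf_lessD[of "J ` V"] zero_mem by auto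
  qed
  then obtain un where un: "\<And>n. un n \<in> V" "\<And>n. J (un n) < m + 1 / Suc n" by metis
  have J_shift: "J (\<lambda>x. u x + c * v x) = J u + 2 * Re (c * (q v u - l v)) + (cmod c)\<^sup>2 * (nrm v)\<^sup>2"
    if "u \<in> V" "v \<in> V" for u v c
    using that unfolding J_def nrm_add_scale_sq[OF that]
    by (simp add: l_add l_scale scale_mem algebra_simps)
  have para: "(nrm (\<lambda>x. u x - w x))\<^sup>2 \<le> 2 * (J u + J w - 2 * m)" if "u \<in> V" "w \<in> V" for u w
  proof -
    let ?d = "\<lambda>x. w x - u x"
    have d: "?d \<in> V" using that diff_mem by blast
    let ?mid = "\<lambda>x. u x + (1/2) * ?d x"
    have mid: "?mid \<in> V" using that d add_mem scale_mem by blast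
    have "J (\<lambda>x. u x + 1 * ?d x) = J u + 2 * Re (q ?d u - l ?d) + (nrm ?d)\<^sup>2"
      using J_shift[OF that(1) d, of 1] by simp
    moreover have "J ?mid = J u + Re (q ?d u - l ?d) + (1/4) * (nrm ?d)\<^sup>2"
      using J_shift[OF that(1) d, of "1/2"] by (simp add: power2_eq_square)
    ultimately have "J u + J w = 2 * J ?mid + (1/2) * (nrm ?d)\<^sup>2" by simp
    then have "(nrm ?d)\<^sup>2 \<le> 2 * (J u + J w - 2 * m)" using m_le[OF mid] by simp
    then show ?thesis using nrm_minus_commute[OF that] by simp
  qed
  have "Cauchy_seq un" unfolding Cauchy_seq_def
  proof (intro allI impI)
    fix e :: real assume e: "e > 0"
    obtain N where N: "1 / Suc N < e\<^sup>2 / 4" using e by (metis nat_approx_posE zero_less_power zero_less_divide_iff zero_less_numeral)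
    show "\<exists>N. \<forall>m\<ge>N. \<forall>n\<ge>N. nrm (\<lambda>x. un m x - un n x) < e"
    proof (intro exI[of _ N] allI impI)
      fix i j assume ij: "N \<le> i" "N \<le> j"
      have "1 / real (Suc i) \<le> 1 / Suc N" "1 / real (Suc j) \<le> 1 / Suc N"
        using ij by (simp_all add: frac_le)
      then have "J (un i) + J (un j) - 2 * m < e\<^sup>2 / 2" using un(2)[of i] un(2)[of j] N by linarith
      then have "(nrm (\<lambda>x. un i x - un j x))\<^sup>2 < e\<^sup>2" using para[OF un(1)[of i] un(1)[of j]] by simp
      then show "nrm (\<lambda>x. un i x - un j x) < e" using e by (meson less_imp_le power2_less_imp_less)
    qed
  qed
  then obtain u where u: "u \<in> V" and lim: "(\<lambda>n. nrm (\<lambda>x. un n x - u x)) \<longlonglongrightarrow> 0"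
    using compl un(1) unfolding complete_form_def by blast
  have "J u \<le> m"
  proof (rule LIMSEQ_le)
    have l_lim: "(\<lambda>n. l (un n)) \<longlonglongrightarrow> l u"
    proof (rule LIM_zero_cancel, rule tendsto_norm_zero_cancel, rule tendsto_sandwich[OF _ _ tendsto_const])
      have l_diff: "l (\<lambda>x. v x - w x) = l v - l w" if "v \<in> V" "w \<in> V" for v w
        using l_add[OF that(1) scale_mem[OF that(2), of "-1"]] l_scale[OF that(2), of "-1"] by simp
      show "\<forall>\<^sub>F n in sequentially. cmod (l (un n) - l u) \<le> C * nrm (\<lambda>x. un n x - u x)"
        using l_bound[OF diff_mem[OF un(1) u]] by (simp add: l_diff un(1) u)
      show "(\<lambda>n. C * nrm (\<lambda>x. un n x - u x)) \<longlonglongrightarrow> 0"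
        using tendsto_mult_right_zero[OF lim] .
    qed simp
    show "(\<lambda>n. J (un n)) \<longlonglongrightarrow> J u" unfolding J_def
      by (intro tendsto_intros tendsto_nrm[OF un(1) u lim] l_lim)
    show "(\<lambda>n. m + 1 / Suc n) \<longlonglongrightarrow> m"
      using tendsto_add[OF tendsto_const[of m] LIMSEQ_inverse_real_of_nat] by (simp add: inverse_eq_divide)
    show "\<exists>N. \<forall>n\<ge>N. J (un n) \<le> m + 1 / Suc n" using un(2) less_imp_le by blast
  qed
  have "q v u = l v" if v: "v \<in> V" for v
  proof -
    let ?z = "q v u - l v"
    have key: "0 \<le> - 2 * e * (cmod ?z)\<^sup>2 + e\<^sup>2 * (cmod ?z)\<^sup>2 * (nrm v)\<^sup>2" for e :: real
    proof -
      have mem: "(\<lambda>x. u x + (- of_real e * cnj ?z) * v x) \<in> V"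
        using u v add_mem scale_mem by blast
      have "J u \<le> J (\<lambda>x. u x + (- of_real e * cnj ?z) * v x)"
        using m_le[OF mem] \<open>J u \<le> m\<close> by linarith
      also have "\<dots> = J u + 2 * Re ((- of_real e * cnj ?z) * ?z) + (cmod (- of_real e * cnj ?z))\<^sup>2 * (nrm v)\<^sup>2"
        by (rule J_shift[OF u v])
      also have "Re ((- of_real e * cnj ?z) * ?z) = - e * (cmod ?z)\<^sup>2" by (rule Re_scaled_cnj)
      also have "(cmod (- of_real e * cnj ?z))\<^sup>2 = e\<^sup>2 * (cmod ?z)\<^sup>2"
        by (simp add: norm_mult power_mult_distrib del: complex_cnj_diff)
      finally show ?thesis by simp
    qed
    \<comment> \<open>This e makes the quadratic term of \<open>key\<close> at most half the linear
      one; the 1 in the denominator allows \<open>nrm v\<close> = 0.\<close>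
    define e where "e = 1 / ((nrm v)\<^sup>2 + 1)"
    have e: "e > 0" "e * (nrm v)\<^sup>2 \<le> 1" unfolding e_def by (auto simp: field_simps add_pos_nonneg)
    have "2 * e * (cmod ?z)\<^sup>2 \<le> (e * (nrm v)\<^sup>2) * (e * (cmod ?z)\<^sup>2)"
      using key[of e] by (simp add: power2_eq_square algebra_simps)
    also have "\<dots> \<le> 1 * (e * (cmod ?z)\<^sup>2)" using e by (intro mult_right_mono) auto
    finally have "e * (cmod ?z)\<^sup>2 \<le> 0" by linarith
    then have "cmod ?z = 0" using e by (simp add: mult_le_0_iff)
    then show ?thesis by simp
  qed
  then show thesis using that u by blast
qed

end

section \<open>The space \<open>L\<^sup>2\<close> and the spectrum of a form operator\<close>

lemma L2_I: "\<lbrakk>u \<in> borel_measurable M; integrable M (\<lambda>x. (cmod (u x))\<^sup>2)\<rbrakk> \<Longrightarrow> u \<in> L2 M"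
  by (simp add: L2_def)

lemma L2_measurable [measurable_dest]: "u \<in> L2 M \<Longrightarrow> u \<in> borel_measurable M"
  by (simp add: L2_def)

lemma L2_integrable: "u \<in> L2 M \<Longrightarrow> integrable M (\<lambda>x. (cmod (u x))\<^sup>2)"
  by (simp add: L2_def)

lemma L2_bound:
  assumes "v \<in> borel_measurable M" "integrable M g" "AE x in M. (cmod (v x))\<^sup>2 \<le> g x"
  shows "v \<in> L2 M"
proof (rule L2_I[OF assms(1)])
  show "integrable M (\<lambda>x. (cmod (v x))\<^sup>2)"
    using assms by (intro Bochner_Integration.integrable_bound[OF assms(2)]) (auto elim!: eventually_mono)
qed

lemma L2_add:
  assumes "u \<in> L2 M" "v \<in> L2 M" shows "(\<lambda>x. u x + v x) \<in> L2 M"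
proof (rule L2_bound)
  show "(\<lambda>x. u x + v x) \<in> borel_measurable M" using assms by measurable
  show "integrable M (\<lambda>x. 2 * (cmod (u x))\<^sup>2 + 2 * (cmod (v x))\<^sup>2)"
    using assms by (auto intro!: L2_integrable)
  have "(cmod (a + b))\<^sup>2 \<le> 2 * (cmod a)\<^sup>2 + 2 * (cmod b)\<^sup>2" for a b
  proof -
    have "(cmod (a + b))\<^sup>2 \<le> (cmod a + cmod b)\<^sup>2" by (simp add: norm_triangle_ineq power_mono)
    also have "\<dots> \<le> 2 * (cmod a)\<^sup>2 + 2 * (cmod b)\<^sup>2"
      using zero_le_power2[of "cmod a - cmod b"] by (simp add: power2_sum power2_diff)
    finally show ?thesis .
  qed
  then show "AE x in M. (cmod (u x + v x))\<^sup>2 \<le> 2 * (cmod (u x))\<^sup>2 + 2 * (cmod (v x))\<^sup>2" by simp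
qed

lemma L2_scale: "u \<in> L2 M \<Longrightarrow> (\<lambda>x. c * u x) \<in> L2 M"
  by (auto simp: L2_def norm_mult power_mult_distrib)

lemma L2_mult_integrable:
  assumes "u \<in> L2 M" "v \<in> L2 M" shows "integrable M (\<lambda>x. u x * v x)"
proof (rule Bochner_Integration.integrable_bound)
  show "integrable M (\<lambda>x. (cmod (u x))\<^sup>2 + (cmod (v x))\<^sup>2)"
    using assms by (auto intro!: L2_integrable)
  show "(\<lambda>x. u x * v x) \<in> borel_measurable M" using assms by measurable
  have "cmod a * cmod b \<le> (cmod a)\<^sup>2 + (cmod b)\<^sup>2" for a b
    using sum_squares_bound[of "cmod a" "cmod b"] mult_nonneg_nonneg[OF norm_ge_zero[of a] norm_ge_zero[of b]] by linarith
  then show "AE x in M. norm (u x * v x) \<le> norm ((cmod (u x))\<^sup>2 + (cmod (v x))\<^sup>2)"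
    by (simp add: norm_mult)
qed

lemma L2_cnj: "u \<in> L2 M \<Longrightarrow> (\<lambda>x. cnj (u x)) \<in> L2 M"
  using borel_measurable_continuous_on[OF continuous_on_cnj[OF continuous_on_id], of u M] by (simp add: L2_def)

lemma L2_inner_self: "L2_inner M u u = of_real (\<integral>x. (cmod (u x))\<^sup>2 \<partial>M)"
  unfolding L2_inner_def complex_norm_square[symmetric] by (rule integral_complex_of_real)

interpretation L2i: semi_inner "L2 M" "L2_inner M"
  rewrites "semi_inner.nrm (L2_inner M) = L2_norm M"
  for M :: "'a measure"
proof -
  show si: "semi_inner (L2 M) (L2_inner M)"
  proof
    show "(\<lambda>_. 0) \<in> L2 M" by (simp add: L2_def)
  next
    fix u v assume "u \<in> L2 M" "v \<in> L2 M"
    then show "L2_inner M v u = cnj (L2_inner M u v)"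
      unfolding L2_inner_def by (simp add: mult.commute flip: Bochner_Integration.integral_cnj)
  next
    fix u v w assume a: "u \<in> L2 M" "v \<in> L2 M" "w \<in> L2 M"
    then show "L2_inner M (\<lambda>x. u x + v x) w = L2_inner M u w + L2_inner M v w"
      unfolding L2_inner_def by (simp add: distrib_right L2_mult_integrable L2_cnj)
  next
    fix u assume a: "u \<in> L2 M"
    show "0 \<le> Re (L2_inner M u u)" by (simp add: L2_inner_self)
  qed (auto simp: L2_inner_def mult.assoc intro: L2_add L2_scale)
  show "semi_inner.nrm (L2_inner M) = L2_norm M"
    unfolding semi_inner.nrm_def[OF si] L2_norm_def fun_eq_iff by (simp add: L2_inner_self)
qed

lemma L2_norm_sq: "u \<in> L2 M \<Longrightarrow> (L2_norm M u)\<^sup>2 = (\<integral>x. (cmod (u x))\<^sup>2 \<partial>M)"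
  by (simp add: L2_norm_def)

lemma L2_nn_integral:
  "u \<in> L2 M \<Longrightarrow> (\<integral>\<^sup>+x. ennreal ((cmod (u x))\<^sup>2) \<partial>M) = ennreal ((L2_norm M u)\<^sup>2)"
  by (simp add: L2_norm_sq nn_integral_eq_integral L2_integrable)

text \<open>The nonnegative integral decides membership in \<open>L2\<close> and the size of the
  norm at once, so integrability need not be shown beforehand.\<close>

lemma L2_norm_le_nn:
  assumes u: "u \<in> borel_measurable M" and le: "(\<integral>\<^sup>+x. ennreal ((cmod (u x))\<^sup>2) \<partial>M) \<le> ennreal (c\<^sup>2)" and c: "0 \<le> c"
  shows "u \<in> L2 M" "L2_norm M u \<le> c"
proof -
  have "integrable M (\<lambda>x. (cmod (u x))\<^sup>2)"
    using u le by (intro integrableI_bounded) (auto simp: le_less_trans[OF le])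
  then show L: "u \<in> L2 M" using u by (rule L2_I[rotated])
  have "(L2_norm M u)\<^sup>2 \<le> c\<^sup>2" using le L2_nn_integral[OF L] by simp
  then show "L2_norm M u \<le> c" using c by (rule power2_le_imp_le)
qed

lemma L2_norm_0_AE:
  assumes "u \<in> L2 M" shows "L2_norm M u = 0 \<longleftrightarrow> (AE x in M. u x = 0)"
  unfolding L2_norm_def using integral_nonneg_eq_0_iff_AE[OF L2_integrable[OF assms]] by simp

lemma L2_cong_AE:
  assumes "u \<in> borel_measurable M" "v \<in> borel_measurable M" "AE x in M. u x = v x"
  shows "u \<in> L2 M \<longleftrightarrow> v \<in> L2 M" "L2_norm M u = L2_norm M v"
proof -
  have "integrable M (\<lambda>x. (cmod (u x))\<^sup>2) \<longleftrightarrow> integrable M (\<lambda>x. (cmod (v x))\<^sup>2)"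
    using assms by (intro integrable_cong_AE) (auto elim!: eventually_mono)
  then show "u \<in> L2 M \<longleftrightarrow> v \<in> L2 M" using assms by (simp add: L2_def)
  have "(\<integral>x. (cmod (u x))\<^sup>2 \<partial>M) = (\<integral>x. (cmod (v x))\<^sup>2 \<partial>M)"
    using assms by (intro integral_cong_AE) (auto elim!: eventually_mono)
  then show "L2_norm M u = L2_norm M v" by (simp add: L2_norm_def)
qed

lemma L2_inner_cong_AE:
  assumes "u \<in> borel_measurable M" "v \<in> borel_measurable M" "AE x in M. u x = u' x"
    "u' \<in> borel_measurable M" "v' \<in> borel_measurable M" "AE x in M. v x = v' x"
  shows "L2_inner M u v = L2_inner M u' v'"
proof -
  have "(\<lambda>x. cnj (w x)) \<in> borel_measurable M" if "w \<in> borel_measurable M" for w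
    using that by (rule borel_measurable_continuous_on[OF continuous_on_cnj[OF continuous_on_id]])
  note cm = this
  show ?thesis unfolding L2_inner_def
  proof (rule integral_cong_AE)
    show "(\<lambda>x. u x * cnj (v x)) \<in> borel_measurable M" "(\<lambda>x. u' x * cnj (v' x)) \<in> borel_measurable M"
      using assms(1,2,4,5) cm by (simp_all add: borel_measurable_times)
    show "AE x in M. u x * cnj (v x) = u' x * cnj (v' x)"
      using assms(3,6) by eventually_elim simp
  qed
qed

text \<open>The weights \<open>2\<^sup>k\<close> in the series below replace Minkowski's inequality.\<close>

theorem L2_complete: "semi_inner.complete_form (L2 M) (L2_inner M)"
  unfolding L2i.complete_form_def
proof (intro allI impI)
  fix un :: "nat \<Rightarrow> 'a \<Rightarrow> complex"
  assume un: "\<forall>n. un n \<in> L2 M" and C: "L2i.Cauchy_seq M un"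
  note [measurable] = L2_measurable[OF un[rule_format]]
  have "\<exists>N. \<forall>m\<ge>N. \<forall>n\<ge>N. L2_norm M (\<lambda>x. un m x - un n x) < (1/2) ^ k" for k :: nat
    using C[unfolded L2i.Cauchy_seq_def, rule_format, of "(1/2)^k"] by simp
  then obtain N where N: "\<And>k m n. \<lbrakk>N k \<le> m; N k \<le> n\<rbrakk> \<Longrightarrow> L2_norm M (\<lambda>x. un m x - un n x) < (1/2) ^ k"
    by metis
  \<comment> \<open>Summing all \<open>N i\<close> up to 2k makes \<open>s\<close> monotone and at
    least \<open>N (2*k)\<close>; the summand k makes it tend to infinity. The index 2k rather than
    k yields squared increments below 16^-k, which leaves room for the weights 4^k.\<close>
  define s where "s k = (\<Sum>i\<le>2*k. N i) + k" for k
  have s_mono: "s k \<le> s (Suc k)" for k by (auto simp: s_def)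
  have s_ge: "N (2*k) \<le> s k" for k unfolding s_def by (rule trans_le_add1, rule member_le_sum) auto
  have s_ge': "k \<le> s k" for k by (simp add: s_def)
  define d where "d k x = un (s (Suc k)) x - un (s k) x" for k x
  have d_L2: "d k \<in> L2 M" for k unfolding d_def[abs_def] using un L2i.diff_mem by blast
  note [measurable] = L2_measurable[OF d_L2]
  have d_norm: "(L2_norm M (d k))\<^sup>2 \<le> (1/16) ^ k" for k
  proof -
    have "L2_norm M (d k) < (1/2) ^ (2*k)" unfolding d_def[abs_def]
      using N[of "2*k" "s (Suc k)" "s k"] s_ge[of k] s_mono[of k] by simp
    then have "(L2_norm M (d k))\<^sup>2 \<le> ((1/2) ^ (2*k))\<^sup>2"
      using L2i.nrm_ge0[OF d_L2] by (intro power_mono) auto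
    also have "\<dots> = (1/16) ^ k" by (simp add: power_divide flip: power_mult) (simp add: power_mult mult.commute[of _ 4])
    finally show ?thesis .
  qed
  have "(\<integral>\<^sup>+x. (\<Sum>k. ennreal (4 ^ k * (cmod (d k x))\<^sup>2)) \<partial>M) = (\<Sum>k. ennreal (4 ^ k * (L2_norm M (d k))\<^sup>2))"
    by (subst nn_integral_suminf) (auto simp: ennreal_mult nn_integral_cmult L2_nn_integral[OF d_L2])
  also have "\<dots> \<le> (\<Sum>k. ennreal ((1/4) ^ k))"
  proof (intro suminf_le ennreal_leI)
    fix k :: nat
    have "4 ^ k * (L2_norm M (d k))\<^sup>2 \<le> 4 ^ k * (1/16) ^ k" using d_norm[of k] by simp
    also have "\<dots> = (1/4::real) ^ k" by (simp flip: power_mult_distrib)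
    finally show "4 ^ k * (L2_norm M (d k))\<^sup>2 \<le> (1/4) ^ k" .
  qed auto
  also have "\<dots> = ennreal (\<Sum>k. (1/4) ^ k)" by (intro suminf_ennreal2 summable_geometric) auto
  also have "\<dots> < \<infinity>" by simp
  finally have "AE x in M. (\<Sum>k. ennreal (4 ^ k * (cmod (d k x))\<^sup>2)) \<noteq> \<infinity>"
    by (intro nn_integral_PInf_AE) auto
  then have conv: "AE x in M. convergent (\<lambda>k. un (s k) x)"
  proof (rule AE_mp, intro AE_I2 impI)
    fix x assume fin: "(\<Sum>k. ennreal (4 ^ k * (cmod (d k x))\<^sup>2)) \<noteq> \<infinity>"
    define B where "B = enn2real (\<Sum>k. ennreal (4 ^ k * (cmod (d k x))\<^sup>2))"
    have B: "(\<Sum>k. ennreal (4 ^ k * (cmod (d k x))\<^sup>2)) = ennreal B" "0 \<le> B"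
      using fin unfolding B_def by (auto simp: less_top)
    have "cmod (d k x) \<le> sqrt B * (1/2) ^ k" for k
    proof -
      have "ennreal (4 ^ k * (cmod (d k x))\<^sup>2) \<le> ennreal B"
        unfolding B(1)[symmetric] by (rule order_trans[OF _ sum_le_suminf[of _ "{k}"]]) auto
      then have "4 ^ k * (cmod (d k x))\<^sup>2 \<le> B" using B(2) by simp
      moreover have "(2 ^ k * cmod (d k x))\<^sup>2 = 4 ^ k * (cmod (d k x))\<^sup>2"
        by (simp add: power_mult_distrib power2_eq_square flip: power_mult_distrib[of 2 2 k])
      ultimately have "(2 ^ k * cmod (d k x))\<^sup>2 \<le> B" by simp
      then have "2 ^ k * cmod (d k x) \<le> sqrt B" by (rule real_le_rsqrt)
      then show ?thesis by (simp add: power_divide field_simps)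
    qed
    moreover have "summable (\<lambda>k. sqrt B * (1/2) ^ k)" by (rule summable_mult[OF summable_geometric]) simp
    ultimately have summ: "summable (\<lambda>k. d k x)" by (metis summable_comparison_test')
    have tele: "un (s k) x = un (s 0) x + (\<Sum>i<k. d i x)" for k
      by (induction k) (auto simp: d_def)
    have eq: "(\<lambda>k. un (s k) x) = (\<lambda>k. un (s 0) x + (\<Sum>i<k. d i x))" by (rule ext) (rule tele)
    have "(\<lambda>k. un (s 0) x + (\<Sum>i<k. d i x)) \<longlonglongrightarrow> un (s 0) x + (\<Sum>k. d k x)"
      by (rule tendsto_add[OF tendsto_const summable_LIMSEQ[OF summ]])
    then show "convergent (\<lambda>k. un (s k) x)" unfolding eq[symmetric] by (rule convergentI)
  qed
  define u where "u x = lim (\<lambda>k. un (s k) x)" for x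
  have um [measurable]: "u \<in> borel_measurable M" unfolding u_def[abs_def] by measurable
  have lim: "AE x in M. (\<lambda>k. un (s k) x) \<longlonglongrightarrow> u x"
    using conv by (auto simp: u_def convergent_LIMSEQ_iff)
  \<comment> \<open>Fatou along the subsequence, with n fixed, carries the Cauchy estimate over to
    the pointwise limit.\<close>
  have fatou: "(\<integral>\<^sup>+x. ennreal ((cmod (un n x - u x))\<^sup>2) \<partial>M) \<le> ennreal (e\<^sup>2)"
    if e: "e > 0" and n: "\<forall>m\<ge>K. L2_norm M (\<lambda>x. un n x - un m x) < e" for n e K
  proof -
    have "(\<integral>\<^sup>+x. ennreal ((cmod (un n x - u x))\<^sup>2) \<partial>M)
        = (\<integral>\<^sup>+x. liminf (\<lambda>k. ennreal ((cmod (un n x - un (s k) x))\<^sup>2)) \<partial>M)"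
    proof (rule nn_integral_cong_AE, use lim in eventually_elim)
      case (elim x)
      have "(\<lambda>k. (cmod (un n x - un (s k) x))\<^sup>2) \<longlonglongrightarrow> (cmod (un n x - u x))\<^sup>2"
        by (intro tendsto_intros elim)
      then have "(\<lambda>k. ennreal ((cmod (un n x - un (s k) x))\<^sup>2)) \<longlonglongrightarrow> ennreal ((cmod (un n x - u x))\<^sup>2)"
        by (rule tendsto_ennrealI)
      then show ?case by (rule lim_imp_Liminf[OF sequentially_bot, symmetric])
    qed
    also have "\<dots> \<le> liminf (\<lambda>k. \<integral>\<^sup>+x. ennreal ((cmod (un n x - un (s k) x))\<^sup>2) \<partial>M)"
      by (rule nn_integral_liminf) auto
    also have "\<dots> \<le> ennreal (e\<^sup>2)"
    proof (rule Liminf_le)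
      show "\<forall>\<^sub>F k in sequentially. (\<integral>\<^sup>+x. ennreal ((cmod (un n x - un (s k) x))\<^sup>2) \<partial>M) \<le> ennreal (e\<^sup>2)"
        using eventually_ge_at_top[of K]
      proof eventually_elim
        case (elim k)
        have mem: "(\<lambda>x. un n x - un (s k) x) \<in> L2 M" using un L2i.diff_mem by blast
        have "L2_norm M (\<lambda>x. un n x - un (s k) x) < e" using n s_ge'[of k] elim by auto
        then show ?case unfolding L2_nn_integral[OF mem]
          using L2i.nrm_ge0[OF mem] by (intro ennreal_leI power_mono) auto
      qed
    qed simp
    finally show ?thesis .
  qed
  have ev: "\<exists>K. \<forall>n\<ge>K. (\<lambda>x. un n x - u x) \<in> L2 M \<and> L2_norm M (\<lambda>x. un n x - u x) \<le> e" if e: "e > 0" for e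
  proof -
    obtain K where "\<forall>m\<ge>K. \<forall>n\<ge>K. L2_norm M (\<lambda>x. un m x - un n x) < e"
      using C e unfolding L2i.Cauchy_seq_def by blast
    then show ?thesis
      using L2_norm_le_nn[OF _ fatou[OF e]] e by (intro exI[of _ K]) (auto simp: less_imp_le)
  qed
  obtain K where "(\<lambda>x. un K x - u x) \<in> L2 M" using ev[of 1] by auto
  then have "(\<lambda>x. un K x - (un K x - u x)) \<in> L2 M" using un L2i.diff_mem[of "un K" M "\<lambda>x. un K x - u x"] by blast
  then have u: "u \<in> L2 M" by simp
  have "(\<lambda>n. L2_norm M (\<lambda>x. un n x - u x)) \<longlonglongrightarrow> 0"
  proof (rule LIMSEQ_I)
    fix e :: real assume "e > 0"
    then obtain K where "\<forall>n\<ge>K. L2_norm M (\<lambda>x. un n x - u x) \<le> e/2" using ev[of "e/2"] by auto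
    then show "\<exists>K. \<forall>n\<ge>K. norm (L2_norm M (\<lambda>x. un n x - u x) - 0) < e"
      using \<open>e > 0\<close> L2i.nrm_ge0[OF L2i.diff_mem[OF un[rule_format] u]] by (intro exI[of _ K]) (auto simp: le_less_trans)
  qed
  then show "\<exists>u\<in>L2 M. (\<lambda>n. L2_norm M (\<lambda>x. un n x - u x)) \<longlonglongrightarrow> 0" using u by blast
qed

text \<open>Completeness is shown once, for the norm of \<open>H1\<close>, and passes from there to
  the forms shifted by different real numbers, whose norms are comparable with constants in both
  directions.\<close>

lemma complete_form_equiv:
  assumes 1: "semi_inner V q1" and 2: "semi_inner V q2" and c: "semi_inner.complete_form V q1"
    and K: "\<And>u. u \<in> V \<Longrightarrow> semi_inner.nrm q1 u \<le> K * semi_inner.nrm q2 u"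
    and K': "\<And>u. u \<in> V \<Longrightarrow> semi_inner.nrm q2 u \<le> K' * semi_inner.nrm q1 u"
  shows "semi_inner.complete_form V q2"
proof -
  interpret a: semi_inner V q1 by fact
  interpret b: semi_inner V q2 by fact
  show ?thesis unfolding b.complete_form_def
  proof (intro allI impI)
    fix un assume un: "\<forall>n. un n \<in> V" and C: "b.Cauchy_seq un"
    have "a.Cauchy_seq un" unfolding a.Cauchy_seq_def
    proof (intro allI impI)
      fix e :: real assume e: "e > 0"
      have "e / (\<bar>K\<bar> + 1) > 0" using e by (simp add: add_nonneg_pos)
      then obtain N where N: "\<forall>m\<ge>N. \<forall>n\<ge>N. b.nrm (\<lambda>x. un m x - un n x) < e / (\<bar>K\<bar> + 1)"
        using C unfolding b.Cauchy_seq_def by blast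
      show "\<exists>N. \<forall>m\<ge>N. \<forall>n\<ge>N. a.nrm (\<lambda>x. un m x - un n x) < e"
      proof (intro exI[of _ N] allI impI)
        fix m n assume mn: "N \<le> m" "N \<le> n"
        have mem: "(\<lambda>x. un m x - un n x) \<in> V" using un a.diff_mem by blast
        have "a.nrm (\<lambda>x. un m x - un n x) \<le> (\<bar>K\<bar> + 1) * b.nrm (\<lambda>x. un m x - un n x)"
          using K[OF mem] mult_right_mono[of K "\<bar>K\<bar> + 1", OF _ b.nrm_ge0[OF mem]] by linarith
        also have "\<dots> < e"
          using N[rule_format, OF mn] by (simp add: pos_less_divide_eq mult.commute)
        finally show "a.nrm (\<lambda>x. un m x - un n x) < e" .
      qed
    qed
    then obtain u where u: "u \<in> V" "(\<lambda>n. a.nrm (\<lambda>x. un n x - u x)) \<longlonglongrightarrow> 0"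
      using c un unfolding a.complete_form_def by blast
    have "(\<lambda>n. b.nrm (\<lambda>x. un n x - u x)) \<longlonglongrightarrow> 0"
    proof (rule tendsto_sandwich[OF _ _ tendsto_const])
      show "\<forall>\<^sub>F n in sequentially. b.nrm (\<lambda>x. un n x - u x) \<le> K' * a.nrm (\<lambda>x. un n x - u x)"
        using K' un u(1) a.diff_mem by simp
      show "\<forall>\<^sub>F n in sequentially. 0 \<le> b.nrm (\<lambda>x. un n x - u x)"
        using un u(1) b.diff_mem b.nrm_ge0 by simp
      show "(\<lambda>n. K' * a.nrm (\<lambda>x. un n x - u x)) \<longlonglongrightarrow> 0" using tendsto_mult_right_zero[OF u(2)] .
    qed
    then show "\<exists>u\<in>V. (\<lambda>n. b.nrm (\<lambda>x. un n x - u x)) \<longlonglongrightarrow> 0" using u(1) by blast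
  qed
qed

section \<open>The spectrum of the operator of a closed form bounded below\<close>

locale form_operator =
  fixes M :: "'a measure" and H :: "('a \<Rightarrow> complex) set"
    and r :: "('a \<Rightarrow> complex) \<Rightarrow> ('a \<Rightarrow> complex) \<Rightarrow> complex" and t0 :: real
  assumes H_sub: "H \<subseteq> L2 M"
    and shifted: "semi_inner H (\<lambda>u v. r u v - of_real t0 * L2_inner M u v)"
    and coercive: "\<And>u. u \<in> H \<Longrightarrow> (L2_norm M u)\<^sup>2 \<le> Re (r u u) - t0 * (L2_norm M u)\<^sup>2"
    and compl: "semi_inner.complete_form H (\<lambda>u v. r u v - of_real t0 * L2_inner M u v)"
    and nontriv: "\<exists>u\<in>H. L2_norm M u \<noteq> 0"
begin

sublocale q0: semi_inner H "\<lambda>u v. r u v - of_real t0 * L2_inner M u v" by (rule shifted)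

text \<open>The operator of the form in the sense of the representation theorem, as a graph.
  Closedness of the form is completeness in the norm shifted by \<open>t0\<close>, and
  \<open>coercive\<close> places \<open>t0\<close> at distance at least 1 below the form.\<close>

definition T where "T = {(u, f). u \<in> H \<and> f \<in> L2 M \<and> (\<forall>v\<in>H. r u v = L2_inner M f v)}"

definition E where "E = Inf {Re (r u u) / (L2_norm M u)\<^sup>2 | u. u \<in> H \<and> L2_norm M u \<noteq> 0}"

lemma H_L2: "u \<in> H \<Longrightarrow> u \<in> L2 M" using H_sub by blast

lemma Rayleigh_bdd: "bdd_below {Re (r u u) / (L2_norm M u)\<^sup>2 | u. u \<in> H \<and> L2_norm M u \<noteq> 0}"
proof (rule bdd_belowI[of _ "t0 + 1"], clarify)
  fix u assume u: "u \<in> H" "L2_norm M u \<noteq> 0"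
  then show "t0 + 1 \<le> Re (r u u) / (L2_norm M u)\<^sup>2"
    using coercive[OF u(1)] by (simp add: pos_le_divide_eq distrib_right)
qed

lemma E_le: "\<lbrakk>u \<in> H; L2_norm M u \<noteq> 0\<rbrakk> \<Longrightarrow> E \<le> Re (r u u) / (L2_norm M u)\<^sup>2"
  unfolding E_def by (rule cInf_lower[OF _ Rayleigh_bdd]) auto

lemma E_ge: "(\<And>u. u \<in> H \<Longrightarrow> c * (L2_norm M u)\<^sup>2 \<le> Re (r u u)) \<Longrightarrow> c \<le> E"
  unfolding E_def using nontriv by (intro cInf_greatest) (auto simp: pos_le_divide_eq)

lemma E_bound: "u \<in> H \<Longrightarrow> E * (L2_norm M u)\<^sup>2 \<le> Re (r u u)"
proof (cases "L2_norm M u = 0")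
  case True
  assume "u \<in> H" then show ?thesis using coercive[of u] True by simp
next
  case False
  assume "u \<in> H" then show ?thesis using E_le[OF _ False] False by (simp add: pos_le_divide_eq)
qed

text \<open>The case t = \<open>E\<close> is included, where the shifted form is nonnegative but no
  longer coercive; this borderline form is the one used to show that \<open>E\<close> belongs to the
  spectrum.\<close>

lemma semi_inner_shift:
  assumes "t \<le> E" shows "semi_inner H (\<lambda>u v. r u v - of_real t * L2_inner M u v)"
proof
  fix u assume u: "u \<in> H"
  have "t * (L2_norm M u)\<^sup>2 \<le> E * (L2_norm M u)\<^sup>2" using assms by (simp add: mult_right_mono)
  then show "0 \<le> Re (r u u - of_real t * L2_inner M u u)"
    using E_bound[OF u] H_L2[OF u] by (simp add: L2i.q_self flip: of_real_power of_real_mult)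
next
  fix u v w assume a: "u \<in> H" "v \<in> H" "w \<in> H"
  show "r (\<lambda>x. u x + v x) w - of_real t * L2_inner M (\<lambda>x. u x + v x) w
     = r u w - of_real t * L2_inner M u w + (r v w - of_real t * L2_inner M v w)"
    using q0.q_add[OF a] a by (simp add: L2i.q_add H_L2 algebra_simps)
next
  fix u w c assume a: "u \<in> H" "w \<in> H"
  show "r (\<lambda>x. c * u x) w - of_real t * L2_inner M (\<lambda>x. c * u x) w = c * (r u w - of_real t * L2_inner M u w)"
    using q0.q_scale[OF a, of c] a by (simp add: L2i.q_scale H_L2 algebra_simps)
next
  fix u v assume a: "u \<in> H" "v \<in> H"
  show "r v u - of_real t * L2_inner M v u = cnj (r u v - of_real t * L2_inner M u v)"
    using q0.q_herm[OF a] L2i.q_herm[OF H_L2[OF a(1)] H_L2[OF a(2)]] by simp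
qed (auto intro: q0.zero_mem q0.add_mem q0.scale_mem)

lemma r_herm: "\<lbrakk>u \<in> H; v \<in> H\<rbrakk> \<Longrightarrow> r v u = cnj (r u v)"
  using q0.q_herm[of u v] L2i.q_herm[OF H_L2 H_L2, of u v] by simp

text \<open>For t < \<open>E\<close> the shifted form dominates (E - t) |u|^2 and its norm is
  equivalent to the given one, so \<open>H\<close> is complete for it. Riesz solves (T - t) u = f
  weakly, and pairing the equation with u bounds the inverse by 1 / (E - t).\<close>

lemma resolvent_below:
  assumes t: "t < E" shows "of_real t \<in> resolvent_set M T"
proof -
  interpret q: semi_inner H "\<lambda>u v. r u v - of_real t * L2_inner M u v"
    by (rule semi_inner_shift[OF less_imp_le[OF t]])
  have q_sq: "(q.nrm u)\<^sup>2 = Re (r u u) - t * (L2_norm M u)\<^sup>2" if "u \<in> H" for u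
    using that by (simp add: q.nrm_sq L2i.q_self H_L2 flip: of_real_power of_real_mult)
  have q0_sq: "(q0.nrm u)\<^sup>2 = Re (r u u) - t0 * (L2_norm M u)\<^sup>2" if "u \<in> H" for u
    using that by (simp add: q0.nrm_sq L2i.q_self H_L2 flip: of_real_power of_real_mult)
  have low: "(E - t) * (L2_norm M u)\<^sup>2 \<le> (q.nrm u)\<^sup>2" if "u \<in> H" for u
    using E_bound[OF that] by (simp add: q_sq[OF that] left_diff_distrib)
  have low': "L2_norm M u \<le> q.nrm u / sqrt (E - t)" if "u \<in> H" for u
  proof -
    have "(L2_norm M u)\<^sup>2 \<le> (q.nrm u / sqrt (E - t))\<^sup>2"
      using low[OF that] t by (simp add: power_divide field_simps)
    moreover have "0 \<le> q.nrm u / sqrt (E - t)" using q.nrm_ge0[OF that] t by simp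
    ultimately show ?thesis by (rule power2_le_imp_le)
  qed
  have compl_q: "q.complete_form"
  proof (rule complete_form_equiv[OF shifted q.semi_inner_axioms compl])
    fix u assume u: "u \<in> H"
    define a where "a = (L2_norm M u)\<^sup>2"
    have a: "0 \<le> a" "(E - t) * a \<le> (q.nrm u)\<^sup>2" "a \<le> (q0.nrm u)\<^sup>2"
      using low[OF u] coercive[OF u] by (simp_all add: a_def q0_sq[OF u])
    have "(q0.nrm u)\<^sup>2 = (q.nrm u)\<^sup>2 + (t - t0) * a"
      by (simp add: q_sq[OF u] q0_sq[OF u] a_def algebra_simps)
    also have "\<dots> \<le> (q.nrm u)\<^sup>2 + \<bar>t - t0\<bar> * ((q.nrm u)\<^sup>2 / (E - t))"
    proof -
      have "(t - t0) * a \<le> \<bar>t - t0\<bar> * a" using a(1) by (intro mult_right_mono) auto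
      also have "\<dots> \<le> \<bar>t - t0\<bar> * ((q.nrm u)\<^sup>2 / (E - t))"
        using a(2) t by (intro mult_left_mono) (auto simp: field_simps)
      finally show ?thesis by simp
    qed
    also have "\<dots> = (sqrt (1 + \<bar>t - t0\<bar> / (E - t)) * q.nrm u)\<^sup>2"
      using t by (simp add: power_mult_distrib algebra_simps)
    finally show "q0.nrm u \<le> sqrt (1 + \<bar>t - t0\<bar> / (E - t)) * q.nrm u"
      by (rule power2_le_imp_le) (use q.nrm_ge0[OF u] t in simp)
    have "(q.nrm u)\<^sup>2 = (q0.nrm u)\<^sup>2 + (t0 - t) * a"
      by (simp add: q_sq[OF u] q0_sq[OF u] a_def algebra_simps)
    also have "\<dots> \<le> (q0.nrm u)\<^sup>2 + \<bar>t0 - t\<bar> * (q0.nrm u)\<^sup>2"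
    proof -
      have "(t0 - t) * a \<le> \<bar>t0 - t\<bar> * a" using a(1) by (intro mult_right_mono) auto
      also have "\<dots> \<le> \<bar>t0 - t\<bar> * (q0.nrm u)\<^sup>2" using a(3) by (intro mult_left_mono) auto
      finally show ?thesis by simp
    qed
    also have "\<dots> = (sqrt (1 + \<bar>t0 - t\<bar>) * q0.nrm u)\<^sup>2"
      by (simp add: power_mult_distrib algebra_simps)
    finally show "q.nrm u \<le> sqrt (1 + \<bar>t0 - t\<bar>) * q0.nrm u"
      by (rule power2_le_imp_le) (use q0.nrm_ge0[OF u] in simp)
  qed
  have solve: "\<exists>u. (u, \<lambda>x. f x + of_real t * u x) \<in> T" if f: "f \<in> L2 M" for f
  proof -
    obtain u where u: "u \<in> H" "\<And>v. v \<in> H \<Longrightarrow> r v u - of_real t * L2_inner M v u = L2_inner M v f"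
    proof (rule q.Riesz[OF compl_q, of "\<lambda>v. L2_inner M v f" "L2_norm M f / sqrt (E - t)"])
      fix v assume v: "v \<in> H"
      have "cmod (L2_inner M v f) \<le> L2_norm M v * L2_norm M f" by (rule L2i.Cauchy_Schwarz[OF H_L2[OF v] f])
      also have "\<dots> \<le> q.nrm v / sqrt (E - t) * L2_norm M f"
        by (rule mult_right_mono[OF low'[OF v] L2i.nrm_ge0[OF f]])
      finally show "cmod (L2_inner M v f) \<le> L2_norm M f / sqrt (E - t) * q.nrm v" by (simp add: mult.commute)
    qed (auto simp: f H_L2 L2i.q_add L2i.q_scale)
    have "r u v = L2_inner M (\<lambda>x. f x + of_real t * u x) v" if v: "v \<in> H" for v
    proof -
      \<comment> \<open>Riesz represents the functional \<open>L2_inner M v f\<close>, linear in v,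
        whereas \<open>T\<close> has v in the second slot; Hermitian symmetry exchanges the
        two.\<close>
      have "cnj (r v u - of_real t * L2_inner M v u) = cnj (L2_inner M v f)" using u(2)[OF v] by simp
      then have "r u v - of_real t * L2_inner M u v = L2_inner M f v"
        using r_herm[OF v u(1)] L2i.q_herm[OF H_L2[OF v] H_L2[OF u(1)]] L2i.q_herm[OF H_L2[OF v] f] by simp
      then show ?thesis using f u(1) v by (simp add: L2i.q_add L2i.q_scale L2_scale H_L2 algebra_simps)
    qed
    moreover have "(\<lambda>x. f x + of_real t * u x) \<in> L2 M" by (rule L2_add[OF f L2_scale[OF H_L2[OF u(1)]]])
    ultimately show ?thesis unfolding T_def using u(1) by blast
  qed
  have "L2_norm M u \<le> (1 / (E - t)) * L2_norm M (\<lambda>x. g x - of_real t * u x)" if "(u, g) \<in> T" for u g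
  proof -
    have u: "u \<in> H" "g \<in> L2 M" "r u u = L2_inner M g u" using that by (auto simp: T_def)
    let ?k = "\<lambda>x. g x - of_real t * u x"
    have k: "?k \<in> L2 M" using u H_L2 L2_scale L2i.diff_mem by blast
    have "(E - t) * (L2_norm M u)\<^sup>2 \<le> Re (r u u) - t * (L2_norm M u)\<^sup>2" using low[OF u(1)] q_sq[OF u(1)] by simp
    also have "\<dots> = Re (L2_inner M ?k u)"
      using u H_L2 by (simp add: L2i.q_diff L2i.q_scale L2_scale L2i.q_self flip: of_real_power of_real_mult)
    also have "\<dots> \<le> L2_norm M ?k * L2_norm M u"
      using L2i.Cauchy_Schwarz[OF k H_L2[OF u(1)]] complex_Re_le_cmod order_trans by blast
    finally have *: "(E - t) * L2_norm M u * L2_norm M u \<le> L2_norm M ?k * L2_norm M u"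
      by (simp add: power2_eq_square)
    show ?thesis
    proof (cases "L2_norm M u = 0")
      case True then show ?thesis using L2i.nrm_ge0[OF k] t by simp
    next
      case False
      then have "L2_norm M u > 0" using L2i.nrm_ge0[OF H_L2[OF u(1)]] by simp
      then have "(E - t) * L2_norm M u \<le> L2_norm M ?k" using * by (simp add: mult_le_cancel_right)
      then show ?thesis using t by (simp add: field_simps)
    qed
  qed
  then show ?thesis unfolding resolvent_set_def using solve by blast
qed

text \<open>Spectral membership without a minimiser. Let q be the nonnegative form r - E, with
  seminorm |.|_q. If T - E had a bounded inverse, solving (T - E) w = u for an almost minimising u
  would give |u|^2 = q(w, u) <= |w|_q |u|_q. Here |u|_q^2 <= e |u|^2, and |w|_q^2 = (u, w) is at
  most a fixed multiple of |u|^2, which is contradictory for small e.\<close>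

lemma E_not_resolvent: "of_real E \<notin> resolvent_set M T"
proof
  assume "of_real E \<in> resolvent_set M T"
  then obtain C where solve: "\<forall>f\<in>L2 M. \<exists>u. (u, \<lambda>x. f x + of_real E * u x) \<in> T"
    and C: "\<forall>(u, g)\<in>T. L2_norm M u \<le> C * L2_norm M (\<lambda>x. g x - of_real E * u x)"
    unfolding resolvent_set_def by blast
  interpret q: semi_inner H "\<lambda>u v. r u v - of_real E * L2_inner M u v"
    by (rule semi_inner_shift[OF order_refl])
  \<comment> \<open>With this e the final chain reads n^4 <= n^4 / 2.\<close>
  define e where "e = 1 / (2 * (\<bar>C\<bar> + 1))"
  have e: "e > 0" "(\<bar>C\<bar> + 1) * e = 1/2" unfolding e_def by (auto simp: field_simps add_pos_nonneg)
  obtain u where u: "u \<in> H" "L2_norm M u \<noteq> 0" "Re (r u u) / (L2_norm M u)\<^sup>2 < E + e"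
  proof -
    have "Inf {Re (r u u) / (L2_norm M u)\<^sup>2 | u. u \<in> H \<and> L2_norm M u \<noteq> 0} < E + e"
      using e unfolding E_def by simp
    from cInf_lessD[OF _ this] show ?thesis using nontriv that by auto
  qed
  define n where "n = L2_norm M u"
  have n: "n > 0" using u L2i.nrm_ge0[OF H_L2[OF u(1)]] by (simp add: n_def)
  have qu: "(q.nrm u)\<^sup>2 \<le> e * n\<^sup>2"
  proof -
    have "(q.nrm u)\<^sup>2 = Re (r u u) - E * n\<^sup>2"
      using u(1) by (simp add: q.nrm_sq L2i.q_self H_L2 n_def flip: of_real_power of_real_mult)
    moreover have "Re (r u u) < (E + e) * n\<^sup>2"
      using u(3) n by (simp add: pos_divide_less_eq n_def)
    ultimately show ?thesis by (simp add: distrib_right)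
  qed
  obtain w where w: "(w, \<lambda>x. u x + of_real E * w x) \<in> T" using solve H_L2[OF u(1)] by blast
  then have wH: "w \<in> H" and wr: "\<And>v. v \<in> H \<Longrightarrow> r w v = L2_inner M (\<lambda>x. u x + of_real E * w x) v"
    by (auto simp: T_def)
  have wq: "r w v - of_real E * L2_inner M w v = L2_inner M u v" if "v \<in> H" for v
    using wr[OF that] that wH u(1) by (simp add: L2i.q_add L2i.q_scale L2_scale H_L2)
  have "L2_norm M w \<le> C * n" using C[rule_format, OF w] by (simp add: n_def)
  then have wn: "L2_norm M w \<le> (\<bar>C\<bar> + 1) * n"
    using n mult_right_mono[of C "\<bar>C\<bar> + 1" n] by linarith
  have "(q.nrm w)\<^sup>2 = Re (L2_inner M u w)" using wq[OF wH] wH by (simp add: q.nrm_sq)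
  also have "\<dots> \<le> n * L2_norm M w" unfolding n_def
    using L2i.Cauchy_Schwarz[OF H_L2[OF u(1)] H_L2[OF wH]] complex_Re_le_cmod order_trans by blast
  also have "\<dots> \<le> n * ((\<bar>C\<bar> + 1) * n)" using wn n by simp
  finally have qw: "(q.nrm w)\<^sup>2 \<le> (\<bar>C\<bar> + 1) * n\<^sup>2" by (simp add: power2_eq_square mult_ac)
  have "n\<^sup>2 = cmod (L2_inner M u u)" using H_L2[OF u(1)] by (simp add: L2i.q_self n_def norm_power flip: of_real_power)
  also have "\<dots> \<le> q.nrm w * q.nrm u" using q.Cauchy_Schwarz[OF wH u(1)] wq[OF u(1)] by simp
  finally have "(n\<^sup>2)\<^sup>2 \<le> (q.nrm w * q.nrm u)\<^sup>2" by (intro power_mono) auto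
  also have "\<dots> = (q.nrm w)\<^sup>2 * (q.nrm u)\<^sup>2" by (simp add: power_mult_distrib)
  also have "\<dots> \<le> ((\<bar>C\<bar> + 1) * n\<^sup>2) * (e * n\<^sup>2)" using qw qu by (intro mult_mono) auto
  also have "\<dots> = ((\<bar>C\<bar> + 1) * e) * (n\<^sup>2)\<^sup>2" by (simp only: power2_eq_square mult_ac)
  also have "\<dots> = (1/2) * (n\<^sup>2)\<^sup>2" by (simp only: e(2))
  finally show False using n by simp
qed

theorem Inf_spectrum: "Inf {t. of_real t \<in> op_spectrum M T} = E"
proof (rule cInf_eq_minimum)
  show "E \<in> {t. of_real t \<in> op_spectrum M T}" using E_not_resolvent by (simp add: op_spectrum_def)
  fix t assume "t \<in> {t. of_real t \<in> op_spectrum M T}"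
  then show "E \<le> t" using resolvent_below[of t] by (force simp: op_spectrum_def)
qed

end

section \<open>Smooth functions\<close>

definition smooth :: "('a::euclidean_space \<Rightarrow> 'b::real_normed_vector) \<Rightarrow> bool" where
  "smooth f \<longleftrightarrow> (\<forall>k. Ck k f)"

lemma Ck_continuous: "Ck k f \<Longrightarrow> continuous_on UNIV f"
  by (cases k) (simp_all add: continuous_at_imp_continuous_on differentiable_imp_continuous_within)

lemma Ck_SucD: "Ck (Suc k) f \<Longrightarrow> Ck k f"
proof (induction k arbitrary: f)
  case 0 then show ?case using Ck_continuous[of "Suc 0" f] by simp
next
  case (Suc k) then show ?case using Ck.simps(2)[of "Suc k" f] Ck.simps(2)[of k f] by blast
qed

lemma Ck_SucI:
  assumes "\<And>x. (f has_derivative f' x) (at x)" "\<And>i. i \<in> Basis \<Longrightarrow> Ck k (\<lambda>x. f' x i)"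
  shows "Ck (Suc k) f"
proof -
  have "frechet_derivative f (at x) = f' x" for x using frechet_derivative_at[OF assms(1)[of x]] by simp
  then show ?thesis using assms by (auto simp: differentiable_def)
qed

lemma Ck_Suc_derivative:
  assumes "Ck (Suc k) f"
  shows "(f has_derivative frechet_derivative f (at x)) (at x)"
    "i \<in> Basis \<Longrightarrow> Ck k (\<lambda>x. frechet_derivative f (at x) i)"
  using assms frechet_derivative_works[of f "at x"] by auto

lemma Ck_const: "Ck k (\<lambda>x. c)"
proof (induction k arbitrary: c)
  case (Suc k) then show ?case by (intro Ck_SucI[where f' = "\<lambda>x h. 0"]) auto
qed simp

lemma Ck_linear:
  assumes "bounded_linear L" shows "Ck k L"
proof (cases k)
  case 0 then show ?thesis using linear_continuous_on[OF assms] by simp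
next
  case (Suc m)
  then show ?thesis
    using Ck_SucI[of L "\<lambda>x. L" m] bounded_linear_imp_has_derivative[OF assms] Ck_const by auto
qed

lemma Ck_add: "\<lbrakk>Ck k f; Ck k g\<rbrakk> \<Longrightarrow> Ck k (\<lambda>x. f x + g x)"
proof (induction k arbitrary: f g)
  case 0 then show ?case by (simp add: continuous_on_add)
next
  case (Suc k)
  define f' where "f' x = frechet_derivative f (at x)" for x
  note f' = Ck_Suc_derivative[OF Suc.prems(1), folded f'_def]
  define g' where "g' x = frechet_derivative g (at x)" for x
  note g' = Ck_Suc_derivative[OF Suc.prems(2), folded g'_def]
  show ?case
    using f' g' Suc.IH by (intro Ck_SucI[where f' = "\<lambda>x h. f' x h + g' x h"] has_derivative_add) auto
qed

text \<open>A single Leibniz induction covers products, scalar multiples and inner products.\<close>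

lemma Ck_bilinear:
  assumes "bounded_bilinear p" shows "\<lbrakk>Ck k f; Ck k g\<rbrakk> \<Longrightarrow> Ck k (\<lambda>x. p (f x) (g x))"
proof (induction k arbitrary: f g)
  case 0 then show ?case by (simp add: bounded_bilinear.continuous_on[OF assms])
next
  case (Suc k)
  define f' where "f' x = frechet_derivative f (at x)" for x
  note f' = Ck_Suc_derivative[OF Suc.prems(1), folded f'_def]
  define g' where "g' x = frechet_derivative g (at x)" for x
  note g' = Ck_Suc_derivative[OF Suc.prems(2), folded g'_def]
  show ?case
    using f' g' Suc.IH Suc.prems[THEN Ck_SucD]
    by (intro Ck_SucI[where f' = "\<lambda>x h. p (f x) (g' x h) + p (f' x h) (g x)"]
        bounded_bilinear.FDERIV[OF assms] Ck_add) auto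
qed

text \<open>The inner function is real-valued, so the derivative of f is determined by the vector
  \<open>f' t 1\<close>; the chain rule then produces a product to which \<open>Ck_bilinear\<close>
  applies at the lower order.\<close>

lemma Ck_compose:
  fixes f :: "real \<Rightarrow> 'b::real_normed_vector" and g :: "'a::euclidean_space \<Rightarrow> real"
  shows "\<lbrakk>Ck k f; Ck k g\<rbrakk> \<Longrightarrow> Ck k (\<lambda>x. f (g x))"
proof (induction k arbitrary: f g)
  case 0 then show ?case using continuous_on_compose2[of UNIV f UNIV g] by simp
next
  case (Suc k)
  define f' where "f' x = frechet_derivative f (at x)" for x
  note f' = Ck_Suc_derivative[OF Suc.prems(1), folded f'_def]
  define g' where "g' x = frechet_derivative g (at x)" for x
  note g' = Ck_Suc_derivative[OF Suc.prems(2), folded g'_def]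
  have lin: "f' t h = h *\<^sub>R f' t 1" for t h
    using linear_scale[OF has_derivative_linear[OF f'(1)[of t]], of h 1] by simp
  show ?case
  proof (rule Ck_SucI)
    show "((\<lambda>x. f (g x)) has_derivative (\<lambda>h. f' (g x) (g' x h))) (at x)" for x
      using diff_chain_at[OF g'(1) f'(1)] by (simp add: o_def)
    fix i :: 'a assume i: "i \<in> Basis"
    have "Ck k (\<lambda>x. g' x i *\<^sub>R f' (g x) 1)"
      using i g'(2) f'(2)[of 1] Suc.prems(2)[THEN Ck_SucD]
      by (intro Ck_bilinear[OF bounded_bilinear_scaleR] Suc.IH) auto
    then show "Ck k (\<lambda>x. f' (g x) (g' x i))" by (subst lin)
  qed
qed

lemma Ck_affine: "Ck k f \<Longrightarrow> Ck k (\<lambda>x. f (c *\<^sub>R x + a))"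
proof (induction k arbitrary: f)
  case 0
  then have "continuous_on UNIV f" by simp
  then show ?case by (auto intro!: continuous_on_compose2[of UNIV f UNIV] continuous_intros)
next
  case (Suc k)
  define f' where "f' x = frechet_derivative f (at x)" for x
  note f' = Ck_Suc_derivative[OF Suc.prems(1), folded f'_def]
  show ?case
  proof (rule Ck_SucI)
    fix x
    have "((\<lambda>x. c *\<^sub>R x + a) has_derivative (\<lambda>h. c *\<^sub>R h)) (at x)" by (auto intro!: derivative_eq_intros)
    from diff_chain_at[OF this f'(1)]
    show "((\<lambda>x. f (c *\<^sub>R x + a)) has_derivative (\<lambda>h. f' (c *\<^sub>R x + a) (c *\<^sub>R h))) (at x)" by (simp add: o_def)
  next
    fix i :: 'a assume i: "i \<in> Basis"
    have "f' y (c *\<^sub>R i) = c *\<^sub>R f' y i" for y using linear_scale[OF has_derivative_linear[OF f'(1)]] by blast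
    then show "Ck k (\<lambda>x. f' (c *\<^sub>R x + a) (c *\<^sub>R i))"
      using Ck_bilinear[OF bounded_bilinear_scaleR Ck_const Suc.IH[OF f'(2)[OF i]], of c] by simp
  qed
qed

lemma smooth_continuous: "smooth f \<Longrightarrow> continuous_on UNIV f"
  unfolding smooth_def using Ck_continuous by blast

text \<open>Suits explicit families whose derivatives stay in the family, such as the exponential,
  \<open>flat_fun\<close> and the convolutions of a fixed function; the induction on the order is
  done here once for all of them.\<close>

lemma smooth_coinduct:
  assumes "f \<in> P" and step: "\<And>f. f \<in> P \<Longrightarrow> \<exists>f'. (\<forall>x. (f has_derivative f' x) (at x)) \<and> (\<forall>i\<in>Basis. (\<lambda>x. f' x i) \<in> P)"
  shows "smooth f"
proof -
  have "Ck k f" if "f \<in> P" for k f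
    using that
  proof (induction k arbitrary: f)
    case 0
    from step[OF 0] obtain f' where "\<forall>x. (f has_derivative f' x) (at x)" by blast
    then show ?case unfolding Ck.simps
      by (intro continuous_at_imp_continuous_on ballI) (use has_derivative_continuous in blast)
  next
    case (Suc k)
    from step[OF Suc.prems] obtain f'
      where f': "\<forall>x. (f has_derivative f' x) (at x)" "\<forall>i\<in>Basis. (\<lambda>x. f' x i) \<in> P" by blast
    then show ?case using Suc.IH by (intro Ck_SucI[of f f']) auto
  qed
  then show ?thesis using assms(1) by (auto simp: smooth_def)
qed

lemma smooth_has_derivative:
  "smooth f \<Longrightarrow> (f has_derivative frechet_derivative f (at x)) (at x)"
  unfolding smooth_def using frechet_derivative_works Ck.simps(2)[of 0 f] by blast

lemma smooth_partial: "\<lbrakk>smooth f; i \<in> Basis\<rbrakk> \<Longrightarrow> smooth (\<lambda>x. frechet_derivative f (at x) i)"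
  unfolding smooth_def using Ck.simps(2)[of _ f] by blast

lemma smooth_bilinear: "\<lbrakk>bounded_bilinear p; smooth f; smooth g\<rbrakk> \<Longrightarrow> smooth (\<lambda>x. p (f x) (g x))"
  by (simp add: smooth_def Ck_bilinear)

lemmas smooth_mult = smooth_bilinear[OF bounded_bilinear_mult]
  and smooth_scaleR = smooth_bilinear[OF bounded_bilinear_scaleR]

lemma smooth_const: "smooth (\<lambda>x. c)" by (simp add: smooth_def Ck_const)

lemma smooth_linear: "bounded_linear L \<Longrightarrow> smooth L" by (simp add: smooth_def Ck_linear)

lemma smooth_add: "\<lbrakk>smooth f; smooth g\<rbrakk> \<Longrightarrow> smooth (\<lambda>x. f x + g x)" by (simp add: smooth_def Ck_add)

lemma smooth_affine: "smooth f \<Longrightarrow> smooth (\<lambda>x. f (c *\<^sub>R x + a))" by (simp add: smooth_def Ck_affine)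

lemma smooth_compose:
  fixes f :: "real \<Rightarrow> 'b::real_normed_vector"
  shows "\<lbrakk>smooth f; smooth g\<rbrakk> \<Longrightarrow> smooth (\<lambda>x. f (g x))" by (simp add: smooth_def Ck_compose)

lemma smooth_of_real:
  fixes f :: "'a::euclidean_space \<Rightarrow> real"
  assumes "smooth f" shows "smooth (\<lambda>x. of_real (f x) :: complex)"
  using smooth_scaleR[OF assms smooth_const[of "1::complex"]] by (simp add: scaleR_conv_of_real)

lemma smooth_exp: "smooth (\<lambda>x::real. exp x)"
proof (rule smooth_coinduct[where P = "{\<lambda>x. exp x}"])
  fix f :: "real \<Rightarrow> real" assume "f \<in> {\<lambda>x. exp x}"
  then have "f = exp" by simp
  then show "\<exists>f'. (\<forall>x. (f has_derivative f' x) (at x)) \<and> (\<forall>i\<in>Basis. (\<lambda>x. f' x i) \<in> {\<lambda>x. exp x})"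
    using DERIV_exp by (intro exI[of _ "\<lambda>x h. exp x * h"]) (auto simp: has_field_derivative_def)
qed simp

text \<open>All derivatives of \<open>exp (-1/x)\<close> have the form \<open>p (1/x) exp (-1/x)\<close> with a polynomial \<open>p\<close>.\<close>

definition flat_fun :: "real poly \<Rightarrow> real \<Rightarrow> real" where
  "flat_fun p x = (if x > 0 then poly p (1 / x) * exp (- 1 / x) else 0)"

text \<open>The additional factor t^k is what the induction over the coefficients needs:
  multiplication of p by t is absorbed into k.\<close>

lemma poly_exp_tendsto_0: "((\<lambda>t::real. t ^ k * poly p t * exp (- t)) \<longlongrightarrow> 0) at_top"
proof (induction p arbitrary: k)
  case (pCons a p)
  have "((\<lambda>t::real. a * (t ^ k / exp t) + t ^ (Suc k) * poly p t * exp (- t)) \<longlongrightarrow> a * 0 + 0) at_top"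
    by (intro tendsto_intros tendsto_power_div_exp_0 pCons.IH)
  then show ?case by (simp add: algebra_simps exp_minus divide_inverse)
qed simp

text \<open>With s = 1/x one has ds/dx = - s^2, so differentiating p(s) exp(-s) gives s^2 (p -
  pderiv p)(s) exp(-s), and \<open>[:0, 0, 1:]\<close> is s^2. At 0 the difference quotient from the
  right is s p(s) exp(-s), which tends to 0 as s grows.\<close>

lemma flat_fun_deriv:
  "(flat_fun p has_field_derivative flat_fun ([:0, 0, 1:] * (p - pderiv p)) x) (at x)"
proof (cases x "0::real" rule: linorder_cases)
  case less
  have "((\<lambda>x. 0) has_field_derivative 0) (at x)" by simp
  then have "(flat_fun p has_field_derivative 0) (at x)"
    by (rule has_field_derivative_transform_within_open[of _ _ _ "{..<0}"]) (use less in \<open>auto simp: flat_fun_def\<close>)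
  then show ?thesis using less by (simp add: flat_fun_def)
next
  case greater
  have "((\<lambda>x. poly p (1 / x) * exp (- 1 / x)) has_field_derivative
      poly ([:0, 0, 1:] * (p - pderiv p)) (1 / x) * exp (- 1 / x)) (at x)"
    using greater by (auto intro!: derivative_eq_intros poly_DERIV[THEN DERIV_chain2] simp: field_simps power2_eq_square)
  then have "(flat_fun p has_field_derivative poly ([:0, 0, 1:] * (p - pderiv p)) (1 / x) * exp (- 1 / x)) (at x)"
    by (rule has_field_derivative_transform_within_open[of _ _ _ "{0<..}"]) (use greater in \<open>auto simp: flat_fun_def\<close>)
  then show ?thesis using greater by (simp add: flat_fun_def)
next
  case equal
  have "((\<lambda>y. flat_fun p y / y) \<longlongrightarrow> 0) (at_right 0)"
  proof (subst filterlim_at_right_to_top)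
    show "((\<lambda>y. flat_fun p (inverse y) / inverse y) \<longlongrightarrow> 0) at_top"
    proof (rule Lim_transform_eventually[OF poly_exp_tendsto_0[of 1 p]])
      show "\<forall>\<^sub>F t in at_top. t ^ 1 * poly p t * exp (- t) = flat_fun p (inverse t) / inverse t"
        using eventually_gt_at_top[of 0] by eventually_elim (simp add: flat_fun_def inverse_eq_divide)
    qed
  qed
  moreover have "((\<lambda>y. flat_fun p y / y) \<longlongrightarrow> 0) (at_left 0)"
  proof (rule Lim_transform_eventually[OF tendsto_const[of 0]])
    show "\<forall>\<^sub>F t in at_left 0. 0 = flat_fun p t / t"
      using eventually_at_left_real[of "-1" 0] by (auto elim!: eventually_mono simp: flat_fun_def)
  qed
  ultimately have "((\<lambda>y. flat_fun p y / y) \<longlongrightarrow> 0) (at 0)"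
    by (simp add: filterlim_at_split)
  then show ?thesis using equal by (simp add: has_field_derivative_iff flat_fun_def)
qed

lemma smooth_flat_fun: "smooth (flat_fun p)"
proof (rule smooth_coinduct[where P = "range flat_fun"])
  fix f assume "f \<in> range flat_fun"
  then obtain p where f: "f = flat_fun p" by blast
  show "\<exists>f'. (\<forall>x. (f has_derivative f' x) (at x)) \<and> (\<forall>i\<in>Basis. (\<lambda>x. f' x i) \<in> range flat_fun)"
  proof (intro exI[of _ "\<lambda>x h. flat_fun ([:0, 0, 1:] * (p - pderiv p)) x * h"] conjI allI ballI)
    fix x show "(f has_derivative (*) (flat_fun ([:0, 0, 1:] * (p - pderiv p)) x)) (at x)"
      unfolding f using flat_fun_deriv[of p x] by (simp only: has_field_derivative_def)
  next
    fix i :: real assume "i \<in> Basis"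
    then have "(\<lambda>x. flat_fun ([:0, 0, 1:] * (p - pderiv p)) x * i) = flat_fun ([:0, 0, 1:] * (p - pderiv p))"
      by (auto simp: fun_eq_iff)
    then show "(\<lambda>x. flat_fun ([:0, 0, 1:] * (p - pderiv p)) x * i) \<in> range flat_fun" by simp
  qed
qed simp

text \<open>The standard bump exp (-1 / (1 - |z|^2)) on the open unit ball, extended by 0.\<close>

definition bump :: "'a::euclidean_space \<Rightarrow> real" where
  "bump z = flat_fun [:1:] (1 - z \<bullet> z)"

lemma smooth_bump: "smooth (bump :: 'a::euclidean_space \<Rightarrow> real)"
proof -
  have "smooth (\<lambda>z::'a. z \<bullet> z)"
    by (rule smooth_bilinear[OF bounded_bilinear_inner smooth_linear smooth_linear]) (rule bounded_linear_ident)+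
  from smooth_mult[OF smooth_const[of "-1"] this] smooth_const[of 1]
  have "smooth (\<lambda>z::'a. 1 + (-1) * (z \<bullet> z))" by (rule smooth_add[rotated])
  from smooth_compose[OF smooth_flat_fun this, of "[:1:]"] show ?thesis
    unfolding bump_def[abs_def] by simp
qed

lemma bump_nonneg: "0 \<le> bump z" by (simp add: bump_def flat_fun_def)

lemma bump_pos: "norm z < 1 \<Longrightarrow> 0 < bump z"
  by (simp add: bump_def flat_fun_def norm_eq_sqrt_inner real_sqrt_less_iff)

lemma bump_zero: "1 \<le> norm z \<Longrightarrow> bump z = 0"
  by (simp add: bump_def flat_fun_def norm_eq_sqrt_inner)

section \<open>Functions of bounded support\<close>

definition bdd_supp :: "('a::euclidean_space \<Rightarrow> 'b::real_normed_vector) \<Rightarrow> bool" where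
  "bdd_supp f \<longleftrightarrow> (\<exists>R. \<forall>x. R < norm x \<longrightarrow> f x = 0)"

lemma test_functions_iff:
  "\<phi> \<in> test_functions S \<longleftrightarrow> smooth \<phi> \<and> bdd_supp \<phi> \<and> closure {x. \<phi> x \<noteq> 0} \<subseteq> S"
proof -
  have "bdd_supp \<phi> \<longleftrightarrow> bounded {x. \<phi> x \<noteq> 0}"
  proof -
    have "(\<forall>x. R < norm x \<longrightarrow> \<phi> x = 0) \<longleftrightarrow> (\<forall>x\<in>{x. \<phi> x \<noteq> 0}. norm x \<le> R)" for R
      by (auto simp: not_less[symmetric])
    then show ?thesis unfolding bdd_supp_def bounded_iff by simp
  qed
  then show ?thesis by (simp add: test_functions_def smooth_def)
qed

lemma bdd_supp_bound:
  fixes f :: "'a::euclidean_space \<Rightarrow> 'b::real_normed_vector"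
  assumes "continuous_on UNIV f" "bdd_supp f"
  obtains B where "0 < B" "\<And>x. norm (f x) \<le> B"
proof -
  obtain R where R: "\<And>x. R < norm x \<Longrightarrow> f x = 0" using assms(2) by (auto simp: bdd_supp_def)
  have "bounded (f ` cball 0 R)"
    using assms(1) by (intro compact_imp_bounded compact_continuous_image) (auto intro: continuous_on_subset)
  then obtain B where B: "0 < B" "\<And>x. x \<in> cball 0 R \<Longrightarrow> norm (f x) \<le> B" by (auto simp: bounded_pos)
  have "norm (f x) \<le> B" for x using B R[of x] by (cases "R < norm x") auto
  then show thesis using that B by blast
qed

text \<open>Uniform continuity on the ball of radius R + 1 suffices: if two points at distance below
  1 are not both in this ball, both lie outside radius R, where f vanishes.\<close>

lemma bdd_supp_uniformly_continuous:
  fixes f :: "'a::euclidean_space \<Rightarrow> 'b::real_normed_vector"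
  assumes "continuous_on UNIV f" "bdd_supp f" "0 < e"
  obtains d where "0 < d" "\<And>x y. norm (x - y) < d \<Longrightarrow> norm (f x - f y) < e"
proof -
  obtain R where R: "\<And>x. R < norm x \<Longrightarrow> f x = 0" using assms(2) by (auto simp: bdd_supp_def)
  have "uniformly_continuous_on (cball 0 (R + 1)) f"
    using assms(1) by (intro compact_uniformly_continuous) (auto intro: continuous_on_subset)
  then obtain d where d: "0 < d" "\<And>x y. \<lbrakk>x \<in> cball 0 (R+1); y \<in> cball 0 (R+1); dist y x < d\<rbrakk> \<Longrightarrow> dist (f y) (f x) < e"
    using assms(3) unfolding uniformly_continuous_on_def by metis
  show thesis
  proof (rule that[of "min d 1"])
    fix x y :: 'a assume xy: "norm (x - y) < min d 1"
    show "norm (f x - f y) < e"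
    proof (cases "norm x \<le> R + 1 \<and> norm y \<le> R + 1")
      case True
      then show ?thesis using d(2)[of y x] xy by (simp add: dist_norm)
    next
      case False
      have "\<bar>norm x - norm y\<bar> < 1" using norm_triangle_ineq3[of x y] xy by linarith
      then have "R < norm x" "R < norm y" using False by linarith+
      then show ?thesis using R assms(3) by simp
    qed
  qed (use d in simp)
qed

lemma bdd_supp_partial:
  assumes "smooth f" "bdd_supp f" shows "bdd_supp (\<lambda>x. frechet_derivative f (at x) i)"
proof -
  obtain R where R: "\<And>x. R < norm x \<Longrightarrow> f x = 0" using assms(2) by (auto simp: bdd_supp_def)
  have "frechet_derivative f (at x) i = 0" if x: "R < norm x" for x
  proof -
    have "((\<lambda>x. 0) has_derivative (\<lambda>h. 0)) (at x)" by simp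
    moreover have "open {x::'a. R < norm x}" by (intro open_Collect_less continuous_intros)
    ultimately have "(f has_derivative (\<lambda>h. 0)) (at x)"
      by (rule has_derivative_transform_within_open) (use x R in auto)
    then show ?thesis using frechet_derivative_at by metis
  qed
  then show ?thesis unfolding bdd_supp_def by blast
qed

lemma frechet_expand:
  fixes f :: "'a::euclidean_space \<Rightarrow> 'b::real_normed_vector"
  assumes "(f has_derivative f') (at x)"
  shows "f' v = (\<Sum>i\<in>Basis. (v \<bullet> i) *\<^sub>R f' i)"
proof -
  have l: "linear f'" by (rule has_derivative_linear[OF assms])
  have "f' v = f' (\<Sum>i\<in>Basis. (v \<bullet> i) *\<^sub>R i)" by (simp add: euclidean_representation)
  also have "\<dots> = (\<Sum>i\<in>Basis. (v \<bullet> i) *\<^sub>R f' i)" by (simp add: linear_sum[OF l] linear_scale[OF l] o_def)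
  finally show ?thesis .
qed

text \<open>The step d does not depend on x: the partial derivatives are uniformly continuous by
  bounded support, and the mean value inequality is applied to the deviation from the linearisation.
  This uniformity is what allows differentiation under an integral sign.\<close>

lemma uniform_differentiable:
  fixes f :: "'a::euclidean_space \<Rightarrow> 'b::real_normed_vector"
  assumes f: "smooth f" "bdd_supp f" and e: "0 < e"
  obtains d where "0 < d"
    "\<And>x v. norm v < d \<Longrightarrow> norm (f (x + v) - f x - frechet_derivative f (at x) v) \<le> e * norm v"
proof -
  let ?D = "\<lambda>x. frechet_derivative f (at x)"
  define n where "n = real DIM('a)"
  have n: "n > 0" by (simp add: n_def)
  have "\<exists>d>0. \<forall>x y. norm (x - y) < d \<longrightarrow> norm (?D x i - ?D y i) < e / n" if i: "i \<in> Basis" for i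
    using bdd_supp_uniformly_continuous[OF smooth_continuous[OF smooth_partial[OF f(1) i]] bdd_supp_partial[OF f], of "e / n"] e n
    by (metis divide_pos_pos)
  then obtain d where d: "\<And>i. i \<in> Basis \<Longrightarrow> 0 < d i"
    "\<And>i x y. \<lbrakk>i \<in> Basis; norm (x - y) < d i\<rbrakk> \<Longrightarrow> norm (?D x i - ?D y i) < e / n" by metis
  define d0 where "d0 = Min (d ` Basis)"
  have d0: "0 < d0" "\<And>i. i \<in> Basis \<Longrightarrow> d0 \<le> d i" using d(1) by (auto simp: d0_def)
  have D: "(f has_derivative ?D x) (at x)" for x by (rule smooth_has_derivative[OF f(1)])
  have on: "onorm (\<lambda>v. ?D x v - ?D y v) \<le> e" if xy: "norm (x - y) < d0" for x y
  proof (rule onorm_le)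
    fix v
    have "?D x v - ?D y v = (\<Sum>i\<in>Basis. (v \<bullet> i) *\<^sub>R (?D x i - ?D y i))"
      unfolding frechet_expand[OF D[of x], of v] frechet_expand[OF D[of y], of v]
      by (simp add: sum_subtractf scaleR_diff_right)
    also have "norm \<dots> \<le> (\<Sum>i\<in>(Basis :: 'a set). norm v * (e / n))"
    proof (rule sum_norm_le)
      fix i :: 'a assume i: "i \<in> Basis"
      have "norm (x - y) < d i" using d0(2)[OF i] xy by linarith
      then have "norm (?D x i - ?D y i) \<le> e / n" by (rule less_imp_le[OF d(2)[OF i]])
      moreover have "\<bar>v \<bullet> i\<bar> \<le> norm v" using Basis_le_norm[OF i] by (simp add: abs_le_iff)
      ultimately show "norm ((v \<bullet> i) *\<^sub>R (?D x i - ?D y i)) \<le> norm v * (e / n)"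
        by (simp add: mult_mono del: times_divide_eq_right)
    qed
    also have "\<dots> = e * norm v" using n by (simp add: n_def)
    finally show "norm (?D x v - ?D y v) \<le> e * norm v" .
  qed
  show thesis
  proof (rule that[OF d0(1)])
    fix x v :: 'a assume v: "norm v < d0"
    have "norm (f (x + v) - f x - ?D x (x + v - x)) \<le> norm (x + v - x) * e"
    proof (rule differentiable_bound_linearization[where S = "ball x d0" and f' = ?D])
      fix t :: real assume t: "t \<in> {0..1}"
      have "\<bar>t\<bar> * norm v \<le> 1 * norm v" using t by (intro mult_right_mono) auto
      then show "x + t *\<^sub>R (x + v - x) \<in> ball x d0" using v by (simp add: dist_norm)
    next
      fix y assume "y \<in> ball x d0"
      then show "onorm (?D y - ?D x) \<le> e"
        unfolding fun_diff_def using on[of y x] by (simp add: dist_norm norm_minus_commute)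
      show "(f has_derivative ?D y) (at y within ball x d0)" using D has_derivative_at_withinI by blast
    qed (use d0 in simp)
    then show "norm (f (x + v) - f x - ?D x v) \<le> e * norm v" by (simp add: mult.commute)
  qed
qed

lemma bdd_supp_integrable:
  fixes f :: "'a::euclidean_space \<Rightarrow> 'b::{banach, second_countable_topology}"
  assumes "continuous_on UNIV f" "bdd_supp f" shows "integrable lborel f"
proof -
  obtain R where R: "\<And>x. R < norm x \<Longrightarrow> f x = 0" using assms(2) by (auto simp: bdd_supp_def)
  have "integrable lborel (\<lambda>x. indicator (cball 0 R) x *\<^sub>R f x)"
    using assms(1) by (intro borel_integrable_compact) (auto intro: continuous_on_subset)
  moreover have "indicator (cball 0 R) x *\<^sub>R f x = f x" for x
    using R[of x] by (auto simp: indicator_def)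
  ultimately show ?thesis by simp
qed

lemma lborel_integral_shift:
  fixes f :: "'a::euclidean_space \<Rightarrow> 'b::{banach, second_countable_topology}"
  assumes f: "f \<in> borel_measurable borel"
  shows "(\<integral>x. f (x + a) \<partial>lborel) = (\<integral>x. f x \<partial>lborel)"
proof -
  have "integral\<^sup>L (distr lborel borel ((+) a)) f = (\<integral>x. f (a + x) \<partial>lborel)"
    using f by (intro integral_distr) simp_all
  then show ?thesis by (simp add: lborel_distr_plus add.commute)
qed

lemma lborel_integrable_shift:
  fixes f :: "'a::euclidean_space \<Rightarrow> 'b::{banach, second_countable_topology}"
  assumes f: "f \<in> borel_measurable borel"
  shows "integrable lborel (\<lambda>x. f (x + a)) \<longleftrightarrow> integrable lborel f"
proof -
  have "integrable (distr lborel borel ((+) a)) f \<longleftrightarrow> integrable lborel (\<lambda>x. f (a + x))"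
    using f by (intro integrable_distr_eq) simp_all
  then show ?thesis by (simp add: lborel_distr_plus add.commute)
qed

lemma norm_integral_le:
  "\<lbrakk>integrable M f; integrable M g; \<And>x. norm (f x) \<le> g x\<rbrakk> \<Longrightarrow> norm (\<integral>x. f x \<partial>M) \<le> (\<integral>x. g x \<partial>M)"
  for f :: "'a \<Rightarrow> 'b::{banach, second_countable_topology}"
  by (rule order_trans[OF integral_norm_bound integral_mono]) auto

text \<open>The integral of a difference quotient vanishes by translation invariance.\<close>

lemma integral_partial_zero:
  fixes f :: "'a::euclidean_space \<Rightarrow> complex"
  assumes f: "smooth f" "bdd_supp f" and i: "i \<in> Basis"
  shows "(\<integral>x. frechet_derivative f (at x) i \<partial>lborel) = 0"
proof -
  let ?D = "\<lambda>x. frechet_derivative f (at x) i"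
  note c = smooth_continuous[OF f(1)]
  obtain R where R: "\<And>x. R < norm x \<Longrightarrow> f x = 0" using f(2) by (auto simp: bdd_supp_def)
  \<comment> \<open>The radius grows by 1 because the difference quotient with step t <= 1 is
    supported in the larger ball.\<close>
  define V where "V = measure lborel (cball (0::'a) (R + 1))"
  have intD: "integrable lborel ?D"
    by (rule bdd_supp_integrable[OF smooth_continuous[OF smooth_partial[OF f(1) i]] bdd_supp_partial[OF f]])
  have intf: "integrable lborel f" by (rule bdd_supp_integrable[OF c f(2)])
  have "norm (\<integral>x. ?D x \<partial>lborel) \<le> e * V" if e: "e > 0" for e
  proof -
    obtain d where d: "0 < d" "\<And>x v. norm v < d \<Longrightarrow> norm (f (x + v) - f x - frechet_derivative f (at x) v) \<le> e * norm v"
      using uniform_differentiable[OF f e] by blast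
    define t where "t = min (d / 2) 1"
    have t: "0 < t" "t < d" "t \<le> 1" using d(1) by (auto simp: t_def)
    have lin: "frechet_derivative f (at x) (t *\<^sub>R i) = t *\<^sub>R ?D x" for x
      using linear_scale[OF has_derivative_linear[OF smooth_has_derivative[OF f(1)]]] by blast
    note fm = borel_measurable_continuous_onI[OF c]
    have int_shift: "integrable lborel (\<lambda>x. f (x + t *\<^sub>R i))"
      using intf lborel_integrable_shift[OF fm] by simp
    have shift: "(\<integral>x. f (x + t *\<^sub>R i) \<partial>lborel) = (\<integral>x. f x \<partial>lborel)"
      by (rule lborel_integral_shift[OF fm])
    have "t *\<^sub>R (\<integral>x. ?D x \<partial>lborel) = - (\<integral>x. f (x + t *\<^sub>R i) - f x - t *\<^sub>R ?D x \<partial>lborel)"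
      using intD intf int_shift shift by simp
    then have "norm (t *\<^sub>R (\<integral>x. ?D x \<partial>lborel)) = norm (- (\<integral>x. f (x + t *\<^sub>R i) - f x - t *\<^sub>R ?D x \<partial>lborel))"
      by (rule arg_cong)
    then have "t * norm (\<integral>x. ?D x \<partial>lborel) = norm (\<integral>x. f (x + t *\<^sub>R i) - f x - t *\<^sub>R ?D x \<partial>lborel)"
      using t(1) by (simp only: norm_minus_cancel norm_scaleR abs_of_pos)
    also have "\<dots> \<le> (\<integral>x. e * t * indicator (cball (0::'a) (R+1)) x \<partial>lborel)"
    proof (rule norm_integral_le)
      show "integrable lborel (\<lambda>x. f (x + t *\<^sub>R i) - f x - t *\<^sub>R ?D x)" using intD intf int_shift by simp
      show "integrable lborel (\<lambda>x. e * t * indicator (cball (0::'a) (R+1)) x)"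
        using emeasure_lborel_cball_finite[of "0::'a" "R + 1"]
        by (intro integrable_mult_right integrable_real_indicator) auto
      fix x
      show "norm (f (x + t *\<^sub>R i) - f x - t *\<^sub>R ?D x) \<le> e * t * indicator (cball 0 (R+1)) x"
      proof (cases "x \<in> cball 0 (R+1)")
        case True
        then show ?thesis using d(2)[of "t *\<^sub>R i" x] t i by (simp add: lin)
      next
        case False
        then have x: "R + 1 < norm x" by simp
        have "norm x \<le> norm (x + t *\<^sub>R i) + norm (t *\<^sub>R i)" using norm_triangle_ineq4[of "x + t *\<^sub>R i" "t *\<^sub>R i"] by simp
        then have "R < norm (x + t *\<^sub>R i)" using x t i by simp
        moreover have "?D x = 0"
        proof -
          have "((\<lambda>x. 0) has_derivative (\<lambda>h. 0)) (at x)" by simp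
          moreover have "open {x::'a. R < norm x}" by (intro open_Collect_less continuous_intros)
          ultimately have "(f has_derivative (\<lambda>h. 0)) (at x)"
            by (rule has_derivative_transform_within_open) (use x R in auto)
          then show ?thesis using frechet_derivative_at by metis
        qed
        ultimately show ?thesis using R x by simp
      qed
    qed
    also have "\<dots> = t * (e * V)" by (simp add: V_def)
    finally show ?thesis using t by simp
  qed
  then have "norm (\<integral>x. ?D x \<partial>lborel) \<le> 0"
  proof (cases "V = 0")
    case False
    assume a: "\<And>e. 0 < e \<Longrightarrow> norm (\<integral>x. ?D x \<partial>lborel) \<le> e * V"
    have V: "V > 0" using False by (simp add: V_def zero_less_measure_iff)
    show ?thesis
    proof (rule field_le_epsilon)
      fix e :: real assume "e > 0"
      then show "norm (\<integral>x. ?D x \<partial>lborel) \<le> 0 + e" using a[of "e / V"] V by simp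
    qed
  qed (metis mult_zero_right zero_less_one)
  then show ?thesis by simp
qed

section \<open>Convolution\<close>

text \<open>The factor l dilates the argument, so that shrinking towards the origin and mollifying
  are one operation; derivatives in x fall on the kernel with the factor -l.\<close>

definition conv :: "('a::euclidean_space \<Rightarrow> complex) \<Rightarrow> ('a \<Rightarrow> complex) \<Rightarrow> real \<Rightarrow> 'a \<Rightarrow> complex" where
  "conv f K l x = (\<integral>w. f w * K (w - l *\<^sub>R x) \<partial>lborel)"

lemma conv_integrable:
  fixes f K :: "'a::euclidean_space \<Rightarrow> complex"
  assumes f: "integrable lborel f" and K: "continuous_on UNIV K" "bdd_supp K"
  shows "integrable lborel (\<lambda>w. f w * K (w - y))"
proof -
  obtain B where B: "0 < B" "\<And>x. norm (K x) \<le> B" using bdd_supp_bound[OF K] by blast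
  have [measurable]: "K \<in> borel_measurable borel" using K(1) by (rule borel_measurable_continuous_onI)
  show ?thesis
  proof (rule Bochner_Integration.integrable_bound)
    show "integrable lborel (\<lambda>w. B * norm (f w))" using f by simp
    show "(\<lambda>w. f w * K (w - y)) \<in> borel_measurable lborel" using f by measurable
    have "norm (f w) * norm (K (w - y)) \<le> norm (f w) * B" for w using B by (intro mult_left_mono) auto
    then show "AE w in lborel. norm (f w * K (w - y)) \<le> norm (B * norm (f w))"
      using B by (simp add: norm_mult mult.commute)
  qed
qed

text \<open>Differentiation under the integral: the remainder of \<open>K\<close> is at most e' |l|
  |y - x| uniformly in the integration variable, and f is integrable.\<close>

lemma conv_has_derivative:
  assumes f: "integrable lborel f" and K: "smooth K" "bdd_supp K"
  shows "(conv f K l has_derivative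
    (\<lambda>v. \<Sum>i\<in>Basis. (v \<bullet> i) *\<^sub>R conv f (\<lambda>z. - of_real l * frechet_derivative K (at z) i) l x)) (at x)"
proof -
  let ?D = "\<lambda>z. frechet_derivative K (at z)"
  let ?Ki = "\<lambda>i z. - of_real l * ?D z i"
  let ?F = "\<lambda>v. \<Sum>i\<in>Basis. (v \<bullet> i) *\<^sub>R conv f (?Ki i) l x"
  have DK: "(K has_derivative ?D z) (at z)" for z by (rule smooth_has_derivative[OF K(1)])
  have Ki: "continuous_on UNIV (?Ki i)" "bdd_supp (?Ki i)" if "i \<in> Basis" for i
    using smooth_continuous[OF smooth_partial[OF K(1) that]] bdd_supp_partial[OF K, of i]
    by (auto intro!: continuous_intros simp: bdd_supp_def)
  have inti: "integrable lborel (\<lambda>w. f w * ?Ki i (w - l *\<^sub>R x))" if "i \<in> Basis" for i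
    using conv_integrable[OF f Ki[OF that]] .
  have F_eq: "?F v = (\<integral>w. f w * ?D (w - l *\<^sub>R x) (- l *\<^sub>R v) \<partial>lborel)"
    and F_int: "integrable lborel (\<lambda>w. f w * ?D (w - l *\<^sub>R x) (- l *\<^sub>R v))" for v
  proof -
    have eq: "f w * ?D (w - l *\<^sub>R x) (- l *\<^sub>R v) = (\<Sum>i\<in>Basis. (v \<bullet> i) *\<^sub>R (f w * ?Ki i (w - l *\<^sub>R x)))" for w
      unfolding frechet_expand[OF DK, of _ "- l *\<^sub>R v"]
      by (simp add: sum_distrib_left scaleR_conv_of_real mult_ac inner_minus_left)
    show "integrable lborel (\<lambda>w. f w * ?D (w - l *\<^sub>R x) (- l *\<^sub>R v))"
      unfolding eq using inti by (intro Bochner_Integration.integrable_sum integrable_scaleR_right) auto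
    show "?F v = (\<integral>w. f w * ?D (w - l *\<^sub>R x) (- l *\<^sub>R v) \<partial>lborel)"
      unfolding eq conv_def using inti by (simp add: Bochner_Integration.integral_sum integral_scaleR_right del: scaleR_conv_of_real)
  qed
  define N where "N = (\<integral>w. norm (f w) \<partial>lborel)"
  have N: "0 \<le> N" by (simp add: N_def)
  show ?thesis unfolding has_derivative_at_alt
  proof (intro conjI allI impI)
    show "bounded_linear ?F"
      by (intro bounded_linear_sum bounded_linear_scaleR_const bounded_linear_inner_left)
    fix e :: real assume e: "e > 0"
    \<comment> \<open>The summands 1 keep the denominator positive when l = 0 or f = 0 almost
      everywhere.\<close>
    define e' where "e' = e / ((\<bar>l\<bar> + 1) * (N + 1))"
    have e': "e' > 0" "e' * (\<bar>l\<bar> * N) \<le> e"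
    proof -
      show "e' > 0" using e N by (simp add: e'_def)
      have "e' * (\<bar>l\<bar> * N) \<le> e' * ((\<bar>l\<bar> + 1) * (N + 1))"
        using \<open>e' > 0\<close> N by (intro mult_left_mono mult_mono) auto
      also have "\<dots> = e" using N by (simp add: e'_def add_nonneg_pos)
      finally show "e' * (\<bar>l\<bar> * N) \<le> e" .
    qed
    obtain d where d: "0 < d" "\<And>z v. norm v < d \<Longrightarrow> norm (K (z + v) - K z - ?D z v) \<le> e' * norm v"
      using uniform_differentiable[OF K e'(1)] by blast
    show "\<exists>d>0. \<forall>y. norm (y - x) < d \<longrightarrow> norm (conv f K l y - conv f K l x - ?F (y - x)) \<le> e * norm (y - x)"
    proof (intro exI[of _ "d / (\<bar>l\<bar> + 1)"] conjI allI impI)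
      show "0 < d / (\<bar>l\<bar> + 1)" using d by simp
      fix y assume y: "norm (y - x) < d / (\<bar>l\<bar> + 1)"
      let ?v = "- l *\<^sub>R (y - x)"
      have nv: "norm ?v = \<bar>l\<bar> * norm (y - x)" by simp
      have "\<bar>l\<bar> * norm (y - x) \<le> (\<bar>l\<bar> + 1) * norm (y - x)" by (intro mult_right_mono) auto
      also have "\<dots> < d" using y by (simp add: pos_less_divide_eq mult.commute)
      finally have vd: "norm ?v < d" using nv by simp
      have Kint: "integrable lborel (\<lambda>w. f w * K (w - z))" for z
        by (rule conv_integrable[OF f smooth_continuous[OF K(1)] K(2)])
      have arg: "w - l *\<^sub>R x + ?v = w - l *\<^sub>R y" for w by (simp add: algebra_simps)
      have "conv f K l y - conv f K l x - ?F (y - x)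
          = (\<integral>w. f w * (K (w - l *\<^sub>R x + ?v) - K (w - l *\<^sub>R x) - ?D (w - l *\<^sub>R x) ?v) \<partial>lborel)"
      proof -
        have "conv f K l y - conv f K l x - ?F (y - x)
          = conv f K l y - conv f K l x - (\<integral>w. f w * ?D (w - l *\<^sub>R x) ?v \<partial>lborel)"
          by (simp only: F_eq)
        also have "\<dots> = (\<integral>w. f w * K (w - l *\<^sub>R y) - f w * K (w - l *\<^sub>R x) - f w * ?D (w - l *\<^sub>R x) ?v \<partial>lborel)"
          unfolding conv_def
          by (simp only: Bochner_Integration.integral_diff Bochner_Integration.integrable_diff Kint F_int)
        finally show ?thesis by (simp only: arg right_diff_distrib)
      qed
      also have "norm \<dots> \<le> (\<integral>w. norm (f w) * (e' * norm ?v) \<partial>lborel)"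
      proof (rule norm_integral_le)
        show "integrable lborel (\<lambda>w. f w * (K (w - l *\<^sub>R x + ?v) - K (w - l *\<^sub>R x) - ?D (w - l *\<^sub>R x) ?v))"
          unfolding arg right_diff_distrib using Kint F_int by (intro Bochner_Integration.integrable_diff)
        show "integrable lborel (\<lambda>w. norm (f w) * (e' * norm ?v))" using f by simp
        show "norm (f w * (K (w - l *\<^sub>R x + ?v) - K (w - l *\<^sub>R x) - ?D (w - l *\<^sub>R x) ?v)) \<le> norm (f w) * (e' * norm ?v)" for w
          unfolding norm_mult using d(2)[OF vd] by (intro mult_left_mono) auto
      qed
      also have "\<dots> = (e' * (\<bar>l\<bar> * N)) * norm (y - x)" by (simp add: N_def)
      also have "\<dots> \<le> e * norm (y - x)" using e'(2) by (intro mult_right_mono) auto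
      finally show "norm (conv f K l y - conv f K l x - ?F (y - x)) \<le> e * norm (y - x)" .
    qed
  qed
qed

text \<open>A partial derivative of the convolution is again a convolution of f, with another smooth
  kernel of bounded support; so the family of all of them is closed under differentiation.\<close>

lemma smooth_conv:
  assumes f: "integrable lborel f" and K: "smooth K" "bdd_supp K"
  shows "smooth (conv f K l)"
proof (rule smooth_coinduct[where P = "{conv f K l | K. smooth K \<and> bdd_supp K}"])
  fix g assume "g \<in> {conv f K l | K. smooth K \<and> bdd_supp K}"
  then obtain K where g: "g = conv f K l" and K: "smooth K" "bdd_supp K" by blast
  let ?Ki = "\<lambda>i z. - of_real l * frechet_derivative K (at z) i"
  have Ki: "smooth (?Ki i)" "bdd_supp (?Ki i)" if "i \<in> Basis" for i
    using smooth_mult[OF smooth_const[of "- of_real l"] smooth_partial[OF K(1) that]] bdd_supp_partial[OF K, of i]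
    by (auto simp: bdd_supp_def)
  show "\<exists>f'. (\<forall>x. (g has_derivative f' x) (at x)) \<and> (\<forall>i\<in>Basis. (\<lambda>x. f' x i) \<in> {conv f K l | K. smooth K \<and> bdd_supp K})"
  proof (intro exI conjI allI ballI)
    show "(g has_derivative (\<lambda>v. \<Sum>i\<in>Basis. (v \<bullet> i) *\<^sub>R conv f (?Ki i) l x)) (at x)" for x
      unfolding g by (rule conv_has_derivative[OF f K])
    fix i :: 'a assume i: "i \<in> Basis"
    have "(\<lambda>x. \<Sum>j\<in>Basis. (i \<bullet> j) *\<^sub>R conv f (?Ki j) l x) = conv f (?Ki i) l"
      using i by (auto simp: fun_eq_iff inner_Basis if_distrib[of "\<lambda>c. c *\<^sub>R _"] cong: if_cong)
    then show "(\<lambda>x. \<Sum>j\<in>Basis. (i \<bullet> j) *\<^sub>R conv f (?Ki j) l x) \<in> {conv f K l | K. smooth K \<and> bdd_supp K}"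
      using Ki[OF i] by auto
  qed
qed (use K in blast)

lemma conv_partial:
  assumes f: "integrable lborel f" and K: "smooth K" "bdd_supp K" and i: "i \<in> Basis"
  shows "frechet_derivative (conv f K l) (at x) i = - of_real l * conv f (\<lambda>z. frechet_derivative K (at z) i) l x"
proof -
  have "frechet_derivative (conv f K l) (at x) i = conv f (\<lambda>z. - of_real l * frechet_derivative K (at z) i) l x"
    unfolding frechet_derivative_at[OF conv_has_derivative[OF f K], symmetric]
    using i by (simp add: inner_Basis if_distrib[of "\<lambda>c. c *\<^sub>R _"] cong: if_cong)
  also have "\<dots> = - of_real l * conv f (\<lambda>z. frechet_derivative K (at z) i) l x"
    unfolding conv_def by (subst integral_mult_right_zero[symmetric]) (simp add: mult_ac)
  finally show ?thesis .
qed

lemma ennreal_less_add_pos: "x \<noteq> \<infinity> \<Longrightarrow> 0 < e \<Longrightarrow> (x::ennreal) < x + e"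
  using ennreal_add_left_cancel_less[of x 0 e] by simp

text \<open>Passes from sets to functions through simple functions. It turns comparisons of
  Hausdorff measure with a measure on a parameter interval into comparisons of boundary
  integrals.\<close>

lemma nn_integral_mono_emeasure:
  assumes sets: "sets M = sets N" and le: "\<And>A. A \<in> sets M \<Longrightarrow> emeasure M A \<le> emeasure N A"
  shows "(\<integral>\<^sup>+x. f x \<partial>M) \<le> (\<integral>\<^sup>+x. f x \<partial>N)"
proof -
  have sp: "space M = space N" using sets by (rule sets_eq_imp_space_eq)
  have sf: "simple_function M g \<longleftrightarrow> simple_function N g" for g :: "'a \<Rightarrow> ennreal"
    unfolding simple_function_def using sets sp by simp
  have "integral\<^sup>S M g \<le> integral\<^sup>S N g" if "simple_function M g" for g
    unfolding simple_integral_def sp[symmetric]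
    using that by (intro sum_mono mult_left_mono le) (auto simp: simple_function_def)
  then show ?thesis unfolding nn_integral_def by (intro SUP_mono) (auto simp: sf)
qed

section \<open>Hausdorff measure\<close>

abbreviation haus_size :: "nat \<Rightarrow> 'a::metric_space set \<Rightarrow> ennreal" where
  "haus_size s U \<equiv> (if U = {} then 0 else ennreal (unit_ball_vol (real s) / 2 ^ s * diameter U ^ s))"

lemma hausdorff_pre_le:
  assumes "A \<subseteq> (\<Union>i. U i)" "\<And>i. bounded (U i)" "\<And>i. diameter (U i) \<le> \<delta>"
  shows "hausdorff_pre s \<delta> A \<le> (\<Sum>i::nat. haus_size s (U i))"
  unfolding hausdorff_pre_def using assms by (intro INF_lower) auto

lemma hausdorff_pre_greatest:
  assumes "\<And>U :: nat \<Rightarrow> 'a::metric_space set. \<lbrakk>A \<subseteq> (\<Union>i. U i); \<And>i. bounded (U i); \<And>i. diameter (U i) \<le> \<delta>\<rbrakk>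
    \<Longrightarrow> c \<le> (\<Sum>i. haus_size s (U i))"
  shows "c \<le> hausdorff_pre s \<delta> A"
  unfolding hausdorff_pre_def using assms by (intro INF_greatest) auto

lemma hausdorff_pre_mono: "A \<subseteq> B \<Longrightarrow> hausdorff_pre s \<delta> A \<le> hausdorff_pre s \<delta> B"
  by (rule hausdorff_pre_greatest, rule hausdorff_pre_le) auto

lemma hausdorff_pre_antimono: "\<delta> \<le> \<delta>' \<Longrightarrow> hausdorff_pre s \<delta>' A \<le> hausdorff_pre s \<delta> A"
  by (rule hausdorff_pre_greatest, rule hausdorff_pre_le) (auto intro: order_trans)

lemma hausdorff_pre_countable_subadditive:
  "hausdorff_pre s \<delta> (\<Union>n::nat. A n) \<le> (\<Sum>n. hausdorff_pre s \<delta> (A n))"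
proof (cases "\<exists>n. hausdorff_pre s \<delta> (A n) = \<infinity>")
  case True
  then obtain n where "hausdorff_pre s \<delta> (A n) = \<infinity>" by blast
  moreover have "hausdorff_pre s \<delta> (A n) \<le> (\<Sum>n. hausdorff_pre s \<delta> (A n))"
    by (rule order_trans[OF _ sum_le_suminf[of _ "{n}"]]) auto
  ultimately show ?thesis by (simp add: top_unique)
next
  case False
  show ?thesis
  proof (rule ennreal_le_epsilon)
    fix e :: real assume e: "e > 0"
    have "\<exists>U. A n \<subseteq> (\<Union>i. U i) \<and> (\<forall>i. bounded (U i) \<and> diameter (U i) \<le> \<delta>) \<and>
        (\<Sum>i::nat. haus_size s (U i)) \<le> hausdorff_pre s \<delta> (A n) + ennreal (e * (1/2) ^ Suc n)" for n
    proof -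
      have pos: "0 < ennreal (e * (1/2) ^ Suc n)" using e by simp
      have "hausdorff_pre s \<delta> (A n) < hausdorff_pre s \<delta> (A n) + ennreal (e * (1/2) ^ Suc n)"
        using False pos by (intro ennreal_less_add_pos) auto
      then show ?thesis
        unfolding hausdorff_pre_def INF_less_iff by (auto intro: less_imp_le)
    qed
    then have "\<forall>n. \<exists>U. A n \<subseteq> (\<Union>i. U i) \<and> (\<forall>i. bounded (U i) \<and> diameter (U i) \<le> \<delta>) \<and>
        (\<Sum>i::nat. haus_size s (U i)) \<le> hausdorff_pre s \<delta> (A n) + ennreal (e * (1/2) ^ Suc n)" by blast
    from choice[OF this] obtain U where U0: "\<forall>n. A n \<subseteq> (\<Union>i. U n i) \<and> (\<forall>i. bounded (U n i) \<and> diameter (U n i) \<le> \<delta>) \<and>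
        (\<Sum>i::nat. haus_size s (U n i)) \<le> hausdorff_pre s \<delta> (A n) + ennreal (e * (1/2) ^ Suc n)" by blast
    have U: "A n \<subseteq> (\<Union>i. U n i)" "bounded (U n i)" "diameter (U n i) \<le> \<delta>"
      "(\<Sum>i::nat. haus_size s (U n i)) \<le> hausdorff_pre s \<delta> (A n) + ennreal (e * (1/2) ^ Suc n)" for n i
      using U0 by blast+
    define W where "W i = (case prod_decode i of (n, m) \<Rightarrow> U n m)" for i
    have "(\<Union>n. A n) \<subseteq> (\<Union>i. W i)"
    proof
      fix x assume "x \<in> (\<Union>n. A n)"
      then obtain n m where "x \<in> U n m" using U(1) by blast
      then have "x \<in> W (prod_encode (n, m))" by (simp add: W_def)
      then show "x \<in> (\<Union>i. W i)" by blast
    qed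
    then have "hausdorff_pre s \<delta> (\<Union>n. A n) \<le> (\<Sum>i. haus_size s (W i))"
      by (rule hausdorff_pre_le) (auto simp: W_def U split: prod.split)
    also have "\<dots> = (\<Sum>i. (\<lambda>(n, m). haus_size s (U n m)) (prod_decode i))"
      by (auto simp: W_def split: prod.split intro!: suminf_cong)
    also have "\<dots> = (\<Sum>n. \<Sum>m. haus_size s (U n m))"
      by (rule suminf_ennreal_2dimen) simp
    also have "\<dots> \<le> (\<Sum>n. hausdorff_pre s \<delta> (A n) + ennreal (e * (1/2) ^ Suc n))"
      by (rule suminf_le[OF U(4)]) auto
    also have "\<dots> = (\<Sum>n. hausdorff_pre s \<delta> (A n)) + (\<Sum>n. ennreal (e * (1/2) ^ Suc n))"
      by (rule suminf_add[symmetric]) auto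
    also have "(\<Sum>n. ennreal (e * (1/2) ^ Suc n)) = ennreal e"
      using sums_mult[OF power_half_series, of e] e by (intro suminf_ennreal_eq) auto
    finally show "hausdorff_pre s \<delta> (\<Union>n. A n) \<le> (\<Sum>n. hausdorff_pre s \<delta> (A n)) + ennreal e" .
  qed
qed

lemma hausdorff_pre_le_outer: "0 < \<delta> \<Longrightarrow> hausdorff_pre s \<delta> A \<le> hausdorff_outer s A"
  unfolding hausdorff_outer_def by (rule SUP_upper) simp

lemma hausdorff_outer_least: "(\<And>\<delta>. 0 < \<delta> \<Longrightarrow> hausdorff_pre s \<delta> A \<le> c) \<Longrightarrow> hausdorff_outer s A \<le> c"
  unfolding hausdorff_outer_def by (rule SUP_least) simp

lemma hausdorff_outer_mono: "A \<subseteq> B \<Longrightarrow> hausdorff_outer s A \<le> hausdorff_outer s B"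
  by (rule hausdorff_outer_least) (meson hausdorff_pre_le_outer hausdorff_pre_mono order_trans)

lemma hausdorff_outer_empty [simp]: "hausdorff_outer s {} = 0"
proof -
  have "hausdorff_outer s {} \<le> 0"
  proof (rule hausdorff_outer_least)
    fix \<delta> :: real assume "\<delta> > 0"
    then show "hausdorff_pre s \<delta> {} \<le> 0"
      using hausdorff_pre_le[of "{}" "\<lambda>_. {}" \<delta> s] by simp
  qed
  then show ?thesis by simp
qed

lemma hausdorff_outer_countable_subadditive:
  "hausdorff_outer s (\<Union>n::nat. A n) \<le> (\<Sum>n. hausdorff_outer s (A n))"
proof (rule hausdorff_outer_least)
  fix \<delta> :: real assume d: "\<delta> > 0"
  have "hausdorff_pre s \<delta> (\<Union>n. A n) \<le> (\<Sum>n. hausdorff_pre s \<delta> (A n))"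
    by (rule hausdorff_pre_countable_subadditive)
  also have "\<dots> \<le> (\<Sum>n. hausdorff_outer s (A n))"
    by (rule suminf_le[OF hausdorff_pre_le_outer[OF d]]) auto
  finally show "hausdorff_pre s \<delta> (\<Union>n. A n) \<le> (\<Sum>n. hausdorff_outer s (A n))" .
qed

lemma hausdorff_outer_subadditive:
  "hausdorff_outer s (A \<union> B) \<le> hausdorff_outer s A + hausdorff_outer s B"
proof -
  show ?thesis
    using hausdorff_outer_countable_subadditive[of s "binaryset A B"]
    by (simp add: suminf_binaryset_eq UN_binaryset_eq)
qed

text \<open>As soon as \<delta> < \<eta>, no covering set of diameter at most \<delta> meets both
  \<open>A\<close> and \<open>B\<close>, so a cover of the union splits into two covers.\<close>

lemma hausdorff_outer_separated:
  assumes sep: "\<And>x y. \<lbrakk>x \<in> A; y \<in> B\<rbrakk> \<Longrightarrow> \<eta> \<le> dist x y" and \<eta>: "0 < \<eta>"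
  shows "hausdorff_outer s A + hausdorff_outer s B \<le> hausdorff_outer s (A \<union> B)"
proof -
  have pre: "hausdorff_pre s \<delta> A + hausdorff_pre s \<delta> B \<le> hausdorff_pre s \<delta> (A \<union> B)" if \<delta>: "\<delta> < \<eta>" "0 < \<delta>" for \<delta>
  proof (rule hausdorff_pre_greatest)
    fix U :: "nat \<Rightarrow> 'a set"
    assume U: "A \<union> B \<subseteq> (\<Union>i. U i)" "\<And>i. bounded (U i)" "\<And>i. diameter (U i) \<le> \<delta>"
    define X where "X i = (if U i \<inter> A = {} then {} else U i)" for i
    define Y where "Y i = (if U i \<inter> B = {} then {} else U i)" for i
    have excl: "X i = {} \<or> Y i = {}" for i
    proof (rule ccontr)
      assume "\<not> (X i = {} \<or> Y i = {})"
      then obtain x y where xy: "x \<in> U i" "x \<in> A" "y \<in> U i" "y \<in> B"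
        by (auto simp: X_def Y_def split: if_splits)
      then have "\<eta> \<le> diameter (U i)"
        using sep[of x y] diameter_bounded_bound[OF U(2)[of i] xy(1,3)] by linarith
      then show False using U(3)[of i] \<delta> by linarith
    qed
    have "hausdorff_pre s \<delta> A \<le> (\<Sum>i. haus_size s (X i))"
    proof (rule hausdorff_pre_le)
      show "A \<subseteq> (\<Union>i. X i)" using U(1) by (fastforce simp: X_def)
    qed (use U \<delta> in \<open>simp_all add: X_def\<close>)
    moreover have "hausdorff_pre s \<delta> B \<le> (\<Sum>i. haus_size s (Y i))"
    proof (rule hausdorff_pre_le)
      show "B \<subseteq> (\<Union>i. Y i)" using U(1) by (fastforce simp: Y_def)
    qed (use U \<delta> in \<open>simp_all add: Y_def\<close>)
    ultimately have "hausdorff_pre s \<delta> A + hausdorff_pre s \<delta> B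
        \<le> (\<Sum>i. haus_size s (X i)) + (\<Sum>i. haus_size s (Y i))" by (rule add_mono)
    also have "\<dots> = (\<Sum>i. haus_size s (X i) + haus_size s (Y i))" by (rule suminf_add) auto
    also have "\<dots> \<le> (\<Sum>i. haus_size s (U i))"
    proof (rule suminf_le)
      fix i
      have "X i = {} \<or> X i = U i" "Y i = {} \<or> Y i = U i" by (simp_all add: X_def Y_def)
      then show "haus_size s (X i) + haus_size s (Y i) \<le> haus_size s (U i)"
        using excl[of i] by (elim disjE) simp_all
    qed auto
    finally show "hausdorff_pre s \<delta> A + hausdorff_pre s \<delta> B \<le> (\<Sum>i. haus_size s (U i))" .
  qed
  \<comment> \<open>The two suprema are taken independently of each other; a common \<delta> below
    both and below \<eta> suffices by antimonotonicity.\<close>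
  have "hausdorff_pre s \<delta>1 A + hausdorff_pre s \<delta>2 B \<le> hausdorff_outer s (A \<union> B)" if "\<delta>1 > 0" "\<delta>2 > 0" for \<delta>1 \<delta>2
  proof -
    define \<delta> where "\<delta> = min (min \<delta>1 \<delta>2) (\<eta>/2)"
    have d: "0 < \<delta>" "\<delta> < \<eta>" "\<delta> \<le> \<delta>1" "\<delta> \<le> \<delta>2" using that \<eta> by (auto simp: \<delta>_def)
    have "hausdorff_pre s \<delta>1 A + hausdorff_pre s \<delta>2 B \<le> hausdorff_pre s \<delta> A + hausdorff_pre s \<delta> B"
      using d by (intro add_mono hausdorff_pre_antimono)
    also have "\<dots> \<le> hausdorff_pre s \<delta> (A \<union> B)" using pre d by blast
    also have "\<dots> \<le> hausdorff_outer s (A \<union> B)" using d by (intro hausdorff_pre_le_outer)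
    finally show ?thesis .
  qed
  then have "(SUP \<delta>1\<in>{0<..}. hausdorff_pre s \<delta>2 B + hausdorff_pre s \<delta>1 A) \<le> hausdorff_outer s (A \<union> B)" if "\<delta>2 > 0" for \<delta>2
    using that by (intro SUP_least) (simp add: add.commute[of "hausdorff_pre s \<delta>2 B"])
  then have "hausdorff_pre s \<delta>2 B + hausdorff_outer s A \<le> hausdorff_outer s (A \<union> B)" if "\<delta>2 > 0" for \<delta>2
    using that unfolding hausdorff_outer_def[of s A] by (simp add: ennreal_SUP_add_right[symmetric])
  then have "(SUP \<delta>2\<in>{0<..}. hausdorff_outer s A + hausdorff_pre s \<delta>2 B) \<le> hausdorff_outer s (A \<union> B)"
    by (intro SUP_least) (simp add: add.commute[of "hausdorff_outer s A"])
  then show ?thesis unfolding hausdorff_outer_def[of s B] by (simp add: ennreal_SUP_add_right[symmetric])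
qed

text \<open>The separation may depend on the larger index, which suits shells around a closed set,
  whose mutual gaps shrink to 0.\<close>

lemma hausdorff_outer_separated_sum:
  fixes A :: "nat \<Rightarrow> 'a::metric_space set"
  assumes "\<And>i j x y. \<lbrakk>i < j; j < n; x \<in> A i; y \<in> A j\<rbrakk> \<Longrightarrow> \<eta> j \<le> dist x y" "\<And>j. 0 < \<eta> j"
  shows "(\<Sum>i<n. hausdorff_outer s (A i)) \<le> hausdorff_outer s (\<Union>i<n. A i)"
proof -
  have "(\<Sum>i<m. hausdorff_outer s (A i)) \<le> hausdorff_outer s (\<Union>i<m. A i)" if "m \<le> n" for m
    using that
  proof (induction m)
    case (Suc m)
    have "(\<Sum>i<Suc m. hausdorff_outer s (A i)) \<le> hausdorff_outer s (\<Union>i<m. A i) + hausdorff_outer s (A m)"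
      using Suc by (simp add: add_right_mono)
    also have "\<dots> \<le> hausdorff_outer s ((\<Union>i<m. A i) \<union> A m)"
    proof (rule hausdorff_outer_separated)
      fix x y assume "x \<in> (\<Union>i<m. A i)" "y \<in> A m"
      then show "\<eta> m \<le> dist x y" using assms(1)[of _ m x y] Suc.prems by auto
    qed (rule assms(2))
    also have "(\<Union>i<m. A i) \<union> A m = (\<Union>i<Suc m. A i)" unfolding lessThan_Suc by blast
    finally show ?case .
  qed simp
  then show ?thesis by simp
qed

text \<open>Caratheodory's criterion: the complement of \<open>F\<close> is split into shells around \<open>F\<close>,
  and shells with indices of equal parity are separated from each other.\<close>

lemma hausdorff_outer_closed_split:
  assumes F: "closed F" "F \<noteq> {}"
  shows "hausdorff_outer s (F \<inter> A) + hausdorff_outer s (A - F) \<le> hausdorff_outer s A"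
proof (cases "hausdorff_outer s A = \<infinity>")
  case False
  define P where "P n = {x \<in> A - F. 1 / real (Suc n) \<le> infdist x F}" for n
  \<comment> \<open>The shell 1/(n+2) <= distance < 1/(n+1). Consecutive shells touch, but shells
    whose indices differ by at least 2 have a positive distance.\<close>
  define R where "R n = P (Suc n) - P n" for n
  have R: "1 / real (Suc (Suc n)) \<le> infdist x F" "infdist x F < 1 / real (Suc n)" "x \<in> A" if "x \<in> R n" for x n
    using that by (auto simp: R_def P_def)
  have sepR: "1 / real (Suc (Suc i)) - 1 / real (Suc j) \<le> dist x y" if "x \<in> R i" "y \<in> R j" for i j x y
    using R(1)[OF that(1)] R(2)[OF that(2)] infdist_triangle[of x F y] by linarith
  have par: "(\<Sum>i<n. hausdorff_outer s (R (2 * i + p))) \<le> hausdorff_outer s A" for n p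
  proof -
    have "(\<Sum>i<n. hausdorff_outer s (R (2 * i + p))) \<le> hausdorff_outer s (\<Union>i<n. R (2 * i + p))"
    proof (rule hausdorff_outer_separated_sum)
      fix i j x y assume a: "i < j" "j < n" "x \<in> R (2 * i + p)" "y \<in> R (2 * j + p)"
      have "1 / real (Suc (2 * j + p - 1)) - 1 / real (Suc (2 * j + p)) \<le> 1 / real (Suc (Suc (2 * i + p))) - 1 / real (Suc (2 * j + p))"
        using a(1) by (intro diff_right_mono frac_le) auto
      \<comment> \<open>The separation is the width of the shell just before index 2j + p. For j = 0
        and p = 0 the natural subtraction truncates and this width is 0; no i < j exists then, and
        the added 1 keeps the value positive.\<close>
      then show "1 / real (Suc (2 * j + p - 1)) - 1 / real (Suc (2 * j + p)) + (if j = 0 then 1 else 0) \<le> dist x y"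
        using sepR[OF a(3,4)] a(1) by auto
    next
      fix j show "0 < 1 / real (Suc (2 * j + p - 1)) - 1 / real (Suc (2 * j + p)) + (if j = 0 then 1 else 0 :: real)"
      proof (cases "j = 0")
        case True
        have "1 / real (Suc (p - 1)) - 1 / real (Suc p) \<ge> 0" by (simp add: frac_le)
        then show ?thesis using True by simp
      qed (auto simp: frac_less2)
    qed
    also have "\<dots> \<le> hausdorff_outer s A" using R(3) by (intro hausdorff_outer_mono) auto
    finally show ?thesis .
  qed
  have "(\<Sum>i<n. hausdorff_outer s (R i)) \<le> 2 * hausdorff_outer s A" for n
  proof -
    have "(\<Sum>i<n. hausdorff_outer s (R i)) \<le> (\<Sum>i<2*n. hausdorff_outer s (R i))"
      by (intro sum_mono2) auto
    also have "\<dots> = (\<Sum>i<n. hausdorff_outer s (R (2 * i + 0))) + (\<Sum>i<n. hausdorff_outer s (R (2 * i + 1)))"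
      by (induction n) (auto simp: algebra_simps)
    also have "\<dots> \<le> hausdorff_outer s A + hausdorff_outer s A" by (intro add_mono par)
    finally show ?thesis by (simp add: mult_2)
  qed
  then have "(\<Sum>i. hausdorff_outer s (R i)) \<le> 2 * hausdorff_outer s A"
    by (intro suminf_le_const) auto
  then have fin: "(\<Sum>i. hausdorff_outer s (R i)) \<noteq> \<infinity>"
    using False by (auto simp: top_unique ennreal_mult_eq_top_iff)
  define g where "g i = enn2real (hausdorff_outer s (R i))" for i
  have "hausdorff_outer s (R i) \<noteq> \<infinity>" for i
  proof -
    have "hausdorff_outer s (R i) \<le> hausdorff_outer s A" using R(3) by (intro hausdorff_outer_mono) auto
    then show ?thesis using False by (auto simp: top_unique)
  qed
  then have g: "hausdorff_outer s (R i) = ennreal (g i)" "0 \<le> g i" for i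
    by (auto simp: g_def less_top)
  have summ: "summable g" using fin g by (intro summable_suminf_not_top) auto
  show ?thesis
  proof (rule ennreal_le_epsilon)
    fix e :: real assume e: "e > 0"
    obtain n where n: "norm (\<Sum>i. g (i + n)) < e" using suminf_exist_split[OF e summ] by blast
    have "(\<Sum>i. hausdorff_outer s (R (i + n))) = ennreal (\<Sum>i. g (i + n))"
      unfolding g(1) using g(2) summ by (intro suminf_ennreal2) (auto simp: summable_iff_shift)
    then have tail: "(\<Sum>i. hausdorff_outer s (R (i + n))) \<le> ennreal e"
      using n by (auto intro!: ennreal_leI)
    have "A - F \<subseteq> P n \<union> (\<Union>i. R (i + n))"
    proof
      fix x assume x: "x \<in> A - F"
      then have "infdist x F > 0" using F by (simp add: infdist_pos_not_in_closed)
      then obtain m where m: "1 / real (Suc m) < infdist x F" by (metis nat_approx_posE)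
      have "x \<in> P k \<Longrightarrow> x \<in> P n \<union> (\<Union>i. R (i + n))" for k
      proof (induction k)
        case 0
        then have "1 \<le> infdist x F" by (simp add: P_def)
        moreover have "1 / real (Suc n) \<le> 1" by simp
        ultimately have "1 / real (Suc n) \<le> infdist x F" by linarith
        then show ?case using 0 by (simp add: P_def)
      next
        case (Suc k)
        show ?case
        proof (cases "x \<in> P k")
          case False
          then have xR: "x \<in> R k" using Suc.prems by (simp add: R_def)
          show ?thesis
          proof (cases "n \<le> k")
            case True
            then have "x \<in> R ((k - n) + n)" using xR by simp
            then show ?thesis by blast
          next
            case False
            then have "1 / real (Suc n) \<le> 1 / real (Suc (Suc k))" by (intro frac_le) auto
            then show ?thesis using Suc.prems by (auto simp: P_def)
          qed
        qed (use Suc in blast)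
      qed
      moreover have "x \<in> P m" using m x by (simp add: P_def)
      ultimately show "x \<in> P n \<union> (\<Union>i. R (i + n))" by blast
    qed
    then have "hausdorff_outer s (A - F) \<le> hausdorff_outer s (P n) + hausdorff_outer s (\<Union>i. R (i + n))"
      by (meson hausdorff_outer_mono hausdorff_outer_subadditive order_trans)
    also have "\<dots> \<le> hausdorff_outer s (P n) + ennreal e"
      using hausdorff_outer_countable_subadditive[of s "\<lambda>i. R (i + n)"] tail by (intro add_left_mono) auto
    finally have "hausdorff_outer s (F \<inter> A) + hausdorff_outer s (A - F)
        \<le> hausdorff_outer s (F \<inter> A) + hausdorff_outer s (P n) + ennreal e"
      by (simp add: add_left_mono add.assoc)
    also have "hausdorff_outer s (F \<inter> A) + hausdorff_outer s (P n) \<le> hausdorff_outer s ((F \<inter> A) \<union> P n)"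
    proof (rule hausdorff_outer_separated)
      fix x y assume "x \<in> F \<inter> A" "y \<in> P n"
      then show "1 / real (Suc n) \<le> dist x y"
        using infdist_le[of x F y] by (auto simp: P_def dist_commute)
    qed simp
    also have "\<dots> \<le> hausdorff_outer s A" by (rule hausdorff_outer_mono) (auto simp: P_def)
    finally show "hausdorff_outer s (F \<inter> A) + hausdorff_outer s (A - F) \<le> hausdorff_outer s A + ennreal e"
      by (simp add: add_right_mono)
  qed
qed simp

text \<open>Caratheodory's theorem gives a measure on the sets that split the outer measure
  additively; closed sets are among them by the shell argument, hence all Borel sets. This is what
  makes \<open>hausdorff_measure\<close> agree with the outer measure, since
  \<open>measure_of\<close> keeps a set function only if it is a measure.\<close>

lemma measure_space_hausdorff: "measure_space UNIV (sets (borel :: 'a::metric_space measure)) (hausdorff_outer s)"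
proof -
  let ?L = "lambda_system UNIV (Pow UNIV) (hausdorff_outer s :: 'a set \<Rightarrow> ennreal)"
  interpret P: sigma_algebra "UNIV :: 'a set" "Pow UNIV" by (rule sigma_algebra_Pow)
  have "outer_measure_space (Pow UNIV) (hausdorff_outer s :: 'a set \<Rightarrow> ennreal)"
    unfolding outer_measure_space_def positive_def increasing_def countably_subadditive_def
    by (auto intro: hausdorff_outer_mono hausdorff_outer_countable_subadditive)
  then have L: "measure_space UNIV ?L (hausdorff_outer s)" by (rule P.caratheodory_lemma)
  have "F \<in> ?L" if "closed F" for F
  proof -
    have "hausdorff_outer s (F \<inter> A) + hausdorff_outer s ((UNIV - F) \<inter> A) = hausdorff_outer s A" for A
    proof (rule antisym)
      have eq: "(UNIV - F) \<inter> A = A - F" by blast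
      show "hausdorff_outer s (F \<inter> A) + hausdorff_outer s ((UNIV - F) \<inter> A) \<le> hausdorff_outer s A"
        using hausdorff_outer_closed_split[OF that, of s A] unfolding eq by (cases "F = {}") auto
      have "A = (F \<inter> A) \<union> (A - F)" by blast
      then show "hausdorff_outer s A \<le> hausdorff_outer s (F \<inter> A) + hausdorff_outer s ((UNIV - F) \<inter> A)"
        unfolding eq by (metis hausdorff_outer_subadditive)
    qed
    then show ?thesis by (simp add: lambda_system_def)
  qed
  then have "sigma_sets UNIV {F. closed F} \<subseteq> ?L"
    using L by (intro sigma_algebra.sigma_sets_subset) (auto simp: measure_space_def)
  then have sub: "sets borel \<subseteq> ?L" by (simp add: borel_eq_closed)
  show ?thesis unfolding measure_space_def
  proof (intro conjI)
    show "sigma_algebra UNIV (sets (borel :: 'a measure))" using sets.sigma_algebra_axioms[of "borel :: 'a measure"] by simp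
    show "positive (sets (borel :: 'a measure)) (hausdorff_outer s)" by (simp add: positive_def)
    show "countably_additive (sets (borel :: 'a measure)) (hausdorff_outer s)"
    proof -
      have "countably_additive ?L (hausdorff_outer s)" using L by (simp add: measure_space_def)
      then show ?thesis unfolding countably_additive_def by (meson sub order_trans subsetD)
    qed
  qed
qed

lemma sets_hausdorff_measure [simp, measurable_cong]: "sets (hausdorff_measure s) = sets borel"
  unfolding hausdorff_measure_def using sets.sigma_sets_eq[of borel] by (simp add: sets_measure_of_conv)

lemma space_hausdorff_measure [simp]: "space (hausdorff_measure s) = UNIV"
  using sets_eq_imp_space_eq[OF sets_hausdorff_measure] by simp

lemma emeasure_hausdorff_measure: "A \<in> sets borel \<Longrightarrow> emeasure (hausdorff_measure s) A = hausdorff_outer s A"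
  unfolding hausdorff_measure_def
  using measure_space_hausdorff[of s] by (intro emeasure_measure_of_sigma) (auto simp: measure_space_def)

section \<open>Comparison of one-dimensional Hausdorff measure with measures on parameter
  intervals\<close>

lemma haus_size_1: "haus_size 1 U = ennreal (diameter U)"
  by (simp add: unit_ball_vol_1)

text \<open>A map that does not increase distances sends a covering set of diameter d into an
  interval of length at most d, so a cover of \<open>B\<close> yields a cover of \<open>C\<close> by
  intervals of no larger total length. Lower bounds for length by projection rest on this.\<close>

lemma lborel_le_hausdorff_outer:
  fixes P :: "'a::metric_space \<Rightarrow> real"
  assumes C: "C \<in> sets borel" "C \<subseteq> P ` B" and P: "\<And>x y. dist (P x) (P y) \<le> dist x y"
  shows "emeasure lborel C \<le> hausdorff_outer 1 B"
proof -
  have "emeasure lborel C \<le> hausdorff_pre 1 1 B"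
  proof (rule hausdorff_pre_greatest)
    fix U :: "nat \<Rightarrow> 'a set"
    assume U: "B \<subseteq> (\<Union>i. U i)" "\<And>i. bounded (U i)" "\<And>i. diameter (U i) \<le> 1"
    define J where "J i = (if U i = {} then {} else {Inf (P ` U i) .. Sup (P ` U i)})" for i
    have bdd: "bounded (P ` U i)" for i
    proof -
      obtain x e where "\<And>y. y \<in> U i \<Longrightarrow> dist x y \<le> e" using U(2)[of i] by (auto simp: bounded_def)
      then have "\<And>y. y \<in> U i \<Longrightarrow> dist (P x) (P y) \<le> e" using P order_trans by blast
      then show ?thesis by (auto simp: bounded_def)
    qed
    note bd = bounded_imp_bdd_above[OF bdd] bounded_imp_bdd_below[OF bdd]
    have "C \<subseteq> (\<Union>i. J i)"
    proof
      fix c assume "c \<in> C"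
      then obtain x i where x: "c = P x" "x \<in> U i" using C(2) U(1) by blast
      then have "c \<in> J i" unfolding J_def using bd by (auto intro!: cInf_lower cSup_upper)
      then show "c \<in> (\<Union>i. J i)" by blast
    qed
    then have "emeasure lborel C \<le> emeasure lborel (\<Union>i. J i)"
      by (intro emeasure_mono) (auto simp: J_def)
    also have "\<dots> \<le> (\<Sum>i. emeasure lborel (J i))"
      by (intro emeasure_subadditive_countably) (auto simp: J_def)
    also have "\<dots> \<le> (\<Sum>i. haus_size 1 (U i))"
    proof (rule suminf_le)
      fix i show "emeasure lborel (J i) \<le> haus_size 1 (U i)"
      proof (cases "U i = {}")
        case False
        have "Sup (P ` U i) \<le> Inf (P ` U i) + diameter (U i)"
        proof (rule cSup_least)
          fix a assume "a \<in> P ` U i"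
          then obtain x where x: "x \<in> U i" "a = P x" by blast
          have "a - diameter (U i) \<le> Inf (P ` U i)"
          proof (rule cInf_greatest)
            fix b assume "b \<in> P ` U i"
            then obtain y where y: "y \<in> U i" "b = P y" by blast
            have "dist a b \<le> diameter (U i)"
              using P[of x y] diameter_bounded_bound[OF U(2) x(1) y(1)] x y by simp
            then show "a - diameter (U i) \<le> b" by (simp add: dist_real_def)
          qed (use False in simp)
          then show "a \<le> Inf (P ` U i) + diameter (U i)" by simp
        qed (use False in simp)
        moreover have "Inf (P ` U i) \<le> Sup (P ` U i)"
          using False bd by (intro cInf_le_cSup) auto
        ultimately show ?thesis unfolding haus_size_1 using False by (auto simp: J_def intro!: ennreal_leI)
      qed (simp add: J_def)
    qed auto
    finally show "emeasure lborel C \<le> (\<Sum>i. haus_size 1 (U i))" .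
  qed
  also have "\<dots> \<le> hausdorff_outer 1 B" by (rule hausdorff_pre_le_outer) simp
  finally show ?thesis .
qed

text \<open>The measure \<mu> on the parameter interval dominates arc length. Take an open set
  around \<open>A\<close> of almost the same \<mu>-measure and cover \<open>A\<close> by small
  non-overlapping intervals inside it. The image of each has diameter at most its \<mu>-measure, and
  disjointness of the interiors bounds the sum by the measure of the open set.\<close>

lemma hausdorff_outer_curve_le:
  fixes \<gamma> :: "real \<Rightarrow> 'a::euclidean_space"
  assumes \<mu>: "sets \<mu> = sets borel" "finite_measure \<mu>" and cd: "c < d"
    and lip: "\<And>s t. \<lbrakk>c \<le> s; s \<le> t; t \<le> d\<rbrakk> \<Longrightarrow> ennreal (dist (\<gamma> s) (\<gamma> t)) \<le> emeasure \<mu> {s..t}"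
    and W: "\<And>s t. s \<le> t \<Longrightarrow> emeasure \<mu> {s..t} \<le> ennreal (W * (t - s))" "0 < W"
    and A: "A \<in> sets borel" "A \<subseteq> {c..d}"
  shows "hausdorff_outer 1 (\<gamma> ` A) \<le> emeasure \<mu> A"
proof -
  interpret finite_measure \<mu> by fact
  have sp: "space \<mu> = UNIV" using sets_eq_imp_space_eq[OF \<mu>(1)] by simp
  have dist_W: "dist (\<gamma> s) (\<gamma> t) \<le> W * \<bar>s - t\<bar>" if "s \<in> {c..d}" "t \<in> {c..d}" for s t
  proof -
    have *: "dist (\<gamma> s) (\<gamma> t) \<le> W * (t - s)" if "s \<in> {c..d}" "t \<in> {c..d}" "s \<le> t" for s t
    proof -
      have "ennreal (dist (\<gamma> s) (\<gamma> t)) \<le> ennreal (W * (t - s))"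
        using lip[of s t] W(1)[of s t] that by auto
      then show ?thesis using that W by (simp add: ennreal_le_iff)
    qed
    show ?thesis using *[of s t] *[of t s] that by (cases "s \<le> t") (auto simp: dist_commute)
  qed
  have single: "emeasure \<mu> {x} = 0" for x using W(1)[of x x] by simp
  show ?thesis
  proof (rule ennreal_le_epsilon)
    fix e :: real assume e: "e > 0"
    obtain V where V: "A \<subseteq> V" "open V" "emeasure \<mu> V < emeasure \<mu> A + ennreal e"
    proof -
      have "emeasure \<mu> A < emeasure \<mu> A + ennreal e"
        using e by (intro ennreal_less_add_pos) auto
      then have "(INF U \<in> {U. A \<subseteq> U \<and> open U}. emeasure \<mu> U) < emeasure \<mu> A + ennreal e"
        using outer_regular[OF \<mu>(1) _ A(1)] emeasure_finite by simp
      then show ?thesis using that by (auto simp: INF_less_iff)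
    qed
    have "hausdorff_pre 1 \<delta> (\<gamma> ` A) \<le> emeasure \<mu> A + ennreal e" if \<delta>: "\<delta> > 0" for \<delta>
    proof -
      \<comment> \<open>Points of an interval inside \<open>g x\<close> differ by at most \<delta> /
        W, so its image has diameter at most \<delta>; the intersection with \<open>V\<close> keeps
        the intervals in the open set. Off \<open>A\<close> the value of the gauge is
        arbitrary.\<close>
      define g where "g x = (if x \<in> A then ball x (\<delta> / (2 * W)) \<inter> V else ball x 1)" for x
      have gauge: "gauge g" unfolding gauge_def g_def using V \<delta> W(2) by auto
      have cov: "A \<subseteq> cbox c d" "box c d \<noteq> {}" using A(2) cd by simp_all
      have "\<exists>\<D>. countable \<D> \<and> \<Union>\<D> \<subseteq> cbox c d \<and> (\<forall>K\<in>\<D>. interior K \<noteq> {} \<and> (\<exists>u v. K = cbox u v)) \<and>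
          pairwise (\<lambda>A B. interior A \<inter> interior B = {}) \<D> \<and> (\<forall>K\<in>\<D>. \<exists>x\<in>A \<inter> K. K \<subseteq> g x) \<and> A \<subseteq> \<Union>\<D>"
        by (rule covering_lemma[OF cov gauge], rule exI, intro conjI ballI) (assumption | blast)+
      then obtain \<D> where \<D>: "countable \<D>" "\<Union>\<D> \<subseteq> cbox c d"
        "\<forall>K\<in>\<D>. interior K \<noteq> {} \<and> (\<exists>u v. K = cbox u v)"
        "pairwise (\<lambda>A B. interior A \<inter> interior B = {}) \<D>"
        "\<forall>K\<in>\<D>. \<exists>x\<in>A \<inter> K. K \<subseteq> g x" "A \<subseteq> \<Union>\<D>" by blast
      define K where "K i = (if i \<in> to_nat_on \<D> ` \<D> then from_nat_into \<D> i else {})" for i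
      have dec: "from_nat_into \<D> (to_nat_on \<D> X) = X" if "X \<in> \<D>" for X
        by (rule from_nat_into_to_nat_on[OF \<D>(1) that])
      have K_in: "K i \<in> \<D> \<or> K i = {}" for i
        using dec by (cases "i \<in> to_nat_on \<D> ` \<D>") (force simp: K_def, simp add: K_def)
      have K_ex: "\<exists>i. K i = X" if "X \<in> \<D>" for X
        using that dec[OF that] by (intro exI[of _ "to_nat_on \<D> X"]) (simp add: K_def)
      have K_inj: "interior (K i) \<inter> interior (K j) = {}" if "i \<noteq> j" for i j
      proof (cases "i \<in> to_nat_on \<D> ` \<D> \<and> j \<in> to_nat_on \<D> ` \<D>")
        case True
        then obtain X Y where XY: "X \<in> \<D>" "Y \<in> \<D>" "i = to_nat_on \<D> X" "j = to_nat_on \<D> Y" by blast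
        then have "K i = X" "K j = Y" "X \<noteq> Y" using dec that by (simp_all add: K_def, blast)
        then show ?thesis using \<D>(4) XY by (auto simp: pairwise_def)
      qed (auto simp: K_def)
      have small: "bounded (\<gamma> ` K i)" "diameter (\<gamma> ` K i) \<le> \<delta>"
        "ennreal (diameter (\<gamma> ` K i)) \<le> emeasure \<mu> (interior (K i))" "interior (K i) \<subseteq> V" for i
      proof -
        have "bounded (\<gamma> ` K i) \<and> diameter (\<gamma> ` K i) \<le> \<delta> \<and>
          ennreal (diameter (\<gamma> ` K i)) \<le> emeasure \<mu> (interior (K i)) \<and> interior (K i) \<subseteq> V"
        proof (cases "K i = {}")
          case False
          then have KD: "K i \<in> \<D>" using K_in by blast
          then obtain u v where uv: "K i = {u..v}" "u \<le> v" using \<D>(3) KD False by (metis atLeastatMost_empty_iff cbox_interval)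
          have "K i \<subseteq> cbox c d" using \<D>(2) KD by blast
          then have cdK: "{u..v} \<subseteq> {c..d}" by (simp only: uv(1) cbox_interval)
          obtain x where x: "x \<in> A" "x \<in> K i" "K i \<subseteq> ball x (\<delta> / (2 * W))" "K i \<subseteq> V"
            using bspec[OF \<D>(5) KD] by (auto simp: g_def)
          \<comment> \<open>Points are \<mu>-null, so passing to the interiors, which are pairwise
            disjoint, loses nothing.\<close>
          have m: "emeasure \<mu> {u..v} = emeasure \<mu> {u<..<v}"
          proof -
            have "emeasure \<mu> {u..v} \<le> emeasure \<mu> ({u<..<v} \<union> ({u} \<union> {v}))"
              using \<mu>(1) by (intro emeasure_mono) auto
            also have "\<dots> \<le> emeasure \<mu> {u<..<v} + (emeasure \<mu> {u} + emeasure \<mu> {v})"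
              using \<mu>(1) by (intro order_trans[OF emeasure_subadditive] add_left_mono emeasure_subadditive) auto
            finally have "emeasure \<mu> {u..v} \<le> emeasure \<mu> {u<..<v}" by (simp add: single)
            moreover have "emeasure \<mu> {u<..<v} \<le> emeasure \<mu> {u..v}"
              using \<mu>(1) by (intro emeasure_mono) auto
            ultimately show ?thesis by simp
          qed
          have dW: "dist (\<gamma> s) (\<gamma> t) \<le> \<delta>" if "s \<in> K i" "t \<in> K i" for s t
          proof -
            have "\<bar>s - t\<bar> \<le> \<delta> / W"
            proof -
              have "dist x s < \<delta> / (2 * W)" "dist x t < \<delta> / (2 * W)" using x(3) that by auto
              moreover have "\<delta> / W = \<delta> / (2 * W) + \<delta> / (2 * W)" by (simp add: field_simps)
              ultimately show ?thesis by (simp add: dist_real_def)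
            qed
            then have "W * \<bar>s - t\<bar> \<le> \<delta>" using W(2) by (simp add: pos_le_divide_eq mult.commute)
            then show ?thesis using dist_W[of s t] that uv cdK by force
          qed
          have b: "bounded (\<gamma> ` K i)" unfolding bounded_two_points using dW by blast
          have d1: "diameter (\<gamma> ` K i) \<le> \<delta>" using dW \<delta> by (intro diameter_le) (auto simp: dist_norm)
          have "diameter (\<gamma> ` K i) \<le> measure \<mu> {u..v}"
          proof (rule diameter_le)
            fix p q assume "p \<in> \<gamma> ` K i" "q \<in> \<gamma> ` K i"
            then obtain s t where st: "s \<in> {u..v}" "t \<in> {u..v}" "p = \<gamma> s" "q = \<gamma> t" using uv by blast
            have *: "dist (\<gamma> s) (\<gamma> t) \<le> measure \<mu> {u..v}" if "s \<in> {u..v}" "t \<in> {u..v}" "s \<le> t" for s t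
            proof -
              have "ennreal (dist (\<gamma> s) (\<gamma> t)) \<le> emeasure \<mu> {s..t}"
                using that cdK by (intro lip) auto
              also have "\<dots> \<le> emeasure \<mu> {u..v}" using that \<mu>(1) by (intro emeasure_mono) auto
              finally show ?thesis by (simp add: emeasure_eq_measure)
            qed
            show "norm (p - q) \<le> measure \<mu> {u..v}"
              using *[of s t] *[of t s] st by (cases "s \<le> t") (auto simp: dist_norm norm_minus_commute)
          qed auto
          then have "ennreal (diameter (\<gamma> ` K i)) \<le> emeasure \<mu> {u..v}"
            by (simp add: emeasure_eq_measure ennreal_leI)
          then have "ennreal (diameter (\<gamma> ` K i)) \<le> emeasure \<mu> (interior (K i))"
            using m uv by (simp add: interior_atLeastAtMost_real)
          moreover have "interior (K i) \<subseteq> V" using x(4) interior_subset by blast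
          ultimately show ?thesis using b d1 by blast
        qed (use \<delta> in simp)
        then show "bounded (\<gamma> ` K i)" "diameter (\<gamma> ` K i) \<le> \<delta>"
          "ennreal (diameter (\<gamma> ` K i)) \<le> emeasure \<mu> (interior (K i))" "interior (K i) \<subseteq> V" by auto
      qed
      have "\<gamma> ` A \<subseteq> (\<Union>i. \<gamma> ` K i)" using \<D>(6) K_ex by blast
      then have "hausdorff_pre 1 \<delta> (\<gamma> ` A) \<le> (\<Sum>i. haus_size 1 (\<gamma> ` K i))"
        using small by (intro hausdorff_pre_le) auto
      also have "\<dots> \<le> (\<Sum>i. emeasure \<mu> (interior (K i)))"
        using small(3) unfolding haus_size_1 by (intro suminf_le) auto
      also have "\<dots> = emeasure \<mu> (\<Union>i. interior (K i))"
        using K_inj \<mu>(1) by (intro suminf_emeasure) (auto simp: disjoint_family_on_def)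
      also have "\<dots> \<le> emeasure \<mu> V" using small(4) V(2) \<mu>(1) by (intro emeasure_mono) auto
      also have "\<dots> \<le> emeasure \<mu> A + ennreal e" using V(3) by simp
      finally show ?thesis .
    qed
    then show "hausdorff_outer 1 (\<gamma> ` A) \<le> emeasure \<mu> A + ennreal e" by (rule hausdorff_outer_least)
  qed
qed

text \<open>Applied to the preimage of an arbitrary Borel set,
  \<open>hausdorff_outer_curve_le\<close> shows that Hausdorff measure restricted to
  \<open>C\<close> is dominated by the image of \<mu> under \<gamma>.\<close>

theorem hausdorff_integral_curve_le:
  fixes \<gamma> :: "real \<Rightarrow> 'a::euclidean_space" and f :: "'a \<Rightarrow> ennreal"
  assumes \<mu>: "sets \<mu> = sets borel" "finite_measure \<mu>" and cd: "c < d"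
    and lip: "\<And>s t. \<lbrakk>c \<le> s; s \<le> t; t \<le> d\<rbrakk> \<Longrightarrow> ennreal (dist (\<gamma> s) (\<gamma> t)) \<le> emeasure \<mu> {s..t}"
    and W: "\<And>s t. s \<le> t \<Longrightarrow> emeasure \<mu> {s..t} \<le> ennreal (W * (t - s))" "0 < W"
    and A: "A \<in> sets borel" "A \<subseteq> {c..d}" and C: "C \<in> sets borel" "C \<subseteq> \<gamma> ` A"
    and \<gamma> [measurable]: "\<gamma> \<in> borel_measurable borel" and f [measurable]: "f \<in> borel_measurable borel"
  shows "(\<integral>\<^sup>+x. f x * indicator C x \<partial>hausdorff_measure 1) \<le> (\<integral>\<^sup>+t. f (\<gamma> t) * indicator A t \<partial>\<mu>)"
proof -
  note [measurable_cong] = \<mu>(1)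
  note [measurable] = A(1) C(1)
  let ?M = "density (hausdorff_measure 1) (indicator C) :: 'a measure"
  let ?N = "distr (density \<mu> (indicator A)) borel \<gamma>"
  have gm: "\<gamma> \<in> density \<mu> (indicator A) \<rightarrow>\<^sub>M borel"
    using \<gamma> by (simp add: measurable_cong_sets[OF \<mu>(1) refl])
  have "(\<integral>\<^sup>+x. f x \<partial>?M) \<le> (\<integral>\<^sup>+x. f x \<partial>?N)"
  proof (rule nn_integral_mono_emeasure)
    fix B :: "'a set" assume "B \<in> sets ?M"
    then have B [measurable]: "B \<in> sets borel" by simp
    have AB: "A \<inter> \<gamma> -` B \<in> sets borel" using measurable_sets[OF \<gamma> B] by simp
    have "emeasure ?M B = emeasure (hausdorff_measure 1) (C \<inter> B)"
      using B C by (subst emeasure_density) (auto simp: nn_integral_indicator[symmetric] indicator_inter_arith[symmetric] simp del: nn_integral_indicator)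
    also have "\<dots> = hausdorff_outer 1 (C \<inter> B)"
      by (rule emeasure_hausdorff_measure) measurable
    also have "\<dots> \<le> hausdorff_outer 1 (\<gamma> ` (A \<inter> \<gamma> -` B))" using C(2) by (intro hausdorff_outer_mono) auto
    also have "\<dots> \<le> emeasure \<mu> (A \<inter> \<gamma> -` B)"
      using AB A(2) by (intro hausdorff_outer_curve_le[OF \<mu> cd lip W]) auto
    also have "\<dots> = emeasure ?N B"
      using B AB \<mu>(1) sets_eq_imp_space_eq[OF \<mu>(1)] measurable_sets[OF \<gamma> B]
      by (subst emeasure_distr[OF gm B], subst emeasure_density)
         (auto simp: nn_integral_indicator[symmetric] indicator_inter_arith[symmetric] simp del: nn_integral_indicator)
    finally show "emeasure ?M B \<le> emeasure ?N B" .
  qed simp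
  then show ?thesis
    by (simp add: nn_integral_density nn_integral_distr[OF gm] mult.commute)
qed

text \<open>On \<open>A\<close> the composite of \<open>P\<close> and \<gamma> is affine with slope
  \<open>K\<close>, so the projected arc over a set of parameters has \<open>K\<close> times the
  measure of that set, and projecting cannot increase Hausdorff measure.\<close>

theorem hausdorff_integral_curve_ge:
  fixes \<gamma> :: "real \<Rightarrow> 'a::euclidean_space" and f :: "'a \<Rightarrow> ennreal" and P :: "'a \<Rightarrow> real"
  assumes P: "\<And>x y. dist (P x) (P y) \<le> dist x y" and K: "0 < K" "\<And>t. t \<in> A \<Longrightarrow> P (\<gamma> t) = K * t + k"
    and A: "A \<in> sets borel" and C: "C \<in> sets borel" "\<gamma> ` A \<subseteq> C"
    and \<gamma> [measurable]: "\<gamma> \<in> borel_measurable borel" and f [measurable]: "f \<in> borel_measurable borel"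
  shows "ennreal K * (\<integral>\<^sup>+t. f (\<gamma> t) * indicator A t \<partial>lborel) \<le> (\<integral>\<^sup>+x. f x * indicator C x \<partial>hausdorff_measure 1)"
proof -
  note [measurable] = A(1) C(1)
  let ?M = "density (hausdorff_measure 1) (indicator C) :: 'a measure"
  let ?N = "distr (density lborel (\<lambda>t. ennreal K * indicator A t)) borel \<gamma>"
  have gm: "\<gamma> \<in> density lborel (\<lambda>t. ennreal K * indicator A t) \<rightarrow>\<^sub>M borel" using \<gamma> by simp
  have "(\<integral>\<^sup>+x. f x \<partial>?N) \<le> (\<integral>\<^sup>+x. f x \<partial>?M)"
  proof (rule nn_integral_mono_emeasure)
    fix B :: "'a set" assume "B \<in> sets ?N"
    then have B [measurable]: "B \<in> sets borel" by simp
    have AB [measurable]: "A \<inter> \<gamma> -` B \<in> sets borel" using measurable_sets[OF \<gamma> B] by simp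
    let ?D = "(\<lambda>t. k + K * t) ` (A \<inter> \<gamma> -` B)"
    have D_eq: "?D = (\<lambda>y. (y - k) / K) -` (A \<inter> \<gamma> -` B)"
      using K(1) by (auto simp: image_iff field_simps intro!: bexI[of _ "(_ - k) / K"])
    have D: "?D \<in> sets borel"
      unfolding D_eq using measurable_sets[of "\<lambda>y. (y - k) / K" borel borel "A \<inter> \<gamma> -` B"] AB by simp
    have "emeasure ?N B = ennreal K * emeasure lborel (A \<inter> \<gamma> -` B)"
      using measurable_sets[OF \<gamma> B]
      by (subst emeasure_distr[OF gm B], subst emeasure_density)
         (auto simp: mult.assoc nn_integral_cmult nn_integral_indicator[symmetric] indicator_inter_arith[symmetric] simp del: nn_integral_indicator)
    also have "\<dots> = emeasure lborel ?D"
    proof -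
      have "emeasure lborel ?D = (\<integral>\<^sup>+y. indicator ?D y \<partial>lborel)" using D by simp
      also have "\<dots> = ennreal \<bar>K\<bar> * (\<integral>\<^sup>+t. indicator ?D (k + K * t) \<partial>lborel)"
        using K(1) D by (intro nn_integral_real_affine) auto
      also have "(\<lambda>t. indicator ?D (k + K * t) :: ennreal) = indicator (A \<inter> \<gamma> -` B)"
        using K(1) by (auto simp: fun_eq_iff indicator_def)
      finally show ?thesis using K(1) by simp
    qed
    also have "\<dots> \<le> hausdorff_outer 1 (C \<inter> B)"
    proof (rule lborel_le_hausdorff_outer[OF D _ P])
      show "?D \<subseteq> P ` (C \<inter> B)"
      proof
        fix y assume "y \<in> ?D"
        then obtain t where t: "t \<in> A" "\<gamma> t \<in> B" "y = k + K * t" by blast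
        then have "y = P (\<gamma> t)" using K(2) by simp
        then show "y \<in> P ` (C \<inter> B)" using t C(2) by blast
      qed
    qed
    also have "\<dots> = emeasure ?M B"
      using B C by (subst emeasure_density) (auto simp: emeasure_hausdorff_measure[symmetric] nn_integral_indicator[symmetric] indicator_inter_arith[symmetric] simp del: nn_integral_indicator)
    finally show "emeasure ?N B \<le> emeasure ?M B" .
  qed simp
  then show ?thesis
    by (simp add: nn_integral_density nn_integral_distr[OF gm] mult_ac nn_integral_cmult)
qed

section \<open>Mollification\<close>

lemma emeasure_open_pos:
  fixes S :: "'a::euclidean_space set"
  assumes "open S" "S \<noteq> {}" shows "emeasure lborel S \<noteq> 0"
proof
  assume "emeasure lborel S = 0"
  then have "S \<in> null_sets lborel" using assms(1) by (simp add: null_sets_def)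
  then have "negligible S" by (simp add: negligible_iff_null_sets null_sets_completionI)
  then show False using open_not_negligible[OF assms] by simp
qed

definition mollifier :: "real \<Rightarrow> 'a::euclidean_space \<Rightarrow> real" where
  "mollifier e z = bump ((1 / e) *\<^sub>R z) / (\<integral>y. bump ((1 / e) *\<^sub>R y) \<partial>(lborel :: 'a measure))"

lemma smooth_bump_scale: "smooth (\<lambda>z::'a::euclidean_space. bump (c *\<^sub>R z))"
  using smooth_affine[OF smooth_bump, of c 0] by simp

lemma bdd_supp_bump_scale: "0 < e \<Longrightarrow> bdd_supp (\<lambda>z::'a::euclidean_space. bump ((1 / e) *\<^sub>R z))"
  unfolding bdd_supp_def by (intro exI[of _ e]) (auto intro!: bump_zero simp: field_simps)

lemma integrable_bump_scale: "0 < e \<Longrightarrow> integrable lborel (\<lambda>z::'a::euclidean_space. bump ((1 / e) *\<^sub>R z))"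
  by (intro bdd_supp_integrable smooth_continuous smooth_bump_scale bdd_supp_bump_scale)

lemma integral_bump_pos: "0 < e \<Longrightarrow> 0 < (\<integral>z. bump ((1 / e) *\<^sub>R z) \<partial>(lborel :: 'a::euclidean_space measure))"
proof -
  assume e: "0 < e"
  have "(\<integral>z. bump ((1 / e) *\<^sub>R z) \<partial>(lborel :: 'a measure)) \<noteq> 0"
  proof
    assume "(\<integral>z. bump ((1 / e) *\<^sub>R z) \<partial>(lborel :: 'a measure)) = 0"
    then have "AE z::'a in lborel. bump ((1 / e) *\<^sub>R z) = 0"
      using integral_nonneg_eq_0_iff_AE[OF integrable_bump_scale[OF e, where 'a='a]] by (simp add: bump_nonneg)
    then have "AE z::'a in lborel. z \<notin> ball 0 e"
    proof eventually_elim
      case (elim z)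
      show ?case
      proof
        assume "z \<in> ball 0 e"
        then have "norm ((1 / e) *\<^sub>R z) < 1" using e by simp
        then show False using bump_pos[of "(1 / e) *\<^sub>R z"] elim by simp
      qed
    qed
    then have "emeasure lborel (ball (0::'a) e) = 0"
      by (subst (asm) AE_iff_measurable[where N = "ball 0 e"]) auto
    then show False using e emeasure_open_pos[of "ball (0::'a) e"] by simp
  qed
  moreover have "0 \<le> (\<integral>z. bump ((1 / e) *\<^sub>R z) \<partial>(lborel :: 'a measure))" by (simp add: bump_nonneg)
  ultimately show ?thesis by simp
qed

lemma mollifier_nonneg: "0 < e \<Longrightarrow> 0 \<le> mollifier e z"
  unfolding mollifier_def by (intro divide_nonneg_nonneg bump_nonneg) (simp add: bump_nonneg)

lemma mollifier_zero: "\<lbrakk>0 < e; e \<le> norm z\<rbrakk> \<Longrightarrow> mollifier e z = 0"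
  unfolding mollifier_def by (subst bump_zero) (auto simp: field_simps)

lemma smooth_mollifier: "smooth (mollifier e :: 'a::euclidean_space \<Rightarrow> real)"
proof -
  have "smooth (\<lambda>z::'a. (1 / (\<integral>y. bump ((1 / e) *\<^sub>R y) \<partial>(lborel :: 'a measure))) * bump ((1 / e) *\<^sub>R z))"
    by (intro smooth_mult smooth_const smooth_bump_scale)
  then show ?thesis unfolding mollifier_def[abs_def] by simp
qed

lemma bdd_supp_mollifier: "0 < e \<Longrightarrow> bdd_supp (mollifier e)"
  unfolding bdd_supp_def by (intro exI[of _ e]) (auto intro!: mollifier_zero)

lemma continuous_mollifier: "continuous_on UNIV (mollifier e)"
  by (rule smooth_continuous[OF smooth_mollifier])

lemma measurable_mollifier [measurable]: "mollifier e \<in> borel_measurable borel"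
  by (rule borel_measurable_continuous_onI[OF continuous_mollifier])

lemma integrable_mollifier: "0 < e \<Longrightarrow> integrable lborel (mollifier e)"
  by (intro bdd_supp_integrable continuous_mollifier bdd_supp_mollifier)

lemma integral_mollifier: "0 < e \<Longrightarrow> (\<integral>z. mollifier e z \<partial>(lborel :: 'a::euclidean_space measure)) = 1"
  unfolding mollifier_def using integral_bump_pos[where 'a='a and e = e] by simp

lemma integral_mollifier_shift:
  assumes e: "0 < e"
  shows "integrable lborel (\<lambda>w::'a::euclidean_space. mollifier e (w - y))"
    "(\<integral>w. mollifier e (w - y) \<partial>(lborel :: 'a measure)) = 1"
  using lborel_integrable_shift[OF measurable_mollifier, of e "- y"] integrable_mollifier[OF e]
    lborel_integral_shift[OF measurable_mollifier, of e "- y"] integral_mollifier[OF e] by simp_all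

text \<open>Substitute z = w - l x: the Jacobian is l^n with l >= 1/2, whence the factor 2^n. The
  variable x is the point at which a smoothing is evaluated; its dilation is what prevents the value
  1.\<close>

lemma nn_integral_mollifier_reflect:
  fixes w :: "'a::euclidean_space"
  assumes e: "0 < e" and l: "1 / 2 \<le> l"
  shows "(\<integral>\<^sup>+x. ennreal (mollifier e (w - l *\<^sub>R x)) \<partial>lborel) \<le> ennreal (2 ^ DIM('a))"
proof -
  have "(\<integral>\<^sup>+x. ennreal (mollifier e x) \<partial>(lborel :: 'a measure))
      = (\<integral>\<^sup>+x. ennreal (mollifier e x) \<partial>density (distr lborel borel (\<lambda>x::'a. w + (- l) *\<^sub>R x)) (\<lambda>_. ennreal (\<bar>- l\<bar> ^ DIM('a))))"
    by (rule arg_cong[where f = "\<lambda>N. nn_integral N (\<lambda>x. ennreal (mollifier e x))"])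
      (rule lborel_affine, use l in simp)
  also have "\<dots> = (\<integral>\<^sup>+x. ennreal (\<bar>- l\<bar> ^ DIM('a)) * ennreal (mollifier e x) \<partial>distr lborel borel (\<lambda>x::'a. w + (- l) *\<^sub>R x))"
    by (rule nn_integral_density) measurable
  also have "\<dots> = (\<integral>\<^sup>+x. ennreal (\<bar>- l\<bar> ^ DIM('a)) * ennreal (mollifier e (w + (- l) *\<^sub>R x)) \<partial>lborel)"
    by (rule nn_integral_distr) measurable
  also have "\<dots> = ennreal (l ^ DIM('a)) * (\<integral>\<^sup>+x. ennreal (mollifier e (w - l *\<^sub>R x)) \<partial>lborel)"
    using l by (simp add: nn_integral_cmult)
  finally have "ennreal (l ^ DIM('a)) * (\<integral>\<^sup>+x. ennreal (mollifier e (w - l *\<^sub>R x)) \<partial>lborel) = 1"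
    using nn_integral_eq_integral[OF integrable_mollifier[OF e, where 'a='a]] mollifier_nonneg[OF e, where 'a='a] integral_mollifier[OF e, where 'a='a] by simp
  moreover have "1 \<le> ennreal (2 ^ DIM('a)) * ennreal (l ^ DIM('a))"
  proof -
    have "1 \<le> (2 * l) ^ DIM('a)" using l by (intro one_le_power) simp
    then show ?thesis using l by (simp add: power_mult_distrib flip: ennreal_mult ennreal_1)
  qed
  ultimately show ?thesis
    using mult_right_mono[of 1 "ennreal (2 ^ DIM('a)) * ennreal (l ^ DIM('a))" "\<integral>\<^sup>+x. ennreal (mollifier e (w - l *\<^sub>R x)) \<partial>lborel"]
    by (simp add: mult.assoc)
qed

lemma L2_dominated:
  assumes un: "\<And>n. un n \<in> borel_measurable M" and u: "u \<in> borel_measurable M"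
    and lim: "AE x in M. (\<lambda>n. un n x) \<longlonglongrightarrow> u x"
    and w: "integrable M w" "\<And>n. AE x in M. (cmod (un n x - u x))\<^sup>2 \<le> w x"
  shows "(\<lambda>n. L2_norm M (\<lambda>x. un n x - u x)) \<longlonglongrightarrow> 0"
proof -
  note [measurable] = un u
  have "(\<lambda>n. \<integral>x. (cmod (un n x - u x))\<^sup>2 \<partial>M) \<longlonglongrightarrow> (\<integral>x. 0 \<partial>M)"
  proof (rule integral_dominated_convergence[OF _ _ w(1)])
    show "AE x in M. (\<lambda>n. (cmod (un n x - u x))\<^sup>2) \<longlonglongrightarrow> 0"
      using lim
    proof eventually_elim
      case (elim x)
      have "(\<lambda>n. (cmod (un n x - u x))\<^sup>2) \<longlonglongrightarrow> (cmod (u x - u x))\<^sup>2" by (intro tendsto_intros elim)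
      then show ?case by simp
    qed
    show "AE x in M. norm ((cmod (un n x - u x))\<^sup>2) \<le> w x" for n using w(2)[of n] by simp
  qed auto
  then have "(\<lambda>n. sqrt (\<integral>x. (cmod (un n x - u x))\<^sup>2 \<partial>M)) \<longlonglongrightarrow> sqrt 0"
    by (intro tendsto_real_sqrt) simp
  then show ?thesis unfolding L2_norm_def by simp
qed

text \<open>The last assumption makes \<open>\<Omega>\<close> star-shaped about \<open>0\<close> with enough room for dilating and
  mollifying at the same time, so that no partition of unity is needed.\<close>

locale star_domain =
  fixes \<Omega> :: "'a::euclidean_space set" and K e0 :: real
  assumes open_\<Omega>: "open \<Omega>" and bounded_\<Omega>: "bounded \<Omega>" and ne_\<Omega>: "\<Omega> \<noteq> {}"
    and K: "0 < K" and e0: "0 < e0" "K * e0 \<le> 1 / 2"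
    and shrink: "\<And>x e z. \<lbrakk>x \<in> \<Omega>; 0 < e; e \<le> e0; norm z \<le> 1\<rbrakk> \<Longrightarrow> (1 - K * e) *\<^sub>R x + e *\<^sub>R z \<in> \<Omega>"
begin

abbreviation "M \<equiv> volume_on \<Omega>"

lemma borel_\<Omega> [measurable]: "\<Omega> \<in> sets borel" using open_\<Omega> by simp

lemma emeasure_\<Omega>: "emeasure lborel \<Omega> < \<infinity>" using bounded_\<Omega> by (rule emeasure_bounded_finite)

lemma finite_M: "finite_measure M"
  using emeasure_\<Omega> by (intro finite_measureI) (simp add: space_restrict_space emeasure_restrict_space less_top)

lemma space_M [simp]: "space M = \<Omega>" by (simp add: space_restrict_space)

definition ext :: "('a \<Rightarrow> complex) \<Rightarrow> 'a \<Rightarrow> complex" where "ext u x = indicator \<Omega> x *\<^sub>R u x"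

lemma ext_measurable: "u \<in> borel_measurable M \<Longrightarrow> ext u \<in> borel_measurable borel"
  unfolding ext_def[abs_def] by (simp add: borel_measurable_restrict_space_iff)

lemma integral_M: "(\<integral>x. u x \<partial>M) = (\<integral>x. indicator \<Omega> x *\<^sub>R u x \<partial>lborel)"
  for u :: "'a \<Rightarrow> 'b::{banach, second_countable_topology}"
  by (simp add: integral_restrict_space)

lemma integrable_M: "integrable M u \<longleftrightarrow> integrable lborel (\<lambda>x. indicator \<Omega> x *\<^sub>R u x)"
  for u :: "'a \<Rightarrow> 'b::{banach, second_countable_topology}"
  by (simp add: integrable_restrict_space)

lemma const_L2: "(\<lambda>x. c) \<in> L2 M"
  using finite_measure.integrable_const[OF finite_M, of "(cmod c)\<^sup>2"] by (simp add: L2_def)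

lemma L2_integrable_M: "u \<in> L2 M \<Longrightarrow> integrable M u"
  using L2_mult_integrable[of u M "\<lambda>_. 1"] const_L2 by simp

lemma ext_integrable: "u \<in> L2 M \<Longrightarrow> integrable lborel (ext u)"
  using L2_integrable_M[of u] unfolding integrable_M ext_def[abs_def] .

lemma bounded_L2:
  assumes "u \<in> borel_measurable M" "\<And>x. x \<in> \<Omega> \<Longrightarrow> cmod (u x) \<le> B"
  shows "u \<in> L2 M"
proof (rule L2_bound[OF assms(1), of "\<lambda>_. B\<^sup>2"])
  show "integrable M (\<lambda>_. B\<^sup>2)" by (rule finite_measure.integrable_const[OF finite_M])
  show "AE x in M. (cmod (u x))\<^sup>2 \<le> B\<^sup>2" using assms(2) by (intro AE_I2) (auto intro!: power_mono)
qed

lemma measurable_M_continuous: "continuous_on UNIV g \<Longrightarrow> g \<in> borel_measurable M" for g :: "'a \<Rightarrow> complex"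
  by (rule measurable_restrict_space1) (simp add: borel_measurable_continuous_onI)

lemma continuous_L2:
  assumes "continuous_on UNIV g" shows "g \<in> L2 M"
proof -
  have "compact (g ` closure \<Omega>)"
    using assms bounded_\<Omega> by (intro compact_continuous_image) (auto intro: continuous_on_subset)
  then obtain B where "\<And>x. x \<in> closure \<Omega> \<Longrightarrow> cmod (g x) \<le> B"
    using compact_imp_bounded bounded_iff by (metis imageI)
  then show ?thesis
    using assms closure_subset by (intro bounded_L2[OF measurable_M_continuous]) blast+
qed

text \<open>The value at x is an average of u over the ball of radius e about (1 - K e) x, which
  lies in \<Omega> for x in \<Omega> by \<open>shrink\<close>. So at points of \<Omega>, even close
  to the boundary, the extension by 0 is never seen.\<close>

definition smoothing :: "real \<Rightarrow> ('a \<Rightarrow> complex) \<Rightarrow> 'a \<Rightarrow> complex" where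
  "smoothing e u = conv (ext u) (\<lambda>z. of_real (mollifier e z)) (1 - K * e)"

lemma dil: "\<lbrakk>0 < e; e \<le> e0\<rbrakk> \<Longrightarrow> 1 / 2 \<le> 1 - K * e \<and> 1 - K * e \<le> 1"
proof -
  assume "0 < e" "e \<le> e0"
  then have "K * e \<le> K * e0" "0 \<le> K * e" using K by auto
  then show ?thesis using e0(2) by linarith
qed

lemma kernel:
  assumes "0 < e"
  shows "smooth (\<lambda>z::'a. of_real (mollifier e z) :: complex)" "bdd_supp (\<lambda>z::'a. of_real (mollifier e z) :: complex)"
  using smooth_of_real[OF smooth_mollifier] bdd_supp_mollifier[OF assms] by (auto simp: bdd_supp_def)

lemma smoothing_eq: "smoothing e u x = (\<integral>w. ext u w * of_real (mollifier e (w - (1 - K * e) *\<^sub>R x)) \<partial>lborel)"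
  by (simp add: smoothing_def conv_def)

lemma smooth_smoothing: "\<lbrakk>u \<in> L2 M; 0 < e\<rbrakk> \<Longrightarrow> smooth (smoothing e u)"
  unfolding smoothing_def by (intro smooth_conv ext_integrable kernel)

lemma smoothing_test:
  assumes u: "u \<in> L2 M" and e: "0 < e" "e \<le> e0"
  shows "smoothing e u \<in> test_functions UNIV"
proof -
  obtain R where R: "\<And>x. x \<in> \<Omega> \<Longrightarrow> norm x \<le> R" using bounded_\<Omega> by (auto simp: bounded_iff)
  have "smoothing e u x = 0" if x: "2 * (R + e) < norm x" for x
  proof -
    have "ext u w * of_real (mollifier e (w - (1 - K * e) *\<^sub>R x)) = 0" for w
    proof (cases "w \<in> \<Omega>")
      case True
      have "R + e < (1 / 2) * norm x" using x by simp
      also have "\<dots> \<le> (1 - K * e) * norm x" using dil[OF e] by (intro mult_right_mono) auto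
      also have "\<dots> = norm ((1 - K * e) *\<^sub>R x)" using dil[OF e] by simp
      finally have "e \<le> norm (w - (1 - K * e) *\<^sub>R x)"
        using R[OF True] norm_triangle_ineq2[of "(1 - K * e) *\<^sub>R x" w] by (simp add: norm_minus_commute)
      then show ?thesis using mollifier_zero[OF e(1), of "w - (1 - K * e) *\<^sub>R x"] by simp
    qed (simp add: ext_def)
    then show ?thesis unfolding smoothing_eq by (simp only: integral_zero)
  qed
  then show ?thesis using smooth_smoothing[OF u e(1)] by (auto simp: test_functions_iff bdd_supp_def)
qed

lemma smoothing_L2: "\<lbrakk>u \<in> L2 M; 0 < e\<rbrakk> \<Longrightarrow> smoothing e u \<in> L2 M"
  by (rule continuous_L2[OF smooth_continuous[OF smooth_smoothing]])

lemma conv_int: "\<lbrakk>u \<in> L2 M; 0 < e\<rbrakk> \<Longrightarrow> integrable lborel (\<lambda>w. ext u w * of_real (mollifier e (w - y)))"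
  by (intro conv_integrable ext_integrable smooth_continuous kernel)

lemma smoothing_diff:
  assumes "u \<in> L2 M" "v \<in> L2 M" "0 < e"
  shows "smoothing e (\<lambda>x. u x - v x) x = smoothing e u x - smoothing e v x"
proof -
  have "ext (\<lambda>x. u x - v x) w = ext u w - ext v w" for w by (simp add: ext_def scaleR_diff_right)
  then show ?thesis using conv_int[OF assms(1,3)] conv_int[OF assms(2,3)] by (simp add: smoothing_eq left_diff_distrib)
qed

text \<open>Jensen's inequality for the probability density \<open>mollifier e\<close>, obtained
  from 2 t |f| <= |f|^2 + t^2 with t the mean of |f|.\<close>

lemma smoothing_sq_le:
  assumes u: "u \<in> L2 M" and e: "0 < e"
  shows "ennreal ((cmod (smoothing e u x))\<^sup>2)
    \<le> (\<integral>\<^sup>+w. ennreal ((cmod (ext u w))\<^sup>2 * mollifier e (w - (1 - K * e) *\<^sub>R x)) \<partial>lborel)"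
proof -
  let ?k = "\<lambda>w. mollifier e (w - (1 - K * e) *\<^sub>R x)"
  note k = integral_mollifier_shift[OF e, of "(1 - K * e) *\<^sub>R x"] mollifier_nonneg[OF e, where 'a='a]
  have [measurable]: "ext u \<in> borel_measurable borel" using u by (intro ext_measurable L2_measurable)
  define t where "t = (\<integral>w. cmod (ext u w) * ?k w \<partial>lborel)"
  have int1: "integrable lborel (\<lambda>w. cmod (ext u w) * ?k w)"
    using integrable_norm[OF conv_int[OF u e, of "(1 - K * e) *\<^sub>R x"]] by (simp add: norm_mult abs_of_nonneg[OF k(3)])
  obtain B where B: "0 < B" "\<And>z::'a. norm (mollifier e z) \<le> B"
    using bdd_supp_bound[OF continuous_mollifier bdd_supp_mollifier[OF e]] by blast
  have int2: "integrable lborel (\<lambda>w. (cmod (ext u w))\<^sup>2 * ?k w)"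
  proof (rule Bochner_Integration.integrable_bound)
    have "integrable lborel (\<lambda>w. indicator \<Omega> w *\<^sub>R (cmod (u w))\<^sup>2)"
      using L2_integrable[OF u] unfolding integrable_M .
    moreover have "indicator \<Omega> w *\<^sub>R (cmod (u w))\<^sup>2 = (cmod (ext u w))\<^sup>2" for w
      by (simp add: ext_def indicator_def)
    ultimately show "integrable lborel (\<lambda>w. B * (cmod (ext u w))\<^sup>2)" by simp
    have "(cmod (ext u w))\<^sup>2 * ?k w \<le> (cmod (ext u w))\<^sup>2 * B" for w
      using B(2)[of "w - (1 - K * e) *\<^sub>R x"] by (intro mult_left_mono) auto
    then show "AE w in lborel. norm ((cmod (ext u w))\<^sup>2 * ?k w) \<le> norm (B * (cmod (ext u w))\<^sup>2)"
      using k(3) B(1) by (simp add: mult.commute)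
  qed measurable
  have "2 * t * t \<le> (\<integral>w. (cmod (ext u w))\<^sup>2 * ?k w \<partial>lborel) + t\<^sup>2"
  proof -
    have "2 * t * t = (\<integral>w. 2 * t * (cmod (ext u w) * ?k w) \<partial>lborel)" by (simp add: t_def)
    also have "\<dots> \<le> (\<integral>w. (cmod (ext u w))\<^sup>2 * ?k w + t\<^sup>2 * ?k w \<partial>lborel)"
    proof (rule integral_mono)
      show "integrable lborel (\<lambda>w. 2 * t * (cmod (ext u w) * ?k w))" using int1 by simp
      show "integrable lborel (\<lambda>w. (cmod (ext u w))\<^sup>2 * ?k w + t\<^sup>2 * ?k w)" using int2 k(1) by simp
      fix w
      have "2 * t * cmod (ext u w) \<le> (cmod (ext u w))\<^sup>2 + t\<^sup>2"
        using sum_squares_bound[of t "cmod (ext u w)"] by simp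
      then have "(2 * t * cmod (ext u w)) * ?k w \<le> ((cmod (ext u w))\<^sup>2 + t\<^sup>2) * ?k w"
        using k(3) by (rule mult_right_mono)
      then show "2 * t * (cmod (ext u w) * ?k w) \<le> (cmod (ext u w))\<^sup>2 * ?k w + t\<^sup>2 * ?k w"
        by (simp add: algebra_simps)
    qed
    also have "\<dots> = (\<integral>w. (cmod (ext u w))\<^sup>2 * ?k w \<partial>lborel) + t\<^sup>2" using int2 k by simp
    finally show ?thesis .
  qed
  then have t2: "t\<^sup>2 \<le> (\<integral>w. (cmod (ext u w))\<^sup>2 * ?k w \<partial>lborel)" by (simp add: power2_eq_square)
  have "cmod (smoothing e u x) \<le> (\<integral>w. norm (ext u w * of_real (?k w)) \<partial>lborel)"
    unfolding smoothing_eq by (rule integral_norm_bound)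
  also have "\<dots> = t" unfolding t_def using k(3) by (simp add: norm_mult)
  finally have "(cmod (smoothing e u x))\<^sup>2 \<le> t\<^sup>2" by (intro power_mono) auto
  then have "ennreal ((cmod (smoothing e u x))\<^sup>2) \<le> ennreal (\<integral>w. (cmod (ext u w))\<^sup>2 * ?k w \<partial>lborel)"
    using t2 by (intro ennreal_leI) linarith
  also have "\<dots> = (\<integral>\<^sup>+w. ennreal ((cmod (ext u w))\<^sup>2 * ?k w) \<partial>lborel)"
    using int2 k(3) by (intro nn_integral_eq_integral[symmetric]) auto
  finally show ?thesis .
qed

text \<open>Fubini and \<open>nn_integral_mollifier_reflect\<close>. Only uniformity in e matters;
  the factor 2^n for the squared norm is weakened to its own square, which avoids a root.\<close>

lemma smoothing_norm_le:
  assumes u: "u \<in> L2 M" and e: "0 < e" "e \<le> e0"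
  shows "L2_norm M (smoothing e u) \<le> 2 ^ DIM('a) * L2_norm M u"
proof (rule L2_norm_le_nn(2))
  let ?l = "1 - K * e"
  have [measurable]: "ext u \<in> borel_measurable borel" using u by (intro ext_measurable L2_measurable)
  have "(\<integral>\<^sup>+x. ennreal ((cmod (smoothing e u x))\<^sup>2) \<partial>M)
      \<le> (\<integral>\<^sup>+x. ennreal ((cmod (smoothing e u x))\<^sup>2) \<partial>lborel)"
    by (subst nn_integral_restrict_space) (auto intro!: nn_integral_mono simp: indicator_def)
  also have "\<dots> \<le> (\<integral>\<^sup>+x. \<integral>\<^sup>+w. ennreal ((cmod (ext u w))\<^sup>2 * mollifier e (w - ?l *\<^sub>R x)) \<partial>lborel \<partial>lborel)"
    by (intro nn_integral_mono smoothing_sq_le[OF u e(1)])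
  also have "\<dots> = (\<integral>\<^sup>+w. \<integral>\<^sup>+x. ennreal ((cmod (ext u w))\<^sup>2 * mollifier e (w - ?l *\<^sub>R x)) \<partial>lborel \<partial>lborel)"
    by (rule lborel_pair.Fubini') measurable
  also have "\<dots> = (\<integral>\<^sup>+w. ennreal ((cmod (ext u w))\<^sup>2) * (\<integral>\<^sup>+x. ennreal (mollifier e (w - ?l *\<^sub>R x)) \<partial>lborel) \<partial>lborel)"
    by (simp add: ennreal_mult mollifier_nonneg[OF e(1)] nn_integral_cmult)
  also have "\<dots> \<le> (\<integral>\<^sup>+w. ennreal ((cmod (ext u w))\<^sup>2) * ennreal (2 ^ DIM('a)) \<partial>lborel)"
    using dil[OF e] by (intro nn_integral_mono mult_left_mono nn_integral_mollifier_reflect[OF e(1)]) auto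
  also have "\<dots> = (\<integral>\<^sup>+w. ennreal ((cmod (ext u w))\<^sup>2) \<partial>lborel) * ennreal (2 ^ DIM('a))"
    by (rule nn_integral_multc) measurable
  also have "(\<integral>\<^sup>+w. ennreal ((cmod (ext u w))\<^sup>2) \<partial>lborel) = (\<integral>\<^sup>+w. ennreal ((cmod (u w))\<^sup>2) * indicator \<Omega> w \<partial>lborel)"
    by (intro nn_integral_cong) (simp add: ext_def indicator_def)
  also have "(\<integral>\<^sup>+w. ennreal ((cmod (u w))\<^sup>2) * indicator \<Omega> w \<partial>lborel) = (\<integral>\<^sup>+w. ennreal ((cmod (u w))\<^sup>2) \<partial>M)"
    by (subst nn_integral_restrict_space) auto
  also have "\<dots> * ennreal (2 ^ DIM('a)) = ennreal ((L2_norm M u)\<^sup>2 * 2 ^ DIM('a))"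
    unfolding L2_nn_integral[OF u] by (simp add: ennreal_mult)
  also have "\<dots> \<le> ennreal ((2 ^ DIM('a) * L2_norm M u)\<^sup>2)"
  proof (rule ennreal_leI)
    have "(2::real) ^ DIM('a) \<le> (2 ^ DIM('a))\<^sup>2" by (rule self_le_power) auto
    then show "(L2_norm M u)\<^sup>2 * 2 ^ DIM('a) \<le> (2 ^ DIM('a) * L2_norm M u)\<^sup>2"
      by (simp only: power_mult_distrib mult.commute[of "(2 ^ DIM('a))\<^sup>2"]) (simp add: mult_left_mono)
  qed
  finally show "(\<integral>\<^sup>+x. ennreal ((cmod (smoothing e u x))\<^sup>2) \<partial>M) \<le> ennreal ((2 ^ DIM('a) * L2_norm M u)\<^sup>2)" .
qed (use smoothing_L2[OF u e(1)] L2i.nrm_ge0[OF u] in \<open>auto intro: L2_measurable\<close>)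


end

lemma tendsto_0_small: "\<lbrakk>X \<longlonglongrightarrow> 0; 0 < e\<rbrakk> \<Longrightarrow> \<exists>n::nat. X n < e" for X :: "nat \<Rightarrow> real"
  using order_tendstoD(2)[of X 0 sequentially e] by (auto simp: eventually_sequentially)

section \<open>Density of continuous functions and convergence of the smoothings\<close>

context star_domain
begin

lemma norm_le_sup:
  assumes "u \<in> borel_measurable M" "\<And>x. x \<in> \<Omega> \<Longrightarrow> cmod (u x) \<le> B" "0 \<le> B"
  shows "L2_norm M u \<le> B * sqrt (measure lborel \<Omega>)"
proof (rule L2_norm_le_nn(2)[OF assms(1)])
  have "(\<integral>\<^sup>+x. ennreal ((cmod (u x))\<^sup>2) \<partial>M) \<le> (\<integral>\<^sup>+x. ennreal (B\<^sup>2) \<partial>M)"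
    using assms(2) by (intro nn_integral_mono ennreal_leI power_mono) auto
  also have "\<dots> = ennreal (B\<^sup>2) * emeasure lborel \<Omega>"
    by (simp add: emeasure_restrict_space)
  also have "\<dots> = ennreal ((B * sqrt (measure lborel \<Omega>))\<^sup>2)"
    using emeasure_\<Omega> by (simp add: emeasure_eq_ennreal_measure less_top power_mult_distrib ennreal_mult)
  finally show "(\<integral>\<^sup>+x. ennreal ((cmod (u x))\<^sup>2) \<partial>M) \<le> ennreal ((B * sqrt (measure lborel \<Omega>))\<^sup>2)" .
qed (use assms(3) in simp)

text \<open>Two dominated convergences: the values are truncated by the closest-point map
  \<open>c k\<close> onto a disc, and the truncated function is approximated almost everywhere by
  continuous functions, truncated by the same map so that the constant 2 k dominates.\<close>

lemma continuous_dense: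
  assumes u: "u \<in> L2 M" and \<eta>: "0 < \<eta>"
  obtains g where "continuous_on UNIV g" "L2_norm M (\<lambda>x. u x - g x) < \<eta>"
proof -
  define f where "f = ext u"
  have f [measurable]: "f \<in> borel_measurable borel" unfolding f_def using u by (intro ext_measurable L2_measurable)
  have fu: "f x = u x" if "x \<in> \<Omega>" for x using that by (simp add: f_def ext_def)
  define c where "c k = closest_point (cball (0::complex) (real k))" for k :: nat
  have c_cont: "continuous_on UNIV (c k)" for k unfolding c_def by (intro continuous_on_closest_point) auto
  have c_norm: "cmod (c k z) \<le> real k" for k z
    unfolding c_def using closest_point_in_set[of "cball (0::complex) (real k)" z] by simp
  have c_self: "c k z = z" if "cmod z \<le> real k" for k z
    unfolding c_def using that by (intro closest_point_self) simp
  have c_dist: "cmod (c k z - z) \<le> cmod z" for k z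
    unfolding c_def using closest_point_le[of "cball (0::complex) (real k)" 0 z] by (simp add: dist_norm norm_minus_commute)
  have c_meas [measurable]: "c k \<in> borel_measurable borel" for k by (rule borel_measurable_continuous_onI[OF c_cont])
  have meas: "h \<in> borel_measurable M" if "h \<in> borel_measurable borel" for h :: "'a \<Rightarrow> complex"
    by (rule measurable_restrict_space1) (use that in simp)
  have um: "u \<in> borel_measurable M" using u by (rule L2_measurable)
  have "(\<lambda>k. L2_norm M (\<lambda>x. c k (f x) - u x)) \<longlonglongrightarrow> 0"
  proof (rule L2_dominated[OF _ um _ L2_integrable[OF u]])
    show "(\<lambda>x. c k (f x)) \<in> borel_measurable M" for k by (rule meas) measurable
    show "AE x in M. (\<lambda>k. c k (f x)) \<longlonglongrightarrow> u x"
    proof (rule AE_I2)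
      fix x assume "x \<in> space M"
      then have x: "f x = u x" using fu by simp
      obtain N where N: "cmod (u x) \<le> real N" using real_arch_simple by blast
      show "(\<lambda>k. c k (f x)) \<longlonglongrightarrow> u x"
        by (rule tendsto_eventually, rule eventually_sequentiallyI[of N]) (use N x c_self in auto)
    qed
    show "AE x in M. (cmod (c k (f x) - u x))\<^sup>2 \<le> (cmod (u x))\<^sup>2" for k
      by (rule AE_I2) (use fu c_dist in \<open>auto intro!: power_mono\<close>)
  qed
  then obtain k where k: "L2_norm M (\<lambda>x. c k (f x) - u x) < \<eta> / 2"
    using tendsto_0_small[of _ "\<eta> / 2"] \<eta> by auto
  have "f \<in> borel_measurable lebesgue" using f by (intro measurable_completion) simp
  then have "f measurable_on UNIV" by (rule lebesgue_measurable_imp_measurable_on) simp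
  then have "\<exists>N g. negligible N \<and> (\<forall>n. continuous_on UNIV (g n)) \<and> (\<forall>x. x \<notin> N \<longrightarrow> (\<lambda>n. g n x) \<longlonglongrightarrow> f x)"
    unfolding measurable_on_def by simp
  then obtain N g where N: "negligible N" and g: "\<And>n. continuous_on UNIV (g n)"
    "\<And>x. x \<notin> N \<Longrightarrow> (\<lambda>n. g n x) \<longlonglongrightarrow> f x" by blast
  have "AE x in lebesgue. x \<notin> N" using N by (simp add: negligible_iff_null_sets AE_not_in)
  then have "AE x in lborel. x \<notin> N" by (simp add: AE_completion_iff)
  then have AEN: "AE x in M. x \<notin> N" by (subst AE_restrict_space_iff) auto
  have gm [measurable]: "g n \<in> borel_measurable borel" for n by (rule borel_measurable_continuous_onI[OF g(1)])
  have "(\<lambda>n. L2_norm M (\<lambda>x. c k (g n x) - c k (f x))) \<longlonglongrightarrow> 0"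
  proof (rule L2_dominated[where w = "\<lambda>_. (2 * real k)\<^sup>2"])
    show "(\<lambda>x. c k (g n x)) \<in> borel_measurable M" for n by (rule meas) measurable
    show "(\<lambda>x. c k (f x)) \<in> borel_measurable M" by (rule meas) measurable
    show "integrable M (\<lambda>_. (2 * real k)\<^sup>2)" by (rule finite_measure.integrable_const[OF finite_M])
    show "AE x in M. (\<lambda>n. c k (g n x)) \<longlonglongrightarrow> c k (f x)"
      using AEN
    proof eventually_elim
      case (elim x)
      have "isCont (c k) (f x)" using c_cont by (simp add: continuous_on_eq_continuous_at)
      then show ?case using g(2)[OF elim] by (rule isCont_tendsto_compose)
    qed
    show "AE x in M. (cmod (c k (g n x) - c k (f x)))\<^sup>2 \<le> (2 * real k)\<^sup>2" for n
    proof (rule AE_I2, rule power_mono)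
      fix x show "cmod (c k (g n x) - c k (f x)) \<le> 2 * real k"
        using norm_triangle_ineq4[of "c k (g n x)" "c k (f x)"] c_norm[of k "g n x"] c_norm[of k "f x"] by linarith
    qed simp
  qed
  then obtain n where n: "L2_norm M (\<lambda>x. c k (g n x) - c k (f x)) < \<eta> / 2"
    using tendsto_0_small[of _ "\<eta> / 2"] \<eta> by auto
  have cg: "continuous_on UNIV (\<lambda>x. c k (g n x))"
    using continuous_on_compose2[OF c_cont g(1)] by simp
  have L: "(\<lambda>x. c k (f x)) \<in> L2 M" using c_norm by (intro bounded_L2[of _ "real k"] meas) auto
  have "L2_norm M (\<lambda>x. u x - c k (g n x)) \<le> L2_norm M (\<lambda>x. u x - c k (f x)) + L2_norm M (\<lambda>x. c k (f x) - c k (g n x))"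
    by (rule L2i.nrm_triangle_diff[OF u L continuous_L2[OF cg]])
  also have "\<dots> = L2_norm M (\<lambda>x. c k (f x) - u x) + L2_norm M (\<lambda>x. c k (g n x) - c k (f x))"
    by (simp add: L2i.nrm_minus_commute[OF u L] L2i.nrm_minus_commute[OF L continuous_L2[OF cg]])
  also have "\<dots> < \<eta>" using k n by linarith
  finally show thesis using that cg by blast
qed

lemma smoothing_approx_continuous:
  assumes g: "continuous_on UNIV g" and \<eta>: "0 < \<eta>"
  obtains d where "0 < d" "\<And>e. \<lbrakk>0 < e; e \<le> d; e \<le> e0\<rbrakk> \<Longrightarrow> L2_norm M (\<lambda>x. smoothing e g x - g x) \<le> \<eta>"
proof -
  obtain R where R: "0 < R" "\<And>x. x \<in> \<Omega> \<Longrightarrow> norm x \<le> R" using bounded_\<Omega> by (auto simp: bounded_pos)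
  define m where "m = sqrt (measure lborel \<Omega>)"
  have m: "0 \<le> m" by (simp add: m_def)
  define \<eta>' where "\<eta>' = \<eta> / (m + 1)"
  have \<eta>': "0 < \<eta>'" "\<eta>' * m \<le> \<eta>" using \<eta> m by (auto simp: \<eta>'_def field_simps)
  have "uniformly_continuous_on (closure \<Omega>) g"
    using g bounded_\<Omega> by (intro compact_uniformly_continuous) (auto intro: continuous_on_subset)
  then obtain d where d: "0 < d" "\<And>x y. \<lbrakk>x \<in> \<Omega>; y \<in> \<Omega>; dist y x < d\<rbrakk> \<Longrightarrow> dist (g y) (g x) < \<eta>'"
    using \<eta>'(1) closure_subset[of \<Omega>] unfolding uniformly_continuous_on_def by (metis subsetD)
  \<comment> \<open>A point w contributing to the value at x satisfies |w - x| <= e (1 + K R), with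
    e from mollifying and K e R from dilating; the factor 2 makes this strictly smaller than
    d.\<close>
  define d' where "d' = d / (2 * (1 + K * R))"
  have KR: "1 + K * R > 0" using K R by (simp add: add_pos_pos)
  have d': "0 < d'" using d KR by (simp add: d'_def)
  have gL: "g \<in> L2 M" by (rule continuous_L2[OF g])
  show thesis
  proof (rule that[OF d'])
    fix e assume e: "0 < e" "e \<le> d'" "e \<le> e0"
    let ?l = "1 - K * e"
    have ed: "e * (1 + K * R) < d"
    proof -
      have "e * (1 + K * R) \<le> d' * (1 + K * R)" using e KR by (intro mult_right_mono) auto
      also have "\<dots> = d / 2"
      proof -
        have "d / (2 * X) * X = d / 2" if "X > 0" for X :: real using that by simp
        from this[OF KR] show ?thesis by (simp only: d'_def)
      qed
      finally show ?thesis using d by simp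
    qed
    have "cmod (smoothing e g x - g x) \<le> \<eta>'" if x: "x \<in> \<Omega>" for x
    proof -
      note k = integral_mollifier_shift[OF e(1), of "?l *\<^sub>R x"] mollifier_nonneg[OF e(1), where 'a='a]
      have "smoothing e g x - g x = (\<integral>w. ext g w * of_real (mollifier e (w - ?l *\<^sub>R x)) - g x * of_real (mollifier e (w - ?l *\<^sub>R x)) \<partial>lborel)"
        unfolding smoothing_eq using conv_int[OF gL e(1)] k by (subst Bochner_Integration.integral_diff) auto
      also have "cmod \<dots> \<le> (\<integral>w. \<eta>' * mollifier e (w - ?l *\<^sub>R x) \<partial>lborel)"
      proof (rule norm_integral_le)
        show "integrable lborel (\<lambda>w. ext g w * of_real (mollifier e (w - ?l *\<^sub>R x)) - g x * of_real (mollifier e (w - ?l *\<^sub>R x)))"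
          using conv_int[OF gL e(1)] k by (intro Bochner_Integration.integrable_diff) auto
        show "integrable lborel (\<lambda>w. \<eta>' * mollifier e (w - ?l *\<^sub>R x))" using k by simp
        fix w
        show "norm (ext g w * of_real (mollifier e (w - ?l *\<^sub>R x)) - g x * of_real (mollifier e (w - ?l *\<^sub>R x)))
          \<le> \<eta>' * mollifier e (w - ?l *\<^sub>R x)"
        proof (cases "norm (w - ?l *\<^sub>R x) < e")
          case True
          define z where "z = (1 / e) *\<^sub>R (w - ?l *\<^sub>R x)"
          have "w = ?l *\<^sub>R x + e *\<^sub>R z" using e by (simp add: z_def)
          moreover have "norm z \<le> 1" using True e by (simp add: z_def)
          ultimately have w: "w \<in> \<Omega>" using shrink[OF x e(1,3)] by simp
          have "norm (w - x) \<le> norm (w - ?l *\<^sub>R x) + norm ((K * e) *\<^sub>R x)"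
            using norm_triangle_ineq4[of "w - ?l *\<^sub>R x" "(K * e) *\<^sub>R x"] by (simp add: algebra_simps)
          also have "\<dots> \<le> e + (K * e) * R"
            using True R(2)[OF x] K e by (intro add_mono) (auto intro!: mult_left_mono)
          also have "\<dots> < d" using ed by (simp add: algebra_simps)
          finally have "cmod (g w - g x) \<le> \<eta>'" using d(2)[OF x w] by (simp add: dist_norm)
          then show ?thesis using w k(3)
            by (simp add: ext_def norm_mult mult_right_mono flip: left_diff_distrib)
        next
          case False
          then show ?thesis using mollifier_zero[OF e(1), of "w - ?l *\<^sub>R x"] by simp
        qed
      qed
      also have "\<dots> = \<eta>'" using k by simp
      finally show ?thesis .
    qed
    then have "L2_norm M (\<lambda>x. smoothing e g x - g x) \<le> \<eta>' * m" unfolding m_def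
      using \<eta>' smoothing_L2[OF gL e(1)] gL by (intro norm_le_sup L2_measurable[OF L2i.diff_mem]) auto
    then show "L2_norm M (\<lambda>x. smoothing e g x - g x) \<le> \<eta>" using \<eta>' by simp
  qed
qed

text \<open>The uniform bound \<open>smoothing_norm_le\<close> transfers the convergence from
  continuous functions to all of \<open>L2\<close>; \<open>C\<close> collects its factor 2^n and the
  direct error.\<close>

lemma smoothing_approx:
  assumes u: "u \<in> L2 M" and \<eta>: "0 < \<eta>"
  obtains d where "0 < d" "\<And>e. \<lbrakk>0 < e; e \<le> d; e \<le> e0\<rbrakk> \<Longrightarrow> L2_norm M (\<lambda>x. smoothing e u x - u x) \<le> \<eta>"
proof -
  define C where "C = (2::real) ^ DIM('a) + 1"
  have C: "C > 0" by (simp add: C_def add_pos_pos)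
  obtain g where g: "continuous_on UNIV g" "L2_norm M (\<lambda>x. u x - g x) < \<eta> / (2 * C)"
    using continuous_dense[OF u, of "\<eta> / (2 * C)"] \<eta> C by auto
  obtain d where d: "0 < d" "\<And>e. \<lbrakk>0 < e; e \<le> d; e \<le> e0\<rbrakk> \<Longrightarrow> L2_norm M (\<lambda>x. smoothing e g x - g x) \<le> \<eta> / 2"
    using smoothing_approx_continuous[OF g(1), of "\<eta> / 2"] \<eta> by auto
  note gL = continuous_L2[OF g(1)]
  show thesis
  proof (rule that[OF d(1)])
    fix e assume e: "0 < e" "e \<le> d" "e \<le> e0"
    note L = smoothing_L2[OF u e(1)] smoothing_L2[OF gL e(1)]
    have ug: "(\<lambda>x. u x - g x) \<in> L2 M" by (rule L2i.diff_mem[OF u gL])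
    have "(\<lambda>x. smoothing e u x - smoothing e g x) = smoothing e (\<lambda>x. u x - g x)"
      by (rule ext) (simp add: smoothing_diff[OF u gL e(1)])
    then have "L2_norm M (\<lambda>x. smoothing e u x - smoothing e g x) = L2_norm M (smoothing e (\<lambda>x. u x - g x))" by simp
    also have "\<dots> \<le> 2 ^ DIM('a) * L2_norm M (\<lambda>x. u x - g x)" by (rule smoothing_norm_le[OF ug e(1,3)])
    finally have 1: "L2_norm M (\<lambda>x. smoothing e u x - smoothing e g x) \<le> 2 ^ DIM('a) * L2_norm M (\<lambda>x. u x - g x)" .
    have "L2_norm M (\<lambda>x. smoothing e u x - u x)
        \<le> L2_norm M (\<lambda>x. smoothing e u x - smoothing e g x) + L2_norm M (\<lambda>x. smoothing e g x - u x)"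
      by (rule L2i.nrm_triangle_diff[OF L u])
    also have "L2_norm M (\<lambda>x. smoothing e g x - u x) \<le> L2_norm M (\<lambda>x. smoothing e g x - g x) + L2_norm M (\<lambda>x. g x - u x)"
      by (rule L2i.nrm_triangle_diff[OF L(2) gL u])
    also have "L2_norm M (\<lambda>x. g x - u x) = L2_norm M (\<lambda>x. u x - g x)" by (rule L2i.nrm_minus_commute[OF gL u])
    finally have "L2_norm M (\<lambda>x. smoothing e u x - u x) \<le> C * L2_norm M (\<lambda>x. u x - g x) + L2_norm M (\<lambda>x. smoothing e g x - g x)"
      using 1 by (simp add: C_def distrib_right)
    also have "\<dots> \<le> C * (\<eta> / (2 * C)) + \<eta> / 2" using g(2) d(2)[OF e] C by (intro add_mono mult_left_mono) auto
    also have "\<dots> = \<eta>" using C by simp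
    finally show "L2_norm M (\<lambda>x. smoothing e u x - u x) \<le> \<eta>" .
  qed
qed

text \<open>As a function of w the kernel is supported in the closed ball of radius e about (1 - K
  e) x, inside \<Omega> by \<open>shrink\<close>. The values of a smoothing on \<Omega> are
  therefore pairings with test functions, to which weak derivatives and vanishing conditions
  apply.\<close>

lemma kernel_test:
  assumes x: "x \<in> \<Omega>" and e: "0 < e" "e \<le> e0"
  shows "(\<lambda>w::'a. of_real (mollifier e (w - (1 - K * e) *\<^sub>R x))) \<in> test_functions \<Omega>"
proof -
  let ?y = "(1 - K * e) *\<^sub>R x"
  have "smooth (\<lambda>w::'a. of_real (mollifier e (w - ?y)) :: complex)"
    using smooth_affine[OF kernel(1)[OF e(1)], of 1 "- ?y"] by simp
  moreover have "bdd_supp (\<lambda>w::'a. of_real (mollifier e (w - ?y)) :: complex)" unfolding bdd_supp_def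
  proof (intro exI[of _ "norm ?y + e"] allI impI)
    fix w :: 'a assume "norm ?y + e < norm w"
    then have "e \<le> norm (w - ?y)" using norm_triangle_ineq2[of w ?y] by linarith
    then show "(of_real (mollifier e (w - ?y)) :: complex) = 0" using mollifier_zero[OF e(1), of "w - ?y"] by simp
  qed
  moreover have "closure {w::'a. (of_real (mollifier e (w - ?y)) :: complex) \<noteq> 0} \<subseteq> \<Omega>"
  proof -
    have "closure {w::'a. (of_real (mollifier e (w - ?y)) :: complex) \<noteq> 0} \<subseteq> cball ?y e"
    proof (rule closure_minimal)
      show "{w::'a. (of_real (mollifier e (w - ?y)) :: complex) \<noteq> 0} \<subseteq> cball ?y e"
      proof
        fix w assume "w \<in> {w::'a. (of_real (mollifier e (w - ?y)) :: complex) \<noteq> 0}"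
        then have "\<not> e \<le> norm (w - ?y)" using mollifier_zero[OF e(1), of "w - ?y"] by auto
        then show "w \<in> cball ?y e" by (simp add: dist_norm norm_minus_commute)
      qed
    qed simp
    also have "\<dots> \<subseteq> \<Omega>"
    proof
      fix w assume "w \<in> cball ?y e"
      then have "norm ((1 / e) *\<^sub>R (w - ?y)) \<le> 1" using e by (simp add: dist_norm norm_minus_commute)
      from shrink[OF x e this] show "w \<in> \<Omega>" using e by simp
    qed
    finally show ?thesis .
  qed
  ultimately show ?thesis by (simp add: test_functions_iff)
qed

lemma smoothing_eq_M: "smoothing e u x = (\<integral>w. u w * of_real (mollifier e (w - (1 - K * e) *\<^sub>R x)) \<partial>M)"
  unfolding smoothing_eq integral_M by (simp add: ext_def)

text \<open>All smoothings of g vanish on \<Omega>, being pairings with test functions, and yet they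
  converge to g.\<close>

lemma fundamental_lemma:
  assumes g: "g \<in> L2 M" and 0: "\<And>\<phi>. \<phi> \<in> test_functions \<Omega> \<Longrightarrow> (\<integral>x. g x * \<phi> x \<partial>M) = 0"
  shows "AE x in M. g x = 0"
proof -
  have small: "L2_norm M g \<le> \<eta>" if \<eta>: "0 < \<eta>" for \<eta>
  proof -
    obtain d where d: "0 < d" "\<And>e. \<lbrakk>0 < e; e \<le> d; e \<le> e0\<rbrakk> \<Longrightarrow> L2_norm M (\<lambda>x. smoothing e g x - g x) \<le> \<eta>"
      using smoothing_approx[OF g \<eta>] by blast
    define e where "e = min d e0"
    have e: "0 < e" "e \<le> d" "e \<le> e0" using d(1) e0 by (auto simp: e_def)
    have "L2_norm M g = L2_norm M (\<lambda>x. g x - smoothing e g x)"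
    proof (rule L2_cong_AE(2))
      show "AE x in M. g x = g x - smoothing e g x"
        using 0[OF kernel_test[OF _ e(1,3)]] by (intro AE_I2) (simp add: smoothing_eq_M)
    qed (use g smoothing_L2[OF g e(1)] L2i.diff_mem L2_measurable in blast)+
    also have "\<dots> = L2_norm M (\<lambda>x. smoothing e g x - g x)"
      by (rule L2i.nrm_minus_commute[OF g smoothing_L2[OF g e(1)]])
    also have "\<dots> \<le> \<eta>" by (rule d(2)[OF e])
    finally show ?thesis .
  qed
  have "L2_norm M g \<le> 0" by (rule field_le_epsilon) (simp add: small)
  then show ?thesis using L2_norm_0_AE[OF g] L2i.nrm_ge0[OF g] by simp
qed

end

section \<open>The Sobolev space\<close>

lemma frechet_outside_support:
  assumes "x \<notin> closure {x. f x \<noteq> 0}" shows "frechet_derivative f (at x) i = 0"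
proof -
  have z: "0 = f y" if "y \<in> - closure {x. f x \<noteq> 0}" for y
    using that closure_subset[of "{x. f x \<noteq> 0}"] by force
  have "((\<lambda>x. 0) has_derivative (\<lambda>h. 0)) (at x)" by simp
  then have "(f has_derivative (\<lambda>h. 0)) (at x)"
    by (rule has_derivative_transform_within_open[OF _ open_Compl[OF closed_closure] _ z]) (use assms in auto)
  then show ?thesis by (metis frechet_derivative_at)
qed

lemma frechet_shift:
  assumes "smooth f"
  shows "frechet_derivative (\<lambda>w. f (w - y)) (at w) = frechet_derivative f (at (w - y))"
proof -
  have "((\<lambda>w. w - y) has_derivative (\<lambda>h. h)) (at w)" by (auto intro!: derivative_eq_intros)
  from diff_chain_at[OF this smooth_has_derivative[OF assms]]
  have "((\<lambda>w. f (w - y)) has_derivative frechet_derivative f (at (w - y))) (at w)" by (simp add: o_def)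
  then show ?thesis by (rule frechet_derivative_at[symmetric])
qed

context star_domain
begin

lemma smooth_L2: "smooth \<phi> \<Longrightarrow> \<phi> \<in> L2 M"
  by (intro continuous_L2 smooth_continuous)

lemma test_smooth: "\<phi> \<in> test_functions S \<Longrightarrow> smooth \<phi>" by (simp add: test_functions_iff)

lemma smooth_partial_L2: "\<lbrakk>smooth \<phi>; i \<in> Basis\<rbrakk> \<Longrightarrow> (\<lambda>x. frechet_derivative \<phi> (at x) i) \<in> L2 M"
  by (intro smooth_L2 smooth_partial)

lemma has_weak_deriv_add:
  assumes i: "i \<in> Basis" and L: "u \<in> L2 M" "v \<in> L2 M" "g \<in> L2 M" "h \<in> L2 M"
    and w: "has_weak_deriv \<Omega> i u g" "has_weak_deriv \<Omega> i v h"
  shows "has_weak_deriv \<Omega> i (\<lambda>x. u x + v x) (\<lambda>x. g x + h x)"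
  unfolding has_weak_deriv_def
proof
  fix \<phi> assume \<phi>: "\<phi> \<in> test_functions \<Omega>"
  note s = test_smooth[OF \<phi>]
  note int = L2_mult_integrable[OF _ smooth_partial_L2[OF s i]] L2_mult_integrable[OF _ smooth_L2[OF s]]
  show "(\<integral>x. (u x + v x) * frechet_derivative \<phi> (at x) i \<partial>M) = - (\<integral>x. (g x + h x) * \<phi> x \<partial>M)"
    using w \<phi> L int by (simp add: has_weak_deriv_def distrib_right)
qed

lemma has_weak_deriv_scale:
  assumes "has_weak_deriv \<Omega> i u g"
  shows "has_weak_deriv \<Omega> i (\<lambda>x. c * u x) (\<lambda>x. c * g x)"
  using assms by (simp add: has_weak_deriv_def mult.assoc)

lemma has_weak_deriv_diff:
  assumes i: "i \<in> Basis" and L: "u \<in> L2 M" "v \<in> L2 M" "g \<in> L2 M" "h \<in> L2 M"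
    and w: "has_weak_deriv \<Omega> i u g" "has_weak_deriv \<Omega> i v h"
  shows "has_weak_deriv \<Omega> i (\<lambda>x. u x - v x) (\<lambda>x. g x - h x)"
  using has_weak_deriv_add[OF i L(1) L2_scale[OF L(2), of "-1"] L(3) L2_scale[OF L(4), of "-1"] w(1)
      has_weak_deriv_scale[OF w(2), of "-1"]] by simp

lemma weak_deriv_unique:
  assumes L: "g \<in> L2 M" "h \<in> L2 M" and w: "has_weak_deriv \<Omega> i u g" "has_weak_deriv \<Omega> i u h"
  shows "AE x in M. g x = h x"
proof -
  have "AE x in M. g x - h x = 0"
  proof (rule fundamental_lemma[OF L2i.diff_mem[OF L]])
    fix \<phi> assume \<phi>: "\<phi> \<in> test_functions \<Omega>"
    note int = L2_mult_integrable[OF _ smooth_L2[OF test_smooth[OF \<phi>]]]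
    have "(\<integral>x. g x * \<phi> x \<partial>M) = (\<integral>x. h x * \<phi> x \<partial>M)"
      using w \<phi> unfolding has_weak_deriv_def by (metis neg_equal_iff_equal)
    then show "(\<integral>x. (g x - h x) * \<phi> x \<partial>M) = 0" using int L by (simp add: left_diff_distrib)
  qed
  then show ?thesis by simp
qed

text \<open>Makes the arbitrary choice in \<open>weak_deriv\<close> harmless as soon as one
  square-integrable weak derivative is known.\<close>

lemma weak_deriv_AE:
  assumes "g \<in> L2 M" "has_weak_deriv \<Omega> i u g"
  shows "weak_deriv \<Omega> i u \<in> L2 M" "has_weak_deriv \<Omega> i u (weak_deriv \<Omega> i u)"
    "AE x in M. weak_deriv \<Omega> i u x = g x"
proof -
  have "weak_deriv \<Omega> i u \<in> L2 M \<and> has_weak_deriv \<Omega> i u (weak_deriv \<Omega> i u)"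
    unfolding weak_deriv_def by (rule someI[of _ g]) (use assms in blast)
  then show 1: "weak_deriv \<Omega> i u \<in> L2 M" "has_weak_deriv \<Omega> i u (weak_deriv \<Omega> i u)" by auto
  show "AE x in M. weak_deriv \<Omega> i u x = g x" by (rule weak_deriv_unique[OF 1(1) assms(1) 1(2) assms(2)])
qed

lemma H1_D:
  assumes "u \<in> H1 \<Omega>"
  shows "u \<in> L2 M" "i \<in> Basis \<Longrightarrow> weak_deriv \<Omega> i u \<in> L2 M"
    "i \<in> Basis \<Longrightarrow> has_weak_deriv \<Omega> i u (weak_deriv \<Omega> i u)"
  using assms weak_deriv_AE(1,2) unfolding H1_def by blast+

lemma H1_I:
  assumes "u \<in> L2 M" "\<And>i. i \<in> Basis \<Longrightarrow> g i \<in> L2 M" "\<And>i. i \<in> Basis \<Longrightarrow> has_weak_deriv \<Omega> i u (g i)"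
  shows "u \<in> H1 \<Omega>"
  using assms unfolding H1_def by blast

lemma H1_add: "\<lbrakk>u \<in> H1 \<Omega>; v \<in> H1 \<Omega>\<rbrakk> \<Longrightarrow> (\<lambda>x. u x + v x) \<in> H1 \<Omega>"
  by (rule H1_I[where g = "\<lambda>i x. weak_deriv \<Omega> i u x + weak_deriv \<Omega> i v x"])
    (auto intro: L2_add H1_D has_weak_deriv_add)

lemma H1_scale: "u \<in> H1 \<Omega> \<Longrightarrow> (\<lambda>x. c * u x) \<in> H1 \<Omega>"
  by (rule H1_I[where g = "\<lambda>i x. c * weak_deriv \<Omega> i u x"])
    (auto intro: L2_scale H1_D has_weak_deriv_scale)

lemma weak_deriv_add:
  assumes "u \<in> H1 \<Omega>" "v \<in> H1 \<Omega>" "i \<in> Basis"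
  shows "AE x in M. weak_deriv \<Omega> i (\<lambda>x. u x + v x) x = weak_deriv \<Omega> i u x + weak_deriv \<Omega> i v x"
  using assms by (intro weak_deriv_AE(3)) (auto intro: L2_add H1_D has_weak_deriv_add)

lemma weak_deriv_scale:
  assumes "u \<in> H1 \<Omega>" "i \<in> Basis"
  shows "AE x in M. weak_deriv \<Omega> i (\<lambda>x. c * u x) x = c * weak_deriv \<Omega> i u x"
  using assms by (intro weak_deriv_AE(3)) (auto intro: L2_scale H1_D has_weak_deriv_scale)

definition grad_inner :: "('a \<Rightarrow> complex) \<Rightarrow> ('a \<Rightarrow> complex) \<Rightarrow> complex" where
  "grad_inner u v = (\<Sum>i\<in>Basis. L2_inner M (weak_deriv \<Omega> i u) (weak_deriv \<Omega> i v))"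

definition h1_inner :: "('a \<Rightarrow> complex) \<Rightarrow> ('a \<Rightarrow> complex) \<Rightarrow> complex" where
  "h1_inner u v = L2_inner M u v + grad_inner u v"

lemma zero_H1: "(\<lambda>_. 0) \<in> H1 \<Omega>"
  by (rule H1_I[where g = "\<lambda>_ _. 0"]) (auto simp: has_weak_deriv_def intro: const_L2)

lemma H1_diff: "\<lbrakk>u \<in> H1 \<Omega>; v \<in> H1 \<Omega>\<rbrakk> \<Longrightarrow> (\<lambda>x. u x - v x) \<in> H1 \<Omega>"
  using H1_add[of u "\<lambda>x. (-1) * v x"] H1_scale[of v "-1"] by simp

lemma grad_inner_add:
  assumes "u \<in> H1 \<Omega>" "v \<in> H1 \<Omega>" "w \<in> H1 \<Omega>"
  shows "grad_inner (\<lambda>x. u x + v x) w = grad_inner u w + grad_inner v w"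
  unfolding grad_inner_def sum.distrib[symmetric]
proof (rule sum.cong[OF refl])
  fix i :: 'a assume i: "i \<in> Basis"
  note [intro] = L2_measurable H1_D(2)[OF _ i]
  have "L2_inner M (weak_deriv \<Omega> i (\<lambda>x. u x + v x)) (weak_deriv \<Omega> i w)
      = L2_inner M (\<lambda>x. weak_deriv \<Omega> i u x + weak_deriv \<Omega> i v x) (weak_deriv \<Omega> i w)"
    using weak_deriv_add[OF assms(1,2) i] assms H1_add[OF assms(1,2)]
    by (intro L2_inner_cong_AE) (auto intro!: L2_measurable[OF L2_add])
  also have "\<dots> = L2_inner M (weak_deriv \<Omega> i u) (weak_deriv \<Omega> i w) + L2_inner M (weak_deriv \<Omega> i v) (weak_deriv \<Omega> i w)"
    using assms by (intro L2i.q_add) auto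
  finally show "L2_inner M (weak_deriv \<Omega> i (\<lambda>x. u x + v x)) (weak_deriv \<Omega> i w) = \<dots>" .
qed

lemma grad_inner_scale:
  assumes "u \<in> H1 \<Omega>" "w \<in> H1 \<Omega>"
  shows "grad_inner (\<lambda>x. c * u x) w = c * grad_inner u w"
  unfolding grad_inner_def sum_distrib_left
proof (rule sum.cong[OF refl])
  fix i :: 'a assume i: "i \<in> Basis"
  note [intro] = L2_measurable H1_D(2)[OF _ i]
  have "L2_inner M (weak_deriv \<Omega> i (\<lambda>x. c * u x)) (weak_deriv \<Omega> i w)
      = L2_inner M (\<lambda>x. c * weak_deriv \<Omega> i u x) (weak_deriv \<Omega> i w)"
    using weak_deriv_scale[OF assms(1) i] assms H1_scale[OF assms(1)]
    by (intro L2_inner_cong_AE) (auto intro!: L2_measurable[OF L2_scale])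
  also have "\<dots> = c * L2_inner M (weak_deriv \<Omega> i u) (weak_deriv \<Omega> i w)"
    using assms by (intro L2i.q_scale) auto
  finally show "L2_inner M (weak_deriv \<Omega> i (\<lambda>x. c * u x)) (weak_deriv \<Omega> i w) = \<dots>" .
qed

lemma grad_inner_herm:
  assumes "u \<in> H1 \<Omega>" "v \<in> H1 \<Omega>" shows "grad_inner v u = cnj (grad_inner u v)"
  unfolding grad_inner_def cnj_sum using assms by (intro sum.cong refl L2i.q_herm H1_D)

definition grad_sq :: "('a \<Rightarrow> complex) \<Rightarrow> real" where
  "grad_sq u = (\<Sum>i\<in>Basis. (L2_norm M (weak_deriv \<Omega> i u))\<^sup>2)"

lemma grad_inner_self: "u \<in> H1 \<Omega> \<Longrightarrow> grad_inner u u = of_real (grad_sq u)"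
  unfolding grad_inner_def grad_sq_def of_real_sum by (intro sum.cong refl L2i.q_self H1_D)

lemma grad_sq_nonneg: "0 \<le> grad_sq u"
  unfolding grad_sq_def by (intro sum_nonneg) simp

lemma H1_norm_sq: "(H1_norm \<Omega> u)\<^sup>2 = (L2_norm M u)\<^sup>2 + grad_sq u"
  unfolding H1_norm_def grad_sq_def[symmetric] using grad_sq_nonneg by simp

sublocale H: semi_inner "H1 \<Omega>" h1_inner
proof
  fix u assume u: "u \<in> H1 \<Omega>"
  then show "0 \<le> Re (h1_inner u u)"
    by (simp add: h1_inner_def grad_inner_self L2i.q_self H1_D(1) grad_sq_nonneg flip: of_real_power)
next
  fix u v assume "u \<in> H1 \<Omega>" "v \<in> H1 \<Omega>"
  then show "h1_inner v u = cnj (h1_inner u v)"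
    using grad_inner_herm[of u v] L2i.q_herm[of u M v] by (simp add: h1_inner_def H1_D(1))
qed (auto simp: h1_inner_def grad_inner_add grad_inner_scale L2i.q_add L2i.q_scale H1_D(1) algebra_simps
    intro: zero_H1 H1_add H1_scale)

lemma H_nrm: "u \<in> H1 \<Omega> \<Longrightarrow> H.nrm u = H1_norm \<Omega> u"
proof -
  assume u: "u \<in> H1 \<Omega>"
  have "(H1_norm \<Omega> u)\<^sup>2 = Re (h1_inner u u)"
    using u by (simp add: H1_norm_sq h1_inner_def grad_inner_self L2i.q_self H1_D(1) flip: of_real_power)
  moreover have "0 \<le> H1_norm \<Omega> u" unfolding H1_norm_def by (simp add: sum_nonneg)
  ultimately show ?thesis by (metis H.nrm_def real_sqrt_unique)
qed

lemma H1_norm_nonneg: "0 \<le> H1_norm \<Omega> u" unfolding H1_norm_def by (simp add: sum_nonneg)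

lemma L2_le_H1: "u \<in> H1 \<Omega> \<Longrightarrow> L2_norm M u \<le> H1_norm \<Omega> u"
  using H1_norm_sq[of u] grad_sq_nonneg[of u] H1_norm_nonneg[of u] by (intro power2_le_imp_le[of "L2_norm M u"]) auto

lemma deriv_le_H1:
  assumes u: "u \<in> H1 \<Omega>" and i: "i \<in> Basis" shows "L2_norm M (weak_deriv \<Omega> i u) \<le> H1_norm \<Omega> u"
proof (rule power2_le_imp_le)
  have "(L2_norm M (weak_deriv \<Omega> i u))\<^sup>2 \<le> grad_sq u"
    unfolding grad_sq_def using i by (intro member_le_sum) auto
  then show "(L2_norm M (weak_deriv \<Omega> i u))\<^sup>2 \<le> (H1_norm \<Omega> u)\<^sup>2"
    using H1_norm_sq[of u] zero_le_power2[of "L2_norm M u"] by linarith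
qed (rule H1_norm_nonneg)

lemma L2_norm_weak_deriv_diff:
  assumes "u \<in> H1 \<Omega>" "g \<in> L2 M" "has_weak_deriv \<Omega> i v g" "v \<in> H1 \<Omega>" "i \<in> Basis"
  shows "L2_norm M (weak_deriv \<Omega> i (\<lambda>x. u x - v x)) = L2_norm M (\<lambda>x. weak_deriv \<Omega> i u x - g x)"
proof (rule L2_cong_AE(2))
  note d = H1_D(2)[OF H1_diff[OF assms(1,4)] assms(5)] L2i.diff_mem[OF H1_D(2)[OF assms(1,5)] assms(2)]
  show "weak_deriv \<Omega> i (\<lambda>x. u x - v x) \<in> borel_measurable M" "(\<lambda>x. weak_deriv \<Omega> i u x - g x) \<in> borel_measurable M"
    using d by (auto intro: L2_measurable)
  show "AE x in M. weak_deriv \<Omega> i (\<lambda>x. u x - v x) x = weak_deriv \<Omega> i u x - g x"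
    using assms by (intro weak_deriv_AE(3) has_weak_deriv_diff L2i.diff_mem) (auto intro: H1_D)
qed

lemma L2_pairing_tendsto:
  assumes "\<And>n. un n \<in> L2 M" "u \<in> L2 M" "\<psi> \<in> L2 M" "(\<lambda>n. L2_norm M (\<lambda>x. un n x - u x)) \<longlonglongrightarrow> 0"
  shows "(\<lambda>n. \<integral>x. un n x * \<psi> x \<partial>M) \<longlonglongrightarrow> (\<integral>x. u x * \<psi> x \<partial>M)"
  using L2i.tendsto_q_left[OF assms(1,2) L2_cnj[OF assms(3)] assms(4)] by (simp add: L2_inner_def)

lemma tendsto_sq_0: "(f \<longlongrightarrow> 0) F \<Longrightarrow> ((\<lambda>n. (f n :: real)\<^sup>2) \<longlongrightarrow> 0) F"
  using tendsto_power[of f 0 F 2] by simp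

text \<open>Functions and weak derivatives converge separately in \<open>L2\<close>; the defining
  identity pairs them with fixed test functions and so survives the limit, which identifies the
  limits of the derivatives.\<close>

theorem H1_complete: "H.complete_form"
  unfolding H.complete_form_def
proof (intro allI impI)
  fix un assume un: "\<forall>n. un n \<in> H1 \<Omega>" and C: "H.Cauchy_seq un"
  have un': "un n \<in> H1 \<Omega>" for n using un by blast
  have d: "(\<lambda>x. un m x - un n x) \<in> H1 \<Omega>" for m n using un' H1_diff by blast
  have C1: "L2i.Cauchy_seq M un" unfolding L2i.Cauchy_seq_def
  proof (intro allI impI)
    fix e :: real assume "e > 0"
    then obtain N where N: "\<forall>m\<ge>N. \<forall>n\<ge>N. H.nrm (\<lambda>x. un m x - un n x) < e" using C unfolding H.Cauchy_seq_def by blast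
    have "L2_norm M (\<lambda>x. un m x - un n x) < e" if "N \<le> m" "N \<le> n" for m n
      using L2_le_H1[OF d, of m n] H_nrm[OF d, of m n] N that by fastforce
    then show "\<exists>N. \<forall>m\<ge>N. \<forall>n\<ge>N. L2_norm M (\<lambda>x. un m x - un n x) < e" by blast
  qed
  have C2: "L2i.Cauchy_seq M (\<lambda>n. weak_deriv \<Omega> i (un n))" if i: "i \<in> Basis" for i unfolding L2i.Cauchy_seq_def
  proof (intro allI impI)
    fix e :: real assume "e > 0"
    then obtain N where N: "\<forall>m\<ge>N. \<forall>n\<ge>N. H.nrm (\<lambda>x. un m x - un n x) < e" using C unfolding H.Cauchy_seq_def by blast
    have le: "L2_norm M (\<lambda>x. weak_deriv \<Omega> i (un m) x - weak_deriv \<Omega> i (un n) x) \<le> H.nrm (\<lambda>x. un m x - un n x)" for m n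
      using deriv_le_H1[OF d i, of m n] H_nrm[OF d]
        L2_norm_weak_deriv_diff[OF un' H1_D(2)[OF un' i] H1_D(3)[OF un' i] un' i] by simp
    have "L2_norm M (\<lambda>x. weak_deriv \<Omega> i (un m) x - weak_deriv \<Omega> i (un n) x) < e" if "N \<le> m" "N \<le> n" for m n
      using le[of m n] N that by fastforce
    then show "\<exists>N. \<forall>m\<ge>N. \<forall>n\<ge>N. L2_norm M (\<lambda>x. weak_deriv \<Omega> i (un m) x - weak_deriv \<Omega> i (un n) x) < e" by blast
  qed
  obtain u where u: "u \<in> L2 M" "(\<lambda>n. L2_norm M (\<lambda>x. un n x - u x)) \<longlonglongrightarrow> 0"
    using L2_complete C1 H1_D(1)[OF un'] unfolding L2i.complete_form_def by blast
  have "\<forall>i\<in>Basis. \<exists>g. g \<in> L2 M \<and> (\<lambda>n. L2_norm M (\<lambda>x. weak_deriv \<Omega> i (un n) x - g x)) \<longlonglongrightarrow> 0"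
  proof
    fix i :: 'a assume i: "i \<in> Basis"
    have "\<forall>n. weak_deriv \<Omega> i (un n) \<in> L2 M" using H1_D(2)[OF un' i] by blast
    from L2_complete[unfolded L2i.complete_form_def, THEN spec, THEN mp, THEN mp, OF this C2[OF i]]
    show "\<exists>g. g \<in> L2 M \<and> (\<lambda>n. L2_norm M (\<lambda>x. weak_deriv \<Omega> i (un n) x - g x)) \<longlonglongrightarrow> 0" by blast
  qed
  from bchoice[OF this] obtain g where g0: "\<forall>i\<in>Basis. g i \<in> L2 M \<and> (\<lambda>n. L2_norm M (\<lambda>x. weak_deriv \<Omega> i (un n) x - g i x)) \<longlonglongrightarrow> 0"
    by blast
  have g: "g i \<in> L2 M" "(\<lambda>n. L2_norm M (\<lambda>x. weak_deriv \<Omega> i (un n) x - g i x)) \<longlonglongrightarrow> 0" if "i \<in> Basis" for i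
    using g0 that by auto
  have wd: "has_weak_deriv \<Omega> i u (g i)" if i: "i \<in> Basis" for i unfolding has_weak_deriv_def
  proof
    fix \<phi> assume \<phi>: "\<phi> \<in> test_functions \<Omega>"
    note s = test_smooth[OF \<phi>]
    have 1: "(\<lambda>n. \<integral>x. un n x * frechet_derivative \<phi> (at x) i \<partial>M) \<longlonglongrightarrow> (\<integral>x. u x * frechet_derivative \<phi> (at x) i \<partial>M)"
      by (rule L2_pairing_tendsto[OF H1_D(1)[OF un'] u(1) smooth_partial_L2[OF s i] u(2)])
    have 2: "(\<lambda>n. - (\<integral>x. weak_deriv \<Omega> i (un n) x * \<phi> x \<partial>M)) \<longlonglongrightarrow> - (\<integral>x. g i x * \<phi> x \<partial>M)"
      by (rule tendsto_minus[OF L2_pairing_tendsto[OF H1_D(2)[OF un' i] g(1)[OF i] smooth_L2[OF s] g(2)[OF i]]])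
    have "(\<integral>x. un n x * frechet_derivative \<phi> (at x) i \<partial>M) = - (\<integral>x. weak_deriv \<Omega> i (un n) x * \<phi> x \<partial>M)" for n
      using H1_D(3)[OF un' i] \<phi> unfolding has_weak_deriv_def by blast
    then show "(\<integral>x. u x * frechet_derivative \<phi> (at x) i \<partial>M) = - (\<integral>x. g i x * \<phi> x \<partial>M)"
      using LIMSEQ_unique[OF 1] 2 by simp
  qed
  have uH: "u \<in> H1 \<Omega>" by (rule H1_I[OF u(1) g(1) wd])
  have "(\<lambda>n. (H1_norm \<Omega> (\<lambda>x. un n x - u x))\<^sup>2) \<longlonglongrightarrow> 0"
  proof -
    have eq: "(H1_norm \<Omega> (\<lambda>x. un n x - u x))\<^sup>2 = (L2_norm M (\<lambda>x. un n x - u x))\<^sup>2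
        + (\<Sum>i\<in>Basis. (L2_norm M (\<lambda>x. weak_deriv \<Omega> i (un n) x - g i x))\<^sup>2)" for n
      unfolding H1_norm_sq grad_sq_def using L2_norm_weak_deriv_diff[OF un' g(1) wd uH] by simp
    have "(\<lambda>n. (L2_norm M (\<lambda>x. un n x - u x))\<^sup>2
        + (\<Sum>i\<in>Basis. (L2_norm M (\<lambda>x. weak_deriv \<Omega> i (un n) x - g i x))\<^sup>2)) \<longlonglongrightarrow> 0 + (\<Sum>i\<in>(Basis::'a set). 0)"
      by (intro tendsto_add tendsto_sum tendsto_sq_0 u(2) g(2))
    then show ?thesis unfolding eq by simp
  qed
  then have "(\<lambda>n. sqrt ((H1_norm \<Omega> (\<lambda>x. un n x - u x))\<^sup>2)) \<longlonglongrightarrow> sqrt 0" by (rule tendsto_real_sqrt)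
  then have "(\<lambda>n. H.nrm (\<lambda>x. un n x - u x)) \<longlonglongrightarrow> 0"
    using H_nrm[OF H1_diff[OF un' uH]] H1_norm_nonneg by simp
  then show "\<exists>u\<in>H1 \<Omega>. (\<lambda>n. H.nrm (\<lambda>x. un n x - u x)) \<longlonglongrightarrow> 0" using uH by blast
qed

text \<open>Integration by parts without boundary terms: the product of \<phi> with a test function
  \<psi> is smooth with bounded support, so its partial derivative integrates to 0 over the whole
  space, and nothing is contributed outside \<Omega>.\<close>

lemma smooth_weak_deriv:
  assumes \<phi>: "smooth \<phi>" and i: "i \<in> Basis"
  shows "has_weak_deriv \<Omega> i \<phi> (\<lambda>x. frechet_derivative \<phi> (at x) i)"
  unfolding has_weak_deriv_def
proof
  fix \<psi> assume \<psi>: "\<psi> \<in> test_functions \<Omega>"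
  then have \<psi>': "smooth \<psi>" "bdd_supp \<psi>" "closure {x. \<psi> x \<noteq> 0} \<subseteq> \<Omega>" by (auto simp: test_functions_iff)
  have p: "smooth (\<lambda>x. \<phi> x * \<psi> x)" by (rule smooth_mult[OF \<phi> \<psi>'(1)])
  have pb: "bdd_supp (\<lambda>x. \<phi> x * \<psi> x)" using \<psi>'(2) by (auto simp: bdd_supp_def)
  have der: "frechet_derivative (\<lambda>x. \<phi> x * \<psi> x) (at x) i
      = \<phi> x * frechet_derivative \<psi> (at x) i + frechet_derivative \<phi> (at x) i * \<psi> x" for x
    by (subst frechet_derivative_at[OF has_derivative_mult[OF smooth_has_derivative[OF \<phi>] smooth_has_derivative[OF \<psi>'(1)]], symmetric]) simp
  have out: "\<psi> x = 0" "frechet_derivative \<psi> (at x) i = 0" if "x \<notin> \<Omega>" for x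
    using that \<psi>'(3) closure_subset[of "{x. \<psi> x \<noteq> 0}"] frechet_outside_support[of x \<psi> i] by blast+
  have int: "integrable M (\<lambda>x. \<phi> x * frechet_derivative \<psi> (at x) i)" "integrable M (\<lambda>x. frechet_derivative \<phi> (at x) i * \<psi> x)"
    using smooth_L2[OF \<phi>] smooth_partial_L2[OF \<psi>'(1) i] smooth_partial_L2[OF \<phi> i] smooth_L2[OF \<psi>'(1)]
    by (auto intro: L2_mult_integrable)
  have "(\<integral>x. \<phi> x * frechet_derivative \<psi> (at x) i \<partial>M) + (\<integral>x. frechet_derivative \<phi> (at x) i * \<psi> x \<partial>M)
      = (\<integral>x. \<phi> x * frechet_derivative \<psi> (at x) i + frechet_derivative \<phi> (at x) i * \<psi> x \<partial>M)"
    using int by simp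
  also have "\<dots> = (\<integral>x. frechet_derivative (\<lambda>x. \<phi> x * \<psi> x) (at x) i \<partial>lborel)"
    unfolding integral_M der using out by (intro Bochner_Integration.integral_cong) (auto simp: indicator_def)
  also have "\<dots> = 0" by (rule integral_partial_zero[OF p pb i])
  finally show "(\<integral>x. \<phi> x * frechet_derivative \<psi> (at x) i \<partial>M) = - (\<integral>x. frechet_derivative \<phi> (at x) i * \<psi> x \<partial>M)"
    by (simp add: eq_neg_iff_add_eq_0)
qed

lemma smooth_H1: "smooth \<phi> \<Longrightarrow> \<phi> \<in> H1 \<Omega>"
  by (rule H1_I[OF smooth_L2 smooth_partial_L2 smooth_weak_deriv])

lemma smooth_grad_sq:
  assumes "smooth \<phi>"
  shows "grad_sq \<phi> = (\<Sum>i\<in>Basis. (L2_norm M (\<lambda>x. frechet_derivative \<phi> (at x) i))\<^sup>2)"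
  unfolding grad_sq_def
proof (rule sum.cong[OF refl])
  fix i :: 'a assume i: "i \<in> Basis"
  note wd = weak_deriv_AE[OF smooth_partial_L2[OF assms i] smooth_weak_deriv[OF assms i]]
  have "L2_norm M (weak_deriv \<Omega> i \<phi>) = L2_norm M (\<lambda>x. frechet_derivative \<phi> (at x) i)"
    by (rule L2_cong_AE(2)[OF L2_measurable[OF wd(1)] L2_measurable[OF smooth_partial_L2[OF assms i]] wd(3)])
  then show "(L2_norm M (weak_deriv \<Omega> i \<phi>))\<^sup>2 = (L2_norm M (\<lambda>x. frechet_derivative \<phi> (at x) i))\<^sup>2" by simp
qed

text \<open>The derivative falls on the kernel, a test function of \<Omega>, and the definition of
  the weak derivative moves it to u. The two signs cancel and the dilation leaves the factor 1 - K
  e.\<close>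

lemma smoothing_partial:
  assumes u: "u \<in> L2 M" "g \<in> L2 M" "has_weak_deriv \<Omega> i u g" and i: "i \<in> Basis"
    and e: "0 < e" "e \<le> e0" and x: "x \<in> \<Omega>"
  shows "frechet_derivative (smoothing e u) (at x) i = of_real (1 - K * e) * smoothing e g x"
proof -
  let ?l = "1 - K * e" and ?k = "\<lambda>z::'a. of_real (mollifier e z) :: complex"
  have "conv (ext u) (\<lambda>z. frechet_derivative ?k (at z) i) ?l x
      = (\<integral>w. u w * frechet_derivative (\<lambda>w. ?k (w - ?l *\<^sub>R x)) (at w) i \<partial>M)"
    unfolding conv_def integral_M frechet_shift[OF kernel(1)[OF e(1)]] by (simp add: ext_def)
  also have "\<dots> = - (\<integral>w. g w * ?k (w - ?l *\<^sub>R x) \<partial>M)"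
    using u(3) kernel_test[OF x e] unfolding has_weak_deriv_def by blast
  finally have c: "conv (ext u) (\<lambda>z. frechet_derivative ?k (at z) i) ?l x = - smoothing e g x"
    by (simp add: smoothing_eq_M)
  show ?thesis
    unfolding smoothing_def[of e u] conv_partial[OF ext_integrable[OF u(1)] kernel[OF e(1)] i] c
    by (simp add: algebra_simps)
qed

text \<open>Approximation up to the boundary by \<open>smoothing e u\<close>. Its gradient is the
  smoothing of the weak gradient times 1 - K e, so besides the convergence of smoothings there is
  only the error K e times a bounded norm.\<close>

theorem test_dense:
  assumes u: "u \<in> H1 \<Omega>" and \<eta>: "0 < \<eta>"
  obtains \<phi> where "\<phi> \<in> test_functions UNIV" "H1_norm \<Omega> (\<lambda>x. \<phi> x - u x) \<le> \<eta>"
proof -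
  define n where "n = real DIM('a)"
  define N where "N = (\<Sum>i\<in>Basis. L2_norm M (weak_deriv \<Omega> i u))"
  have Ni: "L2_norm M (weak_deriv \<Omega> i u) \<le> N" if "i \<in> Basis" for i
    unfolding N_def using that H1_D(2)[OF u] by (intro member_le_sum) (auto intro: L2i.nrm_ge0)
  have N: "0 \<le> N" unfolding N_def using H1_D(2)[OF u] by (intro sum_nonneg) (auto intro: L2i.nrm_ge0)
  define \<delta> where "\<delta> = \<eta> / (2 * (n + 1))"
  have n: "n \<ge> 1" by (simp add: n_def Suc_leI)
  have \<delta>: "0 < \<delta>" "(n + 1) * (2 * \<delta>) \<le> \<eta>" using \<eta> n by (simp_all add: \<delta>_def field_simps)
  obtain d where d: "0 < d" "\<And>e. \<lbrakk>0 < e; e \<le> d; e \<le> e0\<rbrakk> \<Longrightarrow> L2_norm M (\<lambda>x. smoothing e u x - u x) \<le> \<delta>"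
    using smoothing_approx[OF H1_D(1)[OF u] \<delta>(1)] by blast
  have "\<forall>i\<in>Basis. \<exists>d>0. \<forall>e. 0 < e \<and> e \<le> d \<and> e \<le> e0 \<longrightarrow>
      L2_norm M (\<lambda>x. smoothing e (weak_deriv \<Omega> i u) x - weak_deriv \<Omega> i u x) \<le> \<delta>"
  proof
    fix i :: 'a assume i: "i \<in> Basis"
    obtain d where "0 < d" "\<And>e. \<lbrakk>0 < e; e \<le> d; e \<le> e0\<rbrakk> \<Longrightarrow>
        L2_norm M (\<lambda>x. smoothing e (weak_deriv \<Omega> i u) x - weak_deriv \<Omega> i u x) \<le> \<delta>"
      using smoothing_approx[OF H1_D(2)[OF u i] \<delta>(1)] by blast
    then show "\<exists>d>0. \<forall>e. 0 < e \<and> e \<le> d \<and> e \<le> e0 \<longrightarrow>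
      L2_norm M (\<lambda>x. smoothing e (weak_deriv \<Omega> i u) x - weak_deriv \<Omega> i u x) \<le> \<delta>" by blast
  qed
  from bchoice[OF this] obtain di where di: "\<forall>i\<in>Basis. di i > 0 \<and> (\<forall>e. 0 < e \<and> e \<le> di i \<and> e \<le> e0 \<longrightarrow>
      L2_norm M (\<lambda>x. smoothing e (weak_deriv \<Omega> i u) x - weak_deriv \<Omega> i u x) \<le> \<delta>)" by blast
  \<comment> \<open>\<open>C\<close> bounds the dilation error per unit of e; the summand 1 keeps it
    positive.\<close>
  define C where "C = K * (2 ^ DIM('a) * N) + 1"
  have C: "C > 0" "K * (2 ^ DIM('a) * N) \<le> C" using K N by (auto simp: C_def add_nonneg_pos)
  define e where "e = min (min d e0) (min (Min (di ` Basis)) (\<delta> / C))"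
  have Min_pos: "0 < Min (di ` Basis)" using di by (subst Min_gr_iff) auto
  have e: "0 < e" "e \<le> d" "e \<le> e0" "e \<le> \<delta> / C"
    using d e0 Min_pos \<delta> C by (auto simp: e_def)
  have edi: "e \<le> di i" if "i \<in> Basis" for i
  proof -
    have "e \<le> Min (di ` Basis)" unfolding e_def by (rule min.coboundedI2, rule min.coboundedI1, rule order_refl)
    also have "\<dots> \<le> di i" using that by (intro Min_le) auto
    finally show ?thesis .
  qed
  let ?\<phi> = "smoothing e u"
  let ?l = "1 - K * e"
  have t: "?\<phi> \<in> test_functions UNIV" by (rule smoothing_test[OF H1_D(1)[OF u] e(1,3)])
  note s = test_smooth[OF t]
  note \<phi>H = smooth_H1[OF s]
  have deriv: "L2_norm M (weak_deriv \<Omega> i (\<lambda>x. ?\<phi> x - u x)) \<le> 2 * \<delta>" if i: "i \<in> Basis" for i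
  proof -
    let ?g = "weak_deriv \<Omega> i u"
    note gL = H1_D(2)[OF u i] and gw = H1_D(3)[OF u i]
    note sL = smoothing_L2[OF gL e(1)]
    have lL: "(\<lambda>x. of_real ?l * smoothing e ?g x) \<in> L2 M" by (rule L2_scale[OF sL])
    have "L2_norm M (weak_deriv \<Omega> i (\<lambda>x. ?\<phi> x - u x)) = L2_norm M (\<lambda>x. weak_deriv \<Omega> i ?\<phi> x - ?g x)"
      by (rule L2_norm_weak_deriv_diff[OF \<phi>H gL gw u i])
    also have "\<dots> = L2_norm M (\<lambda>x. of_real ?l * smoothing e ?g x - ?g x)"
    proof (rule L2_cong_AE(2))
      have "AE x in M. weak_deriv \<Omega> i ?\<phi> x = frechet_derivative ?\<phi> (at x) i"
        by (rule weak_deriv_AE(3)[OF smooth_partial_L2[OF s i] smooth_weak_deriv[OF s i]])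
      moreover have "AE x in M. frechet_derivative ?\<phi> (at x) i = of_real ?l * smoothing e ?g x"
        by (rule AE_I2) (simp add: smoothing_partial[OF H1_D(1)[OF u] gL gw i e(1,3)])
      ultimately show "AE x in M. weak_deriv \<Omega> i ?\<phi> x - ?g x = of_real ?l * smoothing e ?g x - ?g x"
        by eventually_elim simp
    qed (use L2i.diff_mem[OF H1_D(2)[OF \<phi>H i] gL] L2i.diff_mem[OF lL gL] in \<open>auto intro: L2_measurable\<close>)
    also have "\<dots> \<le> L2_norm M (\<lambda>x. of_real ?l * smoothing e ?g x - smoothing e ?g x) + L2_norm M (\<lambda>x. smoothing e ?g x - ?g x)"
      by (rule L2i.nrm_triangle_diff[OF lL sL gL])
    also have "L2_norm M (\<lambda>x. of_real ?l * smoothing e ?g x - smoothing e ?g x) = K * e * L2_norm M (smoothing e ?g)"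
    proof -
      have "(\<lambda>x. of_real ?l * smoothing e ?g x - smoothing e ?g x) = (\<lambda>x. of_real (- (K * e)) * smoothing e ?g x)"
        by (simp add: fun_eq_iff algebra_simps)
      then show ?thesis using L2i.nrm_scale[OF sL, of "of_real (- (K * e))"] K e by (simp add: norm_mult abs_mult)
    qed
    also have "K * e * L2_norm M (smoothing e ?g) \<le> K * e * (2 ^ DIM('a) * N)"
    proof (rule mult_left_mono)
      have "L2_norm M (smoothing e ?g) \<le> 2 ^ DIM('a) * L2_norm M ?g" by (rule smoothing_norm_le[OF gL e(1,3)])
      also have "\<dots> \<le> 2 ^ DIM('a) * N" using Ni[OF i] by simp
      finally show "L2_norm M (smoothing e ?g) \<le> 2 ^ DIM('a) * N" .
    qed (use K e in simp)
    also have "\<dots> \<le> \<delta>"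
    proof -
      have "K * e * (2 ^ DIM('a) * N) = (K * (2 ^ DIM('a) * N)) * e" by simp
      also have "\<dots> \<le> C * e" using C(2) e(1) by (intro mult_right_mono) auto
      also have "\<dots> \<le> \<delta>" using e(4) C(1) by (simp add: pos_le_divide_eq mult.commute)
      finally show ?thesis .
    qed
    also have "L2_norm M (\<lambda>x. smoothing e ?g x - ?g x) \<le> \<delta>" using di i e edi[OF i] by blast
    finally show ?thesis by simp
  qed
  have "H1_norm \<Omega> (\<lambda>x. ?\<phi> x - u x) \<le> \<eta>"
  proof (rule power2_le_imp_le)
    have "(H1_norm \<Omega> (\<lambda>x. ?\<phi> x - u x))\<^sup>2 \<le> (2 * \<delta>)\<^sup>2 + (\<Sum>i\<in>(Basis::'a set). (2 * \<delta>)\<^sup>2)"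
      unfolding H1_norm_sq grad_sq_def
    proof (rule add_mono)
      show "(L2_norm M (\<lambda>x. ?\<phi> x - u x))\<^sup>2 \<le> (2 * \<delta>)\<^sup>2"
        using d(2)[OF e(1,2,3)] \<delta> L2i.nrm_ge0[OF H1_D(1)[OF H1_diff[OF \<phi>H u]]] by (intro power_mono) auto
      show "(\<Sum>i\<in>Basis. (L2_norm M (weak_deriv \<Omega> i (\<lambda>x. ?\<phi> x - u x)))\<^sup>2) \<le> (\<Sum>i\<in>(Basis::'a set). (2 * \<delta>)\<^sup>2)"
        using deriv L2i.nrm_ge0[OF H1_D(2)[OF H1_diff[OF \<phi>H u]]] by (intro sum_mono power_mono) auto
    qed
    also have "\<dots> = (n + 1) * (2 * \<delta>)\<^sup>2" by (simp add: n_def algebra_simps)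
    also have "\<dots> \<le> ((n + 1) * (2 * \<delta>))\<^sup>2"
    proof -
      have "(n + 1) * 1 \<le> (n + 1) * (n + 1)" using n by (intro mult_left_mono) auto
      then show ?thesis unfolding power_mult_distrib by (intro mult_right_mono) (auto simp: power2_eq_square)
    qed
    also have "\<dots> \<le> \<eta>\<^sup>2" using \<delta> n by (intro power_mono) auto
    finally show "(H1_norm \<Omega> (\<lambda>x. ?\<phi> x - u x))\<^sup>2 \<le> \<eta>\<^sup>2" .
  qed (use \<eta> in simp)
  then show thesis using that t by blast
qed

end

section \<open>Traces and the Robin form\<close>

lemma test_UNIV_iff: "\<phi> \<in> test_functions UNIV \<longleftrightarrow> smooth \<phi> \<and> bdd_supp \<phi>"
  by (simp add: test_functions_iff)

lemma test_UNIV_lin: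
  assumes "\<phi> \<in> test_functions UNIV" "\<psi> \<in> test_functions UNIV"
  shows "(\<lambda>x. \<phi> x + a * \<psi> x) \<in> test_functions UNIV"
proof -
  obtain R1 R2 where "\<And>x. R1 < norm x \<Longrightarrow> \<phi> x = 0" "\<And>x. R2 < norm x \<Longrightarrow> \<psi> x = 0"
    using assms by (auto simp: test_UNIV_iff bdd_supp_def)
  then have "bdd_supp (\<lambda>x. \<phi> x + a * \<psi> x)"
    unfolding bdd_supp_def by (intro exI[of _ "max R1 R2"]) simp
  then show ?thesis
    using assms by (auto simp: test_UNIV_iff intro!: smooth_add smooth_mult[OF smooth_const])
qed

lemma test_UNIV_diff:
  "\<lbrakk>\<phi> \<in> test_functions UNIV; \<psi> \<in> test_functions UNIV\<rbrakk> \<Longrightarrow> (\<lambda>x. \<phi> x - \<psi> x) \<in> test_functions UNIV"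
  using test_UNIV_lin[of \<phi> \<psi> "-1"] by simp

text \<open>By \<open>trace_eps\<close> the boundary term is form bounded with arbitrarily small
  relative bound: for each B the gradient enters with coefficient 1/2 only. This gives bounded
  traces and, for every parameter, a form bounded below. Test functions suffice by density.\<close>

locale robin_domain = star_domain \<Omega> K e0
  for \<Omega> :: "'a::euclidean_space set" and K e0 :: real +
  assumes surface_finite: "emeasure (surface_on \<Omega>) (frontier \<Omega>) < \<infinity>"
    and trace_eps: "\<And>B. 0 < B \<Longrightarrow> \<exists>m\<ge>0. \<forall>\<phi>\<in>test_functions UNIV.
      B * (L2_norm (surface_on \<Omega>) \<phi>)\<^sup>2 \<le> (1 / 2) * grad_sq \<phi> + m * (L2_norm M \<phi>)\<^sup>2"
begin

abbreviation "Sg \<equiv> surface_on \<Omega>"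

lemma space_Sg: "space Sg = frontier \<Omega>"
  by (simp add: surface_on_def space_restrict_space)

lemma finite_Sg: "finite_measure Sg"
  using surface_finite by (intro finite_measureI) (simp add: space_Sg less_top)

lemma continuous_Sg:
  fixes g :: "'a \<Rightarrow> complex"
  assumes "continuous_on UNIV g" shows "g \<in> L2 Sg"
proof -
  have "compact (g ` frontier \<Omega>)"
    using assms bounded_\<Omega> by (intro compact_continuous_image compact_frontier_bounded) (auto intro: continuous_on_subset)
  then obtain B where B: "\<And>x. x \<in> frontier \<Omega> \<Longrightarrow> cmod (g x) \<le> B"
    using compact_imp_bounded bounded_iff by (metis imageI)
  have "g \<in> borel_measurable (hausdorff_measure (DIM('a) - 1))"
    using borel_measurable_continuous_onI[OF assms]
    by (simp add: measurable_cong_sets[OF sets_hausdorff_measure refl])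
  then have gm: "g \<in> borel_measurable Sg"
    unfolding surface_on_def by (rule measurable_restrict_space1)
  show ?thesis
  proof (rule L2_bound[OF gm, of "\<lambda>_. B\<^sup>2"])
    show "integrable Sg (\<lambda>_. B\<^sup>2)" by (rule finite_measure.integrable_const[OF finite_Sg])
    show "AE x in Sg. (cmod (g x))\<^sup>2 \<le> B\<^sup>2"
      using B by (intro AE_I2) (auto simp: space_Sg intro!: power_mono)
  qed
qed

lemma test_Sg: "\<phi> \<in> test_functions UNIV \<Longrightarrow> \<phi> \<in> L2 Sg"
  by (intro continuous_Sg smooth_continuous test_smooth)

lemma test_H1: "\<phi> \<in> test_functions UNIV \<Longrightarrow> \<phi> \<in> H1 \<Omega>"
  by (intro smooth_H1 test_smooth)

lemma trace_const_ex: "\<exists>c\<ge>0. \<forall>\<phi>\<in>test_functions UNIV. L2_norm Sg \<phi> \<le> c * H1_norm \<Omega> \<phi>"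
proof -
  obtain m where m: "m \<ge> 0" "\<And>\<phi>. \<phi> \<in> test_functions UNIV \<Longrightarrow>
      1 * (L2_norm Sg \<phi>)\<^sup>2 \<le> (1 / 2) * grad_sq \<phi> + m * (L2_norm M \<phi>)\<^sup>2"
    using trace_eps[of 1] by auto
  show ?thesis
  proof (intro exI[of _ "sqrt (1 + m)"] conjI ballI)
    fix \<phi> :: "'a \<Rightarrow> complex" assume \<phi>: "\<phi> \<in> test_functions UNIV"
    show "L2_norm Sg \<phi> \<le> sqrt (1 + m) * H1_norm \<Omega> \<phi>"
    proof (rule power2_le_imp_le)
      have "(L2_norm Sg \<phi>)\<^sup>2 \<le> grad_sq \<phi> + m * (L2_norm M \<phi>)\<^sup>2"
        using m(2)[OF \<phi>] grad_sq_nonneg[of \<phi>] by simp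
      also have "\<dots> \<le> (1 + m) * (H1_norm \<Omega> \<phi>)\<^sup>2"
        using m(1) grad_sq_nonneg[of \<phi>] mult_nonneg_nonneg[OF m(1) grad_sq_nonneg[of \<phi>]]
        by (simp add: H1_norm_sq algebra_simps)
      finally show "(L2_norm Sg \<phi>)\<^sup>2 \<le> (sqrt (1 + m) * H1_norm \<Omega> \<phi>)\<^sup>2"
        using m(1) by (simp add: power_mult_distrib)
    qed (use m(1) H1_norm_nonneg in simp)
  qed (use m(1) in simp)
qed

definition tc :: real where
  "tc = (SOME c. 0 \<le> c \<and> (\<forall>\<phi>\<in>test_functions UNIV. L2_norm Sg \<phi> \<le> c * H1_norm \<Omega> \<phi>))"

lemma tc: "0 \<le> tc" "\<phi> \<in> test_functions UNIV \<Longrightarrow> L2_norm Sg \<phi> \<le> tc * H1_norm \<Omega> \<phi>"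
  using someI_ex[OF trace_const_ex] unfolding tc_def by blast+

lemma H1_norm_triangle_diff:
  assumes "u \<in> H1 \<Omega>" "v \<in> H1 \<Omega>" "w \<in> H1 \<Omega>"
  shows "H1_norm \<Omega> (\<lambda>x. u x - w x) \<le> H1_norm \<Omega> (\<lambda>x. u x - v x) + H1_norm \<Omega> (\<lambda>x. v x - w x)"
  using H.nrm_triangle_diff[OF assms] assms by (simp add: H_nrm H1_diff)

lemma H1_norm_minus_commute:
  "\<lbrakk>u \<in> H1 \<Omega>; v \<in> H1 \<Omega>\<rbrakk> \<Longrightarrow> H1_norm \<Omega> (\<lambda>x. u x - v x) = H1_norm \<Omega> (\<lambda>x. v x - u x)"
  using H.nrm_minus_commute[of u v] by (simp add: H_nrm H1_diff)

text \<open>Smooth approximations of u are Cauchy in \<open>H1\<close>, hence on the boundary by the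
  constant \<open>tc\<close>, and completeness of \<open>L2\<close> over the boundary provides the
  trace.\<close>

lemma trace_exists:
  assumes u: "u \<in> H1 \<Omega>" shows "\<exists>g. has_trace \<Omega> u g"
proof -
  have "\<exists>\<phi>. \<phi> \<in> test_functions UNIV \<and> H1_norm \<Omega> (\<lambda>x. \<phi> x - u x) \<le> 1 / real (Suc k)" for k
    using test_dense[OF u, of "1 / real (Suc k)"] by auto
  then obtain \<phi> where \<phi>: "\<And>k. \<phi> k \<in> test_functions UNIV" "\<And>k. H1_norm \<Omega> (\<lambda>x. \<phi> k x - u x) \<le> 1 / real (Suc k)"
    by metis
  have 1: "(\<lambda>k. H1_norm \<Omega> (\<lambda>x. \<phi> k x - u x)) \<longlonglongrightarrow> 0"
  proof (rule tendsto_sandwich[OF _ _ tendsto_const])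
    show "(\<lambda>k. 1 / real (Suc k)) \<longlonglongrightarrow> 0" using LIMSEQ_inverse_real_of_nat by (simp add: inverse_eq_divide)
  qed (use \<phi>(2) H1_norm_nonneg in auto)
  have d: "L2_norm Sg (\<lambda>x. \<phi> m x - \<phi> n x) \<le> tc * (1 / real (Suc m) + 1 / real (Suc n))" for m n
  proof -
    have "L2_norm Sg (\<lambda>x. \<phi> m x - \<phi> n x) \<le> tc * H1_norm \<Omega> (\<lambda>x. \<phi> m x - \<phi> n x)"
      by (rule tc(2)[OF test_UNIV_diff[OF \<phi>(1) \<phi>(1)]])
    also have "\<dots> \<le> tc * (1 / real (Suc m) + 1 / real (Suc n))"
    proof (rule mult_left_mono[OF _ tc(1)])
      have "H1_norm \<Omega> (\<lambda>x. \<phi> m x - \<phi> n x) \<le> H1_norm \<Omega> (\<lambda>x. \<phi> m x - u x) + H1_norm \<Omega> (\<lambda>x. u x - \<phi> n x)"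
        by (rule H1_norm_triangle_diff[OF test_H1[OF \<phi>(1)] u test_H1[OF \<phi>(1)]])
      then show "H1_norm \<Omega> (\<lambda>x. \<phi> m x - \<phi> n x) \<le> 1 / real (Suc m) + 1 / real (Suc n)"
        using \<phi>(2)[of m] \<phi>(2)[of n] H1_norm_minus_commute[OF u test_H1[OF \<phi>(1)], of n] by linarith
    qed
    finally show ?thesis .
  qed
  have "L2i.Cauchy_seq Sg \<phi>" unfolding L2i.Cauchy_seq_def
  proof (intro allI impI)
    fix e :: real assume e: "e > 0"
    obtain N where N: "1 / real (Suc N) < e / (2 * (tc + 1))"
      using e tc(1) nat_approx_posE[of "e / (2 * (tc + 1))"] by (metis add_nonneg_pos divide_pos_pos mult_pos_pos zero_less_numeral zero_less_one)
    show "\<exists>N. \<forall>m\<ge>N. \<forall>n\<ge>N. L2_norm Sg (\<lambda>x. \<phi> m x - \<phi> n x) < e"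
    proof (intro exI[of _ N] allI impI)
      fix m n assume mn: "N \<le> m" "N \<le> n"
      have "1 / real (Suc m) \<le> 1 / real (Suc N)" "1 / real (Suc n) \<le> 1 / real (Suc N)" using mn by (auto intro!: frac_le)
      then have "1 / real (Suc m) + 1 / real (Suc n) \<le> 2 * (e / (2 * (tc + 1)))" using N by linarith
      then have "tc * (1 / real (Suc m) + 1 / real (Suc n)) \<le> tc * (2 * (e / (2 * (tc + 1))))"
        by (rule mult_left_mono[OF _ tc(1)])
      also have "\<dots> < e" using tc(1) e by (simp add: field_simps)
      finally show "L2_norm Sg (\<lambda>x. \<phi> m x - \<phi> n x) < e" using d[of m n] by linarith
    qed
  qed
  then obtain g where "g \<in> L2 Sg" "(\<lambda>k. L2_norm Sg (\<lambda>x. \<phi> k x - g x)) \<longlonglongrightarrow> 0"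
    using L2_complete test_Sg[OF \<phi>(1)] unfolding L2i.complete_form_def by blast
  then show ?thesis unfolding has_trace_def using \<phi>(1) 1 by blast
qed

lemma trace_spec: "u \<in> H1 \<Omega> \<Longrightarrow> has_trace \<Omega> u (trace_on \<Omega> u)"
  unfolding trace_on_def using trace_exists by (rule someI_ex)

lemma has_trace_L2: "has_trace \<Omega> u g \<Longrightarrow> g \<in> L2 Sg" by (simp add: has_trace_def)

lemma trace_L2: "u \<in> H1 \<Omega> \<Longrightarrow> trace_on \<Omega> u \<in> L2 Sg"
  by (rule has_trace_L2[OF trace_spec])

lemma has_trace_norm:
  assumes u: "u \<in> H1 \<Omega>" and t: "has_trace \<Omega> u g" shows "L2_norm Sg g \<le> tc * H1_norm \<Omega> u"
proof -
  obtain \<phi> where \<phi>: "\<And>k. \<phi> k \<in> test_functions UNIV" "(\<lambda>k. H1_norm \<Omega> (\<lambda>x. \<phi> k x - u x)) \<longlonglongrightarrow> 0"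
    "(\<lambda>k. L2_norm Sg (\<lambda>x. \<phi> k x - g x)) \<longlonglongrightarrow> 0" using t unfolding has_trace_def by blast
  have 1: "(\<lambda>k. L2_norm Sg (\<phi> k)) \<longlonglongrightarrow> L2_norm Sg g"
    by (rule L2i.tendsto_nrm[OF test_Sg[OF \<phi>(1)] has_trace_L2[OF t] \<phi>(3)])
  have 2: "(\<lambda>k. H1_norm \<Omega> (\<phi> k)) \<longlonglongrightarrow> H1_norm \<Omega> u"
    using H.tendsto_nrm[OF test_H1[OF \<phi>(1)] u] \<phi>(2) H_nrm[OF H1_diff[OF test_H1[OF \<phi>(1)] u]]
      H_nrm[OF test_H1[OF \<phi>(1)]] H_nrm[OF u] by simp
  show ?thesis
    by (rule LIMSEQ_le[OF 1 tendsto_mult_left[OF 2]]) (use tc(2)[OF \<phi>(1)] in blast)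
qed

lemma has_trace_lin:
  assumes uv: "u \<in> H1 \<Omega>" "v \<in> H1 \<Omega>" and t: "has_trace \<Omega> u g" "has_trace \<Omega> v h"
  shows "has_trace \<Omega> (\<lambda>x. u x + a * v x) (\<lambda>x. g x + a * h x)"
proof -
  obtain \<phi> where \<phi>: "\<And>k. \<phi> k \<in> test_functions UNIV" "(\<lambda>k. H1_norm \<Omega> (\<lambda>x. \<phi> k x - u x)) \<longlonglongrightarrow> 0"
    "(\<lambda>k. L2_norm Sg (\<lambda>x. \<phi> k x - g x)) \<longlonglongrightarrow> 0" using t(1) unfolding has_trace_def by blast
  obtain \<psi> where \<psi>: "\<And>k. \<psi> k \<in> test_functions UNIV" "(\<lambda>k. H1_norm \<Omega> (\<lambda>x. \<psi> k x - v x)) \<longlonglongrightarrow> 0"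
    "(\<lambda>k. L2_norm Sg (\<lambda>x. \<psi> k x - h x)) \<longlonglongrightarrow> 0" using t(2) unfolding has_trace_def by blast
  note g = has_trace_L2[OF t(1)] has_trace_L2[OF t(2)]
  show ?thesis unfolding has_trace_def
  proof (intro conjI exI allI)
    show "(\<lambda>x. g x + a * h x) \<in> L2 Sg" by (rule L2_add[OF g(1) L2_scale[OF g(2)]])
    show "(\<lambda>x. \<phi> k x + a * \<psi> k x) \<in> test_functions UNIV" for k by (rule test_UNIV_lin[OF \<phi>(1) \<psi>(1)])
    show "(\<lambda>k. H1_norm \<Omega> (\<lambda>x. \<phi> k x + a * \<psi> k x - (u x + a * v x))) \<longlonglongrightarrow> 0"
    proof (rule tendsto_sandwich[OF _ _ tendsto_const])
      show "(\<lambda>k. H1_norm \<Omega> (\<lambda>x. \<phi> k x - u x) + cmod a * H1_norm \<Omega> (\<lambda>x. \<psi> k x - v x)) \<longlonglongrightarrow> 0"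
        using tendsto_add[OF \<phi>(2) tendsto_mult_left[OF \<psi>(2), of "cmod a"]] by simp
      show "\<forall>\<^sub>F k in sequentially. H1_norm \<Omega> (\<lambda>x. \<phi> k x + a * \<psi> k x - (u x + a * v x))
          \<le> H1_norm \<Omega> (\<lambda>x. \<phi> k x - u x) + cmod a * H1_norm \<Omega> (\<lambda>x. \<psi> k x - v x)"
      proof (rule always_eventually, rule allI)
        fix k
        have m: "(\<lambda>x. \<phi> k x - u x) \<in> H1 \<Omega>" "(\<lambda>x. \<psi> k x - v x) \<in> H1 \<Omega>"
          using H1_diff[OF test_H1[OF \<phi>(1)] uv(1)] H1_diff[OF test_H1[OF \<psi>(1)] uv(2)] by auto
        have eq: "(\<lambda>x. \<phi> k x + a * \<psi> k x - (u x + a * v x)) = (\<lambda>x. (\<phi> k x - u x) + a * (\<psi> k x - v x))"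
          by (simp add: fun_eq_iff algebra_simps)
        show "H1_norm \<Omega> (\<lambda>x. \<phi> k x + a * \<psi> k x - (u x + a * v x))
          \<le> H1_norm \<Omega> (\<lambda>x. \<phi> k x - u x) + cmod a * H1_norm \<Omega> (\<lambda>x. \<psi> k x - v x)"
          unfolding eq using H.nrm_triangle[OF m(1) H1_scale[OF m(2), of a]] H.nrm_scale[OF m(2), of a]
            H_nrm[OF m(1)] H_nrm[OF m(2)] H_nrm[OF H1_add[OF m(1) H1_scale[OF m(2), of a]]] by simp
      qed
    qed (use H1_norm_nonneg in auto)
    show "(\<lambda>k. L2_norm Sg (\<lambda>x. \<phi> k x + a * \<psi> k x - (g x + a * h x))) \<longlonglongrightarrow> 0"
    proof (rule tendsto_sandwich[OF _ _ tendsto_const])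
      show "(\<lambda>k. L2_norm Sg (\<lambda>x. \<phi> k x - g x) + cmod a * L2_norm Sg (\<lambda>x. \<psi> k x - h x)) \<longlonglongrightarrow> 0"
        using tendsto_add[OF \<phi>(3) tendsto_mult_left[OF \<psi>(3), of "cmod a"]] by simp
      have m: "(\<lambda>x. \<phi> k x - g x) \<in> L2 Sg" "(\<lambda>x. \<psi> k x - h x) \<in> L2 Sg" for k
        using L2i.diff_mem[OF test_Sg[OF \<phi>(1)] g(1)] L2i.diff_mem[OF test_Sg[OF \<psi>(1)] g(2)] by auto
      have eq: "(\<lambda>x. \<phi> k x + a * \<psi> k x - (g x + a * h x)) = (\<lambda>x. (\<phi> k x - g x) + a * (\<psi> k x - h x))" for k
        by (simp add: fun_eq_iff algebra_simps)
      show "\<forall>\<^sub>F k in sequentially. L2_norm Sg (\<lambda>x. \<phi> k x + a * \<psi> k x - (g x + a * h x))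
          \<le> L2_norm Sg (\<lambda>x. \<phi> k x - g x) + cmod a * L2_norm Sg (\<lambda>x. \<psi> k x - h x)"
        unfolding eq using L2i.nrm_triangle[OF m(1) L2_scale[OF m(2), of a]] L2i.nrm_scale[OF m(2), of a] by simp
      show "\<forall>\<^sub>F k in sequentially. 0 \<le> L2_norm Sg (\<lambda>x. \<phi> k x + a * \<psi> k x - (g x + a * h x))"
        unfolding eq using L2i.nrm_ge0[OF L2_add[OF m(1) L2_scale[OF m(2), of a]]] by simp
    qed
  qed
qed

lemma H1_norm_zero: "H1_norm \<Omega> (\<lambda>_. 0) = 0"
  using H.nrm_scale[OF zero_H1, of 0] H_nrm[OF zero_H1] by simp

text \<open>The difference of two traces is a trace of 0, and \<open>has_trace_norm\<close> bounds
  every trace, not only the chosen one.\<close>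

lemma trace_unique:
  assumes u: "u \<in> H1 \<Omega>" and t: "has_trace \<Omega> u g" "has_trace \<Omega> u h"
  shows "AE x in Sg. g x = h x"
proof -
  have m: "(\<lambda>x. g x - h x) \<in> L2 Sg" by (rule L2i.diff_mem[OF has_trace_L2[OF t(1)] has_trace_L2[OF t(2)]])
  have "has_trace \<Omega> (\<lambda>x. 0) (\<lambda>x. g x - h x)"
    using has_trace_lin[OF u u t, of "-1"] by simp
  then have "L2_norm Sg (\<lambda>x. g x - h x) \<le> 0" using has_trace_norm[OF zero_H1] H1_norm_zero by fastforce
  then have "AE x in Sg. g x - h x = 0" using L2_norm_0_AE[OF m] L2i.nrm_ge0[OF m] by simp
  then show ?thesis by simp
qed

lemma trace_lin_AE:
  assumes "u \<in> H1 \<Omega>" "v \<in> H1 \<Omega>"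
  shows "AE x in Sg. trace_on \<Omega> (\<lambda>x. u x + a * v x) x = trace_on \<Omega> u x + a * trace_on \<Omega> v x"
  by (rule trace_unique[OF H1_add[OF assms(1) H1_scale[OF assms(2), of a]]
        trace_spec[OF H1_add[OF assms(1) H1_scale[OF assms(2), of a]]]
        has_trace_lin[OF assms trace_spec[OF assms(1)] trace_spec[OF assms(2)]]])

lemma test_has_trace: "\<phi> \<in> test_functions UNIV \<Longrightarrow> has_trace \<Omega> \<phi> \<phi>"
  unfolding has_trace_def
  using H1_norm_zero test_Sg by (auto intro!: exI[of _ "\<lambda>_. \<phi>"] simp: L2_norm_def)

definition trace_inner where "trace_inner u v = L2_inner Sg (trace_on \<Omega> u) (trace_on \<Omega> v)"

definition trace_sq where "trace_sq u = (L2_norm Sg (trace_on \<Omega> u))\<^sup>2"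

lemma trace_inner_lin:
  assumes "u \<in> H1 \<Omega>" "v \<in> H1 \<Omega>" "w \<in> H1 \<Omega>"
  shows "trace_inner (\<lambda>x. u x + a * v x) w = trace_inner u w + a * trace_inner v w"
proof -
  note t = trace_L2[OF assms(1)] trace_L2[OF assms(2)] trace_L2[OF assms(3)]
  have "trace_inner (\<lambda>x. u x + a * v x) w = L2_inner Sg (\<lambda>x. trace_on \<Omega> u x + a * trace_on \<Omega> v x) (trace_on \<Omega> w)"
    unfolding trace_inner_def
    using trace_lin_AE[OF assms(1,2), of a] trace_L2[OF H1_add[OF assms(1) H1_scale[OF assms(2)]], of a] t
      L2_add[OF t(1) L2_scale[OF t(2)], of a]
    by (intro L2_inner_cong_AE) (auto intro: L2_measurable)
  also have "\<dots> = trace_inner u w + a * trace_inner v w"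
    unfolding trace_inner_def using t by (simp add: L2i.q_add L2i.q_scale L2_scale)
  finally show ?thesis .
qed

lemma trace_inner_herm: "\<lbrakk>u \<in> H1 \<Omega>; v \<in> H1 \<Omega>\<rbrakk> \<Longrightarrow> trace_inner v u = cnj (trace_inner u v)"
  unfolding trace_inner_def by (intro L2i.q_herm trace_L2)

lemma trace_inner_self: "u \<in> H1 \<Omega> \<Longrightarrow> trace_inner u u = of_real (trace_sq u)"
  unfolding trace_inner_def trace_sq_def by (intro L2i.q_self trace_L2)

lemma robin_form_eq: "robin_form \<Omega> \<alpha> u v = grad_inner u v + of_real \<alpha> * trace_inner u v"
  by (simp add: robin_form_def grad_inner_def trace_inner_def)

lemma robin_form_self: "u \<in> H1 \<Omega> \<Longrightarrow> robin_form \<Omega> \<alpha> u u = of_real (grad_sq u + \<alpha> * trace_sq u)"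
  by (simp add: robin_form_eq grad_inner_self trace_inner_self)

lemma test_trace_sq: "\<phi> \<in> test_functions UNIV \<Longrightarrow> trace_sq \<phi> = (L2_norm Sg \<phi>)\<^sup>2"
proof -
  assume \<phi>: "\<phi> \<in> test_functions UNIV"
  have "L2_norm Sg (trace_on \<Omega> \<phi>) = L2_norm Sg \<phi>"
    using trace_unique[OF test_H1[OF \<phi>] trace_spec[OF test_H1[OF \<phi>]] test_has_trace[OF \<phi>]]
      trace_L2[OF test_H1[OF \<phi>]] test_Sg[OF \<phi>]
    by (intro L2_cong_AE(2)) (auto intro: L2_measurable)
  then show ?thesis by (simp add: trace_sq_def)
qed

text \<open>Every term is continuous along the sequence that defines the trace; the gradient term is
  written as the difference of the squared \<open>H1\<close> and \<open>L2\<close> norms. The later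
  estimates are thereby needed for smooth functions only.\<close>

lemma form_inequality:
  assumes ineq: "\<And>\<phi>. \<phi> \<in> test_functions UNIV \<Longrightarrow> B * (L2_norm Sg \<phi>)\<^sup>2 \<le> b * grad_sq \<phi> + c * (L2_norm M \<phi>)\<^sup>2"
    and u: "u \<in> H1 \<Omega>"
  shows "B * trace_sq u \<le> b * grad_sq u + c * (L2_norm M u)\<^sup>2"
proof -
  note t = trace_spec[OF u]
  obtain \<phi> where \<phi>: "\<And>k. \<phi> k \<in> test_functions UNIV" "(\<lambda>k. H1_norm \<Omega> (\<lambda>x. \<phi> k x - u x)) \<longlonglongrightarrow> 0"
    "(\<lambda>k. L2_norm Sg (\<lambda>x. \<phi> k x - trace_on \<Omega> u x)) \<longlonglongrightarrow> 0" using t unfolding has_trace_def by blast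
  note \<phi>H = test_H1[OF \<phi>(1)]
  have S: "(\<lambda>k. (L2_norm Sg (\<phi> k))\<^sup>2) \<longlonglongrightarrow> trace_sq u" unfolding trace_sq_def
    by (intro tendsto_power L2i.tendsto_nrm[OF test_Sg[OF \<phi>(1)] trace_L2[OF u] \<phi>(3)])
  have Hn: "(\<lambda>k. H1_norm \<Omega> (\<phi> k)) \<longlonglongrightarrow> H1_norm \<Omega> u"
    using H.tendsto_nrm[OF \<phi>H u] \<phi>(2) H_nrm[OF H1_diff[OF \<phi>H u]] H_nrm[OF \<phi>H] H_nrm[OF u] by simp
  have "(\<lambda>k. L2_norm M (\<lambda>x. \<phi> k x - u x)) \<longlonglongrightarrow> 0"
    by (rule tendsto_sandwich[OF _ _ tendsto_const \<phi>(2)])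
      (use L2_le_H1[OF H1_diff[OF \<phi>H u]] L2i.nrm_ge0[OF H1_D(1)[OF H1_diff[OF \<phi>H u]]] in auto)
  then have N: "(\<lambda>k. (L2_norm M (\<phi> k))\<^sup>2) \<longlonglongrightarrow> (L2_norm M u)\<^sup>2"
    by (intro tendsto_power L2i.tendsto_nrm[OF H1_D(1)[OF \<phi>H] H1_D(1)[OF u]])
  have G_eq: "grad_sq v = (H1_norm \<Omega> v)\<^sup>2 - (L2_norm M v)\<^sup>2" for v by (simp add: H1_norm_sq)
  have G: "(\<lambda>k. grad_sq (\<phi> k)) \<longlonglongrightarrow> grad_sq u" unfolding G_eq by (intro tendsto_diff tendsto_power Hn N)
  show ?thesis
    by (rule LIMSEQ_le[OF tendsto_mult_left[OF S] tendsto_add[OF tendsto_mult_left[OF G] tendsto_mult_left[OF N]]])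
      (use ineq[OF \<phi>(1)] in blast)
qed

lemma one_norm: "L2_norm M (\<lambda>_. 1) \<noteq> 0"
proof
  assume "L2_norm M (\<lambda>_. 1) = 0"
  then have "AE x in M. (1::complex) = 0" using L2_norm_0_AE[OF const_L2] by simp
  then obtain N where "{x \<in> space M. (1::complex) \<noteq> 0} \<subseteq> N" "emeasure M N = 0" "N \<in> sets M" by (rule AE_E)
  then have "emeasure M (space M) = 0" using emeasure_mono[of "space M" N M] by simp
  then have "emeasure lborel \<Omega> = 0" by (simp add: emeasure_restrict_space)
  then show False using emeasure_open_pos[OF open_\<Omega> ne_\<Omega>] by simp
qed

lemma robin_form_operator:
  assumes B: "0 < B"
  obtains t0 where "form_operator M (H1 \<Omega>) (robin_form \<Omega> (- B)) t0"
proof -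
  obtain m where m: "m \<ge> 0" "\<And>\<phi>. \<phi> \<in> test_functions UNIV \<Longrightarrow>
      B * (L2_norm Sg \<phi>)\<^sup>2 \<le> (1 / 2) * grad_sq \<phi> + m * (L2_norm M \<phi>)\<^sup>2"
    using trace_eps[OF B] by blast
  have tr: "B * trace_sq u \<le> (1 / 2) * grad_sq u + m * (L2_norm M u)\<^sup>2" if "u \<in> H1 \<Omega>" for u
    by (rule form_inequality[OF _ that]) (rule m(2))
  \<comment> \<open>With this shift half of the gradient and the full \<open>L2\<close> norm remain
    after the boundary term is absorbed, which makes the shifted norm equivalent to that of
    \<open>H1\<close>.\<close>
  define t0 where "t0 = - m - 1"
  let ?q = "\<lambda>u v. robin_form \<Omega> (- B) u v - of_real t0 * L2_inner M u v"
  have q_self: "?q u u = of_real (grad_sq u - B * trace_sq u + (m + 1) * (L2_norm M u)\<^sup>2)" if "u \<in> H1 \<Omega>" for u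
    using that by (simp add: robin_form_self L2i.q_self H1_D(1) t0_def algebra_simps)
  have low: "(1/2) * grad_sq u + (L2_norm M u)\<^sup>2 \<le> grad_sq u - B * trace_sq u + (m + 1) * (L2_norm M u)\<^sup>2" if "u \<in> H1 \<Omega>" for u
    using tr[OF that] by (simp add: distrib_right)
  have lin1: "?q (\<lambda>x. u x + v x) w = ?q u w + ?q v w" if "u \<in> H1 \<Omega>" "v \<in> H1 \<Omega>" "w \<in> H1 \<Omega>" for u v w
    using that trace_inner_lin[OF that, of 1]
    by (simp add: robin_form_eq grad_inner_add L2i.q_add H1_D(1) algebra_simps)
  have lin2: "?q (\<lambda>x. c * u x) w = c * ?q u w" if "u \<in> H1 \<Omega>" "w \<in> H1 \<Omega>" for u w c
  proof -
    have "trace_inner (\<lambda>x. c * u x) w = c * trace_inner u w"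
      using trace_inner_lin[OF zero_H1 that, of c] trace_inner_lin[OF zero_H1 zero_H1 that(2), of 1] by simp
    then show ?thesis
      using that by (simp add: robin_form_eq grad_inner_scale L2i.q_scale H1_D(1) algebra_simps)
  qed
  have si: "semi_inner (H1 \<Omega>) ?q"
  proof
    fix u assume u: "u \<in> H1 \<Omega>"
    have "0 \<le> grad_sq u - B * trace_sq u + (m + 1) * (L2_norm M u)\<^sup>2"
      using low[OF u] grad_sq_nonneg[of u] zero_le_power2[of "L2_norm M u"] by linarith
    then show "0 \<le> Re (?q u u)" unfolding q_self[OF u] by simp
  next
    fix u v assume "u \<in> H1 \<Omega>" "v \<in> H1 \<Omega>"
    then show "?q v u = cnj (?q u v)"
      using grad_inner_herm[of u v] trace_inner_herm[of u v] L2i.q_herm[of u M v] by (simp add: robin_form_eq H1_D(1))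
  qed (use lin1 lin2 in \<open>auto intro: zero_H1 H1_add H1_scale\<close>)
  interpret q: semi_inner "H1 \<Omega>" ?q by (rule si)
  have q_sq: "(q.nrm u)\<^sup>2 = grad_sq u - B * trace_sq u + (m + 1) * (L2_norm M u)\<^sup>2" if "u \<in> H1 \<Omega>" for u
    unfolding q.nrm_sq[OF that] q_self[OF that] by simp
  have "form_operator M (H1 \<Omega>) (robin_form \<Omega> (- B)) t0"
  proof
    show "H1 \<Omega> \<subseteq> L2 M" using H1_D(1) by blast
    show "(L2_norm M u)\<^sup>2 \<le> Re (robin_form \<Omega> (- B) u u) - t0 * (L2_norm M u)\<^sup>2" if u: "u \<in> H1 \<Omega>" for u
      using low[OF u] grad_sq_nonneg[of u] by (simp add: robin_form_self[OF u] t0_def algebra_simps)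
    show "\<exists>u\<in>H1 \<Omega>. L2_norm M u \<noteq> 0" using one_norm smooth_H1[OF smooth_const] by blast
    show "q.complete_form"
    proof (rule complete_form_equiv[OF H.semi_inner_axioms si H1_complete])
      fix u assume u: "u \<in> H1 \<Omega>"
      show "H.nrm u \<le> sqrt 2 * q.nrm u"
      proof (rule power2_le_imp_le)
        have "(1/2) * grad_sq u + (L2_norm M u)\<^sup>2 \<le> (q.nrm u)\<^sup>2" using low[OF u] q_sq[OF u] by linarith
        then have "grad_sq u + (L2_norm M u)\<^sup>2 \<le> 2 * (q.nrm u)\<^sup>2"
          using zero_le_power2[of "L2_norm M u"] by linarith
        then show "(H.nrm u)\<^sup>2 \<le> (sqrt 2 * q.nrm u)\<^sup>2"
          by (simp add: H_nrm[OF u] H1_norm_sq power_mult_distrib)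
      qed (use q.nrm_ge0[OF u] in simp)
      show "q.nrm u \<le> sqrt (m + 1) * H.nrm u"
      proof (rule power2_le_imp_le)
        have "0 \<le> B * trace_sq u" using B by (simp add: trace_sq_def)
        then show "(q.nrm u)\<^sup>2 \<le> (sqrt (m + 1) * H.nrm u)\<^sup>2"
          using m(1) mult_nonneg_nonneg[OF m(1) grad_sq_nonneg[of u]]
          by (simp add: H_nrm[OF u] H1_norm_sq power_mult_distrib q_sq[OF u] algebra_simps)
      qed (use H.nrm_ge0[OF u] m(1) in simp)
    qed
  qed
  then show thesis by (rule that)
qed

section \<open>Energy bounds from inequalities for test functions\<close>

lemma robin_energy_eq:
  assumes f: "form_operator M (H1 \<Omega>) (robin_form \<Omega> (- B)) t0"
  shows "robin_energy \<Omega> (- B) = form_operator.E M (H1 \<Omega>) (robin_form \<Omega> (- B))"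
proof -
  interpret f: form_operator M "H1 \<Omega>" "robin_form \<Omega> (- B)" t0 by (rule f)
  have "robin_laplacian \<Omega> (- B) = f.T" by (simp add: robin_laplacian_def f.T_def)
  then show ?thesis using f.Inf_spectrum by (simp add: robin_energy_def)
qed

theorem energy_ge:
  assumes B: "0 < B"
    and ineq: "\<And>\<phi>. \<phi> \<in> test_functions UNIV \<Longrightarrow> B * (L2_norm Sg \<phi>)\<^sup>2 \<le> grad_sq \<phi> + c * (L2_norm M \<phi>)\<^sup>2"
  shows "- c \<le> robin_energy \<Omega> (- B)"
proof -
  obtain t0 where f: "form_operator M (H1 \<Omega>) (robin_form \<Omega> (- B)) t0" by (rule robin_form_operator[OF B])
  interpret f: form_operator M "H1 \<Omega>" "robin_form \<Omega> (- B)" t0 by (rule f)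
  show ?thesis unfolding robin_energy_eq[OF f]
  proof (rule f.E_ge)
    fix u assume u: "u \<in> H1 \<Omega>"
    have "B * trace_sq u \<le> 1 * grad_sq u + c * (L2_norm M u)\<^sup>2"
      using ineq by (intro form_inequality[OF _ u]) auto
    then show "- c * (L2_norm M u)\<^sup>2 \<le> Re (robin_form \<Omega> (- B) u u)" by (simp add: robin_form_self[OF u])
  qed
qed

theorem energy_le:
  assumes B: "0 < B" and \<phi>: "\<phi> \<in> test_functions UNIV" "L2_norm M \<phi> \<noteq> 0"
    and le: "grad_sq \<phi> + c * (L2_norm M \<phi>)\<^sup>2 \<le> B * (L2_norm Sg \<phi>)\<^sup>2"
  shows "robin_energy \<Omega> (- B) \<le> - c"
proof -
  obtain t0 where f: "form_operator M (H1 \<Omega>) (robin_form \<Omega> (- B)) t0" by (rule robin_form_operator[OF B])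
  interpret f: form_operator M "H1 \<Omega>" "robin_form \<Omega> (- B)" t0 by (rule f)
  note u = test_H1[OF \<phi>(1)]
  have "f.E \<le> Re (robin_form \<Omega> (- B) \<phi> \<phi>) / (L2_norm M \<phi>)\<^sup>2" by (rule f.E_le[OF u \<phi>(2)])
  also have "\<dots> \<le> - c"
    using le \<phi>(2) by (simp add: robin_form_self[OF u] test_trace_sq[OF \<phi>(1)] pos_divide_le_eq)
  finally show ?thesis unfolding robin_energy_eq[OF f] .
qed

end

section \<open>The domain\<close>

text \<open>\<open>h\<close> is the infimum of the heights at which a line in direction
  \<open>e\<close> lies in \<open>U\<close>. Invariance under the open cone makes the heights an
  upper half-line and \<open>h\<close> Lipschitz with constant \<open>m\<close>; the points
  \<open>u0\<close> and \<open>w0\<close> keep the set of heights nonempty and bounded below.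
  Explicit boundary functions in rotated coordinates are thus avoided.\<close>

lemma cone_epigraph:
  fixes U :: "'a::euclidean_space set"
  assumes U: "open U" "u0 \<in> U" "w0 \<notin> U" and e: "norm e = 1" and m: "0 \<le> m"
    and cone: "\<And>x v. \<lbrakk>x \<in> U; m * norm (v - (v \<bullet> e) *\<^sub>R e) < v \<bullet> e\<rbrakk> \<Longrightarrow> x + v \<in> U"
  obtains h where "m-lipschitz_on {y. y \<bullet> e = 0} h" "U = {x. h (x - (x \<bullet> e) *\<^sub>R e) < x \<bullet> e}"
proof -
  have ee: "e \<bullet> e = 1" using e by (simp add: norm_eq_1)
  define p where "p v = v - (v \<bullet> e) *\<^sub>R e" for v
  have p_e: "p v \<bullet> e = 0" for v by (simp add: p_def inner_diff_left ee)
  have p_lin: "p (x + t *\<^sub>R e - y) = p x - p y" for x y t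
    by (simp add: p_def inner_simps ee algebra_simps)
  have pt: "p (y + t *\<^sub>R e) = p y" for y t by (simp add: p_def inner_simps ee algebra_simps)
  have cone': "x + t *\<^sub>R e \<in> U" if "y \<in> U" "m * norm (p x - p y) < x \<bullet> e + t - y \<bullet> e" for x y t
  proof -
    have "y + (x + t *\<^sub>R e - y) \<in> U"
    proof (rule cone[OF that(1)])
      have "(x + t *\<^sub>R e - y) - ((x + t *\<^sub>R e - y) \<bullet> e) *\<^sub>R e = p x - p y" using p_lin[of x t y] by (simp add: p_def)
      then show "m * norm ((x + t *\<^sub>R e - y) - ((x + t *\<^sub>R e - y) \<bullet> e) *\<^sub>R e) < (x + t *\<^sub>R e - y) \<bullet> e"
        using that(2) by (simp add: inner_simps ee)
    qed
    then show ?thesis by simp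
  qed
  define T where "T y = {t. y + t *\<^sub>R e \<in> U}" for y
  define h where "h y = Inf (T y)" for y
  have T_ne: "T y \<noteq> {}" for y
  proof -
    have "y + (m * norm (p y - p u0) + u0 \<bullet> e - y \<bullet> e + 1) *\<^sub>R e \<in> U"
      by (rule cone'[OF U(2)]) simp
    then show ?thesis by (auto simp: T_def)
  qed
  have T_lb: "w0 \<bullet> e - y \<bullet> e - m * norm (p w0 - p y) \<le> t" if "t \<in> T y" for y t
  proof (rule ccontr)
    assume "\<not> ?thesis"
    then have lt: "t + m * norm (p w0 - p y) + y \<bullet> e < w0 \<bullet> e" by linarith
    have "w0 + 0 *\<^sub>R e \<in> U"
      by (rule cone'[of "y + t *\<^sub>R e"]) (use lt that in \<open>simp_all add: T_def pt inner_add_left ee\<close>)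
    then show False using U(3) by simp
  qed
  have bdd: "bdd_below (T y)" for y using T_lb by (auto intro!: bdd_belowI)
  have up: "s \<in> T y" if "t \<in> T y" "t < s" for s t y
    using cone'[of "y + t *\<^sub>R e" y s] that by (simp add: T_def pt inner_simps ee)
  \<comment> \<open>Openness of \<open>U\<close> excludes the infimum itself, so the epigraph is
    strict.\<close>
  have T_iff: "t \<in> T y \<longleftrightarrow> h y < t" for t y
  proof
    assume t: "t \<in> T y"
    then have "y + t *\<^sub>R e \<in> U" by (simp add: T_def)
    then obtain d where d: "d > 0" "ball (y + t *\<^sub>R e) d \<subseteq> U" using U(1) openE by blast
    have "y + (t - d / 2) *\<^sub>R e \<in> ball (y + t *\<^sub>R e) d"
      using d(1) e by (simp add: dist_norm scaleR_diff_left)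
    then have "t - d / 2 \<in> T y" using d(2) by (auto simp: T_def)
    then have "h y \<le> t - d / 2" unfolding h_def using bdd by (rule cInf_lower)
    then show "h y < t" using d(1) by linarith
  next
    assume "h y < t"
    then obtain s where "s \<in> T y" "s < t" unfolding h_def using cInf_lessD[OF T_ne] by blast
    then show "t \<in> T y" using up by blast
  qed
  have p0: "p y = y" if "y \<bullet> e = 0" for y using that by (simp add: p_def)
  have le: "h y \<le> h z + m * norm (y - z)" if "y \<bullet> e = 0" "z \<bullet> e = 0" for y z
  proof (rule field_le_epsilon)
    fix d :: real assume d: "d > 0"
    have hz: "h z + d / 2 \<in> T z" using T_iff d by simp
    have "y + (h z + m * norm (y - z) + d) *\<^sub>R e \<in> U"
      by (rule cone'[of "z + (h z + d / 2) *\<^sub>R e"]) (use hz d that in \<open>simp_all add: T_def pt p0 inner_simps ee\<close>)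
    then have "h z + m * norm (y - z) + d \<in> T y" by (simp add: T_def)
    then show "h y \<le> h z + m * norm (y - z) + d" using T_iff by fastforce
  qed
  show thesis
  proof (rule that)
    show "m-lipschitz_on {y. y \<bullet> e = 0} h"
    proof (rule lipschitz_onI[OF _ m])
      fix y z assume "y \<in> {y. y \<bullet> e = 0}" "z \<in> {y. y \<bullet> e = 0}"
      then show "dist (h y) (h z) \<le> m * dist y z"
        using le[of y z] le[of z y] by (auto simp: dist_norm norm_minus_commute abs_le_iff)
    qed
    have "x \<in> U \<longleftrightarrow> h (p x) < x \<bullet> e" for x
      using T_iff[of "x \<bullet> e" "p x"] by (simp add: T_def p_def)
    then show "U = {x. h (x - (x \<bullet> e) *\<^sub>R e) < x \<bullet> e}" by (auto simp: p_def)
  qed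
qed

section \<open>The boundary function with two alternating slopes\<close>

definition bb :: "nat \<Rightarrow> real" where "bb j = (1 / 6) ^ (9 ^ j)"

text \<open>Two successive cubings, from b to a = b^3 and from a to a^3, give the exponents 9^j and
  leave b^2 and a^2 as intermediate scales, far from both neighbouring end points. The base 1/6
  together with slope 3 keeps the total rise of \<open>hh\<close> at most 1/2.\<close>

definition aa :: "nat \<Rightarrow> real" where "aa j = bb j ^ 3"

lemma bb_pos: "0 < bb j" by (simp add: bb_def)

lemma bb_le: "bb j \<le> 1 / 6"
  unfolding bb_def using power_decreasing[of 1 "9 ^ j" "1 / 6 :: real"] by simp

lemma bb_Suc: "bb (Suc j) = aa j ^ 3"
  by (simp add: bb_def aa_def flip: power_mult)

lemma aa_pos: "0 < aa j" by (simp add: aa_def bb_pos)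

lemma cube_less: "\<lbrakk>0 < x; x < 1\<rbrakk> \<Longrightarrow> x ^ 3 < x" for x :: real
  using power_strict_decreasing[of 1 3 x] by simp

lemma aa_less_bb: "aa j < bb j"
  unfolding aa_def using bb_pos[of j] bb_le[of j] by (intro cube_less) auto

lemma bb_Suc_less_aa: "bb (Suc j) < aa j"
  unfolding bb_Suc using aa_pos[of j] aa_less_bb[of j] bb_le[of j] by (intro cube_less) auto

lemma bb_antimono: "i \<le> j \<Longrightarrow> bb j \<le> bb i"
proof (induction rule: dec_induct)
  case (step n) then show ?case using bb_Suc_less_aa[of n] aa_less_bb[of n] by linarith
qed simp

lemma bb_less_aa: "i < j \<Longrightarrow> bb j < aa i"
  using bb_antimono[of "Suc i" j] bb_Suc_less_aa[of i] by linarith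

lemma bb_tendsto_0: "bb \<longlonglongrightarrow> 0"
proof (rule tendsto_sandwich[OF _ _ tendsto_const])
  show "\<forall>\<^sub>F j in sequentially. bb j \<le> (1 / 6) ^ j"
  proof (rule always_eventually, rule allI)
    fix j :: nat
    have "j \<le> 9 ^ j" by (rule less_imp_le[OF power_gt_expt]) simp
    then show "bb j \<le> (1 / 6) ^ j" unfolding bb_def by (rule power_decreasing) auto
  qed
  show "(\<lambda>j. (1 / 6 :: real) ^ j) \<longlonglongrightarrow> 0" by (rule LIMSEQ_power_zero) simp
qed (simp add: bb_pos less_imp_le)

text \<open>The boundary is steep (slope \<open>3\<close>) over \<open>steep_set\<close> and flat elsewhere; since the ratios of
  consecutive end points are unbounded, the corner at \<open>0\<close> looks sharp on the scales between \<open>aa j\<close>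
  and \<open>bb j\<close> and flat on the scales between \<open>bb (Suc j)\<close> and \<open>aa j\<close>.\<close>

definition steep_set :: "real set" where "steep_set = (\<Union>j. {aa j..bb j})"

lemma borel_steep [measurable]: "steep_set \<in> sets borel" by (simp add: steep_set_def)

text \<open>The primitive of the slope function, written with a measure: monotonicity in |x| and the
  Lipschitz bound then follow without derivatives. The lowest boundary point is (0, -1).\<close>

definition hh :: "real \<Rightarrow> real" where "hh x = - 1 + 3 * measure lborel (steep_set \<inter> {0..\<bar>x\<bar>})"

lemma steep_finite: "emeasure lborel (steep_set \<inter> {0..r}) \<noteq> \<infinity>"
proof -
  have "emeasure lborel (steep_set \<inter> {0..r}) \<le> emeasure lborel {0..r}" by (intro emeasure_mono) auto
  also have "\<dots> < \<infinity>" by (cases "0 \<le> r") auto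
  finally show ?thesis by simp
qed

lemma steep_diff:
  assumes "0 \<le> r" "r \<le> s"
  shows "measure lborel (steep_set \<inter> {0..s}) - measure lborel (steep_set \<inter> {0..r}) = measure lborel (steep_set \<inter> {r<..s})"
proof -
  have "measure lborel (steep_set \<inter> {0..s}) = measure lborel ((steep_set \<inter> {0..r}) \<union> (steep_set \<inter> {r<..s}))"
    using assms by (intro arg_cong[where f = "measure lborel"]) auto
  also have "\<dots> = measure lborel (steep_set \<inter> {0..r}) + measure lborel (steep_set \<inter> {r<..s})"
  proof (rule measure_Union)
    have "emeasure lborel (steep_set \<inter> {r<..s}) \<le> emeasure lborel {r<..s}" by (intro emeasure_mono) auto
    also have "\<dots> < \<infinity>" using assms by simp
    finally show "emeasure lborel (steep_set \<inter> {r<..s}) \<noteq> \<infinity>" by simp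
  qed (use steep_finite[of r] in auto)
  finally show ?thesis by simp
qed

lemma hh_diff: "\<bar>x\<bar> \<le> \<bar>y\<bar> \<Longrightarrow> hh y - hh x = 3 * measure lborel (steep_set \<inter> {\<bar>x\<bar><..\<bar>y\<bar>})"
  using steep_diff[of "\<bar>x\<bar>" "\<bar>y\<bar>"] by (simp add: hh_def)

lemma steep_interval_le: "r \<le> s \<Longrightarrow> measure lborel (steep_set \<inter> {r<..s}) \<le> s - r"
proof -
  assume "r \<le> s"
  then show ?thesis
    using measure_mono_fmeasurable[of "steep_set \<inter> {r<..s}" "{r<..s}" lborel] by (simp add: fmeasurable_def)
qed

lemma hh_even: "hh (- x) = hh x" by (simp add: hh_def)

lemma hh_abs: "hh \<bar>x\<bar> = hh x" by (simp add: hh_def)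

lemma hh_mono: "\<bar>x\<bar> \<le> \<bar>y\<bar> \<Longrightarrow> hh x \<le> hh y"
  using hh_diff[of x y] measure_nonneg[of lborel "steep_set \<inter> {\<bar>x\<bar><..\<bar>y\<bar>}"] by linarith

lemma hh_diff_le: "\<bar>x\<bar> \<le> \<bar>y\<bar> \<Longrightarrow> hh y - hh x \<le> 3 * (\<bar>y\<bar> - \<bar>x\<bar>)"
  using hh_diff[of x y] steep_interval_le[of "\<bar>x\<bar>" "\<bar>y\<bar>"] by simp

lemma hh_lipschitz: "\<bar>hh x - hh y\<bar> \<le> 3 * \<bar>x - y\<bar>"
proof -
  have *: "\<bar>hh x - hh y\<bar> \<le> 3 * \<bar>x - y\<bar>" if "\<bar>x\<bar> \<le> \<bar>y\<bar>" for x y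
  proof -
    have "\<bar>y\<bar> - \<bar>x\<bar> \<le> \<bar>x - y\<bar>" by linarith
    then have "3 * (\<bar>y\<bar> - \<bar>x\<bar>) \<le> 3 * \<bar>x - y\<bar>" by simp
    then show ?thesis using hh_diff_le[OF that] hh_mono[OF that] by linarith
  qed
  show ?thesis using *[of x y] *[of y x] by (cases "\<bar>x\<bar> \<le> \<bar>y\<bar>") (simp_all add: abs_minus_commute)
qed

lemma hh_0: "hh 0 = - 1"
proof -
  have "measure lborel (steep_set \<inter> {0..0}) \<le> measure lborel {0::real..0}"
    by (rule measure_mono_fmeasurable) (auto simp: fmeasurable_def)
  then have "measure lborel (steep_set \<inter> {0..0}) = 0"
    using measure_nonneg[of lborel "steep_set \<inter> {0..0}"] by (simp del: atLeastAtMost_singleton Int_insert_right)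
  then show ?thesis by (simp add: hh_def)
qed

lemma hh_ge: "- 1 \<le> hh x" using hh_mono[of 0 x] hh_0 by simp

lemma hh_le_lin: "hh x \<le> - 1 + 3 * \<bar>x\<bar>" using hh_diff_le[of 0 x] hh_0 by simp

lemma steep_subset: "steep_set \<subseteq> {0..1/6}"
proof
  fix x assume "x \<in> steep_set"
  then obtain j where "aa j \<le> x" "x \<le> bb j" by (auto simp: steep_set_def)
  then show "x \<in> {0..1/6}" using aa_pos[of j] bb_le[of j] by simp
qed

text \<open>This keeps vertical chords longer than 1 and gives a dilation towards the origin a
  definite gain in height over the graph.\<close>

lemma hh_le: "hh x \<le> - 1 / 2"
proof -
  have "measure lborel (steep_set \<inter> {0..\<bar>x\<bar>}) \<le> measure lborel {0..1/6::real}"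
    by (rule measure_mono_fmeasurable) (use steep_subset in \<open>auto simp: fmeasurable_def\<close>)
  then show ?thesis by (simp add: hh_def)
qed

lemma hh_continuous: "continuous_on S hh"
proof (rule continuous_on_subset[of UNIV])
  have "3-lipschitz_on UNIV hh"
    by (rule lipschitz_onI) (use hh_lipschitz in \<open>auto simp: dist_real_def\<close>)
  then show "continuous_on UNIV hh" by (rule lipschitz_on_continuous_on)
qed simp

lemma borel_hh [measurable]: "hh \<in> borel_measurable borel"
  by (rule borel_measurable_continuous_onI[OF hh_continuous])

lemma hh_steep:
  assumes "aa j \<le> x" "x \<le> y" "y \<le> bb j" shows "hh y - hh x = 3 * (y - x)"
proof -
  have "z \<in> steep_set" if "x < z" "z \<le> y" for z
    unfolding steep_set_def using assms that by (intro UN_I[of j]) auto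
  then have "steep_set \<inter> {x<..y} = {x<..y}" by auto
  then show ?thesis using hh_diff[of x y] assms aa_pos[of j] by simp
qed

lemma hh_gap: "hh (aa k) = hh (bb (Suc k))"
proof -
  have "x = aa k" if x: "x \<in> steep_set" "bb (Suc k) < x" "x \<le> aa k" for x
  proof -
    obtain j where j: "aa j \<le> x" "x \<le> bb j" using x(1) by (auto simp: steep_set_def)
    have "j \<le> k"
    proof (rule ccontr)
      assume "\<not> j \<le> k"
      then have "bb j \<le> bb (Suc k)" by (intro bb_antimono) simp
      then show False using j x(2) by linarith
    qed
    moreover have "\<not> j < k" using bb_less_aa[of j k] aa_less_bb[of k] j x(3) by linarith
    ultimately show ?thesis using j x by simp
  qed
  then have "steep_set \<inter> {\<bar>bb (Suc k)\<bar><..\<bar>aa k\<bar>} \<subseteq> {aa k}"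
    using bb_pos[of "Suc k"] aa_pos[of k] by auto
  then have "measure lborel (steep_set \<inter> {\<bar>bb (Suc k)\<bar><..\<bar>aa k\<bar>}) \<le> measure lborel {aa k}"
    by (rule measure_mono_fmeasurable) (auto simp: fmeasurable_def)
  then have "measure lborel (steep_set \<inter> {\<bar>bb (Suc k)\<bar><..\<bar>aa k\<bar>}) = 0"
    using measure_nonneg[of lborel "steep_set \<inter> {\<bar>bb (Suc k)\<bar><..\<bar>aa k\<bar>}"] by simp
  moreover have "\<bar>bb (Suc k)\<bar> \<le> \<bar>aa k\<bar>" using bb_Suc_less_aa[of k] bb_pos[of "Suc k"] by simp
  ultimately show ?thesis using hh_diff[of "bb (Suc k)" "aa k"] by simp
qed

section \<open>The planar domain: star shape and Lipschitz boundary\<close>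

definition \<Omega>0 :: "(real^2) set" where
  "\<Omega>0 = {p. \<bar>p $ 1\<bar> < 1 \<and> hh (p $ 1) < p $ 2 \<and> p $ 2 < 1}"

definition mk :: "real \<Rightarrow> real \<Rightarrow> real^2" where "mk x y = vector [x, y]"

lemma mk_nth [simp]: "mk x y $ 1 = x" "mk x y $ 2 = y" by (simp_all add: mk_def)

lemma mk_eta: "mk (p $ 1) (p $ 2) = p" by (simp add: vec_eq_iff forall_2)

lemma norm_vec2: "norm (p :: real^2) = sqrt ((p $ 1)\<^sup>2 + (p $ 2)\<^sup>2)"
  by (simp add: norm_vec_def L2_set_def sum_2)

lemma comp_le_norm: "\<bar>(p :: real^2) $ i\<bar> \<le> norm p" by (rule component_le_norm_cart)

lemma continuous_hh_comp: "continuous_on UNIV (\<lambda>p::real^2. hh (p $ 1))"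
  by (rule continuous_on_compose2[OF hh_continuous[of UNIV]]) (auto intro!: continuous_intros)

lemma open_\<Omega>0: "open \<Omega>0"
proof -
  have "open {p::real^2. \<bar>p $ 1\<bar> < 1}" "open {p::real^2. hh (p $ 1) < p $ 2}" "open {p::real^2. p $ 2 < 1}"
    by (intro open_Collect_less continuous_hh_comp continuous_intros)+
  then have "open ({p::real^2. \<bar>p $ 1\<bar> < 1} \<inter> {p::real^2. hh (p $ 1) < p $ 2} \<inter> {p::real^2. p $ 2 < 1})"
    by (intro open_Int)
  moreover have "\<dots> = \<Omega>0" by (auto simp: \<Omega>0_def)
  ultimately show ?thesis by simp
qed

lemma zero_in_\<Omega>0: "0 \<in> \<Omega>0" by (simp add: \<Omega>0_def hh_0)

lemma bounded_\<Omega>0: "bounded \<Omega>0"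
proof -
  have "norm p \<le> 2" if "p \<in> \<Omega>0" for p
  proof -
    have "\<bar>p $ 1\<bar> < 1" "\<bar>p $ 2\<bar> \<le> 1" using that hh_ge[of "p $ 1"] by (auto simp: \<Omega>0_def)
    moreover have "norm p \<le> \<bar>p $ 1\<bar> + \<bar>p $ 2\<bar>"
      unfolding norm_vec2 using sqrt_sum_squares_le_sum_abs by blast
    ultimately show ?thesis by linarith
  qed
  then show ?thesis by (auto simp: bounded_iff)
qed

text \<open>Since \<open>hh\<close> <= -1/2, the dilation by 1 - 10 e gains at least 5 e in height
  over the graph, while the shift by e z costs at most 3 e through the Lipschitz constant and e in
  height. At the sides and at the top the margin is 10 e against e.\<close>

lemma shrink_\<Omega>0:
  assumes p: "p \<in> \<Omega>0" and e: "0 < e" "e \<le> 1 / 20" and z: "norm z \<le> 1"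
  shows "(1 - 10 * e) *\<^sub>R p + e *\<^sub>R z \<in> \<Omega>0"
proof -
  let ?l = "1 - 10 * e"
  have l: "0 < ?l" "?l \<le> 1" using e by auto
  have z': "\<bar>e * z $ i\<bar> \<le> e" for i
  proof -
    have "\<bar>z $ i\<bar> \<le> 1" using comp_le_norm[of z i] z by linarith
    then show ?thesis using e mult_left_mono[of "\<bar>z $ i\<bar>" 1 e] by (simp add: abs_mult)
  qed
  have P: "\<bar>p $ 1\<bar> < 1" "hh (p $ 1) < p $ 2" "p $ 2 < 1" using p by (auto simp: \<Omega>0_def)
  have 1: "?l * \<bar>p $ 1\<bar> < ?l" "?l * p $ 2 < ?l" using P l by simp_all
  have "\<bar>?l * p $ 1 + e * z $ 1\<bar> \<le> ?l * \<bar>p $ 1\<bar> + e"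
    using z'[of 1] l by (intro order_trans[OF abs_triangle_ineq]) (simp add: abs_mult)
  then have A: "\<bar>?l * p $ 1 + e * z $ 1\<bar> < 1" using 1 e by linarith
  have B: "?l * p $ 2 + e * z $ 2 < 1" using 1(2) z'[of 2] e by linarith
  have "hh (?l * p $ 1 + e * z $ 1) \<le> hh (?l * p $ 1) + 3 * e"
    using hh_lipschitz[of "?l * p $ 1 + e * z $ 1" "?l * p $ 1"] z'[of 1] by simp
  moreover have "hh (?l * p $ 1) \<le> hh (p $ 1)"
    using l mult_right_mono[of ?l 1 "\<bar>p $ 1\<bar>"] by (intro hh_mono) (simp add: abs_mult)
  moreover have "hh (p $ 1) + 4 * e < ?l * p $ 2"
  proof -
    have "?l * hh (p $ 1) < ?l * p $ 2" using P(2) l by simp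
    moreover have "10 * e * hh (p $ 1) \<le> 10 * e * (- 1 / 2)" using hh_le e by (intro mult_left_mono) auto
    ultimately show ?thesis using e by (simp add: left_diff_distrib)
  qed
  ultimately have C: "hh (?l * p $ 1 + e * z $ 1) < ?l * p $ 2 + e * z $ 2" using z'[of 2] by linarith
  show ?thesis using A B C by (simp add: \<Omega>0_def)
qed

lemma starlike_\<Omega>0:
  assumes p: "\<bar>p $ 1\<bar> \<le> 1" "hh (p $ 1) \<le> p $ 2" "p $ 2 \<le> 1" and t: "0 \<le> t" "t < 1"
  shows "t *\<^sub>R p \<in> \<Omega>0"
proof -
  have "\<bar>t * p $ 1\<bar> \<le> t * 1" unfolding abs_mult using p t by (intro mult_mono) auto
  then have 1: "\<bar>t * p $ 1\<bar> < 1" using t by linarith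
  have "\<bar>t * p $ 1\<bar> \<le> \<bar>p $ 1\<bar>" using t mult_right_mono[of t 1 "\<bar>p $ 1\<bar>"] by (simp add: abs_mult)
  then have "hh (t * p $ 1) \<le> hh (p $ 1)" by (rule hh_mono)
  also have "hh (p $ 1) < t * hh (p $ 1)"
    using hh_le[of "p $ 1"] t mult_strict_right_mono_neg[of t 1 "hh (p $ 1)"] by simp
  also have "\<dots> \<le> t * p $ 2" using p(2) t by (intro mult_left_mono) auto
  finally have 2: "hh (t * p $ 1) < t * p $ 2" .
  have "t * p $ 2 \<le> t * 1" using p(3) t by (intro mult_left_mono) auto
  then have 3: "t * p $ 2 < 1" using t by linarith
  show ?thesis using 1 2 3 by (simp add: \<Omega>0_def)
qed

lemma connected_\<Omega>0: "connected \<Omega>0"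
proof -
  have "starlike \<Omega>0" unfolding starlike_def
  proof (intro bexI[OF _ zero_in_\<Omega>0] ballI subsetI)
    fix x y assume x: "x \<in> \<Omega>0" and "y \<in> closed_segment 0 x"
    then obtain t where t: "0 \<le> t" "t \<le> 1" "y = t *\<^sub>R x" by (auto simp: closed_segment_def)
    then show "y \<in> \<Omega>0" using x starlike_\<Omega>0[of x t] by (cases "t = 1") (auto simp: \<Omega>0_def)
  qed
  then show ?thesis by (rule starlike_imp_connected)
qed

lemma perp_small:
  fixes v e :: "real^2"
  assumes "20 * norm (v - (v \<bullet> e) *\<^sub>R e) < v \<bullet> e"
  shows "\<bar>v $ i - (v \<bullet> e) * e $ i\<bar> < (v \<bullet> e) / 20" "0 < v \<bullet> e"
proof -
  show "0 < v \<bullet> e" using assms norm_ge_zero[of "v - (v \<bullet> e) *\<^sub>R e"] by linarith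
  have "\<bar>(v - (v \<bullet> e) *\<^sub>R e) $ i\<bar> \<le> norm (v - (v \<bullet> e) *\<^sub>R e)" by (rule comp_le_norm)
  then show "\<bar>v $ i - (v \<bullet> e) * e $ i\<bar> < (v \<bullet> e) / 20" using assms by simp
qed

text \<open>A ball of radius 1/4 meets at most one of the lines |x| = 1 and at most one of bottom
  and top, so \<open>\<Omega>0\<close> agrees there with a cone-invariant set, and
  \<open>cone_epigraph\<close> provides the Lipschitz function.\<close>

lemma bounded_lipschitz_\<Omega>0: "bounded_lipschitz_domain \<Omega>0"
  unfolding bounded_lipschitz_domain_def
proof (intro conjI ballI open_\<Omega>0 connected_\<Omega>0 bounded_\<Omega>0)
  show "\<Omega>0 \<noteq> {}" using zero_in_\<Omega>0 by blast
  fix p :: "real^2"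
  define \<sigma> :: real where "\<sigma> = (if 0 \<le> p $ 1 then 1 else - 1)"
  have \<sigma>: "\<sigma> = 1 \<or> \<sigma> = - 1" by (auto simp: \<sigma>_def)
  have loc1: "\<bar>x $ 1\<bar> < 1 \<longleftrightarrow> \<sigma> * x $ 1 < 1" if "x \<in> ball p (1/4)" for x
  proof -
    have "\<bar>(p - x) $ 1\<bar> < 1/4" using comp_le_norm[of "p - x" 1] that by (simp add: dist_norm)
    then show ?thesis unfolding \<sigma>_def by (auto simp: abs_if split: if_splits)
  qed
  have loc2: "\<bar>p $ 2 - x $ 2\<bar> < 1/4" if "x \<in> ball p (1/4)" for x
    using comp_le_norm[of "p - x" 2] that by (simp add: dist_norm)
  have "\<exists>U e. open U \<and> 0 \<in> U \<and> mk (2 * \<sigma>) 0 \<notin> U \<and> norm e = 1 \<and> \<Omega>0 \<inter> ball p (1/4) = U \<inter> ball p (1/4) \<and>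
    (\<forall>x v. x \<in> U \<longrightarrow> 20 * norm (v - (v \<bullet> e) *\<^sub>R e) < v \<bullet> e \<longrightarrow> x + v \<in> U)"
  proof (cases "p $ 2 < 1 / 2")
    case True
    define U where "U = {x::real^2. \<sigma> * x $ 1 < 1} \<inter> {x. hh (x $ 1) < x $ 2}"
    \<comment> \<open>Slope 4 beats the Lipschitz constant 3, and the horizontal component points
      away from the side; a cone of opening 1/20 about \<open>e\<close> keeps both
      properties.\<close>
    define e where "e = mk (- \<sigma> / sqrt 17) (4 / sqrt 17)"
    have e_nth: "e $ 1 = - \<sigma> / sqrt 17" "e $ 2 = 4 / sqrt 17" by (simp_all add: e_def)
    have cone: "x + v \<in> U" if x: "x \<in> U" and v: "20 * norm (v - (v \<bullet> e) *\<^sub>R e) < v \<bullet> e" for x v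
    proof -
      define s where "s = v \<bullet> e"
      define c where "c = s / sqrt 17"
      have s: "0 < s" "\<bar>v $ 1 + \<sigma> * c\<bar> < s / 20" "\<bar>v $ 2 - 4 * c\<bar> < s / 20"
        using perp_small(1)[OF v, of 1] perp_small(1)[OF v, of 2] perp_small(2)[OF v] by (simp_all add: s_def e_nth c_def mult.commute)
      have "sqrt 17 < 5" by (rule real_less_lsqrt) auto
      then have c: "s / 5 < c" unfolding c_def using s(1) by (intro divide_strict_left_mono) auto
      have "\<bar>\<sigma> * v $ 1 + c\<bar> = \<bar>v $ 1 + \<sigma> * c\<bar>" by (rule disjE[OF \<sigma>]) (simp_all add: abs_minus_commute)
      moreover have "\<bar>\<sigma> * v $ 1\<bar> = \<bar>v $ 1\<bar>" by (rule disjE[OF \<sigma>]) simp_all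
      ultimately have 1: "\<sigma> * v $ 1 < 0" "\<bar>v $ 1\<bar> < c + s / 20" using s c by linarith+
      have 2: "3 * \<bar>v $ 1\<bar> < v $ 2" using 1 s c by linarith
      have "\<sigma> * (x + v) $ 1 < 1" using x 1 by (simp add: U_def distrib_left)
      moreover have "hh ((x + v) $ 1) < (x + v) $ 2"
      proof -
        have "hh (x $ 1) < x $ 2" using x by (simp add: U_def)
        moreover have "\<bar>hh (x $ 1 + v $ 1) - hh (x $ 1)\<bar> \<le> 3 * \<bar>v $ 1\<bar>"
          using hh_lipschitz[of "x $ 1 + v $ 1" "x $ 1"] by simp
        ultimately have "hh (x $ 1 + v $ 1) < x $ 2 + v $ 2" using 2 by linarith
        then show ?thesis by simp
      qed
      ultimately show ?thesis by (simp add: U_def)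
    qed
    have "open U" unfolding U_def by (intro open_Int open_Collect_less continuous_hh_comp continuous_intros)
    moreover have "norm e = 1" using \<sigma> unfolding norm_vec2 e_nth by (auto simp: power_divide)
    moreover have "\<Omega>0 \<inter> ball p (1/4) = U \<inter> ball p (1/4)"
    proof -
      have "x \<in> \<Omega>0 \<longleftrightarrow> x \<in> U" if x: "x \<in> ball p (1/4)" for x
      proof -
        have "x $ 2 < 1" using loc2[OF x] True by linarith
        then show ?thesis using loc1[OF x] by (auto simp: U_def \<Omega>0_def)
      qed
      then show ?thesis by blast
    qed
    ultimately show ?thesis using cone \<sigma> by (intro exI[of _ U] exI[of _ e]) (auto simp: U_def hh_0)
  next
    case False
    define U where "U = {x::real^2. \<sigma> * x $ 1 < 1} \<inter> {x. x $ 2 < 1}"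
    \<comment> \<open>The diagonal points inward from the side and from the top at once.\<close>
    define e where "e = mk (- \<sigma> / sqrt 2) (- 1 / sqrt 2)"
    have e_nth: "e $ 1 = - \<sigma> / sqrt 2" "e $ 2 = - 1 / sqrt 2" by (simp_all add: e_def)
    have cone: "x + v \<in> U" if x: "x \<in> U" and v: "20 * norm (v - (v \<bullet> e) *\<^sub>R e) < v \<bullet> e" for x v
    proof -
      define s where "s = v \<bullet> e"
      define c where "c = s / sqrt 2"
      have s: "0 < s" "\<bar>v $ 1 + \<sigma> * c\<bar> < s / 20" "\<bar>v $ 2 + c\<bar> < s / 20"
        using perp_small(1)[OF v, of 1] perp_small(1)[OF v, of 2] perp_small(2)[OF v] by (simp_all add: s_def e_nth c_def mult.commute)
      have "sqrt 2 < 5" by (rule real_less_lsqrt) auto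
      then have c: "s / 5 < c" unfolding c_def using s(1) by (intro divide_strict_left_mono) auto
      have "\<bar>\<sigma> * v $ 1 + c\<bar> = \<bar>v $ 1 + \<sigma> * c\<bar>" by (rule disjE[OF \<sigma>]) (simp_all add: abs_minus_commute)
      moreover have "\<bar>\<sigma> * v $ 1\<bar> = \<bar>v $ 1\<bar>" by (rule disjE[OF \<sigma>]) simp_all
      ultimately have 1: "\<sigma> * v $ 1 < 0" "v $ 2 < 0" using s c by linarith+
      then show ?thesis using x by (simp add: U_def distrib_left)
    qed
    have "open U" unfolding U_def by (intro open_Int open_Collect_less continuous_intros)
    moreover have "norm e = 1" using \<sigma> unfolding norm_vec2 e_nth by (auto simp: power_divide)
    moreover have "\<Omega>0 \<inter> ball p (1/4) = U \<inter> ball p (1/4)"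
    proof -
      have "x \<in> \<Omega>0 \<longleftrightarrow> x \<in> U" if x: "x \<in> ball p (1/4)" for x
      proof -
        have "hh (x $ 1) < x $ 2" using loc2[OF x] False hh_le[of "x $ 1"] by linarith
        then show ?thesis using loc1[OF x] by (auto simp: U_def \<Omega>0_def)
      qed
      then show ?thesis by blast
    qed
    ultimately show ?thesis using cone \<sigma> by (intro exI[of _ U] exI[of _ e]) (auto simp: U_def)
  qed
  then obtain U e where U: "open U" "0 \<in> U" "mk (2 * \<sigma>) 0 \<notin> U" "norm e = 1"
    "\<Omega>0 \<inter> ball p (1/4) = U \<inter> ball p (1/4)"
    "\<And>x v. x \<in> U \<Longrightarrow> 20 * norm (v - (v \<bullet> e) *\<^sub>R e) < v \<bullet> e \<Longrightarrow> x + v \<in> U" by blast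
  obtain h where h: "20-lipschitz_on {y. y \<bullet> e = 0} h" "U = {x. h (x - (x \<bullet> e) *\<^sub>R e) < x \<bullet> e}"
    by (rule cone_epigraph[OF U(1-4) _ U(6)]) auto
  have "\<Omega>0 \<inter> ball p (1/4) = {x \<in> ball p (1/4). h (x - (x \<bullet> e) *\<^sub>R e) < x \<bullet> e}"
    unfolding U(5) using h(2) by blast
  then show "\<exists>r>0. \<exists>e L h. norm e = 1 \<and> L-lipschitz_on {y. y \<bullet> e = 0} h \<and>
        \<Omega>0 \<inter> ball p r = {x \<in> ball p r. h (x - (x \<bullet> e) *\<^sub>R e) < x \<bullet> e}"
    using U(4) h(1) by (intro exI[of _ "1/4"] conjI) (auto intro!: exI)
qed

lemma closure_\<Omega>0_iff: "p \<in> closure \<Omega>0 \<longleftrightarrow> \<bar>p $ 1\<bar> \<le> 1 \<and> hh (p $ 1) \<le> p $ 2 \<and> p $ 2 \<le> 1"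
proof
  have "closed ({p::real^2. \<bar>p $ 1\<bar> \<le> 1} \<inter> {p::real^2. hh (p $ 1) \<le> p $ 2} \<inter> {p::real^2. p $ 2 \<le> 1})"
    by (intro closed_Int closed_Collect_le continuous_hh_comp continuous_intros)
  then have "closure \<Omega>0 \<subseteq> {p::real^2. \<bar>p $ 1\<bar> \<le> 1} \<inter> {p::real^2. hh (p $ 1) \<le> p $ 2} \<inter> {p::real^2. p $ 2 \<le> 1}"
    by (intro closure_minimal) (auto simp: \<Omega>0_def)
  then show "p \<in> closure \<Omega>0 \<Longrightarrow> \<bar>p $ 1\<bar> \<le> 1 \<and> hh (p $ 1) \<le> p $ 2 \<and> p $ 2 \<le> 1" by auto
next
  assume p: "\<bar>p $ 1\<bar> \<le> 1 \<and> hh (p $ 1) \<le> p $ 2 \<and> p $ 2 \<le> 1"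
  have "(\<lambda>n. (1 - 1 / real (Suc n)) *\<^sub>R p) \<longlonglongrightarrow> (1 - 0) *\<^sub>R p"
    by (intro tendsto_intros) (use LIMSEQ_inverse_real_of_nat in \<open>simp add: inverse_eq_divide\<close>)
  then show "p \<in> closure \<Omega>0" unfolding closure_sequential
    using p by (intro exI[of _ "\<lambda>n. (1 - 1 / real (Suc n)) *\<^sub>R p"] conjI allI starlike_\<Omega>0) (auto simp: divide_le_eq)
qed

lemma frontier_\<Omega>0_iff:
  "p \<in> frontier \<Omega>0 \<longleftrightarrow> (\<bar>p $ 1\<bar> \<le> 1 \<and> hh (p $ 1) \<le> p $ 2 \<and> p $ 2 \<le> 1) \<and> p \<notin> \<Omega>0"
  using closure_\<Omega>0_iff by (simp add: frontier_def interior_open[OF open_\<Omega>0])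

section \<open>Integration along coordinate lines\<close>

lemma Basis_R2: "(Basis :: (real^2) set) = {axis 1 1, axis 2 1}"
  by (auto simp: Basis_vec_def) (metis exhaust_2)

lemma mk_axis: "mk x y = x *\<^sub>R axis 1 1 + y *\<^sub>R axis 2 1"
  by (simp add: vec_eq_iff forall_2 axis_def)

lemma mk_measurable: "(\<lambda>(x, y). mk x y) \<in> lborel \<Otimes>\<^sub>M lborel \<rightarrow>\<^sub>M borel"
proof -
  have "continuous_on UNIV (\<lambda>p. fst p *\<^sub>R (axis 1 1 :: real^2) + snd p *\<^sub>R axis 2 1 :: real^2)"
    by (intro continuous_intros)
  then have "(\<lambda>p. fst p *\<^sub>R (axis 1 1 :: real^2) + snd p *\<^sub>R axis 2 1) \<in> borel_measurable (borel :: (real \<times> real) measure)"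
    by (rule borel_measurable_continuous_onI)
  then show ?thesis by (simp add: mk_axis case_prod_beta lborel_prod)
qed

text \<open>Transports iterated integration from a product of two lines to \<open>real^2\<close>; it
  is enough that the two measures agree on boxes.\<close>

lemma lborel_R2: "(lborel :: (real^2) measure) = distr (lborel \<Otimes>\<^sub>M lborel) borel (\<lambda>(x, y). mk x y)"
proof (rule lborel_eqI)
  fix l u :: "real^2"
  assume le: "\<And>b. b \<in> Basis \<Longrightarrow> l \<bullet> b \<le> u \<bullet> b"
  then have le': "l $ 1 \<le> u $ 1" "l $ 2 \<le> u $ 2" 
    using le[of "axis 1 1"] le[of "axis 2 1"] by (auto simp: Basis_R2 inner_axis)
  have ne: "axis 1 1 \<noteq> (axis 2 1 :: real^2)" by (simp add: axis_eq_axis)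
  have "emeasure (distr (lborel \<Otimes>\<^sub>M lborel) borel (\<lambda>(x, y). mk x y)) (box l u)
      = emeasure (lborel \<Otimes>\<^sub>M lborel) ((\<lambda>(x, y). mk x y) -` box l u \<inter> space (lborel \<Otimes>\<^sub>M lborel))"
    by (rule emeasure_distr[OF mk_measurable]) simp
  also have "(\<lambda>(x, y). mk x y) -` box l u \<inter> space (lborel \<Otimes>\<^sub>M lborel) = {l $ 1<..<u $ 1} \<times> {l $ 2<..<u $ 2}"
    by (auto simp: mem_box Basis_R2 inner_axis space_pair_measure)
  also have "emeasure (lborel \<Otimes>\<^sub>M lborel) \<dots> = emeasure lborel {l $ 1<..<u $ 1} * emeasure lborel {l $ 2<..<u $ 2}"
    by (rule lborel.emeasure_pair_measure_Times) auto
  also have "\<dots> = ennreal ((u $ 1 - l $ 1) * (u $ 2 - l $ 2))"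
    using le' by (simp add: ennreal_mult)
  also have "(u $ 1 - l $ 1) * (u $ 2 - l $ 2) = (\<Prod>b\<in>Basis. (u - l) \<bullet> b)"
    using ne by (simp add: Basis_R2 inner_axis)
  finally show "emeasure (distr (lborel \<Otimes>\<^sub>M lborel) borel (\<lambda>(x, y). mk x y)) (box l u) = (\<Prod>b\<in>Basis. (u - l) \<bullet> b)" .
qed simp

lemma mk_measurable_1 [measurable]: "(\<lambda>x. mk x y) \<in> borel_measurable borel" "(\<lambda>y. mk x y) \<in> borel_measurable borel"
  by (auto simp: mk_axis intro!: borel_measurable_continuous_onI continuous_intros)

lemma nn_integral_R2:
  assumes f [measurable]: "f \<in> borel_measurable (borel :: (real^2) measure)"
  shows "(\<integral>\<^sup>+p. f p \<partial>lborel) = (\<integral>\<^sup>+x. \<integral>\<^sup>+y. f (mk x y) \<partial>lborel \<partial>lborel)"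
    and "(\<integral>\<^sup>+p. f p \<partial>lborel) = (\<integral>\<^sup>+y. \<integral>\<^sup>+x. f (mk x y) \<partial>lborel \<partial>lborel)"
proof -
  have m: "(\<lambda>p. f (case p of (x, y) \<Rightarrow> mk x y)) \<in> borel_measurable (lborel \<Otimes>\<^sub>M lborel)"
    using measurable_compose[OF mk_measurable f] by simp
  have "(\<integral>\<^sup>+p. f p \<partial>lborel) = (\<integral>\<^sup>+p. f p \<partial>distr (lborel \<Otimes>\<^sub>M lborel) borel (\<lambda>(x, y). mk x y))"
    by (rule arg_cong[where f = "\<lambda>N. nn_integral N f"]) (rule lborel_R2)
  also have "\<dots> = (\<integral>\<^sup>+p. f (case p of (x, y) \<Rightarrow> mk x y) \<partial>(lborel \<Otimes>\<^sub>M lborel))"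
    by (rule nn_integral_distr[OF mk_measurable]) measurable
  finally have 1: "(\<integral>\<^sup>+p. f p \<partial>lborel) = (\<integral>\<^sup>+p. f (case p of (x, y) \<Rightarrow> mk x y) \<partial>(lborel \<Otimes>\<^sub>M lborel))" .
  show 2: "(\<integral>\<^sup>+p. f p \<partial>lborel) = (\<integral>\<^sup>+x. \<integral>\<^sup>+y. f (mk x y) \<partial>lborel \<partial>lborel)"
    unfolding 1 by (subst lborel.nn_integral_fst[OF m, symmetric]) simp
  have m': "(\<lambda>(x, y). f (mk x y)) \<in> borel_measurable (lborel \<Otimes>\<^sub>M lborel)"
    using m by (simp add: case_prod_beta')
  show "(\<integral>\<^sup>+p. f p \<partial>lborel) = (\<integral>\<^sup>+y. \<integral>\<^sup>+x. f (mk x y) \<partial>lborel \<partial>lborel)"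
    unfolding 2 by (rule lborel_pair.Fubini'[OF m', symmetric])
qed

lemma weighted_AM_GM: "0 < \<eta> \<Longrightarrow> 2 * a * b \<le> \<eta> * a\<^sup>2 + (1 / \<eta>) * b\<^sup>2" for a b \<eta> :: real
proof -
  assume \<eta>: "0 < \<eta>"
  have "0 \<le> (\<eta> * a - b)\<^sup>2 / \<eta>" using \<eta> by simp
  also have "\<dots> = \<eta> * a\<^sup>2 + (1 / \<eta>) * b\<^sup>2 - 2 * a * b"
    using \<eta> by (simp add: field_simps power2_eq_square)
  finally show ?thesis by simp
qed

text \<open>Integrate the derivative of \<open>w |f|\<^sup>2\<close>, where \<open>w\<close> runs linearly from \<open>-1\<close> to \<open>1\<close>.\<close>

lemma trace_1d:
  fixes f f' :: "real \<Rightarrow> complex"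
  assumes pq: "0 < l" "l \<le> q - p" and \<eta>: "0 < \<eta>"
    and f: "\<And>t. (f has_vector_derivative f' t) (at t)" and f': "continuous_on UNIV f'"
  shows "ennreal ((cmod (f p))\<^sup>2 + (cmod (f q))\<^sup>2)
    \<le> (\<integral>\<^sup>+t. ennreal ((2 / l + \<eta>) * (cmod (f t))\<^sup>2 + (1 / \<eta>) * (cmod (f' t))\<^sup>2) * indicator {p<..<q} t \<partial>lborel)"
proof -
  have p_q: "p < q" using pq by linarith
  have fc: "continuous_on UNIV f"
    using f by (auto intro!: continuous_at_imp_continuous_on has_vector_derivative_continuous)
  define w where "w t = (2 * t - p - q) / (q - p)" for t
  define g where "g t = (2 / (q - p)) * (f t \<bullet> f t) + w t * (f t \<bullet> f' t + f' t \<bullet> f t)" for t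
  define b where "b t = (2 / l + \<eta>) * (cmod (f t))\<^sup>2 + (1 / \<eta>) * (cmod (f' t))\<^sup>2" for t
  have b_nonneg: "0 \<le> b t" for t using pq \<eta> by (simp add: b_def)
  have wc: "continuous_on S w" for S unfolding w_def by (intro continuous_intros) (use p_q in auto)
  note c = continuous_on_subset[OF fc subset_UNIV] continuous_on_subset[OF f' subset_UNIV]
  have gc: "continuous_on {p..q} g" unfolding g_def by (intro continuous_intros wc c)
  have bc: "continuous_on {p..q} b" unfolding b_def by (intro continuous_intros c)
  have der: "((\<lambda>t. w t * (f t \<bullet> f t)) has_vector_derivative g x) (at x within {p..q})" for x
  proof -
    have 1: "((\<lambda>t. f t \<bullet> f t) has_vector_derivative (f x \<bullet> f' x + f' x \<bullet> f x)) (at x)"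
      by (rule bounded_bilinear.has_vector_derivative[OF bounded_bilinear_inner f f])
    have 2: "(w has_vector_derivative (2 / (q - p))) (at x)"
      unfolding w_def has_real_derivative_iff_has_vector_derivative[symmetric]
      by (rule DERIV_cdivide) (auto intro!: derivative_eq_intros)
    have "((\<lambda>t. w t * (f t \<bullet> f t)) has_vector_derivative (w x * (f x \<bullet> f' x + f' x \<bullet> f x) + (2 / (q - p)) * (f x \<bullet> f x))) (at x)"
      by (rule has_vector_derivative_mult[OF 2 1])
    then show ?thesis by (simp add: g_def add.commute has_vector_derivative_at_within)
  qed
  have g_le: "g t \<le> b t" if t: "t \<in> {p..q}" for t
  proof -
    have "\<bar>w t\<bar> \<le> 1" unfolding w_def using t p_q by (auto simp: abs_le_iff field_simps)
    have "f t \<bullet> f' t \<le> cmod (f t) * cmod (f' t)" "- (f t \<bullet> f' t) \<le> cmod (f t) * cmod (f' t)"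
      using Cauchy_Schwarz_ineq2[of "f t" "f' t"] by (auto simp: abs_le_iff)
    then have i: "\<bar>f t \<bullet> f' t\<bar> \<le> cmod (f t) * cmod (f' t)" by (simp add: abs_le_iff)
    have "w t * (2 * (f t \<bullet> f' t)) \<le> \<bar>w t\<bar> * (2 * \<bar>f t \<bullet> f' t\<bar>)"
      using abs_ge_self[of "w t * (2 * (f t \<bullet> f' t))"] by (simp add: abs_mult)
    also have "\<dots> \<le> 1 * (2 * \<bar>f t \<bullet> f' t\<bar>)" using \<open>\<bar>w t\<bar> \<le> 1\<close> by (intro mult_right_mono) auto
    also have "\<dots> \<le> 2 * cmod (f t) * cmod (f' t)" using i by simp
    also have "\<dots> \<le> \<eta> * (cmod (f t))\<^sup>2 + (1 / \<eta>) * (cmod (f' t))\<^sup>2" by (rule weighted_AM_GM[OF \<eta>])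
    finally have 1: "w t * (f t \<bullet> f' t + f' t \<bullet> f t) \<le> \<eta> * (cmod (f t))\<^sup>2 + (1 / \<eta>) * (cmod (f' t))\<^sup>2"
      by (simp add: inner_commute)
    have "2 / (q - p) \<le> 2 / l" using pq by (intro divide_left_mono) auto
    then have "(2 / (q - p)) * (f t \<bullet> f t) \<le> (2 / l) * (cmod (f t))\<^sup>2"
      unfolding power2_norm_eq_inner by (rule mult_right_mono) simp
    then show ?thesis using 1 by (simp add: g_def b_def distrib_right)
  qed
  have ig: "integrable lborel (\<lambda>x. indicator {p..q} x *\<^sub>R g x)" by (rule borel_integrable_compact) (auto intro: gc)
  have ib: "integrable lborel (\<lambda>x. indicator {p..q} x *\<^sub>R b x)" by (rule borel_integrable_compact) (auto intro: bc)
  have "(cmod (f p))\<^sup>2 + (cmod (f q))\<^sup>2 = w q * (f q \<bullet> f q) - w p * (f p \<bullet> f p)"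
  proof -
    have "w q = 1" "w p = - 1" using p_q by (auto simp: w_def field_simps)
    then show ?thesis by (simp add: power2_norm_eq_inner)
  qed
  also have "\<dots> = (\<integral>x. indicator {p..q} x *\<^sub>R g x \<partial>lborel)"
    using p_q der gc by (intro integral_FTC_atLeastAtMost[symmetric]) auto
  also have "\<dots> \<le> (\<integral>x. indicator {p..q} x *\<^sub>R b x \<partial>lborel)"
    by (rule integral_mono[OF ig ib]) (use g_le in \<open>auto simp: indicator_def\<close>)
  finally have "ennreal ((cmod (f p))\<^sup>2 + (cmod (f q))\<^sup>2) \<le> ennreal (\<integral>x. indicator {p..q} x *\<^sub>R b x \<partial>lborel)"
    by (rule ennreal_leI)
  also have "\<dots> = (\<integral>\<^sup>+x. ennreal (indicator {p..q} x *\<^sub>R b x) \<partial>lborel)"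
    using b_nonneg by (intro nn_integral_eq_integral[symmetric] ib) auto
  also have "\<dots> = (\<integral>\<^sup>+x. ennreal (b x) * indicator {p<..<q} x \<partial>lborel)"
  proof (rule nn_integral_cong_AE)
    have "AE x in lborel. x \<noteq> p" "AE x in lborel. x \<noteq> q" by (rule AE_lborel_singleton)+
    then show "AE x in lborel. ennreal (indicator {p..q} x *\<^sub>R b x) = ennreal (b x) * indicator {p<..<q} x"
      by eventually_elim (auto simp: indicator_def)
  qed
  finally show ?thesis by (simp add: b_def)
qed

text \<open>One of the two parts into which x divides [p, q] has length at least l/2 and has x as an
  end point; hence 4/l in place of 2/l.\<close>

lemma trace_1d_point:
  fixes f f' :: "real \<Rightarrow> complex"
  assumes pq: "0 < l" "l \<le> q - p" and x: "p \<le> x" "x \<le> q" and \<eta>: "0 < \<eta>"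
    and f: "\<And>t. (f has_vector_derivative f' t) (at t)" and f': "continuous_on UNIV f'"
  shows "ennreal ((cmod (f x))\<^sup>2)
    \<le> (\<integral>\<^sup>+t. ennreal ((4 / l + \<eta>) * (cmod (f t))\<^sup>2 + (1 / \<eta>) * (cmod (f' t))\<^sup>2) * indicator {p<..<q} t \<partial>lborel)"
proof -
  have sub: "ennreal ((cmod (f x))\<^sup>2)
    \<le> (\<integral>\<^sup>+t. ennreal ((4 / l + \<eta>) * (cmod (f t))\<^sup>2 + (1 / \<eta>) * (cmod (f' t))\<^sup>2) * indicator {p<..<q} t \<partial>lborel)"
    if r: "l / 2 \<le> s - r" "p \<le> r" "s \<le> q" "x = r \<or> x = s" for r s
  proof -
    have "ennreal ((cmod (f x))\<^sup>2) \<le> ennreal ((cmod (f r))\<^sup>2 + (cmod (f s))\<^sup>2)" using r(4) by (intro ennreal_leI) auto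
    also have "\<dots> \<le> (\<integral>\<^sup>+t. ennreal ((2 / (l / 2) + \<eta>) * (cmod (f t))\<^sup>2 + (1 / \<eta>) * (cmod (f' t))\<^sup>2) * indicator {r<..<s} t \<partial>lborel)"
      using pq r(1) by (intro trace_1d[OF _ _ \<eta> f f']) auto
    also have "\<dots> \<le> (\<integral>\<^sup>+t. ennreal ((4 / l + \<eta>) * (cmod (f t))\<^sup>2 + (1 / \<eta>) * (cmod (f' t))\<^sup>2) * indicator {p<..<q} t \<partial>lborel)"
      using r by (intro nn_integral_mono mult_mono) (auto simp: indicator_def)
    finally show ?thesis .
  qed
  show ?thesis
  proof (cases "l / 2 \<le> x - p")
    case True then show ?thesis using sub[of x p] x by simp
  next
    case False then show ?thesis using sub[of q x] x pq by simp
  qed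
qed

section \<open>Trace inequalities on the domain\<close>

lemma indicator_\<Omega>0:
  "\<bar>x\<bar> < 1 \<Longrightarrow> indicator {hh x<..<1} y = (indicator \<Omega>0 (mk x y) :: ennreal)"
  by (simp add: \<Omega>0_def indicator_def)

lemma borel_\<Omega>0 [measurable]: "\<Omega>0 \<in> sets borel" using open_\<Omega>0 by simp

locale smooth_fun =
  fixes \<phi> :: "real^2 \<Rightarrow> complex"
  assumes smooth: "smooth \<phi>"
begin

definition D where "D i p = frechet_derivative \<phi> (at p) (axis i 1)" for i :: 2

definition W where "W i c d p = c * (cmod (\<phi> p))\<^sup>2 + d * (cmod (D i p))\<^sup>2" for i c d p

lemma D_cont: "continuous_on UNIV (D i)"
  unfolding D_def[abs_def] by (intro smooth_continuous smooth_partial smooth) simp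

lemma \<phi>_cont: "continuous_on UNIV \<phi>" by (rule smooth_continuous[OF smooth])

lemma meas [measurable]: "D i \<in> borel_measurable borel" "\<phi> \<in> borel_measurable borel"
  by (auto intro!: borel_measurable_continuous_onI D_cont \<phi>_cont)

lemma W_meas [measurable]: "W i c d \<in> borel_measurable borel" unfolding W_def[abs_def] by measurable

lemma mk_cont: "continuous_on UNIV (\<lambda>t. mk t y)" "continuous_on UNIV (\<lambda>t. mk x t)"
  by (auto simp: mk_axis intro!: continuous_intros)

lemma deriv_1: "((\<lambda>t. \<phi> (mk t y)) has_vector_derivative D 1 (mk t y)) (at t)"
proof -
  have "((\<lambda>t. mk t y) has_derivative (\<lambda>h. h *\<^sub>R axis 1 1)) (at t)"
    unfolding mk_axis by (auto intro!: derivative_eq_intros)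
  from diff_chain_at[OF this smooth_has_derivative[OF smooth]]
  have "((\<lambda>t. \<phi> (mk t y)) has_derivative (\<lambda>h. frechet_derivative \<phi> (at (mk t y)) (h *\<^sub>R axis 1 1))) (at t)"
    by (simp add: o_def)
  then show ?thesis
    unfolding has_vector_derivative_def D_def
    using linear_scale[OF has_derivative_linear[OF smooth_has_derivative[OF smooth]]] by simp
qed

lemma deriv_2: "((\<lambda>t. \<phi> (mk x t)) has_vector_derivative D 2 (mk x t)) (at t)"
proof -
  have "((\<lambda>t. mk x t) has_derivative (\<lambda>h. h *\<^sub>R axis 2 1)) (at t)"
    unfolding mk_axis by (auto intro!: derivative_eq_intros)
  from diff_chain_at[OF this smooth_has_derivative[OF smooth]]
  have "((\<lambda>t. \<phi> (mk x t)) has_derivative (\<lambda>h. frechet_derivative \<phi> (at (mk x t)) (h *\<^sub>R axis 2 1))) (at t)"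
    by (simp add: o_def)
  then show ?thesis
    unfolding has_vector_derivative_def D_def
    using linear_scale[OF has_derivative_linear[OF smooth_has_derivative[OF smooth]]] by simp
qed

lemma D_line_cont: "continuous_on UNIV (\<lambda>t. D i (mk t y))" "continuous_on UNIV (\<lambda>t. D i (mk x t))"
  using continuous_on_compose2[OF D_cont mk_cont(1)] continuous_on_compose2[OF D_cont mk_cont(2)] by auto

text \<open>Only the derivative along the line enters. Integrals over vertical and over horizontal
  lines therefore draw on different partial derivatives and can be added without exceeding the full
  gradient.\<close>

definition vert :: "real \<Rightarrow> real \<Rightarrow> real \<Rightarrow> ennreal" where
  "vert c d x = (\<integral>\<^sup>+y. ennreal (W 2 c d (mk x y)) * indicator \<Omega>0 (mk x y) \<partial>lborel)"

definition horiz :: "real \<Rightarrow> real \<Rightarrow> real \<Rightarrow> ennreal" where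
  "horiz c d y = (\<integral>\<^sup>+x. ennreal (W 1 c d (mk x y)) * indicator \<Omega>0 (mk x y) \<partial>lborel)"

definition vol :: "2 \<Rightarrow> real \<Rightarrow> real \<Rightarrow> ennreal" where
  "vol i c d = (\<integral>\<^sup>+p. ennreal (W i c d p) * indicator \<Omega>0 p \<partial>lborel)"

lemma vert_vol: "vol 2 c d = (\<integral>\<^sup>+x. vert c d x \<partial>lborel)"
  unfolding vol_def vert_def by (rule nn_integral_R2(1)) measurable

lemma horiz_vol: "vol 1 c d = (\<integral>\<^sup>+y. horiz c d y \<partial>lborel)"
  unfolding vol_def horiz_def by (rule nn_integral_R2(2)) measurable

lemma vert_meas [measurable]: "vert c d \<in> borel_measurable borel"
proof -
  have "(\<lambda>(x, y). ennreal (W 2 c d (mk x y)) * indicator \<Omega>0 (mk x y)) \<in> borel_measurable (lborel \<Otimes>\<^sub>M lborel)"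
    using measurable_compose[OF mk_measurable, of "\<lambda>p. ennreal (W 2 c d p) * indicator \<Omega>0 p" borel]
    by (simp add: case_prod_beta')
  from lborel.borel_measurable_nn_integral[OF this] show ?thesis unfolding vert_def[abs_def] by simp
qed

lemma horiz_meas [measurable]: "horiz c d \<in> borel_measurable borel"
proof -
  have "(\<lambda>(x, y). ennreal (W 1 c d (mk x y)) * indicator \<Omega>0 (mk x y)) \<in> borel_measurable (lborel \<Otimes>\<^sub>M lborel)"
    using measurable_compose[OF mk_measurable, of "\<lambda>p. ennreal (W 1 c d p) * indicator \<Omega>0 p" borel]
    by (simp add: case_prod_beta')
  from measurable_pair_swap[OF this]
  have "(\<lambda>(y, x). ennreal (W 1 c d (mk x y)) * indicator \<Omega>0 (mk x y)) \<in> borel_measurable (lborel \<Otimes>\<^sub>M lborel)"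
    by (simp add: case_prod_beta')
  from lborel.borel_measurable_nn_integral[OF this] show ?thesis unfolding horiz_def[abs_def] by simp
qed

text \<open>The vertical chord has length 1 - \<open>hh x\<close> >= 3/2, so l = 1 may be used; its
  ends are the bottom and the top point over x.\<close>

lemma vertical_trace:
  assumes x: "\<bar>x\<bar> < 1" and \<eta>: "0 < \<eta>"
  shows "ennreal ((cmod (\<phi> (mk x (hh x))))\<^sup>2 + (cmod (\<phi> (mk x 1)))\<^sup>2) \<le> vert (2 + \<eta>) (1 / \<eta>) x"
  using trace_1d[of 1 1 "hh x" \<eta>, OF _ _ \<eta> deriv_2[of x] D_line_cont(2)[of 2 x]] hh_le[of x]
  unfolding vert_def W_def indicator_\<Omega>0[OF x] by simp

lemma vertical_point:
  assumes p: "mk x y \<in> \<Omega>0" and \<eta>: "0 < \<eta>"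
  shows "ennreal ((cmod (\<phi> (mk x y)))\<^sup>2) \<le> vert (4 + \<eta>) (1 / \<eta>) x"
proof -
  have x: "\<bar>x\<bar> < 1" "hh x < y" "y < 1" using p by (auto simp: \<Omega>0_def)
  show ?thesis
    using trace_1d_point[of 1 1 "hh x" y \<eta>, OF _ _ _ _ \<eta> deriv_2[of x] D_line_cont(2)[of 2 x]] hh_le[of x] x
    unfolding vert_def W_def indicator_\<Omega>0[OF x(1)] by simp
qed

lemma section_subset:
  assumes "0 < x" "x \<le> 1" "y < 1" "\<And>t. \<bar>t\<bar> < x \<Longrightarrow> hh t < y"
  shows "indicator {- x<..<x} t \<le> (indicator \<Omega>0 (mk t y) :: ennreal)"
  using assms by (auto simp: \<Omega>0_def indicator_def abs_less_iff)

text \<open>The condition on \<open>hh\<close> says that the open chord from (-x, y) to (x, y) runs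
  inside \<open>\<Omega>0\<close>; its half-length, at least a, gives the constant 1/a.\<close>

lemma horizontal_trace:
  assumes x: "0 < a" "a \<le> x" "x \<le> 1" and y: "y < 1" "\<And>t. \<bar>t\<bar> < x \<Longrightarrow> hh t < y" and \<eta>: "0 < \<eta>"
  shows "ennreal ((cmod (\<phi> (mk x y)))\<^sup>2 + (cmod (\<phi> (mk (- x) y)))\<^sup>2) \<le> horiz (1 / a + \<eta>) (1 / \<eta>) y"
proof -
  have "ennreal ((cmod (\<phi> (mk (- x) y)))\<^sup>2 + (cmod (\<phi> (mk x y)))\<^sup>2)
    \<le> (\<integral>\<^sup>+t. ennreal ((2 / (2 * a) + \<eta>) * (cmod (\<phi> (mk t y)))\<^sup>2 + (1 / \<eta>) * (cmod (D 1 (mk t y)))\<^sup>2) * indicator {- x<..<x} t \<partial>lborel)"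
    using x by (intro trace_1d[OF _ _ \<eta> deriv_1 D_line_cont(1)]) auto
  also have "\<dots> \<le> horiz (1 / a + \<eta>) (1 / \<eta>) y"
    unfolding horiz_def W_def using x y by (intro nn_integral_mono mult_mono section_subset) auto
  finally show ?thesis by (simp add: add.commute)
qed

lemma horizontal_point:
  assumes a: "0 < a" "a \<le> 1" "\<bar>x\<bar> \<le> a" and y: "y < 1" "\<And>t. \<bar>t\<bar> < a \<Longrightarrow> hh t < y" and \<eta>: "0 < \<eta>"
  shows "ennreal ((cmod (\<phi> (mk x y)))\<^sup>2) \<le> horiz (2 / a + \<eta>) (1 / \<eta>) y"
proof -
  have "ennreal ((cmod (\<phi> (mk x y)))\<^sup>2)
    \<le> (\<integral>\<^sup>+t. ennreal ((4 / (2 * a) + \<eta>) * (cmod (\<phi> (mk t y)))\<^sup>2 + (1 / \<eta>) * (cmod (D 1 (mk t y)))\<^sup>2) * indicator {- a<..<a} t \<partial>lborel)"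
    using a by (intro trace_1d_point[OF _ _ _ _ \<eta> deriv_1 D_line_cont(1)]) auto
  also have "\<dots> \<le> horiz (2 / a + \<eta>) (1 / \<eta>) y"
    unfolding horiz_def W_def using a y by (intro nn_integral_mono mult_mono section_subset) auto
  finally show ?thesis .
qed

lemma reflect: "f \<in> borel_measurable borel \<Longrightarrow> (\<integral>\<^sup>+x. f (- x) \<partial>lborel) = (\<integral>\<^sup>+x. f x \<partial>lborel)" for f :: "real \<Rightarrow> ennreal"
  using nn_integral_real_affine[of f "- 1" 0] by simp

text \<open>Values at points \<open>(x, y)\<close> and \<open>(-x, y)\<close> are grouped, since the one-dimensional trace inequality
  bounds them together.\<close>

definition bot2 :: "real \<Rightarrow> ennreal" where
  "bot2 x = ennreal ((cmod (\<phi> (mk x (hh x))))\<^sup>2 + (cmod (\<phi> (mk (- x) (hh x))))\<^sup>2)"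

definition top2 :: "real \<Rightarrow> ennreal" where
  "top2 x = ennreal ((cmod (\<phi> (mk x 1)))\<^sup>2 + (cmod (\<phi> (mk (- x) 1)))\<^sup>2)"

definition side2 :: "real \<Rightarrow> ennreal" where
  "side2 y = ennreal ((cmod (\<phi> (mk 1 y)))\<^sup>2 + (cmod (\<phi> (mk (- 1) y)))\<^sup>2)"

lemma mk_hh_meas [measurable]: "(\<lambda>x. mk x (hh x)) \<in> borel_measurable borel" "(\<lambda>x. mk (- x) (hh x)) \<in> borel_measurable borel"
    "(\<lambda>x. mk (- x) y) \<in> borel_measurable borel"
proof -
  have "continuous_on UNIV (\<lambda>x. mk x (hh x))" "continuous_on UNIV (\<lambda>x. mk (- x) (hh x))" "continuous_on UNIV (\<lambda>x. mk (- x) y)"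
    unfolding mk_axis by (intro continuous_intros hh_continuous)+
  then show "(\<lambda>x. mk x (hh x)) \<in> borel_measurable borel" "(\<lambda>x. mk (- x) (hh x)) \<in> borel_measurable borel"
    "(\<lambda>x. mk (- x) y) \<in> borel_measurable borel"
    by (auto intro: borel_measurable_continuous_onI)
qed

lemma bot2_meas [measurable]: "bot2 \<in> borel_measurable borel" "top2 \<in> borel_measurable borel" "side2 \<in> borel_measurable borel"
  unfolding bot2_def[abs_def] top2_def[abs_def] side2_def[abs_def] by measurable

lemma bot_top_le:
  assumes \<eta>: "0 < \<eta>" and c: "0 \<le> c" "c \<le> 1"
  shows "(\<integral>\<^sup>+x. (bot2 x + top2 x) * indicator {0..c} x \<partial>lborel)
    \<le> (\<integral>\<^sup>+x. vert (2 + \<eta>) (1 / \<eta>) x * indicator {- c..c} x \<partial>lborel)"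
proof -
  let ?v = "vert (2 + \<eta>) (1 / \<eta>)"
  have "(\<integral>\<^sup>+x. (bot2 x + top2 x) * indicator {0..c} x \<partial>lborel)
      \<le> (\<integral>\<^sup>+x. ?v x * indicator {0<..c} x + ?v (- x) * indicator {0<..c} x \<partial>lborel)"
  proof (rule nn_integral_mono_AE)
    have "AE x in lborel. x \<noteq> (1::real)" "AE x in lborel. x \<noteq> (0::real)" by (rule AE_lborel_singleton)+
    then show "AE x in lborel. (bot2 x + top2 x) * indicator {0..c} x \<le> ?v x * indicator {0<..c} x + ?v (- x) * indicator {0<..c} x"
    proof eventually_elim
      case (elim x)
      show ?case
      proof (cases "x \<in> {0..c}")
        case True
        then have x: "0 < x" "\<bar>x\<bar> < 1" "\<bar>- x\<bar> < 1" "x \<le> c" using elim c by auto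
        have "bot2 x + top2 x = ennreal ((cmod (\<phi> (mk x (hh x))))\<^sup>2 + (cmod (\<phi> (mk x 1)))\<^sup>2)
            + ennreal ((cmod (\<phi> (mk (- x) (hh (- x)))))\<^sup>2 + (cmod (\<phi> (mk (- x) 1)))\<^sup>2)"
          by (simp add: bot2_def top2_def hh_even flip: ennreal_plus)
        also have "\<dots> \<le> ?v x + ?v (- x)"
          by (intro add_mono vertical_trace x \<eta>)
        finally show ?thesis using x by simp
      qed simp
    qed
  qed
  also have "\<dots> = (\<integral>\<^sup>+x. ?v x * indicator {0<..c} x \<partial>lborel) + (\<integral>\<^sup>+x. ?v (- x) * indicator {0<..c} x \<partial>lborel)"
    by (rule nn_integral_add) measurable
  also have "(\<integral>\<^sup>+x. ?v (- x) * indicator {0<..c} x \<partial>lborel) = (\<integral>\<^sup>+x. ?v x * indicator {- c..<0} x \<partial>lborel)"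
  proof -
    have "(\<integral>\<^sup>+x. ?v (- x) * indicator {0<..c} x \<partial>lborel) = (\<integral>\<^sup>+x. (\<lambda>x. ?v x * indicator {- c..<0} x) (- x) \<partial>lborel)"
      by (intro nn_integral_cong) (auto simp: indicator_def)
    also have "\<dots> = (\<integral>\<^sup>+x. ?v x * indicator {- c..<0} x \<partial>lborel)" by (rule reflect) measurable
    finally show ?thesis .
  qed
  also have "(\<integral>\<^sup>+x. ?v x * indicator {0<..c} x \<partial>lborel) + (\<integral>\<^sup>+x. ?v x * indicator {- c..<0} x \<partial>lborel)
      = (\<integral>\<^sup>+x. ?v x * indicator {0<..c} x + ?v x * indicator {- c..<0} x \<partial>lborel)"
    by (rule nn_integral_add[symmetric]) measurable
  also have "\<dots> \<le> (\<integral>\<^sup>+x. ?v x * indicator {- c..c} x \<partial>lborel)"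
    by (intro nn_integral_mono) (auto simp: indicator_def)
  finally show ?thesis .
qed

lemma steep_interior:
  assumes "x \<in> {aa j<..<bb j}" "\<bar>t\<bar> < x" shows "hh t < hh x"
proof -
  define s where "s = max \<bar>t\<bar> (aa j)"
  have s: "aa j \<le> s" "s < x" "x \<le> bb j" "\<bar>t\<bar> \<le> \<bar>s\<bar>" using assms by (auto simp: s_def)
  have "hh t \<le> hh s" using s by (intro hh_mono)
  also have "\<dots> < hh x" using hh_steep[of j s x] s by simp
  finally show ?thesis .
qed

text \<open>Over a steep interval y = \<open>hh x\<close> is affine with slope 3, so the factor 3 is
  the Jacobian: the vertical increment of the boundary is parametrised by height, with one
  horizontal chord, of half-length at least \<open>aa j\<close>, for each y.\<close>

lemma steep_piece_le:
  assumes a: "0 < a" "a \<le> aa j" and \<eta>: "0 < \<eta>"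
  shows "3 * (\<integral>\<^sup>+x. bot2 x * indicator {aa j<..<bb j} x \<partial>lborel)
    \<le> (\<integral>\<^sup>+y. horiz (1 / a + \<eta>) (1 / \<eta>) y * indicator {hh (aa j)<..<hh (bb j)} y \<partial>lborel)"
proof -
  let ?H = "horiz (1 / a + \<eta>) (1 / \<eta>)"
  have hx: "hh x = (hh (aa j) - 3 * aa j) + 3 * x" if "x \<in> {aa j..bb j}" for x
    using hh_steep[of j "aa j" x] that by simp
  have "3 * (\<integral>\<^sup>+x. bot2 x * indicator {aa j<..<bb j} x \<partial>lborel) \<le> 3 * (\<integral>\<^sup>+x. ?H (hh x) * indicator {aa j<..<bb j} x \<partial>lborel)"
  proof (intro mult_left_mono nn_integral_mono)
    fix x
    show "bot2 x * indicator {aa j<..<bb j} x \<le> ?H (hh x) * indicator {aa j<..<bb j} x"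
    proof (cases "x \<in> {aa j<..<bb j}")
      case True
      have "bot2 x \<le> ?H (hh x)" unfolding bot2_def
        using True a bb_le[of j] hh_le[of x] steep_interior[OF True] by (intro horizontal_trace \<eta>) auto
      then show ?thesis by (intro mult_right_mono) auto
    qed simp
  qed simp
  also have "\<dots> = ennreal \<bar>3\<bar> * (\<integral>\<^sup>+x. (\<lambda>y. ?H y * indicator {hh (aa j)<..<hh (bb j)} y) ((hh (aa j) - 3 * aa j) + 3 * x) \<partial>lborel)"
  proof -
    have "?H (hh x) * indicator {aa j<..<bb j} x
        = ?H ((hh (aa j) - 3 * aa j) + 3 * x) * indicator {hh (aa j)<..<hh (bb j)} ((hh (aa j) - 3 * aa j) + 3 * x)" for x
      using hx[of x] hx[of "bb j"] aa_less_bb[of j] by (auto simp: indicator_def)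
    then show ?thesis by simp
  qed
  also have "\<dots> = (\<integral>\<^sup>+y. ?H y * indicator {hh (aa j)<..<hh (bb j)} y \<partial>lborel)"
    by (rule nn_integral_real_affine[symmetric]) auto
  finally show ?thesis .
qed

lemma side_le:
  assumes a: "0 < a" "a \<le> 1" and \<eta>: "0 < \<eta>"
  shows "(\<integral>\<^sup>+y. side2 y * indicator {hh 1..1} y \<partial>lborel)
    \<le> (\<integral>\<^sup>+y. horiz (1 / a + \<eta>) (1 / \<eta>) y * indicator {hh 1<..<1} y \<partial>lborel)"
proof (rule nn_integral_mono_AE)
  have "AE x in lborel. x \<noteq> (1::real)" "AE x in lborel. x \<noteq> hh 1" by (rule AE_lborel_singleton)+
  then show "AE y in lborel. side2 y * indicator {hh 1..1} y \<le> horiz (1 / a + \<eta>) (1 / \<eta>) y * indicator {hh 1<..<1} y"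
  proof eventually_elim
    case (elim y)
    show ?case
    proof (cases "y \<in> {hh 1<..<1}")
      case True
      have "hh t < y" if "\<bar>t\<bar> < 1" for t using True hh_mono[of t 1] that by auto
      then have "side2 y \<le> horiz (1 / a + \<eta>) (1 / \<eta>) y" unfolding side2_def
        using True a by (intro horizontal_trace \<eta>) auto
      then show ?thesis using True by (auto simp: indicator_def)
    qed (use elim in \<open>auto simp: indicator_def\<close>)
  qed
qed

text \<open>The height ranges of the steep intervals and of the vertical sides are pairwise
  disjoint, because \<open>hh\<close> is monotone in |x|. Hence each horizontal line is used at most
  once, and a single volume integral bounds the whole sum.\<close>

lemma steep_side_le:
  assumes \<eta>: "0 < \<eta>"
  shows "(\<Sum>j\<le>k. 3 * (\<integral>\<^sup>+x. bot2 x * indicator {aa j<..<bb j} x \<partial>lborel))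
      + (\<integral>\<^sup>+y. side2 y * indicator {hh 1..1} y \<partial>lborel) \<le> vol 1 (1 / aa k + \<eta>) (1 / \<eta>)"
proof -
  let ?H = "horiz (1 / aa k + \<eta>) (1 / \<eta>)"
  have aak: "aa k \<le> aa j" if "j \<le> k" for j
    using that bb_antimono[OF that] bb_pos[of k] unfolding aa_def by (intro power_mono) auto
  have "(\<Sum>j\<le>k. 3 * (\<integral>\<^sup>+x. bot2 x * indicator {aa j<..<bb j} x \<partial>lborel)) + (\<integral>\<^sup>+y. side2 y * indicator {hh 1..1} y \<partial>lborel)
      \<le> (\<Sum>j\<le>k. \<integral>\<^sup>+y. ?H y * indicator {hh (aa j)<..<hh (bb j)} y \<partial>lborel) + (\<integral>\<^sup>+y. ?H y * indicator {hh 1<..<1} y \<partial>lborel)"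
    using aak aa_pos[of k] aa_less_bb[of k] bb_le[of k] by (intro add_mono sum_mono steep_piece_le side_le \<eta>) auto
  also have "(\<Sum>j\<le>k. \<integral>\<^sup>+y. ?H y * indicator {hh (aa j)<..<hh (bb j)} y \<partial>lborel)
      = (\<integral>\<^sup>+y. (\<Sum>j\<le>k. ?H y * indicator {hh (aa j)<..<hh (bb j)} y) \<partial>lborel)"
    by (rule nn_integral_sum[symmetric]) measurable
  also have "\<dots> + (\<integral>\<^sup>+y. ?H y * indicator {hh 1<..<1} y \<partial>lborel)
      = (\<integral>\<^sup>+y. (\<Sum>j\<le>k. ?H y * indicator {hh (aa j)<..<hh (bb j)} y) + ?H y * indicator {hh 1<..<1} y \<partial>lborel)"
    by (rule nn_integral_add[symmetric]) measurable
  also have "\<dots> \<le> (\<integral>\<^sup>+y. ?H y \<partial>lborel)"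
  proof (rule nn_integral_mono)
    fix y
    have order: "hh (bb i) \<le> hh (aa j)" if "j < i" for i j
      using bb_less_aa[OF that] bb_pos[of i] by (intro hh_mono) simp
    have top: "hh (bb j) \<le> hh 1" for j using bb_le[of j] bb_pos[of j] by (intro hh_mono) simp
    show "(\<Sum>j\<le>k. ?H y * indicator {hh (aa j)<..<hh (bb j)} y) + ?H y * indicator {hh 1<..<1} y \<le> ?H y"
    proof (cases "\<exists>j\<le>k. y \<in> {hh (aa j)<..<hh (bb j)}")
      case True
      then obtain j where j: "j \<le> k" "y \<in> {hh (aa j)<..<hh (bb j)}" by blast
      have "y \<notin> {hh (aa i)<..<hh (bb i)}" if "i \<noteq> j" for i
        using order[of i j] order[of j i] that j(2) by (cases "i < j") auto
      then have "(\<Sum>i\<le>k. ?H y * indicator {hh (aa i)<..<hh (bb i)} y) = (\<Sum>i\<in>{j}. ?H y * indicator {hh (aa i)<..<hh (bb i)} y)"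
        using j(1) by (intro sum.mono_neutral_right) (auto simp: indicator_def)
      also have "\<dots> = ?H y * indicator {hh (aa j)<..<hh (bb j)} y"
        by (subst sum.insert) (simp_all only: finite.emptyI sum.empty add_0_right empty_iff not_False_eq_True)
      also have "\<dots> \<le> ?H y" by (simp add: indicator_def)
      finally show ?thesis using j top[of j] by (auto simp: indicator_def)
    next
      case False
      then have z: "(\<Sum>i\<le>k. ?H y * indicator {hh (aa i)<..<hh (bb i)} y) = 0" by (intro sum.neutral) (auto simp: indicator_def)
      show ?thesis unfolding z by (simp add: indicator_def)
    qed
  qed
  also have "\<dots> = vol 1 (1 / aa k + \<eta>) (1 / \<eta>)" by (rule horiz_vol[symmetric])
  finally show ?thesis .
qed

definition strip :: "real \<Rightarrow> ennreal" where
  "strip b = (\<integral>\<^sup>+p. ennreal ((cmod (\<phi> p))\<^sup>2) * (indicator \<Omega>0 p * indicator {- b..b} (p $ 1)) \<partial>lborel)"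

text \<open>A point of the strip above the level \<open>hh (aa k)\<close> sees a horizontal chord of
  half-length \<open>aa k\<close>, much longer than the strip is wide. The other points have height
  at most -1 + 3 b with b = \<open>bb (Suc k)\<close>, because \<open>hh\<close> takes the same
  value at \<open>aa k\<close> and at b; vertical chords handle them. Integrating the line bounds in
  the transverse variable yields the small factors 2 b and 3 b.\<close>

lemma strip_le:
  assumes \<eta>: "0 < \<eta>"
  shows "strip (bb (Suc k)) \<le> ennreal (2 * bb (Suc k)) * vol 1 (2 / aa k + \<eta>) (1 / \<eta>)
    + ennreal (3 * bb (Suc k)) * vol 2 (4 + \<eta>) (1 / \<eta>)"
proof -
  let ?b = "bb (Suc k)" and ?a = "aa k"
  let ?H = "horiz (2 / ?a + \<eta>) (1 / \<eta>)" and ?V = "vert (4 + \<eta>) (1 / \<eta>)"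
  have ab: "0 < ?b" "?b < ?a" "?a \<le> 1" using bb_pos bb_Suc_less_aa[of k] aa_less_bb[of k] bb_le[of k] by auto
  have pw: "ennreal ((cmod (\<phi> (mk x y)))\<^sup>2) * (indicator \<Omega>0 (mk x y) * indicator {- ?b..?b} x)
      \<le> ?H y * indicator {- ?b..?b} x + ?V x * indicator {- 1..- 1 + 3 * ?b} y" for x y
  proof (cases "mk x y \<in> \<Omega>0 \<and> x \<in> {- ?b..?b}")
    case True
    then have p: "\<bar>x\<bar> < 1" "hh x < y" "y < 1" "\<bar>x\<bar> \<le> ?b" by (auto simp: \<Omega>0_def)
    show ?thesis
    proof (cases "hh ?a < y")
      case big: True
      have "hh t < y" if "\<bar>t\<bar> < ?a" for t using hh_mono[of t ?a] that big by simp
      then have "ennreal ((cmod (\<phi> (mk x y)))\<^sup>2) \<le> ?H y"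
        using p ab aa_pos by (intro horizontal_point \<eta>) auto
      then show ?thesis using True by (auto simp: indicator_def intro: add_increasing2)
    next
      case False
      have "y \<le> - 1 + 3 * ?b" using False hh_gap[of k] hh_le_lin[of ?b] ab by simp
      moreover have "- 1 \<le> y" using hh_ge[of x] p by simp
      moreover have "ennreal ((cmod (\<phi> (mk x y)))\<^sup>2) \<le> ?V x" using True by (intro vertical_point \<eta>) auto
      ultimately show ?thesis using True by (auto simp: indicator_def intro: add_increasing)
    qed
  qed (auto simp: indicator_def)
  have "strip ?b = (\<integral>\<^sup>+x. \<integral>\<^sup>+y. ennreal ((cmod (\<phi> (mk x y)))\<^sup>2) * (indicator \<Omega>0 (mk x y) * indicator {- ?b..?b} x) \<partial>lborel \<partial>lborel)"
    unfolding strip_def by (subst nn_integral_R2(1)) auto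
  also have "\<dots> \<le> (\<integral>\<^sup>+x. \<integral>\<^sup>+y. ?H y * indicator {- ?b..?b} x + ?V x * indicator {- 1..- 1 + 3 * ?b} y \<partial>lborel \<partial>lborel)"
    by (intro nn_integral_mono pw)
  also have "\<dots> = (\<integral>\<^sup>+x. (\<integral>\<^sup>+y. ?H y \<partial>lborel) * indicator {- ?b..?b} x + ?V x * ennreal (3 * ?b) \<partial>lborel)"
    using ab by (simp add: nn_integral_add nn_integral_multc nn_integral_cmult_indicator)
  also have "\<dots> = (\<integral>\<^sup>+y. ?H y \<partial>lborel) * ennreal (2 * ?b) + (\<integral>\<^sup>+x. ?V x \<partial>lborel) * ennreal (3 * ?b)"
    using ab by (simp add: nn_integral_add nn_integral_multc nn_integral_cmult_indicator)
  finally show ?thesis by (simp add: horiz_vol vert_vol mult.commute)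
qed

end

section \<open>Arc length on the boundary\<close>

lemma surface_\<Omega>0: "surface_on \<Omega>0 = restrict_space (hausdorff_measure 1) (frontier \<Omega>0)"
  by (simp add: surface_on_def)

lemma borel_frontier_\<Omega>0 [measurable]: "frontier \<Omega>0 \<in> sets borel" by simp

lemma nn_surface: "(\<integral>\<^sup>+p. f p \<partial>surface_on \<Omega>0) = (\<integral>\<^sup>+p. f p * indicator (frontier \<Omega>0) p \<partial>hausdorff_measure 1)"
  unfolding surface_\<Omega>0 by (rule nn_integral_restrict_space) simp

lemma measurable_surface: "f \<in> borel_measurable borel \<Longrightarrow> f \<in> borel_measurable (surface_on \<Omega>0)"
  unfolding surface_\<Omega>0 by (rule measurable_restrict_space1) (simp add: measurable_cong_sets[OF sets_hausdorff_measure refl])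

lemma dist_mk: "dist (mk x y) (mk x' y') \<le> \<bar>x - x'\<bar> + \<bar>y - y'\<bar>"
  unfolding dist_norm norm_vec2 using sqrt_sum_squares_le_sum_abs[of "x - x'" "y - y'"] by simp

text \<open>The form of the curve comparison in which arc length is dominated by a bounded density;
  on the bottom this is 1 off the steep set and 4 on it, which explains the bound 4.\<close>

lemma curve_weight_le:
  fixes \<gamma> :: "real \<Rightarrow> real^2" and w :: "real \<Rightarrow> ennreal" and f :: "real^2 \<Rightarrow> ennreal"
  assumes cd: "c < d" and w [measurable]: "w \<in> borel_measurable borel" and w_le: "\<And>t. w t \<le> 4"
    and lip: "\<And>s t. \<lbrakk>c \<le> s; s \<le> t; t \<le> d\<rbrakk> \<Longrightarrow> ennreal (dist (\<gamma> s) (\<gamma> t)) \<le> (\<integral>\<^sup>+x. w x * indicator {s..t} x \<partial>lborel)"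
    and \<gamma>: "continuous_on UNIV \<gamma>" and f [measurable]: "f \<in> borel_measurable borel"
  shows "(\<integral>\<^sup>+p. f p * indicator (\<gamma> ` {c..d}) p \<partial>hausdorff_measure 1) \<le> (\<integral>\<^sup>+t. f (\<gamma> t) * w t * indicator {c..d} t \<partial>lborel)"
proof -
  let ?\<mu> = "density lborel (\<lambda>t. w t * indicator {c..d} t)"
  have [measurable]: "\<gamma> \<in> borel_measurable borel" using \<gamma> by (rule borel_measurable_continuous_onI)
  have em: "emeasure ?\<mu> A = (\<integral>\<^sup>+x. w x * indicator {c..d} x * indicator A x \<partial>lborel)" if "A \<in> sets borel" for A
    using that by (subst emeasure_density) auto
  have fin: "finite_measure ?\<mu>"
  proof (rule finite_measureI)
    have "emeasure ?\<mu> UNIV = (\<integral>\<^sup>+x. w x * indicator {c..d} x * indicator UNIV x \<partial>lborel)" by (rule em) simp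
    also have "\<dots> \<le> (\<integral>\<^sup>+x. 4 * indicator {c..d} x \<partial>lborel)"
      using w_le by (intro nn_integral_mono) (auto simp: indicator_def)
    also have "\<dots> = 4 * ennreal (d - c)" using cd by (simp add: nn_integral_cmult_indicator)
    also have "\<dots> < \<infinity>" by (simp add: ennreal_mult_less_top)
    finally show "emeasure ?\<mu> (space ?\<mu>) \<noteq> \<infinity>" by simp
  qed
  have lip': "ennreal (dist (\<gamma> s) (\<gamma> t)) \<le> emeasure ?\<mu> {s..t}" if "c \<le> s" "s \<le> t" "t \<le> d" for s t
  proof -
    have "(\<integral>\<^sup>+x. w x * indicator {s..t} x \<partial>lborel) = emeasure ?\<mu> {s..t}"
      unfolding em[OF atLeastAtMost_borel] using that by (intro nn_integral_cong) (auto simp: indicator_def)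
    then show ?thesis using lip[OF that] by simp
  qed
  have W: "emeasure ?\<mu> {s..t} \<le> ennreal (4 * (t - s))" if "s \<le> t" for s t
  proof -
    have "emeasure ?\<mu> {s..t} \<le> (\<integral>\<^sup>+x. 4 * indicator {s..t} x \<partial>lborel)"
      unfolding em[OF atLeastAtMost_borel] using w_le by (intro nn_integral_mono) (auto simp: indicator_def)
    also have "\<dots> = 4 * ennreal (t - s)" using that by (simp add: nn_integral_cmult_indicator)
    also have "\<dots> = ennreal (4 * (t - s))" using that by (subst ennreal_mult) auto
    finally show ?thesis .
  qed
  have C: "\<gamma> ` {c..d} \<in> sets borel"
    by (intro borel_closed compact_imp_closed compact_continuous_image continuous_on_subset[OF \<gamma>]) auto
  have "(\<integral>\<^sup>+p. f p * indicator (\<gamma> ` {c..d}) p \<partial>hausdorff_measure 1) \<le> (\<integral>\<^sup>+t. f (\<gamma> t) * indicator {c..d} t \<partial>?\<mu>)"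
    by (rule hausdorff_integral_curve_le[where W = 4 and c = c and d = d]) (use cd fin lip' W C in auto)
  also have "\<dots> = (\<integral>\<^sup>+t. (w t * indicator {c..d} t) * (f (\<gamma> t) * indicator {c..d} t) \<partial>lborel)"
    by (rule nn_integral_density) auto
  also have "\<dots> = (\<integral>\<^sup>+t. f (\<gamma> t) * w t * indicator {c..d} t \<partial>lborel)"
    by (intro nn_integral_cong) (auto simp: indicator_def mult_ac)
  finally show ?thesis .
qed

lemma curve_le:
  fixes \<gamma> :: "real \<Rightarrow> real^2" and f :: "real^2 \<Rightarrow> ennreal"
  assumes cd: "c < d" and lip: "\<And>s t. s \<le> t \<Longrightarrow> dist (\<gamma> s) (\<gamma> t) \<le> t - s"
    and \<gamma>: "continuous_on UNIV \<gamma>" and f: "f \<in> borel_measurable borel"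
  shows "(\<integral>\<^sup>+p. f p * indicator (\<gamma> ` {c..d}) p \<partial>hausdorff_measure 1) \<le> (\<integral>\<^sup>+t. f (\<gamma> t) * indicator {c..d} t \<partial>lborel)"
proof -
  have "(\<integral>\<^sup>+p. f p * indicator (\<gamma> ` {c..d}) p \<partial>hausdorff_measure 1) \<le> (\<integral>\<^sup>+t. f (\<gamma> t) * 1 * indicator {c..d} t \<partial>lborel)"
  proof (rule curve_weight_le[OF cd _ _ _ \<gamma> f])
    fix s t :: real assume st: "s \<le> t"
    have "ennreal (dist (\<gamma> s) (\<gamma> t)) \<le> ennreal (t - s)" using lip[OF st] by (rule ennreal_leI)
    then show "ennreal (dist (\<gamma> s) (\<gamma> t)) \<le> (\<integral>\<^sup>+x. 1 * indicator {s..t} x \<partial>lborel)" using st by simp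
  qed auto
  then show ?thesis by simp
qed

text \<open>The left side bounds arc length by horizontal plus vertical increment. The crude weight
  1 + 3 over steep intervals, instead of sqrt 10, separates into a part suited to vertical lines and
  a part suited to horizontal lines.\<close>

lemma bottom_length:
  assumes st: "0 \<le> s" "s \<le> t"
  shows "ennreal ((t - s) + (hh t - hh s)) \<le> (\<integral>\<^sup>+x. (1 + 3 * indicator steep_set x) * indicator {s..t} x \<partial>lborel)"
proof -
  have fin: "emeasure lborel (steep_set \<inter> {s<..t}) \<noteq> \<infinity>"
  proof -
    have "emeasure lborel (steep_set \<inter> {s<..t}) \<le> emeasure lborel {s<..t}" by (intro emeasure_mono) auto
    also have "\<dots> < \<infinity>" using st by simp
    finally show ?thesis by simp
  qed
  have "ennreal ((t - s) + (hh t - hh s)) = ennreal (t - s) + 3 * ennreal (measure lborel (steep_set \<inter> {s<..t}))"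
    using st hh_diff[of s t] by (simp add: ennreal_mult ennreal_plus)
  also have "\<dots> = emeasure lborel {s..t} + 3 * emeasure lborel (steep_set \<inter> {s<..t})"
    using st fin by (simp add: emeasure_eq_ennreal_measure)
  also have "\<dots> \<le> emeasure lborel {s..t} + 3 * emeasure lborel (steep_set \<inter> {s..t})"
    by (intro add_mono mult_left_mono emeasure_mono) auto
  also have "\<dots> = (\<integral>\<^sup>+x. indicator {s..t} x + 3 * indicator (steep_set \<inter> {s..t}) x \<partial>lborel)"
    by (simp add: nn_integral_add nn_integral_cmult_indicator)
  also have "\<dots> = (\<integral>\<^sup>+x. (1 + 3 * indicator steep_set x) * indicator {s..t} x \<partial>lborel)"
    by (intro nn_integral_cong) (auto simp: indicator_def)
  finally show ?thesis .
qed

lemma frontier_\<Omega>0_subset: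
  "frontier \<Omega>0 \<subseteq> (\<lambda>x. mk x (hh x)) ` {0..1} \<union> (\<lambda>x. mk (- x) (hh x)) ` {0..1} \<union> (\<lambda>x. mk x 1) ` {0..1} \<union> (\<lambda>x. mk (- x) 1) ` {0..1}
    \<union> (\<lambda>y. mk 1 y) ` {hh 1..1} \<union> (\<lambda>y. mk (- 1) y) ` {hh 1..1}"
proof
  fix p assume "p \<in> frontier \<Omega>0"
  then have p: "\<bar>p $ 1\<bar> \<le> 1" "hh (p $ 1) \<le> p $ 2" "p $ 2 \<le> 1" "p \<notin> \<Omega>0" by (auto simp: frontier_\<Omega>0_iff)
  have eta: "p = mk (p $ 1) (p $ 2)" by (simp add: mk_eta)
  consider "\<bar>p $ 1\<bar> = 1" | "p $ 2 = hh (p $ 1)" | "p $ 2 = 1" using p by (force simp: \<Omega>0_def)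
  then show "p \<in> (\<lambda>x. mk x (hh x)) ` {0..1} \<union> (\<lambda>x. mk (- x) (hh x)) ` {0..1} \<union> (\<lambda>x. mk x 1) ` {0..1} \<union> (\<lambda>x. mk (- x) 1) ` {0..1}
    \<union> (\<lambda>y. mk 1 y) ` {hh 1..1} \<union> (\<lambda>y. mk (- 1) y) ` {hh 1..1}"
  proof cases
    case 1
    then have h: "hh 1 \<le> p $ 2" using p(2) hh_abs[of "p $ 1"] by simp
    from 1 consider "p $ 1 = 1" | "p $ 1 = - 1" by linarith
    then show ?thesis
    proof cases
      case 1 then have "p \<in> (\<lambda>y. mk 1 y) ` {hh 1..1}" using eta h p(3) by (intro image_eqI[of _ _ "p $ 2"]) auto
      then show ?thesis by blast
    next
      case 2 then have "p \<in> (\<lambda>y. mk (- 1) y) ` {hh 1..1}" using eta h p(3) by (intro image_eqI[of _ _ "p $ 2"]) auto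
      then show ?thesis by blast
    qed
  next
    case 2
    show ?thesis
    proof (cases "0 \<le> p $ 1")
      case True then have "p \<in> (\<lambda>x. mk x (hh x)) ` {0..1}" using eta 2 p(1) by (intro image_eqI[of _ _ "p $ 1"]) auto
      then show ?thesis by blast
    next
      case False then have "p \<in> (\<lambda>x. mk (- x) (hh x)) ` {0..1}"
        using eta 2 p(1) by (intro image_eqI[of _ _ "- p $ 1"]) (auto simp: hh_even)
      then show ?thesis by blast
    qed
  next
    case 3
    show ?thesis
    proof (cases "0 \<le> p $ 1")
      case True then have "p \<in> (\<lambda>x. mk x 1) ` {0..1}" using eta 3 p(1) by (intro image_eqI[of _ _ "p $ 1"]) auto
      then show ?thesis by blast
    next
      case False then have "p \<in> (\<lambda>x. mk (- x) 1) ` {0..1}"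
        using eta 3 p(1) by (intro image_eqI[of _ _ "- p $ 1"]) auto
      then show ?thesis by blast
    qed
  qed
qed

lemma mk_curves_cont: "continuous_on UNIV (\<lambda>x. mk x (hh x))" "continuous_on UNIV (\<lambda>x. mk (- x) (hh x))"
  "continuous_on UNIV (\<lambda>x. mk x y)" "continuous_on UNIV (\<lambda>x. mk (- x) y)" "continuous_on UNIV (\<lambda>y. mk x y)"
  unfolding mk_axis by (intro continuous_intros hh_continuous)+

lemma bottom_curve_le:
  assumes f: "f \<in> borel_measurable borel" and \<sigma>: "\<sigma> = 1 \<or> \<sigma> = - 1"
  shows "(\<integral>\<^sup>+p. f p * indicator ((\<lambda>x. mk (\<sigma> * x) (hh x)) ` {0..1}) p \<partial>hausdorff_measure 1)
    \<le> (\<integral>\<^sup>+x. f (mk (\<sigma> * x) (hh x)) * (1 + 3 * indicator steep_set x) * indicator {0..1} x \<partial>lborel)"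
proof (rule curve_weight_le[OF _ _ _ _ _ f])
  show "1 + 3 * indicator steep_set t \<le> (4 :: ennreal)" for t by (simp add: indicator_def)
  show "continuous_on UNIV (\<lambda>x. mk (\<sigma> * x) (hh x))" using \<sigma> mk_curves_cont by auto
  fix s t :: real assume st: "0 \<le> s" "s \<le> t"
  have "dist (mk (\<sigma> * s) (hh s)) (mk (\<sigma> * t) (hh t)) \<le> \<bar>\<sigma> * s - \<sigma> * t\<bar> + \<bar>hh s - hh t\<bar>" by (rule dist_mk)
  also have "\<bar>\<sigma> * s - \<sigma> * t\<bar> = t - s" using \<sigma> st by auto
  also have "\<bar>hh s - hh t\<bar> = hh t - hh s" using hh_mono[of s t] st by simp
  finally show "ennreal (dist (mk (\<sigma> * s) (hh s)) (mk (\<sigma> * t) (hh t))) \<le> (\<integral>\<^sup>+x. (1 + 3 * indicator steep_set x) * indicator {s..t} x \<partial>lborel)"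
    using order_trans[OF ennreal_leI bottom_length[OF st]] by blast
qed auto

context smooth_fun
begin

abbreviation "sq p \<equiv> ennreal ((cmod (\<phi> p))\<^sup>2)"

lemma pair_integral:
  fixes \<gamma> \<gamma>' :: "real \<Rightarrow> real^2"
  assumes [measurable]: "\<gamma> \<in> borel_measurable borel" "\<gamma>' \<in> borel_measurable borel" "w \<in> borel_measurable borel"
  shows "(\<integral>\<^sup>+x. sq (\<gamma> x) * w x \<partial>lborel) + (\<integral>\<^sup>+x. sq (\<gamma>' x) * w x \<partial>lborel)
    = (\<integral>\<^sup>+x. ennreal ((cmod (\<phi> (\<gamma> x)))\<^sup>2 + (cmod (\<phi> (\<gamma>' x)))\<^sup>2) * w x \<partial>lborel)"
  by (subst nn_integral_add[symmetric]) (auto simp: distrib_right)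

lemma surface_le:
  "(\<integral>\<^sup>+p. sq p \<partial>surface_on \<Omega>0) \<le> (\<integral>\<^sup>+x. bot2 x * ((1 + 3 * indicator steep_set x) * indicator {0..1} x) \<partial>lborel)
     + (\<integral>\<^sup>+x. top2 x * indicator {0..1} x \<partial>lborel) + (\<integral>\<^sup>+y. side2 y * indicator {hh 1..1} y \<partial>lborel)"
proof -
  define C where "C = (\<lambda>\<sigma>. (\<lambda>x. mk (\<sigma> * x) (hh x)) ` {0..1})"
  define E where "E = (\<lambda>\<sigma>. (\<lambda>x. mk (\<sigma> * x) 1) ` {0..1})"
  define F where "F = (\<lambda>\<sigma>. (\<lambda>y. mk \<sigma> y) ` {hh 1..1})"
  have cont: "continuous_on UNIV (\<lambda>x. mk (\<sigma> * x) (hh x))" "continuous_on UNIV (\<lambda>x. mk (\<sigma> * x) 1)" for \<sigma>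
    unfolding mk_axis by (intro continuous_intros hh_continuous)+
  have [measurable]: "C \<sigma> \<in> sets borel" "E \<sigma> \<in> sets borel" "F \<sigma> \<in> sets borel" for \<sigma>
    unfolding C_def E_def F_def
    by (intro borel_closed compact_imp_closed compact_continuous_image
        continuous_on_subset[OF cont(1)] continuous_on_subset[OF cont(2)] continuous_on_subset[OF mk_curves_cont(5)]; simp)+
  let ?H = "\<lambda>A. \<integral>\<^sup>+p. sq p * indicator A p \<partial>hausdorff_measure 1"
  have "(\<integral>\<^sup>+p. sq p \<partial>surface_on \<Omega>0) \<le> (\<integral>\<^sup>+p. sq p * indicator (C 1) p + sq p * indicator (C (-1)) p + (sq p * indicator (E 1) p + sq p * indicator (E (-1)) p)
       + (sq p * indicator (F 1) p + sq p * indicator (F (-1)) p) \<partial>hausdorff_measure 1)"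
    unfolding nn_surface
  proof (rule nn_integral_mono)
    fix p
    have "p \<in> C 1 \<or> p \<in> C (-1) \<or> p \<in> E 1 \<or> p \<in> E (-1) \<or> p \<in> F 1 \<or> p \<in> F (-1)" if "p \<in> frontier \<Omega>0"
      using frontier_\<Omega>0_subset that unfolding C_def E_def F_def by auto
    then show "sq p * indicator (frontier \<Omega>0) p \<le> sq p * indicator (C 1) p + sq p * indicator (C (-1)) p + (sq p * indicator (E 1) p + sq p * indicator (E (-1)) p)
       + (sq p * indicator (F 1) p + sq p * indicator (F (-1)) p)"
      by (cases "p \<in> frontier \<Omega>0") (auto simp: add_increasing add_increasing2)
  qed
  also have "\<dots> = ?H (C 1) + ?H (C (-1)) + (?H (E 1) + ?H (E (-1))) + (?H (F 1) + ?H (F (-1)))"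
    by (simp add: nn_integral_add)
  also have "\<dots> \<le> (\<integral>\<^sup>+x. bot2 x * ((1 + 3 * indicator steep_set x) * indicator {0..1} x) \<partial>lborel)
     + (\<integral>\<^sup>+x. top2 x * indicator {0..1} x \<partial>lborel) + (\<integral>\<^sup>+y. side2 y * indicator {hh 1..1} y \<partial>lborel)"
  proof (intro add_mono)
    let ?w = "\<lambda>x. (1 + 3 * indicator steep_set x) * indicator {0..1} x :: ennreal"
    have "?H (C 1) + ?H (C (-1)) \<le> (\<integral>\<^sup>+x. sq (mk x (hh x)) * ?w x \<partial>lborel) + (\<integral>\<^sup>+x. sq (mk (- x) (hh x)) * ?w x \<partial>lborel)"
      unfolding C_def using bottom_curve_le[of sq 1] bottom_curve_le[of sq "-1"] by (intro add_mono) (simp_all add: mult.assoc)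
    also have "\<dots> = (\<integral>\<^sup>+x. bot2 x * ?w x \<partial>lborel)" unfolding bot2_def by (rule pair_integral) measurable
    finally show "?H (C 1) + ?H (C (-1)) \<le> (\<integral>\<^sup>+x. bot2 x * ?w x \<partial>lborel)" .
    have "?H (E \<sigma>) \<le> (\<integral>\<^sup>+x. sq (mk (\<sigma> * x) 1) * indicator {0..1} x \<partial>lborel)" if \<sigma>: "\<sigma> = 1 \<or> \<sigma> = - 1" for \<sigma>
      unfolding E_def
    proof (rule curve_le[OF _ _ cont(2)])
      fix s t :: real assume "s \<le> t"
      then show "dist (mk (\<sigma> * s) 1) (mk (\<sigma> * t) 1) \<le> t - s" using dist_mk[of "\<sigma> * s" 1 "\<sigma> * t" 1] \<sigma> by auto
    qed auto
    from this[of 1] this[of "-1"]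
    have "?H (E 1) + ?H (E (-1)) \<le> (\<integral>\<^sup>+x. sq (mk x 1) * indicator {0..1} x \<partial>lborel) + (\<integral>\<^sup>+x. sq (mk (- x) 1) * indicator {0..1} x \<partial>lborel)"
      by (intro add_mono) simp_all
    also have "\<dots> = (\<integral>\<^sup>+x. top2 x * indicator {0..1} x \<partial>lborel)" unfolding top2_def by (rule pair_integral) measurable
    finally show "?H (E 1) + ?H (E (-1)) \<le> (\<integral>\<^sup>+x. top2 x * indicator {0..1} x \<partial>lborel)" .
    have "?H (F \<sigma>) \<le> (\<integral>\<^sup>+y. sq (mk \<sigma> y) * indicator {hh 1..1} y \<partial>lborel)" for \<sigma>
      unfolding F_def
    proof (rule curve_le[OF _ _ mk_curves_cont(5)])
      show "hh 1 < 1" using hh_le[of 1] by simp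
      fix s t :: real assume "s \<le> t"
      then show "dist (mk \<sigma> s) (mk \<sigma> t) \<le> t - s" using dist_mk[of \<sigma> s \<sigma> t] by auto
    qed auto
    from this[of 1] this[of "-1"]
    have "?H (F 1) + ?H (F (-1)) \<le> (\<integral>\<^sup>+y. sq (mk 1 y) * indicator {hh 1..1} y \<partial>lborel) + (\<integral>\<^sup>+y. sq (mk (- 1) y) * indicator {hh 1..1} y \<partial>lborel)"
      by (intro add_mono)
    also have "\<dots> = (\<integral>\<^sup>+y. side2 y * indicator {hh 1..1} y \<partial>lborel)" unfolding side2_def by (rule pair_integral) measurable
    finally show "?H (F 1) + ?H (F (-1)) \<le> (\<integral>\<^sup>+y. side2 y * indicator {hh 1..1} y \<partial>lborel)" .
  qed
  finally show ?thesis .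
qed

text \<open>Over the steep intervals with index above \<open>k\<close> the horizontal estimate degenerates; this part of
  the boundary is short, and is bounded through the mass in a thin vertical strip instead.\<close>

definition tiny :: "nat \<Rightarrow> ennreal" where
  "tiny k = (\<integral>\<^sup>+x. bot2 x * indicator {0..bb (Suc k)} x \<partial>lborel)"

text \<open>The weight 1 on the bottom, together with the top, is covered by vertical lines; the
  weight 3 over the steep intervals up to index k, together with the sides, by horizontal lines of
  half-length at least \<open>aa k\<close>. The intervals of higher index all lie in |x| <=
  \<open>bb (Suc k)\<close> and are left to \<open>tiny\<close>.\<close>

lemma surface_level:
  assumes \<eta>: "0 < \<eta>"
  shows "(\<integral>\<^sup>+p. sq p \<partial>surface_on \<Omega>0) \<le> vol 2 (2 + \<eta>) (1 / \<eta>) + vol 1 (1 / aa k + \<eta>) (1 / \<eta>) + 3 * tiny k"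
proof -
  let ?b = "bb (Suc k)"
  let ?O = "\<lambda>j. \<integral>\<^sup>+x. bot2 x * indicator {aa j<..<bb j} x \<partial>lborel"
  let ?B = "\<integral>\<^sup>+x. bot2 x * indicator {0..1} x \<partial>lborel" and ?T = "\<integral>\<^sup>+x. top2 x * indicator {0..1} x \<partial>lborel"
  let ?S = "\<integral>\<^sup>+y. side2 y * indicator {hh 1..1} y \<partial>lborel"
  have "(\<integral>\<^sup>+x. bot2 x * ((1 + 3 * indicator steep_set x) * indicator {0..1} x) \<partial>lborel)
      \<le> (\<integral>\<^sup>+x. bot2 x * indicator {0..1} x + (\<Sum>j\<le>k. 3 * (bot2 x * indicator {aa j<..<bb j} x)) + 3 * (bot2 x * indicator {0..?b} x) \<partial>lborel)"
  proof (rule nn_integral_mono_AE)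
    \<comment> \<open>The open intervals in the sum miss only the end points, a countable
      set.\<close>
    have "AE x in lborel. \<forall>j. x \<noteq> aa j \<and> x \<noteq> bb j"
      unfolding AE_all_countable by (intro allI AE_conjI AE_lborel_singleton)
    then show "AE x in lborel. bot2 x * ((1 + 3 * indicator steep_set x) * indicator {0..1} x)
      \<le> bot2 x * indicator {0..1} x + (\<Sum>j\<le>k. 3 * (bot2 x * indicator {aa j<..<bb j} x)) + 3 * (bot2 x * indicator {0..?b} x)"
    proof eventually_elim
      case (elim x)
      have "indicator steep_set x \<le> (\<Sum>j\<le>k. indicator {aa j<..<bb j} x) + (indicator {0..?b} x :: ennreal)"
      proof (cases "x \<in> steep_set")
        case True
        then obtain j where "aa j \<le> x" "x \<le> bb j" by (auto simp: steep_set_def)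
        then have j: "aa j < x" "x < bb j" using elim by (auto simp: order_le_less)
        show ?thesis
        proof (cases "j \<le> k")
          case True
          then have "indicator {aa j<..<bb j} x \<le> (\<Sum>j\<le>k. indicator {aa j<..<bb j} x :: ennreal)"
            by (intro member_le_sum) auto
          then show ?thesis using j by (simp add: indicator_def[of steep_set] add_increasing2)
        next
          case False
          then have "bb j \<le> ?b" by (intro bb_antimono) simp
          then have "x \<in> {0..?b}" using j aa_pos[of j] by simp
          then show ?thesis by (simp add: indicator_def[of steep_set] add_increasing)
        qed
      qed simp
      then have "bot2 x * (3 * indicator steep_set x) \<le> bot2 x * (3 * ((\<Sum>j\<le>k. indicator {aa j<..<bb j} x) + indicator {0..?b} x))"
        by (intro mult_left_mono) auto
      also have "\<dots> = (\<Sum>j\<le>k. 3 * (bot2 x * indicator {aa j<..<bb j} x)) + 3 * (bot2 x * indicator {0..?b} x)"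
      proof -
        have "b * (3 * ((\<Sum>j\<le>k. f j) + t)) = (\<Sum>j\<le>k. 3 * (b * f j)) + 3 * (b * t)" for b t :: ennreal and f :: "nat \<Rightarrow> ennreal"
          by (simp add: sum_distrib_left distrib_left mult_ac)
        then show ?thesis .
      qed
      finally have le: "bot2 x * (3 * indicator steep_set x) \<le> (\<Sum>j\<le>k. 3 * (bot2 x * indicator {aa j<..<bb j} x)) + 3 * (bot2 x * indicator {0..?b} x)" .
      have "bot2 x * ((1 + 3 * indicator steep_set x) * indicator {0..1} x)
          \<le> bot2 x * indicator {0..1} x + bot2 x * (3 * indicator steep_set x)"
        by (auto simp: indicator_def distrib_left)
      also have "\<dots> \<le> bot2 x * indicator {0..1} x + ((\<Sum>j\<le>k. 3 * (bot2 x * indicator {aa j<..<bb j} x)) + 3 * (bot2 x * indicator {0..?b} x))"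
        by (intro add_left_mono le)
      finally show ?case by (simp add: add.assoc)
    qed
  qed
  also have "\<dots> = (\<integral>\<^sup>+x. bot2 x * indicator {0..1} x + (\<Sum>j\<le>k. 3 * (bot2 x * indicator {aa j<..<bb j} x)) \<partial>lborel)
      + (\<integral>\<^sup>+x. 3 * (bot2 x * indicator {0..?b} x) \<partial>lborel)"
    by (rule nn_integral_add) measurable
  also have "(\<integral>\<^sup>+x. 3 * (bot2 x * indicator {0..?b} x) \<partial>lborel) = 3 * tiny k"
    unfolding tiny_def by (rule nn_integral_cmult) measurable
  also have "(\<integral>\<^sup>+x. bot2 x * indicator {0..1} x + (\<Sum>j\<le>k. 3 * (bot2 x * indicator {aa j<..<bb j} x)) \<partial>lborel)
      = ?B + (\<integral>\<^sup>+x. (\<Sum>j\<le>k. 3 * (bot2 x * indicator {aa j<..<bb j} x)) \<partial>lborel)"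
    by (rule nn_integral_add) measurable
  also have "(\<integral>\<^sup>+x. (\<Sum>j\<le>k. 3 * (bot2 x * indicator {aa j<..<bb j} x)) \<partial>lborel)
      = (\<Sum>j\<le>k. \<integral>\<^sup>+x. 3 * (bot2 x * indicator {aa j<..<bb j} x) \<partial>lborel)"
    by (rule nn_integral_sum) measurable
  also have "\<dots> = (\<Sum>j\<le>k. 3 * ?O j)"
    by (intro sum.cong refl nn_integral_cmult) measurable
  finally have "(\<integral>\<^sup>+p. sq p \<partial>surface_on \<Omega>0) \<le> (?B + (\<Sum>j\<le>k. 3 * ?O j) + 3 * tiny k) + ?T + ?S"
    using order_trans[OF surface_le] by (meson add_right_mono)
  also have "\<dots> = (?B + ?T) + ((\<Sum>j\<le>k. 3 * ?O j) + ?S) + 3 * tiny k" by (simp add: ac_simps)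
  also have "\<dots> \<le> vol 2 (2 + \<eta>) (1 / \<eta>) + vol 1 (1 / aa k + \<eta>) (1 / \<eta>) + 3 * tiny k"
  proof (intro add_mono order_refl steep_side_le \<eta>)
    have "?B + ?T = (\<integral>\<^sup>+x. (bot2 x + top2 x) * indicator {0..1} x \<partial>lborel)"
      by (simp add: nn_integral_add distrib_right)
    also have "\<dots> \<le> (\<integral>\<^sup>+x. vert (2 + \<eta>) (1 / \<eta>) x * indicator {- 1..1} x \<partial>lborel)" by (rule bot_top_le[OF \<eta>]) auto
    also have "\<dots> \<le> (\<integral>\<^sup>+x. vert (2 + \<eta>) (1 / \<eta>) x \<partial>lborel)" by (intro nn_integral_mono) (simp add: indicator_def)
    finally show "?B + ?T \<le> vol 2 (2 + \<eta>) (1 / \<eta>)" by (simp add: vert_vol)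
  qed
  finally show ?thesis .
qed

lemma tiny_le_vert:
  assumes \<eta>: "0 < \<eta>"
  shows "tiny k \<le> (\<integral>\<^sup>+x. vert (2 + \<eta>) (1 / \<eta>) x * indicator {- bb (Suc k)..bb (Suc k)} x \<partial>lborel)"
proof -
  have "tiny k \<le> (\<integral>\<^sup>+x. (bot2 x + top2 x) * indicator {0..bb (Suc k)} x \<partial>lborel)"
    unfolding tiny_def by (intro nn_integral_mono mult_right_mono) auto
  also have "\<dots> \<le> (\<integral>\<^sup>+x. vert (2 + \<eta>) (1 / \<eta>) x * indicator {- bb (Suc k)..bb (Suc k)} x \<partial>lborel)"
    using bb_le[of "Suc k"] bb_pos[of "Suc k"] by (intro bot_top_le \<eta>) auto
  finally show ?thesis .
qed

lemma tiny_crude: "0 < \<eta> \<Longrightarrow> tiny k \<le> vol 2 (2 + \<eta>) (1 / \<eta>)"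
  unfolding vert_vol by (rule order_trans[OF tiny_le_vert]) (auto intro!: nn_integral_mono simp: indicator_def)

text \<open>Only the mass term has to be confined to the strip; the derivative term is affordable on
  all of \<open>\<Omega>0\<close>, since its factor 1 / \<eta> becomes small for large
  \<eta>.\<close>

lemma tiny_strip:
  assumes \<eta>: "0 < \<eta>"
  shows "tiny k \<le> ennreal (2 + \<eta>) * strip (bb (Suc k)) + vol 2 0 (1 / \<eta>)"
proof -
  let ?I = "\<lambda>p. indicator {- bb (Suc k)..bb (Suc k)} (p $ 1) :: ennreal"
  have "tiny k \<le> (\<integral>\<^sup>+x. vert (2 + \<eta>) (1 / \<eta>) x * indicator {- bb (Suc k)..bb (Suc k)} x \<partial>lborel)"
    by (rule tiny_le_vert[OF \<eta>])
  also have "\<dots> = (\<integral>\<^sup>+x. \<integral>\<^sup>+y. ennreal (W 2 (2 + \<eta>) (1 / \<eta>) (mk x y)) * indicator \<Omega>0 (mk x y) * ?I (mk x y) \<partial>lborel \<partial>lborel)"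
    unfolding vert_def by (intro nn_integral_cong) (simp add: nn_integral_multc)
  also have "\<dots> = (\<integral>\<^sup>+p. ennreal (W 2 (2 + \<eta>) (1 / \<eta>) p) * indicator \<Omega>0 p * ?I p \<partial>lborel)"
    by (rule nn_integral_R2(1)[symmetric]) measurable
  also have "\<dots> \<le> (\<integral>\<^sup>+p. ennreal (2 + \<eta>) * (sq p * (indicator \<Omega>0 p * ?I p)) + ennreal (W 2 0 (1 / \<eta>) p) * indicator \<Omega>0 p \<partial>lborel)"
  proof (rule nn_integral_mono)
    fix p
    have "ennreal (W 2 (2 + \<eta>) (1 / \<eta>) p) = ennreal (2 + \<eta>) * sq p + ennreal (W 2 0 (1 / \<eta>) p)"
      using \<eta> by (simp add: W_def ennreal_mult)
    then show "ennreal (W 2 (2 + \<eta>) (1 / \<eta>) p) * indicator \<Omega>0 p * ?I p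
        \<le> ennreal (2 + \<eta>) * (sq p * (indicator \<Omega>0 p * ?I p)) + ennreal (W 2 0 (1 / \<eta>) p) * indicator \<Omega>0 p"
      by (auto simp: indicator_def)
  qed
  also have "\<dots> = ennreal (2 + \<eta>) * strip (bb (Suc k)) + vol 2 0 (1 / \<eta>)"
    unfolding strip_def vol_def by (subst nn_integral_add) (auto simp: nn_integral_cmult)
  finally show ?thesis .
qed

end

section \<open>Lower bounds for the energy\<close>

interpretation sd: star_domain \<Omega>0 10 "1 / 20"
proof
  show "(1 - 10 * e) *\<^sub>R x + e *\<^sub>R z \<in> \<Omega>0" if "x \<in> \<Omega>0" "0 < e" "e \<le> 1 / 20" "norm z \<le> 1" for x e z
    using that by (rule shrink_\<Omega>0)
qed (use open_\<Omega>0 bounded_\<Omega>0 zero_in_\<Omega>0 in auto)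

abbreviation "V0 \<equiv> volume_on \<Omega>0"

abbreviation "S0 \<equiv> surface_on \<Omega>0"

context smooth_fun
begin

definition n0 :: real where "n0 = (L2_norm V0 \<phi>)\<^sup>2"

definition d0 :: "2 \<Rightarrow> real" where "d0 i = (L2_norm V0 (D i))\<^sup>2"

lemma n0_nonneg: "0 \<le> n0" "0 \<le> d0 i" by (simp_all add: n0_def d0_def)

lemma grad_sq_d0: "sd.grad_sq \<phi> = d0 1 + d0 2"
proof -
  have "axis 1 1 \<noteq> (axis 2 1 :: real^2)" by (simp add: axis_eq_axis)
  then show ?thesis unfolding sd.smooth_grad_sq[OF smooth] by (simp add: Basis_R2 d0_def D_def[abs_def])
qed

lemma vol_eq:
  assumes cd: "0 \<le> c" "0 \<le> d" shows "vol i c d = ennreal (c * n0 + d * d0 i)"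
proof -
  have L: "\<phi> \<in> L2 V0" "D i \<in> L2 V0"
    by (auto intro!: sd.continuous_L2 D_cont \<phi>_cont)
  note [measurable] = L2_measurable[OF L(1)] L2_measurable[OF L(2)]
  have "vol i c d = (\<integral>\<^sup>+p. ennreal (W i c d p) \<partial>V0)"
    unfolding vol_def by (rule nn_integral_restrict_space[symmetric]) simp
  also have "\<dots> = (\<integral>\<^sup>+p. ennreal c * ennreal ((cmod (\<phi> p))\<^sup>2) + ennreal d * ennreal ((cmod (D i p))\<^sup>2) \<partial>V0)"
    using cd by (intro nn_integral_cong) (simp add: W_def ennreal_mult ennreal_plus)
  also have "\<dots> = ennreal c * (\<integral>\<^sup>+p. ennreal ((cmod (\<phi> p))\<^sup>2) \<partial>V0) + ennreal d * (\<integral>\<^sup>+p. ennreal ((cmod (D i p))\<^sup>2) \<partial>V0)"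
    by (simp add: nn_integral_add nn_integral_cmult)
  also have "\<dots> = ennreal c * ennreal n0 + ennreal d * ennreal (d0 i)"
    by (simp add: L2_nn_integral L n0_def d0_def)
  also have "\<dots> = ennreal (c * n0 + d * d0 i)"
    using cd n0_nonneg by (simp add: ennreal_mult ennreal_plus)
  finally show ?thesis .
qed

lemma surface_real:
  assumes le: "(\<integral>\<^sup>+p. sq p \<partial>S0) \<le> ennreal R" and R: "0 \<le> R" shows "(L2_norm S0 \<phi>)\<^sup>2 \<le> R"
proof -
  have m: "\<phi> \<in> borel_measurable S0" by (rule measurable_surface) measurable
  have "\<phi> \<in> L2 S0" "L2_norm S0 \<phi> \<le> sqrt R" using L2_norm_le_nn[OF m, of "sqrt R"] le R by simp_all
  moreover have "0 \<le> L2_norm S0 \<phi>" by (simp add: L2_norm_def)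
  ultimately have "(L2_norm S0 \<phi>)\<^sup>2 \<le> (sqrt R)\<^sup>2" by (intro power_mono) auto
  then show ?thesis using R by simp
qed

text \<open>Level k = 0, with \<open>tiny\<close> estimated without the strip. As \<eta> is free,
  this serves for finiteness of the surface measure, for \<open>trace_eps\<close> and for the lower
  end of the second interval.\<close>

lemma crude_nn:
  assumes \<eta>: "0 < \<eta>"
  shows "(\<integral>\<^sup>+p. sq p \<partial>S0) \<le> ennreal ((8 + 1 / aa 0 + 5 * \<eta>) * n0 + (4 / \<eta>) * (d0 1 + d0 2))"
proof -
  have a: "0 < aa 0" by (rule aa_pos)
  have "(\<integral>\<^sup>+p. sq p \<partial>S0) \<le> vol 2 (2 + \<eta>) (1 / \<eta>) + vol 1 (1 / aa 0 + \<eta>) (1 / \<eta>) + 3 * tiny 0"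
    by (rule surface_level[OF \<eta>])
  also have "\<dots> \<le> vol 2 (2 + \<eta>) (1 / \<eta>) + vol 1 (1 / aa 0 + \<eta>) (1 / \<eta>) + 3 * vol 2 (2 + \<eta>) (1 / \<eta>)"
    by (intro add_left_mono mult_left_mono tiny_crude \<eta>) simp
  also have "\<dots> = ennreal (((2 + \<eta>) * n0 + (1 / \<eta>) * d0 2) + ((1 / aa 0 + \<eta>) * n0 + (1 / \<eta>) * d0 1) + 3 * ((2 + \<eta>) * n0 + (1 / \<eta>) * d0 2))"
  proof -
    have "0 \<le> (2 + \<eta>) * n0 + (1 / \<eta>) * d0 2" "0 \<le> (1 / aa 0 + \<eta>) * n0 + (1 / \<eta>) * d0 1"
      using \<eta> a n0_nonneg by auto
    moreover have "ennreal X + ennreal Y + 3 * ennreal X = ennreal (X + Y + 3 * X)" if "0 \<le> X" "0 \<le> Y" for X Y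
      using that by (simp only: ennreal_plus ennreal_mult ennreal_numeral add_nonneg_nonneg mult_nonneg_nonneg zero_le_numeral)
    moreover have "vol 2 (2 + \<eta>) (1 / \<eta>) = ennreal ((2 + \<eta>) * n0 + (1 / \<eta>) * d0 2)"
      "vol 1 (1 / aa 0 + \<eta>) (1 / \<eta>) = ennreal ((1 / aa 0 + \<eta>) * n0 + (1 / \<eta>) * d0 1)"
      using \<eta> a by (intro vol_eq; simp)+
    ultimately show ?thesis by presburger
  qed
  also have "\<dots> \<le> ennreal ((8 + 1 / aa 0 + 5 * \<eta>) * n0 + (4 / \<eta>) * (d0 1 + d0 2))"
  proof (rule ennreal_leI)
    define u where "u = 1 / \<eta>"
    have u: "4 / \<eta> = 4 * u" "0 \<le> u * d0 1" using \<eta> n0_nonneg by (auto simp: u_def)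
    show "((2 + \<eta>) * n0 + (1 / \<eta>) * d0 2) + ((1 / aa 0 + \<eta>) * n0 + (1 / \<eta>) * d0 1) + 3 * ((2 + \<eta>) * n0 + (1 / \<eta>) * d0 2)
        \<le> (8 + 1 / aa 0 + 5 * \<eta>) * n0 + (4 / \<eta>) * (d0 1 + d0 2)"
      unfolding u(1) u_def[symmetric] using u(2) by (simp add: algebra_simps)
  qed
  finally show ?thesis .
qed

lemma crude_bound:
  assumes B: "0 < B"
  shows "B * (L2_norm S0 \<phi>)\<^sup>2 \<le> (1 / 2) * sd.grad_sq \<phi> + (B * (8 + 1 / aa 0) + 40 * B\<^sup>2) * n0"
proof -
  have a: "0 < aa 0" by (rule aa_pos)
  \<comment> \<open>With \<eta> = 8 B the gradient coefficient is 4 B / (8 B) = 1/2, and the mass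
    term 5 \<eta> B is 40 B^2.\<close>
  have \<eta>: "0 < 8 * B" using B by simp
  have "(L2_norm S0 \<phi>)\<^sup>2 \<le> (8 + 1 / aa 0 + 5 * (8 * B)) * n0 + (4 / (8 * B)) * (d0 1 + d0 2)"
    by (rule surface_real[OF crude_nn[OF \<eta>]]) (use a B n0_nonneg in \<open>simp add: add_nonneg_nonneg\<close>)
  then have "B * (L2_norm S0 \<phi>)\<^sup>2 \<le> B * ((8 + 1 / aa 0 + 5 * (8 * B)) * n0 + (4 / (8 * B)) * (d0 1 + d0 2))"
    using B by (intro mult_left_mono) auto
  also have "\<dots> = (B * (8 + 1 / aa 0) + 40 * B\<^sup>2) * n0 + (B * (4 / (8 * B))) * (d0 1 + d0 2)"
    by (simp only: power2_eq_square) (simp add: algebra_simps)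
  also have "B * (4 / (8 * B)) = 1 / 2" using B by simp
  finally show ?thesis by (simp add: grad_sq_d0)
qed

end

text \<open>In units of B^2 the main mass terms are 2 + 2; the rest is small with a, since b B = a.
  The gradient coefficients are 1/2 for \<open>x1\<close> and 1/2 + 1/4 for \<open>x2\<close>, the
  1/4 being 3 B / (12 B), up to terms of order a. For a <= 1/1000 all errors fit below 6 and
  1.\<close>

lemma fine_arithmetic:
  fixes a n x1 x2 :: real
  assumes a: "0 < a" "a \<le> 1 / 1000" and n: "0 \<le> n" "0 \<le> x1" "0 \<le> x2"
  defines "B \<equiv> 1 / a\<^sup>2" and "b \<equiv> a ^ 3"
  shows "B * (((2 + 2 * B) * n + (1 / (2 * B)) * x2) + ((1 / a + 2 * B) * n + (1 / (2 * B)) * x1)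
      + 3 * ((2 + 12 * B) * (2 * b * ((2 / a + B) * n + (1 / B) * x1) + 3 * b * ((4 + B) * n + (1 / B) * x2)) + (1 / (12 * B)) * x2))
    \<le> x1 + x2 + 6 * B\<^sup>2 * n"
proof -
  define t where "t = (12 + 2 * a\<^sup>2) * (5 * a + 4 * a\<^sup>2 + 12 * a ^ 3)"
  have B: "0 < B" "B * a\<^sup>2 = 1" using a by (auto simp: B_def)
  have "B * (((2 + 2 * B) * n + (1 / (2 * B)) * x2) + ((1 / a + 2 * B) * n + (1 / (2 * B)) * x1)
      + 3 * ((2 + 12 * B) * (2 * b * ((2 / a + B) * n + (1 / B) * x1) + 3 * b * ((4 + B) * n + (1 / B) * x2)) + (1 / (12 * B)) * x2))
    = B\<^sup>2 * ((2 * a\<^sup>2 + a + 4 + 3 * t) * n) + (1 / 2 + 6 * (12 * a + 2 * a ^ 3)) * x1 + (3 / 4 + 9 * (12 * a + 2 * a ^ 3)) * x2"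
    using a(1) unfolding B_def b_def t_def by (simp add: divide_simps) (simp add: algebra_simps power_numeral_reduce)
  also have "\<dots> \<le> B\<^sup>2 * (6 * n) + 1 * x1 + 1 * x2"
  proof (intro add_mono mult_right_mono mult_left_mono)
    have a2: "a\<^sup>2 \<le> a" "a ^ 3 \<le> a" using a power_decreasing[of 1 2 a] power_decreasing[of 1 3 a] by auto
    have "1 / 2 + 6 * w \<le> 1 \<and> 3 / 4 + 9 * w \<le> 1" if "w \<le> 14 / 1000" for w :: real using that by simp
    moreover have "12 * a + 2 * a ^ 3 \<le> 14 / 1000" using a a2 by linarith
    ultimately show "1 / 2 + 6 * (12 * a + 2 * a ^ 3) \<le> 1" "3 / 4 + 9 * (12 * a + 2 * a ^ 3) \<le> 1" by blast+
    have "t \<le> 14 * (21 * a)" unfolding t_def using a a2 by (intro mult_mono) auto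
    then show "2 * a\<^sup>2 + a + 4 + 3 * t \<le> 6" using a a2 by linarith
  qed (use n in auto)
  finally show ?thesis by simp
qed

context smooth_fun
begin

text \<open>The parameter \<eta> is 2 B for the lines, which spends half of the gradient, 12 B for
  the passage from \<open>tiny\<close> to the strip, and B for the strip itself.\<close>

lemma fine_bound:
  assumes a: "aa k \<le> 1 / 1000"
  defines "B \<equiv> 1 / (aa k)\<^sup>2"
  shows "B * (L2_norm S0 \<phi>)\<^sup>2 \<le> sd.grad_sq \<phi> + 6 * B\<^sup>2 * n0"
proof -
  let ?a = "aa k" and ?b = "aa k ^ 3"
  have apos: "0 < ?a" by (rule aa_pos)
  have B: "0 < B" using apos by (simp add: B_def)
  define s where "s = 2 * ?b * ((2 / ?a + B) * n0 + (1 / B) * d0 1) + 3 * ?b * ((4 + B) * n0 + (1 / B) * d0 2)"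
  define t where "t = (2 + 12 * B) * s + (1 / (12 * B)) * d0 2"
  define v where "v = (2 + 2 * B) * n0 + (1 / (2 * B)) * d0 2"
  define h where "h = (1 / ?a + 2 * B) * n0 + (1 / (2 * B)) * d0 1"
  have nn: "0 \<le> s" "0 \<le> t" "0 \<le> v" "0 \<le> h"
    unfolding s_def t_def v_def h_def using B apos n0_nonneg by (auto intro!: add_nonneg_nonneg mult_nonneg_nonneg)
  have "strip ?b \<le> ennreal (2 * ?b) * vol 1 (2 / ?a + B) (1 / B) + ennreal (3 * ?b) * vol 2 (4 + B) (1 / B)"
    using strip_le[OF B, of k] by (simp add: bb_Suc)
  also have "\<dots> = ennreal s"
  proof -
    have "0 \<le> (2 / ?a + B) * n0 + (1 / B) * d0 1" "0 \<le> (4 + B) * n0 + (1 / B) * d0 2"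
      using B apos n0_nonneg by (auto intro!: add_nonneg_nonneg mult_nonneg_nonneg)
    then show ?thesis unfolding s_def using B apos
      by (simp add: vol_eq ennreal_plus ennreal_mult del: times_divide_eq_left times_divide_eq_right)
  qed
  finally have strip: "strip ?b \<le> ennreal s" .
  have "tiny k \<le> ennreal (2 + 12 * B) * strip ?b + vol 2 0 (1 / (12 * B))"
    using tiny_strip[of "12 * B" k] B by (simp add: bb_Suc)
  also have "\<dots> \<le> ennreal (2 + 12 * B) * ennreal s + vol 2 0 (1 / (12 * B))"
    by (intro add_right_mono mult_left_mono strip) simp
  also have "\<dots> = ennreal t"
    unfolding t_def using B nn(1) n0_nonneg
    by (simp add: vol_eq ennreal_plus ennreal_mult del: times_divide_eq_left times_divide_eq_right)
  finally have tiny: "tiny k \<le> ennreal t" .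
  have "(\<integral>\<^sup>+p. sq p \<partial>S0) \<le> vol 2 (2 + 2 * B) (1 / (2 * B)) + vol 1 (1 / ?a + 2 * B) (1 / (2 * B)) + 3 * tiny k"
    using B by (intro surface_level) simp
  also have "\<dots> \<le> ennreal v + ennreal h + 3 * ennreal t"
  proof (intro add_mono mult_left_mono tiny)
    show "vol 2 (2 + 2 * B) (1 / (2 * B)) \<le> ennreal v" "vol 1 (1 / ?a + 2 * B) (1 / (2 * B)) \<le> ennreal h"
      unfolding v_def h_def using B apos by (simp_all add: vol_eq del: times_divide_eq_left times_divide_eq_right)
  qed simp
  also have "\<dots> = ennreal (v + h + 3 * t)" using nn by (simp add: ennreal_plus ennreal_mult)
  finally have "(L2_norm S0 \<phi>)\<^sup>2 \<le> v + h + 3 * t" by (rule surface_real) (use nn in simp)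
  then have "B * (L2_norm S0 \<phi>)\<^sup>2 \<le> B * (v + h + 3 * t)" using B by (intro mult_left_mono) auto
  also have "\<dots> \<le> d0 1 + d0 2 + 6 * B\<^sup>2 * n0"
    unfolding v_def h_def t_def s_def B_def by (rule fine_arithmetic[OF apos a n0_nonneg(1) n0_nonneg(2) n0_nonneg(2)])
  finally show ?thesis by (simp add: grad_sq_d0)
qed

end

text \<open>The length of the boundary is the boundary integral of the squared constant 1, and the
  crude estimate applies to this as to any smooth function.\<close>

lemma surface_\<Omega>0_finite: "emeasure S0 (frontier \<Omega>0) < \<infinity>"
proof -
  interpret smooth_fun "\<lambda>_. 1" by unfold_locales (rule smooth_const)
  have sp: "space S0 = frontier \<Omega>0" by (simp add: surface_on_def space_restrict_space)
  have "emeasure S0 (frontier \<Omega>0) = (\<integral>\<^sup>+p. 1 \<partial>S0)" by (simp add: sp[symmetric])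
  also have "\<dots> \<le> ennreal ((8 + 1 / aa 0 + 5 * 1) * n0 + (4 / 1) * (d0 1 + d0 2))" using crude_nn[of 1] by simp
  also have "\<dots> < \<infinity>" by simp
  finally show ?thesis .
qed

interpretation rd: robin_domain \<Omega>0 10 "1 / 20"
proof
  show "emeasure S0 (frontier \<Omega>0) < \<infinity>" by (rule surface_\<Omega>0_finite)
  fix B :: real assume B: "0 < B"
  show "\<exists>m\<ge>0. \<forall>\<phi>\<in>test_functions UNIV. B * (L2_norm S0 \<phi>)\<^sup>2 \<le> 1 / 2 * sd.grad_sq \<phi> + m * (L2_norm V0 \<phi>)\<^sup>2"
  proof (intro exI[of _ "B * (8 + 1 / aa 0) + 40 * B\<^sup>2"] conjI ballI)
    show "0 \<le> B * (8 + 1 / aa 0) + 40 * B\<^sup>2" using B aa_pos[of 0] by (simp add: add_nonneg_nonneg)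
    fix \<phi> :: "real^2 \<Rightarrow> complex" assume "\<phi> \<in> test_functions UNIV"
    then interpret smooth_fun \<phi> by unfold_locales (rule sd.test_smooth)
    show "B * (L2_norm S0 \<phi>)\<^sup>2 \<le> 1 / 2 * sd.grad_sq \<phi> + (B * (8 + 1 / aa 0) + 40 * B\<^sup>2) * (L2_norm V0 \<phi>)\<^sup>2"
      using crude_bound[OF B] by (simp add: n0_def)
  qed
qed

text \<open>Keeps the second family of quotients in a compact interval. For B of this size the term
  B (8 + 1 / \<open>aa 0\<close>) is at most B^2, so 40 B^2 grows to no more than 50 B^2.\<close>

lemma energy_lower_crude:
  assumes B: "8 + 1 / aa 0 \<le> B" shows "- (50 * B\<^sup>2) \<le> robin_energy \<Omega>0 (- B)"
proof (rule rd.energy_ge)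
  have "0 < 8 + 1 / aa 0" using aa_pos[of 0] by (simp add: add_pos_pos)
  then show B0: "0 < B" using B by linarith
  fix \<phi> :: "real^2 \<Rightarrow> complex" assume "\<phi> \<in> test_functions UNIV"
  then interpret smooth_fun \<phi> by unfold_locales (rule sd.test_smooth)
  have "B * (8 + 1 / aa 0) + 40 * B\<^sup>2 \<le> 50 * B\<^sup>2"
    using mult_left_mono[OF B, of B] B0 zero_le_power2[of B] by (simp add: power2_eq_square)
  then have "(B * (8 + 1 / aa 0) + 40 * B\<^sup>2) * n0 \<le> 50 * B\<^sup>2 * n0" using n0_nonneg by (intro mult_right_mono) auto
  then show "B * (L2_norm S0 \<phi>)\<^sup>2 \<le> sd.grad_sq \<phi> + 50 * B\<^sup>2 * (L2_norm V0 \<phi>)\<^sup>2"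
    using crude_bound[OF B0] sd.grad_sq_nonneg[of \<phi>] by (simp add: n0_def)
qed

lemma energy_lower_fine:
  assumes a: "aa k \<le> 1 / 1000" shows "- (6 * (1 / (aa k)\<^sup>2)\<^sup>2) \<le> robin_energy \<Omega>0 (- (1 / (aa k)\<^sup>2))"
proof (rule rd.energy_ge)
  show "0 < 1 / (aa k)\<^sup>2" using aa_pos[of k] by simp
  fix \<phi> :: "real^2 \<Rightarrow> complex" assume "\<phi> \<in> test_functions UNIV"
  then interpret smooth_fun \<phi> by unfold_locales (rule sd.test_smooth)
  show "1 / (aa k)\<^sup>2 * (L2_norm S0 \<phi>)\<^sup>2 \<le> sd.grad_sq \<phi> + 6 * (1 / (aa k)\<^sup>2)\<^sup>2 * (L2_norm V0 \<phi>)\<^sup>2"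
    using fine_bound[OF a] unfolding n0_def .
qed

section \<open>Upper bounds for the energy\<close>

definition cut :: "real^2 \<Rightarrow> complex" where
  "cut = conv (indicator (ball 0 4)) (\<lambda>z. of_real (mollifier 1 z)) 1"

lemma cut_eq: "cut x = (\<integral>w. indicator (ball 0 4) w * of_real (mollifier 1 (w - x)) \<partial>lborel)"
  by (simp add: cut_def conv_def)

lemma smooth_cut: "smooth cut"
proof -
  have "integrable lborel (\<lambda>w. of_real (indicator (ball (0::real^2) 4) w) :: complex)"
    by (intro integrable_of_real integrable_real_indicator emeasure_bounded_finite bounded_ball) simp
  moreover have "(\<lambda>w. of_real (indicator (ball (0::real^2) 4) w) :: complex) = indicator (ball 0 4)"
    by (auto simp: indicator_def)
  ultimately have i: "integrable lborel (indicator (ball (0::real^2) 4) :: real^2 \<Rightarrow> complex)" by simp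
  show ?thesis unfolding cut_def by (rule smooth_conv[OF i sd.kernel]) simp_all
qed

lemma cut_1: assumes "norm x \<le> 3" shows "cut x = 1"
proof -
  have e: "indicator (ball 0 4) w * (of_real (mollifier 1 (w - x)) :: complex) = of_real (mollifier 1 (w - x))" for w
  proof (cases "1 \<le> norm (w - x)")
    case True then show ?thesis by (simp add: mollifier_zero)
  next
    case False
    then have "w \<in> ball 0 4" using norm_triangle_sub[of w x] assms by simp
    then show ?thesis by simp
  qed
  have "cut x = (\<integral>w. of_real (mollifier 1 (w - x)) \<partial>lborel)" unfolding cut_eq e ..
  also have "\<dots> = of_real (\<integral>w. mollifier 1 (w - x) \<partial>lborel)" by (rule integral_complex_of_real)
  also have "\<dots> = 1" using integral_mollifier_shift(2)[of 1 x] by simp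
  finally show ?thesis .
qed

lemma cut_0: assumes "5 < norm x" shows "cut x = 0"
proof -
  have e: "indicator (ball 0 4) w * (of_real (mollifier 1 (w - x)) :: complex) = 0" for w
  proof (cases "w \<in> ball 0 4")
    case True
    then have "1 \<le> norm (w - x)" using norm_triangle_ineq2[of x w] assms by (simp add: norm_minus_commute)
    then show ?thesis by (simp add: mollifier_zero)
  qed simp
  show ?thesis unfolding cut_eq e by simp
qed

text \<open>Height is measured from the lowest point (0, -1). The factor \<open>cut\<close> equals 1
  on the ball of radius 3, which contains the closure of \<open>\<Omega>0\<close>; it provides
  bounded support without affecting the integrals over domain and boundary.\<close>

definition decay :: "real \<Rightarrow> real^2 \<Rightarrow> complex" where
  "decay s p = cut p * of_real (exp (- s * (p $ 2 + 1)))"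

lemma decay_test: "decay s \<in> test_functions UNIV"
proof -
  have "smooth (\<lambda>p::real^2. (- s) * p $ 2 + (- s))"
    by (rule smooth_add[OF smooth_mult[OF smooth_const smooth_linear[OF bounded_linear_vec_nth]] smooth_const])
  from smooth_mult[OF smooth_cut smooth_of_real[OF smooth_compose[OF smooth_exp this]]]
  have "smooth (\<lambda>p. cut p * of_real (exp ((- s) * p $ 2 + (- s))))" .
  moreover have "decay s = (\<lambda>p. cut p * of_real (exp ((- s) * p $ 2 + (- s))))"
    by (simp add: decay_def fun_eq_iff algebra_simps)
  ultimately have "smooth (decay s)" by simp
  moreover have "bdd_supp (decay s)" unfolding bdd_supp_def by (intro exI[of _ 5]) (simp add: decay_def cut_0)
  ultimately show ?thesis by (simp add: test_UNIV_iff)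
qed

lemma decay_near: "norm p \<le> 3 \<Longrightarrow> decay s p = of_real (exp (- s * (p $ 2 + 1)))"
  by (simp add: decay_def cut_1)

lemma norm_closure_\<Omega>0: "p \<in> closure \<Omega>0 \<Longrightarrow> norm p \<le> 2"
proof -
  assume "p \<in> closure \<Omega>0"
  then have "\<bar>p $ 1\<bar> \<le> 1" "hh (p $ 1) \<le> p $ 2" "p $ 2 \<le> 1" by (auto simp: closure_\<Omega>0_iff)
  moreover have "norm p \<le> \<bar>p $ 1\<bar> + \<bar>p $ 2\<bar>" unfolding norm_vec2 using sqrt_sum_squares_le_sum_abs by blast
  ultimately show ?thesis using hh_ge[of "p $ 1"] by linarith
qed

lemma norm_\<Omega>0: "p \<in> \<Omega>0 \<Longrightarrow> norm p \<le> 2"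
  using norm_closure_\<Omega>0 closure_subset[of \<Omega>0] by blast

lemma decay_sq: "norm p \<le> 3 \<Longrightarrow> (cmod (decay s p))\<^sup>2 = exp (- 2 * s * (p $ 2 + 1))"
proof -
  assume "norm p \<le> 3"
  then have "(cmod (decay s p))\<^sup>2 = exp (2 * (- s * (p $ 2 + 1)))" unfolding exp_double by (simp add: decay_near)
  also have "2 * (- s * (p $ 2 + 1)) = - 2 * s * (p $ 2 + 1)" by simp
  finally show ?thesis .
qed

lemma decay_deriv:
  assumes p: "norm p < 3"
  shows "frechet_derivative (decay s) (at p) = (\<lambda>h. of_real (exp (- s * (p $ 2 + 1)) * (- s * h $ 2)))"
proof -
  have v: "((\<lambda>p::real^2. p $ 2) has_derivative (\<lambda>h. h $ 2)) (at p)"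
    by (rule bounded_linear_imp_has_derivative[OF bounded_linear_vec_nth])
  have "((\<lambda>p::real^2. exp (- s * (p $ 2 + 1))) has_derivative (\<lambda>h. exp (- s * (p $ 2 + 1)) * (- s * h $ 2))) (at p)"
    by (auto intro!: derivative_eq_intros v)
  then have "((\<lambda>p. of_real (exp (- s * (p $ 2 + 1))) :: complex) has_derivative (\<lambda>h. of_real (exp (- s * (p $ 2 + 1)) * (- s * h $ 2)))) (at p)"
    by (rule has_derivative_of_real)
  then have "(decay s has_derivative (\<lambda>h. of_real (exp (- s * (p $ 2 + 1)) * (- s * h $ 2)))) (at p)"
    by (rule has_derivative_transform_within_open[OF _ open_ball[of 0 3]]) (use p in \<open>auto simp: decay_near\<close>)
  then show ?thesis by (rule frechet_derivative_at[symmetric])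
qed

interpretation dec: smooth_fun "decay s" for s
  by unfold_locales (rule sd.test_smooth[OF decay_test])

lemma dec_D: "p \<in> \<Omega>0 \<Longrightarrow> dec.D s 1 p = 0" "p \<in> \<Omega>0 \<Longrightarrow> dec.D s 2 p = - of_real s * decay s p"
  using norm_\<Omega>0[of p] by (simp_all add: dec.D_def decay_deriv decay_near axis_def)

lemma decay_grad: "sd.grad_sq (decay s) = s\<^sup>2 * dec.n0 s"
proof -
  have "(\<integral>p. (cmod (dec.D s 1 p))\<^sup>2 \<partial>V0) = (\<integral>p. 0 \<partial>V0)"
    by (rule Bochner_Integration.integral_cong) (simp_all add: dec_D)
  then have 1: "dec.d0 s 1 = 0" by (simp add: dec.d0_def L2_norm_def)
  have "(\<integral>p. (cmod (dec.D s 2 p))\<^sup>2 \<partial>V0) = (\<integral>p. s\<^sup>2 * (cmod (decay s p))\<^sup>2 \<partial>V0)"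
    by (rule Bochner_Integration.integral_cong) (simp_all add: dec_D norm_mult power_mult_distrib)
  also have "\<dots> = s\<^sup>2 * (\<integral>p. (cmod (decay s p))\<^sup>2 \<partial>V0)" by (rule integral_mult_right_zero)
  finally have 2: "dec.d0 s 2 = s\<^sup>2 * dec.n0 s" by (simp add: dec.d0_def dec.n0_def L2_norm_def)
  show ?thesis unfolding dec.grad_sq_d0 using 1 2 by simp
qed

lemma decay_norm: "L2_norm V0 (decay s) \<noteq> 0"
proof
  assume "L2_norm V0 (decay s) = 0"
  then have "AE p in V0. decay s p = 0" using L2_norm_0_AE[OF sd.continuous_L2[OF dec.\<phi>_cont]] by blast
  then obtain N where N: "{p \<in> space V0. decay s p \<noteq> 0} \<subseteq> N" "emeasure V0 N = 0" "N \<in> sets V0" by (rule AE_E)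
  have sp: "space V0 = \<Omega>0" by (simp add: space_restrict_space)
  have "decay s p \<noteq> 0" if "p \<in> \<Omega>0" for p using norm_\<Omega>0[OF that] by (simp add: decay_near)
  then have "\<Omega>0 \<subseteq> N" using N(1) sp by auto
  then have "emeasure V0 \<Omega>0 = 0" using emeasure_mono[of \<Omega>0 N V0] N by simp
  then have "emeasure lborel \<Omega>0 = 0" by (simp add: emeasure_restrict_space)
  moreover have "\<Omega>0 \<noteq> {}" using zero_in_\<Omega>0 by blast
  ultimately show False using emeasure_open_pos[OF open_\<Omega>0] by simp
qed

definition trace_dens :: "real \<Rightarrow> real \<Rightarrow> real" where "trace_dens s x = exp (- 2 * s * (hh x + 1))"

definition trace_mass :: "real \<Rightarrow> real set \<Rightarrow> ennreal" where
  "trace_mass s A = (\<integral>\<^sup>+x. ennreal (trace_dens s x) * indicator A x \<partial>lborel)"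

lemma trace_dens_meas [measurable]: "trace_dens s \<in> borel_measurable borel"
  unfolding trace_dens_def[abs_def] by measurable

lemma exp_tail:
  assumes s: "0 < s"
  shows "(\<integral>\<^sup>+y. ennreal (exp (- 2 * s * (y + 1))) * indicator {h..} y \<partial>lborel) = ennreal (exp (- 2 * s * (h + 1)) / (2 * s))"
proof -
  define F where "F y = - exp (- 2 * s * (y + 1)) / (2 * s)" for y
  have "LIM y at_top. (- 2 * s) * (1 + y) :> at_bot"
    by (rule filterlim_tendsto_neg_mult_at_bot[OF tendsto_const _ filterlim_tendsto_add_at_top[OF tendsto_const filterlim_ident]]) (use s in simp)
  from filterlim_compose[OF exp_at_bot this]
  have "((\<lambda>y. exp ((- 2 * s) * (1 + y))) \<longlongrightarrow> 0) at_top" .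
  then have "((\<lambda>y. - exp ((- 2 * s) * (1 + y)) / (2 * s)) \<longlongrightarrow> - 0 / (2 * s)) at_top"
    by (intro tendsto_divide tendsto_minus tendsto_const) (use s in auto)
  then have lim: "(F \<longlongrightarrow> 0) at_top" by (simp add: F_def[abs_def] add.commute)
  have "(\<integral>\<^sup>+y. ennreal (exp (- 2 * s * (y + 1))) * indicator {h..} y \<partial>lborel) = ennreal (0 - F h)"
  proof (rule nn_integral_FTC_atLeast[OF _ _ _ lim])
    show "(F has_real_derivative exp (- 2 * s * (y + 1))) (at y)" for y
      unfolding F_def using s by (auto intro!: derivative_eq_intros)
  qed auto
  then show ?thesis by (simp add: F_def)
qed

text \<open>Each vertical line is integrated to infinity instead of to the top; the integral of the
  square is then exactly the boundary value divided by 2 s. Evenness of \<open>hh\<close> doubles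
  the half x >= 0 and cancels the 2.\<close>

lemma decay_mass:
  assumes s: "0 < s" shows "ennreal (dec.n0 s) \<le> ennreal (1 / s) * trace_mass s {0..1}"
proof -
  let ?I = "trace_mass s {0..1}"
  have "ennreal (dec.n0 s) = (\<integral>\<^sup>+p. ennreal ((cmod (decay s p))\<^sup>2) \<partial>V0)"
    unfolding dec.n0_def by (rule L2_nn_integral[OF sd.continuous_L2[OF dec.\<phi>_cont], symmetric])
  also have "\<dots> = (\<integral>\<^sup>+p. ennreal ((cmod (decay s p))\<^sup>2) * indicator \<Omega>0 p \<partial>lborel)"
    by (rule nn_integral_restrict_space) simp
  also have "\<dots> = (\<integral>\<^sup>+x. \<integral>\<^sup>+y. ennreal ((cmod (decay s (mk x y)))\<^sup>2) * indicator \<Omega>0 (mk x y) \<partial>lborel \<partial>lborel)"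
    by (rule nn_integral_R2(1)) measurable
  also have "\<dots> \<le> (\<integral>\<^sup>+x. \<integral>\<^sup>+y. (ennreal (exp (- 2 * s * (y + 1))) * indicator {hh x..} y) * indicator {- 1..1} x \<partial>lborel \<partial>lborel)"
  proof (intro nn_integral_mono)
    fix x y
    show "ennreal ((cmod (decay s (mk x y)))\<^sup>2) * indicator \<Omega>0 (mk x y)
        \<le> (ennreal (exp (- 2 * s * (y + 1))) * indicator {hh x..} y) * indicator {- 1..1} x"
    proof (cases "mk x y \<in> \<Omega>0")
      case True
      then have xy: "- 1 \<le> x" "x \<le> 1" "hh x \<le> y" by (auto simp: \<Omega>0_def)
      have "(cmod (decay s (mk x y)))\<^sup>2 = exp (- 2 * s * (y + 1))" using decay_sq[of "mk x y" s] norm_\<Omega>0[OF True] by simp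
      then show ?thesis using True xy by (simp add: indicator_def)
    qed simp
  qed
  also have "\<dots> = (\<integral>\<^sup>+x. ennreal (exp (- 2 * s * (hh x + 1)) / (2 * s)) * indicator {- 1..1} x \<partial>lborel)"
  proof (rule nn_integral_cong)
    fix x
    have "(\<integral>\<^sup>+y. (ennreal (exp (- 2 * s * (y + 1))) * indicator {hh x..} y) * indicator {- 1..1} x \<partial>lborel)
        = (\<integral>\<^sup>+y. ennreal (exp (- 2 * s * (y + 1))) * indicator {hh x..} y \<partial>lborel) * indicator {- 1..1} x"
      by (rule nn_integral_multc) measurable
    then show "(\<integral>\<^sup>+y. (ennreal (exp (- 2 * s * (y + 1))) * indicator {hh x..} y) * indicator {- 1..1} x \<partial>lborel)
        = ennreal (exp (- 2 * s * (hh x + 1)) / (2 * s)) * indicator {- 1..1} x"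
      unfolding exp_tail[OF s] .
  qed
  also have "\<dots> = (\<integral>\<^sup>+x. ennreal (1 / (2 * s)) * (ennreal (trace_dens s x) * indicator {- 1..1} x) \<partial>lborel)"
  proof -
    have "ennreal (exp (- 2 * s * (hh x + 1)) / (2 * s)) = ennreal (1 / (2 * s)) * ennreal (trace_dens s x)" for x
      unfolding trace_dens_def by (subst ennreal_mult[symmetric]) (use s in auto)
    then show ?thesis by (simp only: mult.assoc)
  qed
  also have "\<dots> = ennreal (1 / (2 * s)) * (\<integral>\<^sup>+x. ennreal (trace_dens s x) * indicator {- 1..1} x \<partial>lborel)"
    by (rule nn_integral_cmult) measurable
  also have "\<dots> \<le> ennreal (1 / (2 * s)) * (?I + ?I)"
  proof (rule mult_left_mono)
    have "(\<integral>\<^sup>+x. ennreal (trace_dens s x) * indicator {- 1..1} x \<partial>lborel)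
        \<le> (\<integral>\<^sup>+x. ennreal (trace_dens s x) * indicator {0..1} x + (\<lambda>x. ennreal (trace_dens s x) * indicator {0..1} x) (- x) \<partial>lborel)"
      by (intro nn_integral_mono) (auto simp: indicator_def trace_dens_def hh_even)
    also have "\<dots> = ?I + (\<integral>\<^sup>+x. (\<lambda>x. ennreal (trace_dens s x) * indicator {0..1} x) (- x) \<partial>lborel)"
      unfolding trace_mass_def by (rule nn_integral_add) measurable
    also have "(\<integral>\<^sup>+x. (\<lambda>x. ennreal (trace_dens s x) * indicator {0..1} x) (- x) \<partial>lborel) = ?I"
      unfolding trace_mass_def by (rule dec.reflect) measurable
    finally show "(\<integral>\<^sup>+x. ennreal (trace_dens s x) * indicator {- 1..1} x \<partial>lborel) \<le> ?I + ?I" .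
  qed simp
  also have "\<dots> = ennreal (1 / s) * ?I"
  proof -
    have "ennreal (1 / s) = ennreal (1 / (2 * s)) + ennreal (1 / (2 * s))" using s by (simp flip: ennreal_plus)
    then show ?thesis by (simp add: distrib_left distrib_right)
  qed
  finally show ?thesis .
qed

text \<open>Only the bottom arcs over \<open>A\<close> and over its mirror image are counted. They
  lie in the disjoint half-planes x > 0 and x < 0, which is why \<open>A\<close> avoids 0;
  \<open>P\<close> and \<open>Q\<close> project them to an axis with parameter speed
  \<open>K\<close>.\<close>

lemma decay_surface_ge:
  fixes P Q :: "real^2 \<Rightarrow> real"
  assumes P: "\<And>x y. dist (P x) (P y) \<le> dist x y" "\<And>x y. dist (Q x) (Q y) \<le> dist x y" and K: "0 < K"
    and A: "A \<in> sets borel" "A \<subseteq> {0<..1}"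
    and PA: "\<And>t. t \<in> A \<Longrightarrow> P (mk t (hh t)) = K * t + k" "\<And>t. t \<in> A \<Longrightarrow> Q (mk (- t) (hh t)) = K * t + l"
  shows "ennreal (2 * K) * trace_mass s A \<le> ennreal ((L2_norm S0 (decay s))\<^sup>2)"
proof -
  let ?f = "\<lambda>p. ennreal ((cmod (decay s p))\<^sup>2)"
  let ?F1 = "frontier \<Omega>0 \<inter> {p. 0 < p $ 1}" and ?F2 = "frontier \<Omega>0 \<inter> {p. p $ 1 < 0}"
  have "open {p::real^2. 0 < p $ 1}" "open {p::real^2. p $ 1 < 0}" by (intro open_Collect_less continuous_intros)+
  then have [measurable]: "{p::real^2. 0 < p $ 1} \<in> sets borel" "{p::real^2. p $ 1 < 0} \<in> sets borel" by auto
  have F [measurable]: "?F1 \<in> sets borel" "?F2 \<in> sets borel" by measurable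
  have fr: "mk x (hh x) \<in> frontier \<Omega>0" if "\<bar>x\<bar> \<le> 1" for x
  proof -
    have "mk x (hh x) \<notin> \<Omega>0" by (simp add: \<Omega>0_def)
    then show ?thesis using that hh_le[of x] by (simp add: frontier_\<Omega>0_iff)
  qed
  have val: "(cmod (decay s (mk x (hh x))))\<^sup>2 = trace_dens s x" if "\<bar>x\<bar> \<le> 1" for x
  proof -
    have "norm (mk x (hh x)) \<le> 2" using fr[OF that] by (intro norm_closure_\<Omega>0) (simp add: frontier_def)
    then show ?thesis using decay_sq[of "mk x (hh x)" s] by (simp add: trace_dens_def)
  qed
  have eq: "(\<integral>\<^sup>+t. ?f (mk t (hh t)) * indicator A t \<partial>lborel) = trace_mass s A"
    unfolding trace_mass_def using A(2) val by (intro nn_integral_cong) (auto simp: indicator_def subset_eq)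
  have val': "(cmod (decay s (mk (- x) (hh x))))\<^sup>2 = trace_dens s x" if "\<bar>x\<bar> \<le> 1" for x
    using val[of "- x"] that by (simp add: hh_even trace_dens_def)
  have eq': "(\<integral>\<^sup>+t. ?f (mk (- t) (hh t)) * indicator A t \<partial>lborel) = trace_mass s A"
    unfolding trace_mass_def using A(2) val' by (intro nn_integral_cong) (auto simp: indicator_def subset_eq)
  have 1: "ennreal K * (\<integral>\<^sup>+t. ?f (mk t (hh t)) * indicator A t \<partial>lborel) \<le> (\<integral>\<^sup>+p. ?f p * indicator ?F1 p \<partial>hausdorff_measure 1)"
    by (rule hausdorff_integral_curve_ge[where P = P and k = k])
       (use P K A PA fr F in \<open>auto simp: subset_eq\<close>)
  have "mk (- x) (hh x) \<in> frontier \<Omega>0" if "\<bar>x\<bar> \<le> 1" for x using fr[of "- x"] that by (simp add: hh_even)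
  then have 2: "ennreal K * (\<integral>\<^sup>+t. ?f (mk (- t) (hh t)) * indicator A t \<partial>lborel) \<le> (\<integral>\<^sup>+p. ?f p * indicator ?F2 p \<partial>hausdorff_measure 1)"
    by (intro hausdorff_integral_curve_ge[where P = Q and k = l])
       (use P K A PA F in \<open>auto simp: subset_eq\<close>)
  have "ennreal (2 * K) * trace_mass s A = ennreal K * trace_mass s A + ennreal K * trace_mass s A"
  proof -
    have "ennreal (2 * K) = ennreal K + ennreal K" using K by (subst ennreal_plus[symmetric]) auto
    then show ?thesis by (simp only: distrib_right)
  qed
  also have "\<dots> \<le> (\<integral>\<^sup>+p. ?f p * indicator ?F1 p \<partial>hausdorff_measure 1) + (\<integral>\<^sup>+p. ?f p * indicator ?F2 p \<partial>hausdorff_measure 1)"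
    using 1 2 unfolding eq eq' by (rule add_mono)
  also have "\<dots> = (\<integral>\<^sup>+p. ?f p * indicator ?F1 p + ?f p * indicator ?F2 p \<partial>hausdorff_measure 1)"
    by (rule nn_integral_add[symmetric]) measurable
  also have "\<dots> \<le> (\<integral>\<^sup>+p. ?f p * indicator (frontier \<Omega>0) p \<partial>hausdorff_measure 1)"
    by (intro nn_integral_mono) (auto simp: indicator_def)
  also have "\<dots> = ennreal ((L2_norm S0 (decay s))\<^sup>2)"
    unfolding nn_surface[symmetric] by (rule L2_nn_integral[OF rd.test_Sg[OF decay_test]])
  finally show ?thesis .
qed

lemma component_dist: "dist (x $ i) (y $ i) \<le> dist x y" "dist (- x $ i) (- y $ i) \<le> dist x y" for x y :: "real^2"
  using comp_le_norm[of "x - y" i] by (simp_all add: dist_norm norm_minus_commute abs_minus_commute)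

lemma trace_dens_le_1: "0 < s \<Longrightarrow> trace_dens s x \<le> 1"
  using hh_ge[of x] by (simp add: trace_dens_def)

lemma trace_mass_le_1: "0 < s \<Longrightarrow> trace_mass s {0..1} \<le> 1"
proof -
  assume s: "0 < s"
  have "trace_mass s {0..1} \<le> (\<integral>\<^sup>+x. indicator {0..1::real} x \<partial>lborel)"
    unfolding trace_mass_def using trace_dens_le_1[OF s] by (intro nn_integral_mono) (auto simp: indicator_def)
  then show ?thesis by simp
qed

lemma trace_mass_open: "trace_mass s {0<..1} = trace_mass s {0..1}"
  unfolding trace_mass_def
proof (rule nn_integral_cong_AE)
  have "AE x in lborel. x \<noteq> (0::real)" by (rule AE_lborel_singleton)
  then show "AE x in lborel. ennreal (trace_dens s x) * indicator {0<..1} x = ennreal (trace_dens s x) * indicator {0..1} x"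
    by eventually_elim (auto simp: indicator_def)
qed

text \<open>\<open>X\<close> stands for the trace mass on a selected part of the bottom, and
  \<open>q\<close> compares the total with it. The squared norm is at most q X / s and the boundary
  term at least K X, so the quotient is at most s^2 - B K s / q; the condition on \<open>c\<close>
  says that this is at most -c.\<close>

lemma energy_upper:
  assumes B: "0 < B" and s: "0 < s" and X: "trace_mass s {0..1} \<le> ennreal q * X" "0 < q"
    and S: "ennreal K * X \<le> ennreal ((L2_norm S0 (decay s))\<^sup>2)" "0 < K" and c: "0 \<le> c" "(s\<^sup>2 + c) * q \<le> B * K * s"
    and fin: "X \<noteq> \<infinity>"
  shows "robin_energy \<Omega>0 (- B) \<le> - c"
proof (rule rd.energy_le[OF B decay_test decay_norm])
  define x where "x = enn2real X"
  have x: "X = ennreal x" "0 \<le> x" using fin by (auto simp: x_def less_top)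
  have "ennreal (dec.n0 s) \<le> ennreal (1 / s) * (ennreal q * X)"
    using order_trans[OF decay_mass[OF s] mult_left_mono[OF X(1)]] by simp
  also have "\<dots> = ennreal (q * x / s)" using s X(2) x by (simp flip: ennreal_mult)
  finally have n: "dec.n0 s \<le> q * x / s" using s X(2) x by (subst (asm) ennreal_le_iff) auto
  have k: "K * x \<le> (L2_norm S0 (decay s))\<^sup>2" using S x by (simp flip: ennreal_mult)
  have "sd.grad_sq (decay s) + c * (L2_norm V0 (decay s))\<^sup>2 = (s\<^sup>2 + c) * dec.n0 s"
    by (simp add: decay_grad dec.n0_def distrib_right)
  also have "\<dots> \<le> (s\<^sup>2 + c) * (q * x / s)" using n c by (intro mult_left_mono) auto
  also have "\<dots> = ((s\<^sup>2 + c) * q) * (x / s)" by simp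
  also have "\<dots> \<le> (B * K * s) * (x / s)" using c x s by (intro mult_right_mono) auto
  also have "\<dots> = B * (K * x)" using s by simp
  also have "\<dots> \<le> B * (L2_norm S0 (decay s))\<^sup>2" using k B by (intro mult_left_mono) auto
  finally show "sd.grad_sq (decay s) + c * (L2_norm V0 (decay s))\<^sup>2 \<le> B * (L2_norm S0 (decay s))\<^sup>2" .
qed

text \<open>The half-plane profile: s = B, and projection to the horizontal axis counts horizontal
  length only, which gives K = 2 for the two halves. The resulting -1 holds for every B and bounds
  the first interval away from 0.\<close>

lemma energy_upper_flat:
  assumes B: "0 < B" shows "robin_energy \<Omega>0 (- B) \<le> - B\<^sup>2"
proof (rule energy_upper[OF B B, where q = 1 and X = "trace_mass B {0<..1}" and K = 2])
  show "ennreal 2 * trace_mass B {0<..1} \<le> ennreal ((L2_norm S0 (decay B))\<^sup>2)"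
    using decay_surface_ge[of "\<lambda>p. p $ 1" "\<lambda>p. - p $ 1" 1 "{0<..1}" 0 0 B] component_dist by simp
  show "trace_mass B {0<..1} \<noteq> \<infinity>" using trace_mass_le_1[OF B] unfolding trace_mass_open
    by (auto simp: top_unique)
qed (simp_all add: trace_mass_open power2_eq_square)

text \<open>The cube is chosen to match a = b^3: a tail of size exp (-17 / b) becomes a small
  multiple of a.\<close>

lemma exp_neg_le:
  fixes y :: real
  assumes y: "0 < y" shows "exp (- y) \<le> 27 / y ^ 3"
proof -
  have "y / 3 \<le> exp (y / 3)" using exp_ge_add_one_self[of "y / 3"] by linarith
  then have "(y / 3) ^ 3 \<le> exp (y / 3) ^ 3" using y by (intro power_mono) auto
  also have "\<dots> = exp y" by (simp flip: exp_of_nat_mult)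
  finally have "y ^ 3 / 27 \<le> exp y" by (simp add: power_divide)
  then show ?thesis using y by (simp add: exp_minus field_simps)
qed

text \<open>At B = 1 / b^2 the interval (a, b] carries almost all of the trace mass. What lies below
  a has length only a = b^3; beyond b the boundary has risen by almost 3 b, and the density is
  exponentially small. Already (a, a + b^2/18] contributes at least b^2/162, so the two errors
  together are at most 1/9 of the main part.\<close>

lemma steep_mass:
  assumes b: "bb k \<le> 1 / 2000"
  defines "s \<equiv> 3 / (bb k)\<^sup>2"
  shows "trace_mass s {0..1} \<le> ennreal (10 / 9) * trace_mass s {aa k<..bb k}"
proof -
  let ?b = "bb k" and ?a = "aa k" and ?X = "trace_mass s {aa k<..bb k}"
  have b0: "0 < ?b" by (rule bb_pos)
  have s: "0 < s" using b0 by (simp add: s_def)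
  have b2: "?b\<^sup>2 \<le> ?b / 2000" using b0 b mult_left_mono[of ?b "1/2000" ?b] by (simp add: power2_eq_square)
  have b3: "?a = ?b\<^sup>2 * ?b" "?a \<le> ?b\<^sup>2 / 2000"
    using b0 b mult_left_mono[of ?b "1/2000" "?b\<^sup>2"] by (auto simp: aa_def power3_eq_cube power2_eq_square)
  define \<epsilon> where "\<epsilon> = exp (- (17 / ?b))"
  have tail: "trace_dens s x \<le> \<epsilon>" if "?b \<le> x" for x
  proof -
    have "hh ?b - hh ?a = 3 * (?b - ?a)" by (rule hh_steep[of k]) (use aa_less_bb[of k] in auto)
    then have "3 * (?b - ?a) \<le> hh x + 1" using hh_mono[of ?b x] hh_ge[of ?a] that b0 by simp
    \<comment> \<open>The denominator 18 cancels the factor 6 s = 18 / b^2 of the exponent; the loss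
      b/18 covers a.\<close>
    moreover have "3 * (17 * ?b / 18) \<le> 3 * (?b - ?a)"
    proof (rule mult_left_mono)
      show "17 * ?b / 18 \<le> ?b - ?a" using b3(2) b2 b0 by linarith
    qed simp
    ultimately have "3 * (17 * ?b / 18) \<le> hh x + 1" by linarith
    then have "2 * s * (3 * (17 * ?b / 18)) \<le> 2 * s * (hh x + 1)" using s by (intro mult_left_mono) auto
    moreover have "2 * s * (3 * (17 * ?b / 18)) = 17 / ?b" using b0 by (simp add: s_def power2_eq_square field_simps)
    ultimately show ?thesis by (simp add: trace_dens_def \<epsilon>_def)
  qed
  have \<epsilon>: "0 < \<epsilon>" "\<epsilon> \<le> ?a / 100"
  proof -
    show "0 < \<epsilon>" by (simp add: \<epsilon>_def)
    have "\<epsilon> \<le> 27 / (17 / ?b) ^ 3" unfolding \<epsilon>_def by (rule exp_neg_le) (use b0 in simp)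
    also have "\<dots> = (27 / 4913) * ?a" using b0 by (simp add: aa_def power_divide)
    also have "\<dots> \<le> ?a / 100" using aa_pos[of k] by simp
    finally show "\<epsilon> \<le> ?a / 100" .
  qed
  have "trace_mass s {0..1} \<le> (\<integral>\<^sup>+x. indicator {0..?a} x + (ennreal (trace_dens s x) * indicator {?a<..?b} x + ennreal \<epsilon> * indicator {?b..1} x) \<partial>lborel)"
    unfolding trace_mass_def
  proof (rule nn_integral_mono)
    fix x :: real
    consider "x \<notin> {0..1}" | "x \<in> {0..?a}" | "x \<in> {?a<..?b}" | "x \<in> {?b..1}" by fastforce
    then show "ennreal (trace_dens s x) * indicator {0..1} x
        \<le> indicator {0..?a} x + (ennreal (trace_dens s x) * indicator {?a<..?b} x + ennreal \<epsilon> * indicator {?b..1} x)"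
    proof cases
      case 2
      then have "ennreal (trace_dens s x) * indicator {0..1} x \<le> indicator {0..?a} x"
        using trace_dens_le_1[OF s, of x] by (auto simp: indicator_def)
      then show ?thesis by (rule order_trans) simp
    next
      case 3
      then have "ennreal (trace_dens s x) * indicator {0..1} x \<le> ennreal (trace_dens s x) * indicator {?a<..?b} x"
        by (auto simp: indicator_def)
      then show ?thesis by (rule order_trans) (simp add: add_increasing)
    next
      case 4
      then have "ennreal (trace_dens s x) * indicator {0..1} x \<le> ennreal \<epsilon> * indicator {?b..1} x"
        using tail[of x] b0 by (auto simp: indicator_def intro!: ennreal_leI)
      then show ?thesis by (rule order_trans) (simp add: add_increasing)
    qed simp
  qed
  also have "\<dots> = (\<integral>\<^sup>+x. indicator {0..?a} x \<partial>lborel) + (?X + ennreal \<epsilon> * emeasure lborel {?b..1})"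
    by (simp add: nn_integral_add nn_integral_cmult_indicator trace_mass_def)
  also have "\<dots> \<le> ennreal ?a + (?X + ennreal \<epsilon> * ennreal 1)"
    using aa_pos[of k] b0 b by (intro add_mono mult_left_mono order_refl) (auto intro!: ennreal_leI)
  also have "\<dots> = ?X + ennreal (?a + \<epsilon>)" using aa_pos[of k] \<epsilon>(1) by (simp add: ennreal_plus ac_simps)
  also have "\<dots> \<le> ?X + ennreal (1 / 9) * ?X"
  proof (rule add_left_mono)
    \<comment> \<open>Up to a + d the height above -1 is at most 3 a^3 + 3 d <= b^2/3, so the
      exponent, 2 s times this height, is at most 2, and exp (-2) >= 1/9.\<close>
    define d where "d = ?b\<^sup>2 / 18"
    have d: "0 < d" "?a + d \<le> ?b" using b0 b2 b3(2) by (auto simp: d_def)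
    have dens: "1 / 9 \<le> trace_dens s x" if "?a < x" "x \<le> ?a + d" for x
    proof -
      have "hh x - hh ?a = 3 * (x - ?a)" by (rule hh_steep[of k]) (use that d in auto)
      moreover have "hh ?a \<le> - 1 + 3 * ?a ^ 3" using hh_le_lin[of "bb (Suc k)"] bb_pos[of "Suc k"] by (simp add: hh_gap bb_Suc)
      ultimately have h: "hh x + 1 \<le> 3 * ?a ^ 3 + 3 * d" using that by simp
      have "?a ^ 3 \<le> ?b\<^sup>2 / 18"
      proof -
        have "?a ^ 3 \<le> ?a ^ 1" using aa_pos[of k] aa_less_bb[of k] b by (intro power_decreasing) auto
        then have "?a ^ 3 \<le> ?a" by simp
        then show ?thesis using b3(2) zero_le_power2[of ?b] by linarith
      qed
      then have "hh x + 1 \<le> ?b\<^sup>2 / 3" using h by (simp add: d_def)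
      then have "2 * s * (hh x + 1) \<le> 2 * s * (?b\<^sup>2 / 3)" using s by (intro mult_left_mono) auto
      also have "\<dots> = 2" using b0 by (simp add: s_def)
      finally have "exp (- 2) \<le> trace_dens s x" by (simp add: trace_dens_def)
      moreover have "1 / 9 \<le> exp (- 2 :: real)"
      proof -
        have "exp (2::real) = exp 1 ^ 2" using exp_double[of "1::real"] by simp
        also have "\<dots> \<le> 3 ^ 2" by (intro power_mono exp_le) auto
        finally show ?thesis by (simp add: exp_minus field_simps)
      qed
      ultimately show ?thesis by linarith
    qed
    have "ennreal (1 / 9 * d) = ennreal (1 / 9) * ennreal d" using d by (intro ennreal_mult) auto
    also have "\<dots> = (\<integral>\<^sup>+x. ennreal (1 / 9) * indicator {?a<..?a + d} x \<partial>lborel)"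
      using d by (simp add: nn_integral_cmult_indicator)
    also have "\<dots> \<le> ?X" unfolding trace_mass_def using dens d
      by (intro nn_integral_mono) (auto simp: indicator_def intro!: ennreal_leI)
    finally have X: "ennreal (1 / 9 * d) \<le> ?X" .
    have "1 / 9 * (1 / 9 * d) = ?b\<^sup>2 / 1458" by (simp add: d_def)
    then have "?a + \<epsilon> \<le> 1 / 9 * (1 / 9 * d)" using \<epsilon>(2) b3(2) zero_le_power2[of ?b] by linarith
    then have "ennreal (?a + \<epsilon>) \<le> ennreal (1 / 9) * ennreal (1 / 9 * d)"
      using d by (subst ennreal_mult[symmetric]) (auto intro!: ennreal_leI)
    also have "\<dots> \<le> ennreal (1 / 9) * ?X" by (intro mult_left_mono X) simp
    finally show "ennreal (?a + \<epsilon>) \<le> ennreal (1 / 9) * ?X" .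
  qed
  also have "\<dots> = ennreal (10 / 9) * ?X"
  proof -
    have "ennreal (10 / 9) = 1 + ennreal (1 / 9)" by (simp flip: ennreal_1 ennreal_plus)
    then show ?thesis by (simp add: distrib_right)
  qed
  finally show ?thesis .
qed

text \<open>Projected to the vertical axis both arcs have speed 3, hence K = 6, and s = 3 B
  minimises s^2 - 6 B s. For q = 1 this would give -9; with q = 10/9 the condition reads (9 + 7)
  10/9 <= 18.\<close>

lemma energy_upper_steep:
  assumes b: "bb k \<le> 1 / 2000"
  defines "B \<equiv> 1 / (bb k)\<^sup>2"
  shows "robin_energy \<Omega>0 (- B) \<le> - (7 * B\<^sup>2)"
proof (rule energy_upper[where s = "3 * B" and q = "10 / 9" and X = "trace_mass (3 * B) {aa k<..bb k}" and K = 6])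
  show B: "0 < B" using bb_pos[of k] by (simp add: B_def)
  then show s: "0 < 3 * B" by simp
  have AB: "{aa k<..bb k} \<subseteq> {0<..1}" using aa_pos[of k] b by auto
  show "trace_mass (3 * B) {0..1} \<le> ennreal (10 / 9) * trace_mass (3 * B) {aa k<..bb k}"
    using steep_mass[OF b] by (simp add: B_def)
  have lin: "hh t = 3 * t + (hh (aa k) - 3 * aa k)" if "t \<in> {aa k<..bb k}" for t
    using hh_steep[of k "aa k" t] that by simp
  show "ennreal 6 * trace_mass (3 * B) {aa k<..bb k} \<le> ennreal ((L2_norm S0 (decay (3 * B)))\<^sup>2)"
    using decay_surface_ge[of "\<lambda>p. p $ 2" "\<lambda>p. p $ 2" 3 "{aa k<..bb k}" "hh (aa k) - 3 * aa k" "hh (aa k) - 3 * aa k" "3 * B"]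
      component_dist(1) AB lin by simp
  show "((3 * B)\<^sup>2 + 7 * B\<^sup>2) * (10 / 9) \<le> B * 6 * (3 * B)" using B by (simp add: power2_eq_square)
  have "trace_mass (3 * B) {aa k<..bb k} \<le> trace_mass (3 * B) {0..1}"
    unfolding trace_mass_def using AB by (intro nn_integral_mono) (auto simp: indicator_def)
  then show "trace_mass (3 * B) {aa k<..bb k} \<noteq> \<infinity>" using trace_mass_le_1[OF s] by (auto simp: top_unique)
qed auto

lemma neg_inverse_square_at_bot:
  fixes f :: "nat \<Rightarrow> real"
  assumes "f \<longlonglongrightarrow> 0" "\<And>k. 0 < f k" shows "filterlim (\<lambda>k. - (1 / (f k)\<^sup>2)) at_bot sequentially"
proof -
  have "(\<lambda>k. (f k)\<^sup>2) \<longlonglongrightarrow> 0\<^sup>2" by (intro tendsto_power assms)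
  then have "filterlim (\<lambda>k. inverse ((f k)\<^sup>2)) at_top sequentially"
    by (intro filterlim_inverse_at_top always_eventually allI zero_less_power assms(2)) simp
  then show ?thesis by (simp add: filterlim_uminus_at_top inverse_eq_divide)
qed

theorem theorem1:
  "\<exists>(\<Omega> :: (real^2) set) (I' :: real set) (I'' :: real set)
      (\<beta>' :: nat \<Rightarrow> real) (\<beta>'' :: nat \<Rightarrow> real).
     bounded_lipschitz_domain \<Omega> \<and>
     compact I' \<and> is_interval I' \<and> I' \<subseteq> {..<0} \<and>
     compact I'' \<and> is_interval I'' \<and> I'' \<subseteq> {..<0} \<and>
     I' \<inter> I'' = {} \<and>
     (\<forall>k. \<beta>' k < 0) \<and> filterlim \<beta>' at_bot sequentially \<and>
     (\<forall>k. \<beta>'' k < 0) \<and> filterlim \<beta>'' at_bot sequentially \<and>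
     (\<forall>k. robin_energy \<Omega> (\<beta>' k) / (\<beta>' k)\<^sup>2 \<in> I' \<and>
          robin_energy \<Omega> (\<beta>'' k) / (\<beta>'' k)\<^sup>2 \<in> I'')"
proof -
  \<comment> \<open>One threshold serves both sequences, since \<open>aa k\<close> <
    \<open>bb k\<close>.\<close>
  have "\<forall>\<^sub>F k in sequentially. bb k < 1 / 2000" by (rule order_tendstoD(2)[OF bb_tendsto_0]) simp
  then obtain N where N: "\<And>k. N \<le> k \<Longrightarrow> bb k < 1 / 2000" by (auto simp: eventually_sequentially)
  have b: "bb (k + N) \<le> 1 / 2000" for k using N[of "k + N"] by simp
  define B1 where "B1 k = 1 / (aa (k + N))\<^sup>2" for k
  define B2 where "B2 k = 1 / (bb (k + N))\<^sup>2" for k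
  have B1: "0 < B1 k" and B2: "0 < B2 k" for k using aa_pos[of "k + N"] bb_pos[of "k + N"] by (simp_all add: B1_def B2_def)
  have lim: "(\<lambda>k. bb (k + N)) \<longlonglongrightarrow> 0" using bb_tendsto_0 by (rule LIMSEQ_ignore_initial_segment)
  then have lim': "(\<lambda>k. aa (k + N)) \<longlonglongrightarrow> 0" unfolding aa_def using tendsto_power[OF lim, of 3] by simp
  have 1: "robin_energy \<Omega>0 (- B1 k) / (- B1 k)\<^sup>2 \<in> {- 6..- 1}" for k
  proof -
    have "aa (k + N) \<le> 1 / 1000" using aa_less_bb[of "k + N"] b[of k] by simp
    then have "- (6 * (B1 k)\<^sup>2) \<le> robin_energy \<Omega>0 (- B1 k)" unfolding B1_def by (rule energy_lower_fine)
    moreover have "robin_energy \<Omega>0 (- B1 k) \<le> - (B1 k)\<^sup>2" by (rule energy_upper_flat[OF B1])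
    ultimately show ?thesis using B1[of k] by (simp add: pos_le_divide_eq pos_divide_le_eq)
  qed
  have 2: "robin_energy \<Omega>0 (- B2 k) / (- B2 k)\<^sup>2 \<in> {- 50..- 7}" for k
  proof -
    \<comment> \<open>Here 1 / \<open>aa 0\<close> is 216, while \<open>B2 k\<close> is at least
      2000^2.\<close>
    have "8 + 1 / aa 0 \<le> B2 k"
    proof -
      have "(bb (k + N))\<^sup>2 \<le> (1 / 2000)\<^sup>2" using b[of k] bb_pos[of "k + N"] by (intro power_mono) auto
      then have "1 / (1 / 2000)\<^sup>2 \<le> B2 k" unfolding B2_def using bb_pos[of "k + N"] by (intro divide_left_mono) auto
      then show ?thesis by (simp add: aa_def bb_def power_divide)
    qed
    then have "- (50 * (B2 k)\<^sup>2) \<le> robin_energy \<Omega>0 (- B2 k)" by (rule energy_lower_crude)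
    moreover have "robin_energy \<Omega>0 (- B2 k) \<le> - (7 * (B2 k)\<^sup>2)" unfolding B2_def by (rule energy_upper_steep[OF b])
    ultimately show ?thesis using B2[of k] by (simp add: pos_le_divide_eq pos_divide_le_eq)
  qed
  have l1: "filterlim (\<lambda>k. - B1 k) at_bot sequentially"
    unfolding B1_def by (rule neg_inverse_square_at_bot[OF lim' aa_pos])
  have l2: "filterlim (\<lambda>k. - B2 k) at_bot sequentially"
    unfolding B2_def by (rule neg_inverse_square_at_bot[OF lim bb_pos])
  show ?thesis
    using bounded_lipschitz_\<Omega>0 1 2 B1 B2 l1 l2
    by (intro exI[of _ \<Omega>0] exI[of _ "{- 6..- 1}"] exI[of _ "{- 50..- 7}"] exI[of _ "\<lambda>k. - B1 k"] exI[of _ "\<lambda>k. - B2 k"]) auto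
qed

end
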